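(* Let $\Phi_1(G)=\Delta(G)$ be the maximum degree of $G$, $\Phi_2(G)$ the number of connected components of $G$, and $\Phi_3(G)=\chi(G)$ the chromatic number of $G$. For each $j\in\{1,2,3\}$, the problems $\#\mathrm{IndSub}(\Phi_j)$ and $\#\mathrm{cp\text{-}IndSub}(\Phi_j)$ are both $\#\mathrm{W}[1]$-hard, and, assuming ETH, there exists a constant $\alpha_j>0$ such that for all $k\ge3$ no algorithm (that reads the whole input) computes for all graphs $G$ the value $\#\mathrm{IndSub}_{(\Phi_j,k)}(G)$ (or, for all $k$-vertex $H$ and $H$-colored $G$, the value $\#\mathrm{cpIndSub}_{(\Phi_j,H)}(G)$) in time $O(|V(G)|^{\alpha_j k})$.
   Context: All graphs are finite, simple, undirected. For a graph parameter $\Phi$, $\#\mathrm{IndSub}_{(\Phi,k)}(G)=\sum_{A\subseteq V(G),|A|=k}\Phi(G[A])$; $\#\mathrm{IndSub}(\Phi)$ takes $(k,G)$ with parameter $k$. An $H$-colored graph is $G$ with a homomorphism $c:V(G)\to V(H)$; $A$ with $|A|=|V(H)|$ is colorful if $c(A)=V(H)$; $\#\mathrm{cpIndSub}_{(\Phi,H)}(G)=\sum_{A\text{ colorful}}\Phi(G[A])$; $\#\mathrm{cp\text{-}IndSub}(\Phi)$ takes $(H,G)$ with parameter $|V(H)|$. $\#\mathrm{W}[1]$-hard: parameterized Turing reduction from counting $k$-cliques (parameter $k$). ETH: Exponential-Time Hypothesis. *)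

theory Defs
  imports Complex_Main "HOL-Library.FuncSet" "HOL-Library.Landau_Symbols"
begin

section \<open>Finite simple undirected graphs\<close>

type_synonym 'a graph = "'a set \<times> 'a set set"

abbreviation verts :: "'a graph \<Rightarrow> 'a set" where "verts G \<equiv> fst G"
abbreviation edges :: "'a graph \<Rightarrow> 'a set set" where "edges G \<equiv> snd G"

definition simple_graph :: "'a graph \<Rightarrow> bool" where
  "simple_graph G \<longleftrightarrow> finite (verts G) \<and>
     (\<forall>e\<in>edges G. \<exists>u v. e = {u, v} \<and> u \<noteq> v \<and> u \<in> verts G \<and> v \<in> verts G)"

definition induced :: "'a graph \<Rightarrow> 'a set \<Rightarrow> 'a graph" where
  "induced G A = (A, {e \<in> edges G. e \<subseteq> A})"

definition degree :: "'a graph \<Rightarrow> 'a \<Rightarrow> nat" where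
  "degree G v = card {e \<in> edges G. v \<in> e}"

definition max_degree :: "'a graph \<Rightarrow> nat" where
  "max_degree G = (if verts G = {} then 0 else Max (degree G ` verts G))"

definition connected_rel :: "'a graph \<Rightarrow> ('a \<times> 'a) set" where
  "connected_rel G =
     {(u, v). u \<in> verts G \<and> v \<in> verts G \<and> (u, v) \<in> {(a, b). {a, b} \<in> edges G}\<^sup>*}"

definition num_components :: "'a graph \<Rightarrow> nat" where
  "num_components G = card (verts G // connected_rel G)"

definition proper_coloring :: "'a graph \<Rightarrow> nat \<Rightarrow> ('a \<Rightarrow> nat) \<Rightarrow> bool" where
  "proper_coloring G q f \<longleftrightarrow>
     f \<in> verts G \<rightarrow> {..<q} \<and> (\<forall>u v. {u, v} \<in> edges G \<longrightarrow> f u \<noteq> f v)"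

definition chromatic_number :: "'a graph \<Rightarrow> nat" where
  "chromatic_number G = (LEAST q. \<exists>f. proper_coloring G q f)"

definition graph_hom :: "'a graph \<Rightarrow> 'b graph \<Rightarrow> ('a \<Rightarrow> 'b) \<Rightarrow> bool" where
  "graph_hom G H c \<longleftrightarrow>
     c \<in> verts G \<rightarrow> verts H \<and> (\<forall>u v. {u, v} \<in> edges G \<longrightarrow> {c u, c v} \<in> edges H)"

definition num_cliques :: "nat \<Rightarrow> 'a graph \<Rightarrow> nat" where
  "num_cliques k G = card {A. A \<subseteq> verts G \<and> card A = k \<and>
     (\<forall>u\<in>A. \<forall>v\<in>A. u \<noteq> v \<longrightarrow> {u, v} \<in> edges G)}"

definition ind_sub :: "('a graph \<Rightarrow> nat) \<Rightarrow> nat \<Rightarrow> 'a graph \<Rightarrow> nat" where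
  "ind_sub \<Phi> k G = (\<Sum>A | A \<subseteq> verts G \<and> card A = k. \<Phi> (induced G A))"

definition colorful :: "'b graph \<Rightarrow> 'a graph \<Rightarrow> ('a \<Rightarrow> 'b) \<Rightarrow> 'a set \<Rightarrow> bool" where
  "colorful H G c A \<longleftrightarrow> A \<subseteq> verts G \<and> card A = card (verts H) \<and> c ` A = verts H"

definition cp_ind_sub ::
    "('a graph \<Rightarrow> nat) \<Rightarrow> 'b graph \<Rightarrow> 'a graph \<Rightarrow> ('a \<Rightarrow> 'b) \<Rightarrow> nat" where
  "cp_ind_sub \<Phi> H G c = (\<Sum>A | colorful H G c A. \<Phi> (induced G A))"


section \<open>Algorithms\<close>

text \<open>
  Algorithms are programs of a random access machine over natural numbers with unit cost per
  instruction. Addition and truncated subtraction are the only arithmetic operations, so numbers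
  grow by at most one bit per step and the machine is polynomially equivalent to Turing machines.
  The input is a read-only sequence of numbers. An oracle query is written word by word with
  \<open>Put\<close> (so its length is charged to the running time) and submitted with \<open>Ask\<close>. A program
  halts by jumping beyond its last instruction, leaving its result in register 0.
\<close>

datatype instr =
    Const nat nat
  | Add nat nat nat
  | Sub nat nat nat
  | Load nat nat
  | Store nat nat
  | Input nat nat
  | InputLength nat
  | Jump nat
  | JumpZero nat nat
  | Put nat
  | Ask nat

type_synonym program = "instr list"

record conf =
  pc :: nat
  reg :: "nat \<Rightarrow> nat"
  query :: "nat list"

definition init_conf :: conf where
  "init_conf = \<lparr>pc = 0, reg = (\<lambda>_. 0), query = []\<rparr>"

fun exec :: "(nat list \<Rightarrow> nat) \<Rightarrow> nat list \<Rightarrow> instr \<Rightarrow> conf \<Rightarrow> conf" where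
  "exec orc x (Const r n) c = c\<lparr>pc := Suc (pc c), reg := (reg c)(r := n)\<rparr>"
| "exec orc x (Add r s t) c = c\<lparr>pc := Suc (pc c), reg := (reg c)(r := reg c s + reg c t)\<rparr>"
| "exec orc x (Sub r s t) c = c\<lparr>pc := Suc (pc c), reg := (reg c)(r := reg c s - reg c t)\<rparr>"
| "exec orc x (Load r s) c = c\<lparr>pc := Suc (pc c), reg := (reg c)(r := reg c (reg c s))\<rparr>"
| "exec orc x (Store r s) c = c\<lparr>pc := Suc (pc c), reg := (reg c)(reg c r := reg c s)\<rparr>"
| "exec orc x (Input r s) c = c\<lparr>pc := Suc (pc c),
     reg := (reg c)(r := if reg c s < length x then x ! reg c s else 0)\<rparr>"
| "exec orc x (InputLength r) c = c\<lparr>pc := Suc (pc c), reg := (reg c)(r := length x)\<rparr>"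
| "exec orc x (Jump l) c = c\<lparr>pc := l\<rparr>"
| "exec orc x (JumpZero r l) c = c\<lparr>pc := if reg c r = 0 then l else Suc (pc c)\<rparr>"
| "exec orc x (Put r) c = c\<lparr>pc := Suc (pc c), query := query c @ [reg c r]\<rparr>"
| "exec orc x (Ask r) c = c\<lparr>pc := Suc (pc c), reg := (reg c)(r := orc (query c)), query := []\<rparr>"

definition halted :: "program \<Rightarrow> conf \<Rightarrow> bool" where
  "halted P c \<longleftrightarrow> length P \<le> pc c"

definition step :: "(nat list \<Rightarrow> nat) \<Rightarrow> program \<Rightarrow> nat list \<Rightarrow> conf \<Rightarrow> conf" where
  "step orc P x c = (if halted P c then c else exec orc x (P ! pc c) c)"

definition conf_at :: "(nat list \<Rightarrow> nat) \<Rightarrow> program \<Rightarrow> nat list \<Rightarrow> nat \<Rightarrow> conf" where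
  "conf_at orc P x t = (step orc P x ^^ t) init_conf"

definition halts :: "(nat list \<Rightarrow> nat) \<Rightarrow> program \<Rightarrow> nat list \<Rightarrow> bool" where
  "halts orc P x \<longleftrightarrow> (\<exists>t. halted P (conf_at orc P x t))"

definition run_time :: "(nat list \<Rightarrow> nat) \<Rightarrow> program \<Rightarrow> nat list \<Rightarrow> nat" where
  "run_time orc P x = (LEAST t. halted P (conf_at orc P x t))"

definition outputs :: "(nat list \<Rightarrow> nat) \<Rightarrow> program \<Rightarrow> nat list \<Rightarrow> nat \<Rightarrow> bool" where
  "outputs orc P x y \<longleftrightarrow> halts orc P x \<and> reg (conf_at orc P x (run_time orc P x)) 0 = y"

definition queries :: "(nat list \<Rightarrow> nat) \<Rightarrow> program \<Rightarrow> nat list \<Rightarrow> nat list set" where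
  "queries orc P x = {query (conf_at orc P x t) | t r.
     t < run_time orc P x \<and> P ! pc (conf_at orc P x t) = Ask r}"

text \<open>Algorithms without an oracle: the instruction \<open>Ask\<close> always yields 0.\<close>

abbreviation no_oracle :: "nat list \<Rightarrow> nat" where "no_oracle \<equiv> (\<lambda>_. 0)"

definition reads_whole_input :: "program \<Rightarrow> nat list \<Rightarrow> bool" where
  "reads_whole_input P x \<longleftrightarrow> (\<forall>i<length x. \<exists>t<run_time no_oracle P x. \<exists>r s.
     P ! pc (conf_at no_oracle P x t) = Input r s \<and> reg (conf_at no_oracle P x t) s = i)"

definition computable :: "(nat \<Rightarrow> nat) \<Rightarrow> bool" where
  "computable f \<longleftrightarrow> (\<exists>P. \<forall>n. outputs no_oracle P [n] (f n))"


section \<open>Parameterized counting problems and reductions\<close>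

record 'i counting_problem =
  instances :: "'i set"
  encode :: "'i \<Rightarrow> nat list"
  parameter :: "'i \<Rightarrow> nat"
  answer :: "'i \<Rightarrow> nat"

definition oracle_for :: "'i counting_problem \<Rightarrow> nat list \<Rightarrow> nat" where
  "oracle_for Q q = (THE y. \<exists>j\<in>instances Q. encode Q j = q \<and> y = answer Q j)"

definition fpt_turing_reducible :: "'i counting_problem \<Rightarrow> 'j counting_problem \<Rightarrow> bool" where
  "fpt_turing_reducible P Q \<longleftrightarrow> (\<exists>A f g d. computable f \<and> computable g \<and>
     (\<forall>i\<in>instances P.
        outputs (oracle_for Q) A (encode P i) (answer P i) \<and>
        run_time (oracle_for Q) A (encode P i) \<le> f (parameter P i) * length (encode P i) ^ d \<and>
        (\<forall>q\<in>queries (oracle_for Q) A (encode P i).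
           \<exists>j\<in>instances Q. encode Q j = q \<and> parameter Q j \<le> g (parameter P i))))"

text \<open>Input graphs have vertex set \<open>{..<n}\<close> and are given by \<open>n\<close> and their adjacency matrix.\<close>

definition input_graph :: "nat graph \<Rightarrow> bool" where
  "input_graph G \<longleftrightarrow> simple_graph G \<and> (\<exists>n. verts G = {..<n})"

definition encode_graph :: "nat graph \<Rightarrow> nat list" where
  "encode_graph G = (let n = card (verts G) in
     n # [if {u, v} \<in> edges G then 1 else 0. u \<leftarrow> [0..<n], v \<leftarrow> [0..<n]])"

definition input_colored_graph :: "nat graph \<times> nat graph \<times> (nat \<Rightarrow> nat) \<Rightarrow> bool" where
  "input_colored_graph = (\<lambda>(H, G, c). input_graph H \<and> input_graph G \<and> graph_hom G H c)"

definition encode_colored_graph :: "nat graph \<times> nat graph \<times> (nat \<Rightarrow> nat) \<Rightarrow> nat list" where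
  "encode_colored_graph = (\<lambda>(H, G, c).
     encode_graph H @ encode_graph G @ map c [0..<card (verts G)])"

definition Clique_problem :: "(nat \<times> nat graph) counting_problem" where
  "Clique_problem = \<lparr>
     instances = {(k, G). input_graph G},
     encode = (\<lambda>(k, G). k # encode_graph G),
     parameter = (\<lambda>(k, G). k),
     answer = (\<lambda>(k, G). num_cliques k G)\<rparr>"

definition IndSub_problem :: "(nat graph \<Rightarrow> nat) \<Rightarrow> (nat \<times> nat graph) counting_problem" where
  "IndSub_problem \<Phi> = \<lparr>
     instances = {(k, G). input_graph G},
     encode = (\<lambda>(k, G). k # encode_graph G),
     parameter = (\<lambda>(k, G). k),
     answer = (\<lambda>(k, G). ind_sub \<Phi> k G)\<rparr>"

definition cpIndSub_problem ::
    "(nat graph \<Rightarrow> nat) \<Rightarrow> (nat graph \<times> nat graph \<times> (nat \<Rightarrow> nat)) counting_problem" where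
  "cpIndSub_problem \<Phi> = \<lparr>
     instances = {I. input_colored_graph I},
     encode = encode_colored_graph,
     parameter = (\<lambda>(H, G, c). card (verts H)),
     answer = (\<lambda>(H, G, c). cp_ind_sub \<Phi> H G c)\<rparr>"

definition sharp_W1_hard :: "'i counting_problem \<Rightarrow> bool" where
  "sharp_W1_hard Q \<longleftrightarrow> fpt_turing_reducible Clique_problem Q"


section \<open>The Exponential-Time Hypothesis\<close>

text \<open>A literal \<open>(v, b)\<close> asserts that variable \<open>v\<close> has value \<open>b\<close>.\<close>

type_synonym cnf = "(nat \<times> bool) list list"

definition three_cnf :: "nat \<Rightarrow> cnf \<Rightarrow> bool" where
  "three_cnf n F \<longleftrightarrow> (\<forall>C\<in>set F. length C \<le> 3 \<and> (\<forall>(v, b)\<in>set C. v < n))"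

definition satisfiable :: "cnf \<Rightarrow> bool" where
  "satisfiable F \<longleftrightarrow> (\<exists>a. \<forall>C\<in>set F. \<exists>(v, b)\<in>set C. a v = b)"

definition encode_cnf :: "nat \<Rightarrow> cnf \<Rightarrow> nat list" where
  "encode_cnf n F =
     n # concat (map (\<lambda>C. length C # map (\<lambda>(v, b). 2 * v + of_bool b) C) F)"

text \<open>
  For some \<open>\<delta> > 0\<close>, satisfiability of 3-CNF formulas with \<open>n\<close> variables cannot be decided in
  time \<open>O(2\<^bsup>\<delta>n\<^esup>)\<close> up to factors polynomial in the length of the formula.
\<close>

definition ETH :: bool where
  "ETH \<longleftrightarrow> (\<exists>\<delta>>0. \<not> (\<exists>A (C::real) d. \<forall>n F. three_cnf n F \<longrightarrow>
     outputs no_oracle A (encode_cnf n F) (of_bool (satisfiable F)) \<and>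
     real (run_time no_oracle A (encode_cnf n F))
       \<le> C * 2 powr (\<delta> * real n) * real (length (encode_cnf n F)) ^ d))"


section \<open>Computing the counts for fixed \<open>k\<close> in bounded time\<close>

text \<open>
  The bound \<open>T\<close> is in terms of \<open>|V(G)|\<close> only; \<open>k\<close> is fixed, so the program may depend on it.
\<close>

definition computes_IndSub_in_time ::
    "program \<Rightarrow> (nat graph \<Rightarrow> nat) \<Rightarrow> nat \<Rightarrow> (nat \<Rightarrow> real) \<Rightarrow> bool" where
  "computes_IndSub_in_time A \<Phi> k T \<longleftrightarrow> (\<forall>G. input_graph G \<longrightarrow>
     outputs no_oracle A (encode_graph G) (ind_sub \<Phi> k G) \<and>
     reads_whole_input A (encode_graph G) \<and>
     real (run_time no_oracle A (encode_graph G)) \<le> T (card (verts G)))"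

definition computes_cpIndSub_in_time ::
    "program \<Rightarrow> (nat graph \<Rightarrow> nat) \<Rightarrow> nat \<Rightarrow> (nat \<Rightarrow> real) \<Rightarrow> bool" where
  "computes_cpIndSub_in_time A \<Phi> k T \<longleftrightarrow>
     (\<forall>H G c. input_colored_graph (H, G, c) \<and> card (verts H) = k \<longrightarrow>
       outputs no_oracle A (encode_colored_graph (H, G, c)) (cp_ind_sub \<Phi> H G c) \<and>
       reads_whole_input A (encode_colored_graph (H, G, c)) \<and>
       real (run_time no_oracle A (encode_colored_graph (H, G, c))) \<le> T (card (verts G)))"

end

theory Submission
  imports Defs 
begin

text \<open>
  Fix \<open>k\<close> classes of choices and a compatibility relation between choices. The query graph consists of
  two copies of every class, with compatible choices of the first and the second copies joined, and of a
  few special colours. For each of the three parameters, the edges at the special colours can be chosen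
  such that the alternating sum of the parameter over all sets \<open>Z\<close> of deleted colour pairs is nonzero
  only if the selected vertices are pairwise compatible, i.e. form a clique, and is then \<open>\<plusminus>1\<close>. Thus the
  counts for the query graphs determine the number of \<open>k\<close>-cliques; in the uncoloured case, a further
  inclusion-exclusion over deleted colour classes isolates the colourful sets. Taking vertices as choices
  gives \<open>#W[1]\<close>-hardness.

  For the lower bound, a 3-CNF formula is first sparsified into \<open>2\<^bsup>\<epsilon>n\<^esup>\<close> formulas with \<open>O(n)\<close> clauses.
  The clauses of a sparse formula are dealt into \<open>k\<close> groups, and the choices of a group select a
  literal in each of its clauses, so that cliques of consistent choices are the satisfying selections. The query
  graphs have \<open>2\<^bsup>O(n/k)\<^esup>\<close> vertices, hence a program running in time \<open>O(|V(G)|\<^bsup>\<alpha>k\<^esup>)\<close> with small \<open>\<alpha>\<close>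
  would decide satisfiability in time \<open>2\<^bsup>\<delta>n\<^esup>\<close>.
\<close>

section \<open>A combinator language and its compilation to the machine\<close>

text \<open>The alternating sum isolates cliques because a colour pair that is absent from the
  selected subgraph can be deleted without effect: the sets \<open>Z\<close> with and without it
  cancel, and only selections with all \<open>k * k\<close> pairs present survive. Doubling the
  classes makes the tested graph bipartite, where all three parameters are easy to evaluate. A
  compatibility relation that allows only equality inside a class then forces the second copies to
  repeat the first, so completeness between the sides becomes pairwise compatibility. The obstacle
  is the concrete machine: hardness asks for actual programs. Algorithms are therefore compositions
  of functions in a polynomial cost calculus, translated by a compiler with exact step counts. The
  lower bound needs a single \<alpha> for all \<open>n\<close> and all solvers. So one fixed program
  simulates the solver as data, and its polynomial degree is known before the sparsification
  threshold and \<alpha> are chosen; for small \<open>n\<close> the exponent is below 2, and reading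
  the adjacency matrix already takes longer.\<close>

datatype val = Atom nat | Cell val val

datatype prog =
    PId
  | PConst nat
  | PFst
  | PSnd
  | PPair prog prog
  | PSeq prog prog
  | PAdd
  | PSub
  | PIf prog prog
  | PWhile prog
  | PAsk

text \<open>\<open>Atom 0\<close> serves as zero, as false and as the empty list, so a single test
  drives conditionals and loops over lists alike.\<close>

fun is_zero :: "val \<Rightarrow> bool" where
  "is_zero (Atom n) \<longleftrightarrow> n = 0"
| "is_zero (Cell a b) \<longleftrightarrow> False"

primrec val_of_nats :: "nat list \<Rightarrow> val" where
  "val_of_nats [] = Atom 0"
| "val_of_nats (n # ns) = Cell (Atom n) (val_of_nats ns)"

text \<open>
  The last argument is the exact number of machine steps of the compiled program; \<open>Q\<close> is the
  set of queries that may be asked.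
\<close>

inductive evals :: "(nat list \<Rightarrow> nat) \<Rightarrow> nat list set \<Rightarrow> prog \<Rightarrow> val \<Rightarrow> val \<Rightarrow> nat \<Rightarrow> bool"
  for orc Q where
  Id: "evals orc Q PId v v 0"
| Const: "evals orc Q (PConst n) v (Atom n) 1"
| Fst: "evals orc Q PFst (Cell a b) a 1"
| Snd: "evals orc Q PSnd (Cell a b) b 2"
| Pair: "evals orc Q p v a s \<Longrightarrow> evals orc Q q v b t \<Longrightarrow>
    evals orc Q (PPair p q) v (Cell a b) (s + t + 22)"
| Seq: "evals orc Q p v w s \<Longrightarrow> evals orc Q q w u t \<Longrightarrow> evals orc Q (PSeq p q) v u (s + t)"
| Add: "evals orc Q PAdd (Cell (Atom m) (Atom n)) (Atom (m + n)) 4"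
| Sub: "evals orc Q PSub (Cell (Atom m) (Atom n)) (Atom (m - n)) 4"
| IfZ: "is_zero c \<Longrightarrow> evals orc Q p v w s \<Longrightarrow> evals orc Q (PIf p q) (Cell c v) w (s + 4)"
| IfN: "\<not> is_zero c \<Longrightarrow> evals orc Q q v w s \<Longrightarrow> evals orc Q (PIf p q) (Cell c v) w (s + 5)"
| WhileZ: "is_zero c \<Longrightarrow> evals orc Q (PWhile p) (Cell c v) (Cell c v) 2"
| WhileN: "\<not> is_zero c \<Longrightarrow> evals orc Q p (Cell c v) w s \<Longrightarrow> evals orc Q (PWhile p) w u t \<Longrightarrow>
    evals orc Q (PWhile p) (Cell c v) u (s + t + 3)"
| Ask: "ns \<in> Q \<Longrightarrow> evals orc Q PAsk (val_of_nats ns) (Atom (orc ns)) (6 * length ns + 2)"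

lemma evals_mono: "evals orc Q p v w t \<Longrightarrow> Q \<subseteq> Q' \<Longrightarrow> evals orc Q' p v w t"
  by (induction rule: evals.induct) (blast intro: evals.intros)+

text \<open>With no admissible query \<open>PAsk\<close> cannot be evaluated. Pure computations,
  analysed with \<open>no_oracle\<close>, can thus be reused inside a program with a real
  oracle.\<close>

lemma evals_empty_change_oracle: "evals orc {} p v w t \<Longrightarrow> evals orc' {} p v w t"
  by (induction rule: evals.induct) (blast intro: evals.intros)+

text \<open>
  Register 0 holds the current value, 1 a linked stack, 2 the end of the heap, 5 the number 1;
  the heap starts at address 10, so that no pointer is confused with the empty list 0.
\<close>

definition cons_code :: "nat \<Rightarrow> nat \<Rightarrow> nat \<Rightarrow> instr list" where
  "cons_code r s d = [Store 2 r, Add 2 2 5, Store 2 s, Sub d 2 5, Add 2 2 5]"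

definition pop_code :: "instr list" where
  "pop_code = [Load 3 1, Add 4 1 5, Load 1 4]"

text \<open>\<open>l\<close> is the load address, since jump targets are absolute. For a pair, the
  input is parked on the stack while the first component is computed, then swapped with its result.
  Register 6 is never written and stays 0, so adding it is a move.\<close>

fun compile :: "nat \<Rightarrow> prog \<Rightarrow> instr list" where
  "compile l PId = []"
| "compile l (PConst n) = [Const 0 n]"
| "compile l PFst = [Load 0 0]"
| "compile l PSnd = [Add 0 0 5, Load 0 0]"
| "compile l (PPair p q) =
    (let cp = compile (l + 5) p; cq = compile (l + 14 + length cp) q in
     cons_code 0 1 1 @ cp @ (pop_code @ cons_code 0 1 1 @ [Add 0 3 6]) @ cq @
     (pop_code @ cons_code 3 0 0))"
| "compile l (PSeq p q) = (let cp = compile l p in cp @ compile (l + length cp) q)"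
| "compile l PAdd = [Load 3 0, Add 4 0 5, Load 4 4, Add 0 3 4]"
| "compile l PSub = [Load 3 0, Add 4 0 5, Load 4 4, Sub 0 3 4]"
| "compile l (PIf p q) =
    (let cq = compile (l + 4) q; cp = compile (l + 5 + length cq) p in
     [Load 3 0, Add 4 0 5, Load 0 4, JumpZero 3 (l + 5 + length cq)] @ cq @
     [Jump (l + 5 + length cq + length cp)] @ cp)"
| "compile l (PWhile p) =
    (let cp = compile (l + 2) p in
     [Load 3 0, JumpZero 3 (l + 3 + length cp)] @ cp @ [Jump l])"
| "compile l PAsk =
    [JumpZero 0 (l + 6), Load 3 0, Put 3, Add 0 0 5, Load 0 0, Jump l, Ask 0]"

definition code_at :: "program \<Rightarrow> nat \<Rightarrow> instr list \<Rightarrow> bool" where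
  "code_at R l cs \<longleftrightarrow> (\<exists>xs ys. R = xs @ cs @ ys \<and> length xs = l)"

lemma code_at_append:
  "code_at R l (as @ bs) \<Longrightarrow> code_at R l as \<and> code_at R (l + length as) bs"
  unfolding code_at_def
  by (elim exE conjE, rule conjI) (force, metis append.assoc length_append)

lemma code_at_Cons:
  "code_at R l (i # is) \<Longrightarrow> l < length R \<and> R ! l = i \<and> code_at R (Suc l) is"
  unfolding code_at_def
  by (elim exE conjE, intro conjI) (auto, metis append.assoc append_Cons append_Nil length_append_singleton)

section \<open>Execution of code fragments\<close>

definition allowed_step :: "program \<Rightarrow> nat list set \<Rightarrow> conf \<Rightarrow> bool" where
  "allowed_step R Q c \<longleftrightarrow> \<not> halted R c \<and> (\<forall>r. R ! pc c = Ask r \<longrightarrow> query c \<in> Q)"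

text \<open>Every intermediate step is recorded as non-halting and as asking only queries from
  \<open>Q\<close>. Hence step counts add up to the exact running time, and the queries are
  controlled along the way.\<close>

definition reaches ::
    "(nat list \<Rightarrow> nat) \<Rightarrow> nat list set \<Rightarrow> program \<Rightarrow> nat list \<Rightarrow> conf \<Rightarrow> nat \<Rightarrow> conf \<Rightarrow> bool" where
  "reaches orc Q R x c t c' \<longleftrightarrow>
     (step orc R x ^^ t) c = c' \<and> (\<forall>i<t. allowed_step R Q ((step orc R x ^^ i) c))"

lemma reaches_0: "reaches orc Q R x c 0 c"
  by (simp add: reaches_def)

lemma reaches_trans:
  assumes "reaches orc Q R x c s c'" "reaches orc Q R x c' t c''"
  shows "reaches orc Q R x c (s + t) c''"
  unfolding reaches_def
proof (intro conjI allI impI)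
  have *: "(step orc R x ^^ (s + i)) c = (step orc R x ^^ i) c'" for i
    using assms(1) unfolding reaches_def by (subst add.commute) (simp add: funpow_add)
  show "(step orc R x ^^ (s + t)) c = c''" using assms(2) * by (simp add: reaches_def)
  fix i assume "i < s + t"
  show "allowed_step R Q ((step orc R x ^^ i) c)"
  proof (cases "i < s")
    case True then show ?thesis using assms(1) by (simp add: reaches_def)
  next
    case False
    then obtain j where "i = s + j" "j < t" using \<open>i < s + t\<close>
      by (metis add_less_cancel_left le_iff_add not_less)
    then show ?thesis using * assms(2) by (simp add: reaches_def)
  qed
qed

lemma reaches_1:
  assumes "pc c < length R" "R ! pc c = i" "\<forall>r. i = Ask r \<longrightarrow> query c \<in> Q"
  shows "reaches orc Q R x c 1 (exec orc x i c)"
  using assms by (auto simp: reaches_def allowed_step_def halted_def step_def)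

fun straight :: "instr \<Rightarrow> bool" where
  "straight (Jump _) = False"
| "straight (JumpZero _ _) = False"
| "straight (Ask _) = False"
| "straight _ = True"

lemma reaches_straight:
  assumes "code_at R l is" "pc c = l" "\<forall>i\<in>set is. straight i"
  shows "reaches orc Q R x c (length is) (fold (exec orc x) is c)"
  using assms
proof (induction "is" arbitrary: l c)
  case Nil then show ?case by (simp add: reaches_0)
next
  case (Cons i "is")
  note ca = code_at_Cons[OF Cons.prems(1)]
  have 1: "reaches orc Q R x c 1 (exec orc x i c)"
    using ca Cons.prems by (intro reaches_1) auto
  have "pc (exec orc x i c) = Suc l" using Cons.prems by (cases i) auto
  then have 2: "reaches orc Q R x (exec orc x i c) (length is) (fold (exec orc x) is (exec orc x i c))"
    using Cons ca by auto
  show ?case using reaches_trans[OF 1 2] by simp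
qed

section \<open>Memory representation and correctness of the compiler\<close>

primrec rep :: "(nat \<Rightarrow> nat) \<Rightarrow> nat \<Rightarrow> nat \<Rightarrow> val \<Rightarrow> bool" where
  "rep m h w (Atom n) \<longleftrightarrow> w = n"
| "rep m h w (Cell a b) \<longleftrightarrow>
    10 \<le> w \<and> Suc w < h \<and> rep m h (m w) a \<and> rep m h (m (Suc w)) b"

lemma rep_mono:
  "rep m h w v \<Longrightarrow> (\<And>a. 10 \<le> a \<Longrightarrow> a < h \<Longrightarrow> m' a = m a) \<Longrightarrow> h \<le> h' \<Longrightarrow> rep m' h' w v"
  by (induction v arbitrary: w) auto

lemma rep_is_zero: "rep m h w v \<Longrightarrow> is_zero v \<longleftrightarrow> w = 0"
  by (cases v) auto

definition ready :: "nat \<Rightarrow> val \<Rightarrow> conf \<Rightarrow> bool" where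
  "ready l v c \<longleftrightarrow> pc c = l \<and> query c = [] \<and> reg c 5 = 1 \<and> reg c 6 = 0 \<and> 10 \<le> reg c 2 \<and>
     rep (reg c) (reg c 2) (reg c 0) v"

text \<open>The heap only grows and is never overwritten, so everything stored before a subprogram
  runs, including the linked stack, is still readable afterwards. Registers below 10 other than the
  stack pointer may change.\<close>

definition extends :: "conf \<Rightarrow> conf \<Rightarrow> bool" where
  "extends c c' \<longleftrightarrow> reg c 2 \<le> reg c' 2 \<and> reg c' 1 = reg c 1 \<and>
     (\<forall>a. 10 \<le> a \<and> a < reg c 2 \<longrightarrow> reg c' a = reg c a)"

lemma extends_refl: "extends c c" by (simp add: extends_def)

lemma extends_trans: "extends c c' \<Longrightarrow> extends c' c'' \<Longrightarrow> extends c c''"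
  by (auto simp: extends_def)

lemma rep_extends:
  "rep (reg c) (reg c 2) w v \<Longrightarrow> extends c c' \<Longrightarrow> rep (reg c') (reg c' 2) w v"
  by (erule rep_mono) (auto simp: extends_def)

text \<open>The induction needs an arbitrary prefix \<open>query c\<close> that is already written.
  Each further word costs one pass of six instructions; the final jump and \<open>Ask\<close> add
  two.\<close>

lemma reaches_ask:
  assumes "code_at R l (compile l PAsk)" "pc c = l" "reg c 5 = 1"
    "10 \<le> reg c 2" "rep (reg c) (reg c 2) (reg c 0) (val_of_nats ns)" "query c @ ns \<in> Q" "reg c 6 = 0"
  shows "\<exists>c'. reaches orc Q R x c (6 * length ns + 2) c' \<and> pc c' = l + 7 \<and> query c' = [] \<and>
    reg c' 0 = orc (query c @ ns) \<and> reg c' 5 = 1 \<and> reg c' 6 = 0 \<and> extends c c'"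
  using assms
proof (induction ns arbitrary: c)
  case Nil
  let ?c1 = "exec orc x (JumpZero 0 (l + 6)) c"
  note ca = Nil.prems(1)[simplified, THEN code_at_Cons]
  have "R ! (l + 6) = Ask 0 \<and> l + 6 < length R"
    using Nil.prems(1) by (auto dest!: code_at_Cons simp: numeral_eq_Suc)
  then have 2: "reaches orc Q R x ?c1 1 (exec orc x (Ask 0) ?c1)"
    using Nil by (intro reaches_1) auto
  have 1: "reaches orc Q R x c 1 ?c1" using Nil ca by (intro reaches_1) auto
  show ?case using reaches_trans[OF 1 2] Nil
    by (intro exI[of _ "exec orc x (Ask 0) ?c1"]) (auto simp: extends_def)
next
  case (Cons n ns)
  let ?b = "[Load 3 0, Put 3, Add 0 0 5, Load 0 0]"
  let ?c1 = "exec orc x (JumpZero 0 (l + 6)) c"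
  let ?c2 = "fold (exec orc x) ?b ?c1"
  let ?c3 = "exec orc x (Jump l) ?c2"
  have code: "code_at R (Suc l) (?b @ [Jump l, Ask 0])" and l: "l < length R" "R ! l = JumpZero 0 (l + 6)"
    using Cons.prems(1) by (auto dest!: code_at_Cons)
  have j: "R ! (l + 5) = Jump l \<and> l + 5 < length R"
    using code by (auto dest!: code_at_Cons simp: numeral_eq_Suc)
  have nz: "reg c 0 \<noteq> 0" using Cons.prems by auto
  have 1: "reaches orc Q R x c 1 ?c1" using l Cons.prems by (intro reaches_1) auto
  have 2: "reaches orc Q R x ?c1 (length ?b) ?c2"
    using code_at_append[OF code] nz Cons.prems by (intro reaches_straight) auto
  have 3: "reaches orc Q R x ?c2 1 ?c3"
    using j nz Cons.prems by (intro reaches_1) (auto simp: numeral_eq_Suc)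
  have r: "rep (reg ?c3) (reg ?c3 2) (reg ?c3 0) (val_of_nats ns)"
    using Cons.prems by (auto elim!: rep_mono)
  have q: "query ?c3 = query c @ [n]" using Cons.prems nz by auto
  have f: "pc ?c3 = l" "reg ?c3 5 = 1" "10 \<le> reg ?c3 2" "query ?c3 @ ns \<in> Q" "reg ?c3 6 = 0"
    using Cons.prems q by auto
  obtain c' where c': "reaches orc Q R x ?c3 (6 * length ns + 2) c'" "pc c' = l + 7" "query c' = []"
    "reg c' 0 = orc (query ?c3 @ ns)" "reg c' 5 = 1" "reg c' 6 = 0" "extends ?c3 c'"
    using Cons.IH[OF Cons.prems(1) f(1-3) r f(4,5)] by blast
  have "reaches orc Q R x c (1 + length ?b + 1 + (6 * length ns + 2)) c'"
    by (intro reaches_trans[OF reaches_trans[OF reaches_trans[OF 1 2] 3] c'(1)])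
  moreover have "1 + length ?b + 1 + (6 * length ns + 2) = 6 * length (n # ns) + 2" by simp
  moreover have "extends c c'" by (rule extends_trans[OF _ c'(7)]) (auto simp: extends_def)
  moreover have "query ?c3 @ ns = query c @ n # ns" unfolding q by simp
  ultimately show ?case using c'(2-6) by metis
qed

lemma cons_code_correct:
  fixes orc x
  assumes ca: "code_at R l (cons_code r s d)" and c: "pc c = l" "reg c 5 = 1" "10 \<le> reg c 2"
    and rs: "r < 10" "s < 10" "d < 10" "r \<noteq> 2" "s \<noteq> 2" "d \<noteq> 2" "d \<noteq> 5"
  shows "\<exists>c'. reaches orc Q R x c 5 c' \<and> pc c' = l + 5 \<and> query c' = query c \<and>
    reg c' = (reg c)(reg c 2 := reg c r, Suc (reg c 2) := reg c s, d := reg c 2, 2 := reg c 2 + 2)"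
proof -
  let ?c = "fold (exec orc x) (cons_code r s d) c"
  have "length (cons_code r s d) = 5" "\<forall>i\<in>set (cons_code r s d). straight i"
    by (auto simp: cons_code_def)
  then have r: "reaches orc Q R x c 5 ?c"
    using reaches_straight[OF ca c(1)] by metis
  \<comment> \<open>Writing a heap address as \<open>j + 10\<close> lets the simplifier see that it
    differs from every register number in use.\<close>
  obtain j where j: "reg c 2 = j + 10" using c(3) by (metis add.commute le_Suc_ex)
  have "pc ?c = l + 5 \<and> query ?c = query c" using c(1) by (simp add: cons_code_def)
  moreover have "reg ?c = (reg c)(reg c 2 := reg c r, Suc (reg c 2) := reg c s, d := reg c 2, 2 := reg c 2 + 2)"
    using rs c(2) by (simp add: cons_code_def j fun_eq_iff)
  ultimately show ?thesis using r by blast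
qed

lemma pop_code_correct:
  assumes ca: "code_at R l pop_code" and c: "pc c = l" "reg c 5 = 1" "10 \<le> reg c 1"
  shows "\<exists>c'. reaches orc Q R x c 3 c' \<and> pc c' = l + 3 \<and> query c' = query c \<and>
    reg c' = (reg c)(3 := reg c (reg c 1), 4 := Suc (reg c 1), 1 := reg c (Suc (reg c 1)))"
proof -
  let ?c = "fold (exec orc x) pop_code c"
  have "length pop_code = 3" "\<forall>i\<in>set pop_code. straight i"
    by (auto simp: pop_code_def)
  then have r: "reaches orc Q R x c 3 ?c"
    using reaches_straight[OF ca c(1)] by metis
  obtain j where j: "reg c 1 = j + 10" using c(3) by (metis add.commute le_Suc_ex)
  have "pc ?c = l + 3 \<and> query ?c = query c" using c(1) by (simp add: pop_code_def)
  moreover have "reg ?c = (reg c)(3 := reg c (reg c 1), 4 := Suc (reg c 1), 1 := reg c (Suc (reg c 1)))"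
    using c(2) j by (simp add: pop_code_def j fun_eq_iff)
  ultimately show ?thesis using r by blast
qed

text \<open>The induction is over the evaluation, not over the program, so that loops are covered.
  \<open>extends\<close> is what allows a saved pointer to be used after a subprogram has
  run.\<close>

lemma compile_correct:
  "evals orc Q p v w t \<Longrightarrow> code_at R l (compile l p) \<Longrightarrow> ready l v c \<Longrightarrow>
   \<exists>c'. reaches orc Q R x c t c' \<and> ready (l + length (compile l p)) w c' \<and> extends c c'"
proof (induction arbitrary: l c rule: evals.induct)
  case (Id v)
  then show ?case by (auto intro!: exI[of _ c] reaches_0 extends_refl)
next
  case (Const n v)
  let ?c = "fold (exec orc x) (compile l (PConst n)) c"
  show ?case using reaches_straight[OF Const(1), of c orc Q x] Const(2)
    by (intro exI[of _ ?c]) (auto simp: ready_def extends_def)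
next
  case (Fst a b)
  let ?c = "fold (exec orc x) (compile l PFst) c"
  show ?case using reaches_straight[OF Fst(1), of c orc Q x] Fst(2)
    by (intro exI[of _ ?c]) (auto simp: ready_def extends_def elim!: rep_mono)
next
  case (Snd a b)
  let ?c = "fold (exec orc x) (compile l PSnd) c"
  have "reaches orc Q R x c 2 ?c" using reaches_straight[OF Snd(1), of c orc Q x] Snd(2)
    by (simp add: ready_def numeral_eq_Suc)
  then show ?case using Snd(2) by (intro exI[of _ ?c]) (auto simp: ready_def extends_def elim!: rep_mono)
next
  case (Add m n)
  let ?c = "fold (exec orc x) (compile l PAdd) c"
  have "reaches orc Q R x c 4 ?c" using reaches_straight[OF Add(1), of c orc Q x] Add(2)
    by (simp add: ready_def numeral_eq_Suc)
  then show ?case using Add(2) by (intro exI[of _ ?c]) (auto simp: ready_def extends_def)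
next
  case (Sub m n)
  let ?c = "fold (exec orc x) (compile l PSub) c"
  have "reaches orc Q R x c 4 ?c" using reaches_straight[OF Sub(1), of c orc Q x] Sub(2)
    by (simp add: ready_def numeral_eq_Suc)
  then show ?case using Sub(2) by (intro exI[of _ ?c]) (auto simp: ready_def extends_def)
next
  case (Seq p v w s q u t)
  have ca: "code_at R l (compile l p)" "code_at R (l + length (compile l p)) (compile (l + length (compile l p)) q)"
    using code_at_append Seq.prems(1) by (auto simp: Let_def)
  obtain c1 where c1: "reaches orc Q R x c s c1" "ready (l + length (compile l p)) w c1" "extends c c1"
    using Seq.IH(1)[OF ca(1) Seq.prems(2)] by blast
  obtain c2 where c2: "reaches orc Q R x c1 t c2"
    "ready (l + length (compile l p) + length (compile (l + length (compile l p)) q)) u c2" "extends c1 c2"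
    using Seq.IH(2)[OF ca(2) c1(2)] by blast
  show ?case using reaches_trans[OF c1(1) c2(1)] c2(2) extends_trans[OF c1(3) c2(3)]
    by (auto simp: Let_def add.assoc)
next
  case (Pair p v a s q b t)
  define cp where "cp = compile (l + 5) p"
  define cq where "cq = compile (l + 14 + length cp) q"
  have len5: "length (cons_code i j d) = 5" and len3: "length pop_code = 3" for i j d
    by (auto simp: cons_code_def pop_code_def)
  define mv where "mv = [Add 0 3 6]"
  have len1: "length mv = 1" by (simp add: mv_def)
  have code: "code_at R l (cons_code 0 1 1 @ cp @ pop_code @ cons_code 0 1 1 @ mv @ cq @ pop_code @ cons_code 3 0 0)"
    using Pair.prems(1) by (simp add: Let_def cp_def cq_def mv_def)
  have ca: "code_at R l (cons_code 0 1 1)" "code_at R (l + 5) cp" "code_at R (l + 5 + length cp) pop_code"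
    "code_at R (l + 8 + length cp) (cons_code 0 1 1)" "code_at R (l + 13 + length cp) mv"
    "code_at R (l + 14 + length cp) cq" "code_at R (l + 14 + length cp + length cq) pop_code"
    "code_at R (l + 17 + length cp + length cq) (cons_code 3 0 0)"
    using code by (auto dest!: code_at_append simp: len5 len3 len1 add.commute add.left_commute)
  \<comment> \<open>\<open>h\<close> is the stack cell that keeps the input pointer and the old
    stack while \<open>p\<close> runs.\<close>
  define h where "h = reg c 2"
  have r: "pc c = l" "query c = []" "reg c 5 = 1" "reg c 6 = 0" "10 \<le> reg c 2"
    "rep (reg c) (reg c 2) (reg c 0) v" using Pair.prems(2) by (auto simp: ready_def)
  have h: "10 \<le> h" using r by (simp add: h_def)
  obtain c1 where t1: "reaches orc Q R x c 5 c1" and f1: "pc c1 = l + 5" "query c1 = query c"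
    "reg c1 = (reg c)(h := reg c 0, Suc h := reg c 1, 1 := h, 2 := h + 2)"
    using cons_code_correct[OF ca(1) r(1,3,5), of orc Q x] unfolding h_def by auto
  have r1: "rep (reg c1) (h + 2) (reg c 0) v"
    using r(6) h by (auto elim!: rep_mono simp: h_def[symmetric] f1(3))
  have "ready (l + 5) v c1" using f1 r r1 h by (auto simp: ready_def)
  from Pair.IH(1)[OF ca(2)[unfolded cp_def] this]
  obtain c2 where c2: "reaches orc Q R x c1 s c2" "ready (l + 5 + length cp) a c2" "extends c1 c2"
    by (auto simp: cp_def)
  have c2m: "h + 2 \<le> reg c2 2" "reg c2 1 = h" "reg c2 h = reg c 0" "reg c2 (Suc h) = reg c 1"
    "\<And>a. 10 \<le> a \<Longrightarrow> a < h \<Longrightarrow> reg c2 a = reg c a"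
    using c2(3) f1 h by (auto simp: extends_def)
  have s2: "pc c2 = l + 5 + length cp" "query c2 = []" "reg c2 5 = 1" "reg c2 6 = 0" "10 \<le> reg c2 2"
    "rep (reg c2) (reg c2 2) (reg c2 0) a" using c2(2) by (auto simp: ready_def)
  \<comment> \<open>\<open>h2\<close> is the stack cell that keeps the first result while
    \<open>q\<close> runs.\<close>
  define h2 where "h2 = reg c2 2"
  have h2: "10 \<le> h2" "h + 2 \<le> h2" using s2 c2m by (auto simp: h2_def)
  obtain d2 where u2: "reaches orc Q R x c2 3 d2" and g2: "pc d2 = l + 8 + length cp" "query d2 = []"
    "reg d2 = (reg c2)(3 := reg c 0, 4 := Suc h, 1 := reg c 1)"
    using pop_code_correct[OF ca(3) s2(1,3), of orc Q x] h c2m s2 by auto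
  obtain e2 where v2: "reaches orc Q R x d2 5 e2" and k2: "pc e2 = l + 13 + length cp" "query e2 = []"
    "reg e2 = (reg d2)(h2 := reg c2 0, Suc h2 := reg c 1, 1 := h2, 2 := h2 + 2)"
    using cons_code_correct[OF ca(4) g2(1), of orc Q x] g2 s2 h2 by (auto simp: h2_def)
  define c3 where "c3 = exec orc x (Add 0 3 6) e2"
  have t3: "reaches orc Q R x e2 1 c3"
    unfolding c3_def using code_at_Cons[OF ca(5)[unfolded mv_def]] k2(1) by (intro reaches_1) auto
  have f3: "pc c3 = l + 14 + length cp" "query c3 = []"
    "reg c3 = (reg c2)(3 := reg c 0, 4 := Suc h, h2 := reg c2 0, Suc h2 := reg c 1, 1 := h2, 2 := h2 + 2, 0 := reg c 0)"
    using k2 g2 s2 h2 by (auto simp: c3_def fun_eq_iff)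
  have r3: "rep (reg c3) (h2 + 2) (reg c 0) v"
    using r(6) h2 c2m(5) by (auto elim!: rep_mono simp: h_def[symmetric] f3(3))
  have a3: "rep (reg c3) (h2 + 2) (reg c2 0) a"
    using s2(6) h2 by (auto elim!: rep_mono simp: h2_def[symmetric] f3(3))
  have "ready (l + 14 + length cp) v c3" using f3 r3 s2 h2 by (auto simp: ready_def)
  from Pair.IH(2)[OF ca(6)[unfolded cq_def] this]
  obtain c4 where c4: "reaches orc Q R x c3 t c4" "ready (l + 14 + length cp + length cq) b c4" "extends c3 c4"
    by (auto simp: cq_def)
  have s4: "pc c4 = l + 14 + length cp + length cq" "query c4 = []" "reg c4 5 = 1" "reg c4 6 = 0" "10 \<le> reg c4 2"
    "rep (reg c4) (reg c4 2) (reg c4 0) b" using c4(2) by (auto simp: ready_def)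
  have c4m: "h2 + 2 \<le> reg c4 2" "reg c4 1 = h2" "reg c4 h2 = reg c2 0" "reg c4 (Suc h2) = reg c 1"
    "\<And>a. 10 \<le> a \<Longrightarrow> a < h \<Longrightarrow> reg c4 a = reg c a"
    using c4(3) f3 h2 c2m(5) by (auto simp: extends_def)
  have a4: "rep (reg c4) (reg c4 2) (reg c2 0) a"
    using rep_extends[OF _ c4(3)] a3 f3(3) by simp
  define h4 where "h4 = reg c4 2"
  have h4: "10 \<le> h4" "h2 + 2 \<le> h4" using s4 c4m by (auto simp: h4_def)
  obtain d4 where u4: "reaches orc Q R x c4 3 d4" and g4: "pc d4 = l + 17 + length cp + length cq" "query d4 = []"
    "reg d4 = (reg c4)(3 := reg c2 0, 4 := Suc h2, 1 := reg c 1)"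
    using pop_code_correct[OF ca(7) s4(1,3), of orc Q x] h2 c4m s4 by auto
  obtain c5 where v4: "reaches orc Q R x d4 5 c5" and k4: "pc c5 = l + 22 + length cp + length cq" "query c5 = []"
    "reg c5 = (reg d4)(h4 := reg c2 0, Suc h4 := reg c4 0, 0 := h4, 2 := h4 + 2)"
    using cons_code_correct[OF ca(8) g4(1), of orc Q x] g4 s4 h4 by (auto simp: h4_def)
  have "rep (reg c5) (h4 + 2) (reg c2 0) a" "rep (reg c5) (h4 + 2) (reg c4 0) b"
    using a4 s4(6) h4 by (auto elim!: rep_mono simp: h4_def[symmetric] k4(3) g4(3))
  then have "ready (l + 22 + length cp + length cq) (Cell a b) c5"
    using k4 g4 s4 h4 by (auto simp: ready_def)
  moreover have "extends c c5"
    using k4 g4 h4 h2 h c4m by (auto simp: extends_def h_def[symmetric])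
  moreover have "reaches orc Q R x c (5 + s + 3 + 5 + 1 + t + 3 + 5) c5"
    by (intro reaches_trans[OF reaches_trans[OF reaches_trans[OF reaches_trans[OF
      reaches_trans[OF reaches_trans[OF reaches_trans[OF t1 c2(1)] u2] v2] t3] c4(1)] u4] v4])
  \<comment> \<open>Push, pop, push, move, pop and cons together make up the constant 22 of the cost
    rule.\<close>
  moreover have "5 + s + 3 + 5 + 1 + t + 3 + 5 = s + t + 22" by simp
  moreover have "l + length (compile l (PPair p q)) = l + 22 + length cp + length cq"
    by (simp add: Let_def cp_def cq_def len5 len3)
  ultimately show ?case by metis
next
  case (IfZ b p v w s q)
  define cq where "cq = compile (l + 4) q"
  define cp where "cp = compile (l + 5 + length cq) p"
  let ?b = "[Load 3 0, Add 4 0 5, Load 0 4]"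
  have code: "code_at R l (?b @ [JumpZero 3 (l + 5 + length cq)] @ cq @ [Jump (l + 5 + length cq + length cp)] @ cp)"
    using IfZ.prems(1) by (simp add: Let_def cq_def cp_def)
  have cb: "code_at R l ?b" using conjunct1[OF code_at_append[OF code]] .
  have ca: "l + 3 < length R" "R ! (l + 3) = JumpZero 3 (l + 5 + length cq)"
    "code_at R (l + 5 + length cq) cp"
    using code by (auto dest!: code_at_append code_at_Cons simp: add.commute add.left_commute numeral_eq_Suc)
  define c1 where "c1 = fold (exec orc x) ?b c"
  define c2 where "c2 = exec orc x (JumpZero 3 (l + 5 + length cq)) c1"
  have r: "pc c = l" "query c = []" "reg c 5 = 1" "reg c 6 = 0" "10 \<le> reg c 2"
    "rep (reg c) (reg c 2) (reg c 0) (Cell b v)" using IfZ.prems(2) by (auto simp: ready_def)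
  have z: "reg c (reg c 0) = 0" using r(6) rep_is_zero IfZ.hyps by auto
  have 1: "reaches orc Q R x c (length ?b) c1" unfolding c1_def using cb r(1) by (intro reaches_straight) auto
  have f1: "pc c1 = l + 3" "query c1 = []"
    "reg c1 = (reg c)(3 := reg c (reg c 0), 4 := Suc (reg c 0), 0 := reg c (Suc (reg c 0)))"
    using r by (auto simp: c1_def)
  have 2: "reaches orc Q R x c1 1 c2" unfolding c2_def using ca f1 by (intro reaches_1) auto
  have e: "extends c c2" using f1 by (auto simp: extends_def c2_def)
  have "rep (reg c2) (reg c2 2) (reg c (Suc (reg c 0))) v"
    using r(6) e by (auto intro: rep_extends)
  then have "ready (l + 5 + length cq) v c2"
    using r z f1 by (auto simp: ready_def c2_def)
  from IfZ.IH[OF ca(3)[unfolded cp_def] this]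
  obtain c3 where c3: "reaches orc Q R x c2 s c3" "ready (l + 5 + length cq + length cp) w c3" "extends c2 c3"
    by (auto simp: cp_def)
  have "reaches orc Q R x c (length ?b + 1 + s) c3"
    by (intro reaches_trans[OF reaches_trans[OF 1 2] c3(1)])
  moreover have "length ?b + 1 + s = s + 4" by simp
  moreover have "l + length (compile l (PIf p q)) = l + 5 + length cq + length cp"
    by (simp add: Let_def cq_def cp_def)
  ultimately show ?case using c3(2) extends_trans[OF e c3(3)] by metis
next
  case (IfN b q v w s p)
  define cq where "cq = compile (l + 4) q"
  define cp where "cp = compile (l + 5 + length cq) p"
  let ?b = "[Load 3 0, Add 4 0 5, Load 0 4]"
  have code: "code_at R l (?b @ [JumpZero 3 (l + 5 + length cq)] @ cq @ [Jump (l + 5 + length cq + length cp)] @ cp)"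
    using IfN.prems(1) by (simp add: Let_def cq_def cp_def)
  have cb: "code_at R l ?b" using conjunct1[OF code_at_append[OF code]] .
  have ca: "l + 3 < length R" "R ! (l + 3) = JumpZero 3 (l + 5 + length cq)"
    "code_at R (l + 4) cq" "l + 4 + length cq < length R"
    "R ! (l + 4 + length cq) = Jump (l + 5 + length cq + length cp)"
    using code by (auto dest!: code_at_append code_at_Cons simp: add.commute add.left_commute numeral_eq_Suc)
  define c1 where "c1 = fold (exec orc x) ?b c"
  define c2 where "c2 = exec orc x (JumpZero 3 (l + 5 + length cq)) c1"
  have r: "pc c = l" "query c = []" "reg c 5 = 1" "reg c 6 = 0" "10 \<le> reg c 2"
    "rep (reg c) (reg c 2) (reg c 0) (Cell b v)" using IfN.prems(2) by (auto simp: ready_def)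
  have z: "reg c (reg c 0) \<noteq> 0" using r(6) rep_is_zero IfN.hyps by auto
  have 1: "reaches orc Q R x c (length ?b) c1" unfolding c1_def using cb r(1) by (intro reaches_straight) auto
  have f1: "pc c1 = l + 3" "query c1 = []"
    "reg c1 = (reg c)(3 := reg c (reg c 0), 4 := Suc (reg c 0), 0 := reg c (Suc (reg c 0)))"
    using r by (auto simp: c1_def)
  have 2: "reaches orc Q R x c1 1 c2" unfolding c2_def using ca f1 by (intro reaches_1) auto
  have e: "extends c c2" using f1 by (auto simp: extends_def c2_def)
  have "rep (reg c2) (reg c2 2) (reg c (Suc (reg c 0))) v"
    using r(6) e by (auto intro: rep_extends)
  then have "ready (l + 4) v c2"
    using r z f1 by (auto simp: ready_def c2_def)
  from IfN.IH[OF ca(3)[unfolded cq_def] this]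
  obtain c3 where c3: "reaches orc Q R x c2 s c3" "ready (l + 4 + length cq) w c3" "extends c2 c3"
    by (auto simp: cq_def)
  define c4 where "c4 = exec orc x (Jump (l + 5 + length cq + length cp)) c3"
  have 4: "reaches orc Q R x c3 1 c4" unfolding c4_def using ca c3(2) by (intro reaches_1) (auto simp: ready_def)
  have "reaches orc Q R x c (length ?b + 1 + s + 1) c4"
    by (intro reaches_trans[OF reaches_trans[OF reaches_trans[OF 1 2] c3(1)] 4])
  moreover have "extends c c4" using extends_trans[OF e c3(3)] by (auto simp: extends_def c4_def)
  moreover have "length ?b + 1 + s + 1 = s + 5" by simp
  moreover have "l + length (compile l (PIf p q)) = l + 5 + length cq + length cp"
    by (simp add: Let_def cq_def cp_def)
  moreover have "ready (l + 5 + length cq + length cp) w c4"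
    using c3(2) by (auto simp: ready_def c4_def)
  ultimately show ?case by metis
next
  case (WhileZ b p v)
  define cp where "cp = compile (l + 2) p"
  have code: "code_at R l ([Load 3 0] @ [JumpZero 3 (l + 3 + length cp)] @ cp @ [Jump l])"
    using WhileZ.prems(1) by (simp add: Let_def cp_def)
  have cb: "code_at R l [Load 3 0]" using conjunct1[OF code_at_append[OF code]] .
  have ca: "l + 1 < length R" "R ! (l + 1) = JumpZero 3 (l + 3 + length cp)"
    using code by (auto dest!: code_at_append code_at_Cons)
  define c1 where "c1 = fold (exec orc x) [Load 3 0] c"
  define c2 where "c2 = exec orc x (JumpZero 3 (l + 3 + length cp)) c1"
  have r: "pc c = l" "query c = []" "reg c 5 = 1" "reg c 6 = 0" "10 \<le> reg c 2"
    "rep (reg c) (reg c 2) (reg c 0) (Cell b v)" using WhileZ.prems(2) by (auto simp: ready_def)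
  have z: "reg c (reg c 0) = 0" using r(6) rep_is_zero WhileZ.hyps by auto
  have 1: "reaches orc Q R x c (length [Load 3 0]) c1" unfolding c1_def using cb r(1) by (intro reaches_straight) auto
  have f1: "pc c1 = l + 1" "query c1 = []" "reg c1 = (reg c)(3 := reg c (reg c 0))"
    using r by (auto simp: c1_def)
  have 2: "reaches orc Q R x c1 1 c2" unfolding c2_def using ca f1 by (intro reaches_1) auto
  have e: "extends c c2" using f1 by (auto simp: extends_def c2_def)
  have "rep (reg c2) (reg c2 2) (reg c 0) (Cell b v)"
    by (rule rep_extends[OF r(6) e])
  then have "ready (l + 3 + length cp) (Cell b v) c2"
    using r z f1 by (auto simp: ready_def c2_def)
  moreover have "l + length (compile l (PWhile p)) = l + 3 + length cp"
    by (simp add: Let_def cp_def)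
  moreover have "length [Load 3 0] + 1 = 2" by simp
  ultimately show ?case using reaches_trans[OF 1 2] e by metis
next
  case (WhileN b p v w s u t)
  define cp where "cp = compile (l + 2) p"
  have code: "code_at R l ([Load 3 0] @ [JumpZero 3 (l + 3 + length cp)] @ cp @ [Jump l])"
    using WhileN.prems(1) by (simp add: Let_def cp_def)
  have cb: "code_at R l [Load 3 0]" using conjunct1[OF code_at_append[OF code]] .
  have ca: "l + 1 < length R" "R ! (l + 1) = JumpZero 3 (l + 3 + length cp)"
    "code_at R (l + 2) cp" "l + 2 + length cp < length R" "R ! (l + 2 + length cp) = Jump l"
    using code by (auto dest!: code_at_append code_at_Cons)
  define c1 where "c1 = fold (exec orc x) [Load 3 0] c"
  define c2 where "c2 = exec orc x (JumpZero 3 (l + 3 + length cp)) c1"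
  have r: "pc c = l" "query c = []" "reg c 5 = 1" "reg c 6 = 0" "10 \<le> reg c 2"
    "rep (reg c) (reg c 2) (reg c 0) (Cell b v)" using WhileN.prems(2) by (auto simp: ready_def)
  have z: "reg c (reg c 0) \<noteq> 0" using r(6) rep_is_zero WhileN.hyps by auto
  have 1: "reaches orc Q R x c (length [Load 3 0]) c1" unfolding c1_def using cb r(1) by (intro reaches_straight) auto
  have f1: "pc c1 = l + 1" "query c1 = []" "reg c1 = (reg c)(3 := reg c (reg c 0))"
    using r by (auto simp: c1_def)
  have 2: "reaches orc Q R x c1 1 c2" unfolding c2_def using ca f1 by (intro reaches_1) auto
  have e: "extends c c2" using f1 by (auto simp: extends_def c2_def)
  have "rep (reg c2) (reg c2 2) (reg c 0) (Cell b v)"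
    by (rule rep_extends[OF r(6) e])
  then have "ready (l + 2) (Cell b v) c2"
    using r z f1 by (auto simp: ready_def c2_def)
  from WhileN.IH(1)[OF ca(3)[unfolded cp_def] this]
  obtain c3 where c3: "reaches orc Q R x c2 s c3" "ready (l + 2 + length cp) w c3" "extends c2 c3"
    by (auto simp: cp_def)
  define c4 where "c4 = exec orc x (Jump l) c3"
  have 4: "reaches orc Q R x c3 1 c4" unfolding c4_def using ca c3(2) by (intro reaches_1) (auto simp: ready_def)
  have "ready l w c4" using c3(2) by (auto simp: ready_def c4_def)
  from WhileN.IH(2)[OF WhileN.prems(1) this]
  obtain c5 where c5: "reaches orc Q R x c4 t c5" "ready (l + length (compile l (PWhile p))) u c5" "extends c4 c5"
    by auto
  have "extends c c4" using extends_trans[OF e c3(3)] by (auto simp: extends_def c4_def)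
  then have "extends c c5" using c5(3) by (rule extends_trans)
  moreover have "reaches orc Q R x c (length [Load 3 0] + 1 + s + 1 + t) c5"
    by (intro reaches_trans[OF reaches_trans[OF reaches_trans[OF reaches_trans[OF 1 2] c3(1)] 4] c5(1)])
  moreover have "length [Load 3 0] + 1 + s + 1 + t = s + t + 3" by simp
  ultimately show ?case using c5(2) by metis
next
  case (Ask ns)
  from Ask.prems(2) have r: "pc c = l" "query c = []" "reg c 5 = 1" "reg c 6 = 0" "10 \<le> reg c 2"
    "rep (reg c) (reg c 2) (reg c 0) (val_of_nats ns)" by (auto simp: ready_def)
  from reaches_ask[OF Ask.prems(1) r(1,3,5,6), of Q orc x] Ask.hyps r
  obtain c' where "reaches orc Q R x c (6 * length ns + 2) c'" "pc c' = l + 7" "query c' = []"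
    "reg c' 0 = orc ns" "reg c' 5 = 1" "reg c' 6 = 0" "extends c c'" by auto
  then show ?case using r by (intro exI[of _ c']) (auto simp: ready_def extends_def)
qed

section \<open>Loading the input and the complete machine\<close>

definition read_code :: "instr list" where
  "read_code = [Const 5 1, Const 2 10, InputLength 7,
     JumpZero 7 12, Sub 7 7 5, Input 3 7] @ cons_code 3 0 0 @ [Jump 3]"

definition machine :: "prog \<Rightarrow> program" where
  "machine p = read_code @ compile 12 p"

text \<open>The input is read from its last word backwards, so that consing restores its order;
  register 7 counts the words still to be read. One pass of the loop executes nine instructions.
  \<open>read_code\<close> itself has twelve, hence the load address 12.\<close>

lemma read_loop:
  assumes "code_at R 0 read_code" "pc c = 3" "query c = []" "reg c 5 = 1" "reg c 6 = 0"
    "10 \<le> reg c 2" "reg c 7 = n" "n \<le> length x"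
    "rep (reg c) (reg c 2) (reg c 0) (val_of_nats (drop n x))"
  shows "\<exists>c'. reaches orc Q R x c (9 * n + 1) c' \<and> ready 12 (val_of_nats x) c'"
  using assms(2-)
proof (induction n arbitrary: c)
  case 0
  obtain ys where R: "R = read_code @ ys" using assms(1) by (auto simp: code_at_def)
  have "R ! 3 = JumpZero 7 12 \<and> 3 < length R"
    by (simp add: R read_code_def cons_code_def)
  then have "reaches orc Q R x c 1 (exec orc x (JumpZero 7 12) c)"
    using 0 by (intro reaches_1) auto
  then show ?case using 0 by (intro exI[of _ "exec orc x (JumpZero 7 12) c"]) (auto simp: ready_def)
next
  case (Suc n)
  let ?b = "[Sub 7 7 5, Input 3 7]"
  obtain ys where R: "R = read_code @ ys" using assms(1) by (auto simp: code_at_def)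
  have code: "R ! 3 = JumpZero 7 12" "3 < length R" "R ! 11 = Jump 3" "11 < length R"
    by (simp_all add: R read_code_def cons_code_def)
  have ca: "code_at R 4 ?b" "code_at R 6 (cons_code 3 0 0)" unfolding code_at_def R
    by (rule exI[of _ "take 4 read_code"], rule exI[of _ "cons_code 3 0 0 @ [Jump 3] @ ys"])
      (simp add: read_code_def,
       rule exI[of _ "take 6 read_code"], rule exI[of _ "[Jump 3] @ ys"], simp add: read_code_def)
  define c1 where "c1 = exec orc x (JumpZero 7 12) c"
  define c2 where "c2 = fold (exec orc x) ?b c1"
  have 1: "reaches orc Q R x c 1 c1" unfolding c1_def using code Suc.prems by (intro reaches_1) auto
  have "pc c1 = 4" using Suc.prems by (simp add: c1_def)
  then have 2: "reaches orc Q R x c1 (length ?b) c2"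
    unfolding c2_def using ca(1) Suc.prems by (intro reaches_straight) auto
  have f2: "pc c2 = 6" "query c2 = []" "reg c2 = (reg c)(7 := n, 3 := x ! n)"
    using Suc.prems by (auto simp: c1_def c2_def fun_eq_iff)
  define h where "h = reg c 2"
  have h: "10 \<le> h" using Suc.prems by (simp add: h_def)
  obtain c3 where 3: "reaches orc Q R x c2 5 c3" and f3: "pc c3 = 11" "query c3 = []"
    "reg c3 = (reg c2)(h := x ! n, Suc h := reg c 0, 0 := h, 2 := h + 2)"
    using cons_code_correct[OF ca(2) f2(1), of orc Q x] f2 Suc.prems by (auto simp: h_def)
  define c4 where "c4 = exec orc x (Jump 3) c3"
  have 4: "reaches orc Q R x c3 1 c4"
    unfolding c4_def using code f3(1) by (intro reaches_1) auto
  have d: "drop n x = x ! n # drop (Suc n) x" using Suc.prems by (simp add: Cons_nth_drop_Suc)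
  have f4: "pc c4 = 3" "query c4 = []"
    "reg c4 = (reg c)(7 := n, 3 := x ! n, h := x ! n, Suc h := reg c 0, 0 := h, 2 := h + 2)"
    using f3 f2 by (auto simp: c4_def)
  have "rep (reg c4) (h + 2) (reg c 0) (val_of_nats (drop (Suc n) x))"
    using h by (intro rep_mono[OF Suc.prems(8)]) (auto simp: f4(3) h_def[symmetric])
  then have r: "rep (reg c4) (reg c4 2) (reg c4 0) (val_of_nats (drop n x))"
    using h by (simp add: d f4(3))
  have "\<exists>c'. reaches orc Q R x c4 (9 * n + 1) c' \<and> ready 12 (val_of_nats x) c'"
    using Suc.prems h by (intro Suc.IH r) (auto simp: f4)
  then obtain c' where c': "reaches orc Q R x c4 (9 * n + 1) c'" "ready 12 (val_of_nats x) c'" by blast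
  have "reaches orc Q R x c (1 + length ?b + 5 + 1 + (9 * n + 1)) c'"
    by (intro reaches_trans[OF reaches_trans[OF reaches_trans[OF reaches_trans[OF 1 2] 3] 4] c'(1)])
  moreover have "1 + length ?b + 5 + 1 + (9 * n + 1) = 9 * Suc n + 1" by simp
  ultimately show ?case using c'(2) by metis
qed

lemma read_correct:
  assumes "code_at R 0 read_code"
  shows "\<exists>c'. reaches orc Q R x init_conf (9 * length x + 4) c' \<and> ready 12 (val_of_nats x) c'"
proof -
  let ?b = "[Const 5 1, Const 2 10, InputLength 7]"
  let ?c = "fold (exec orc x) ?b init_conf"
  have "code_at R 0 (?b @ drop 3 read_code)" using assms by (simp add: read_code_def)
  from conjunct1[OF code_at_append[OF this]]
  have 1: "reaches orc Q R x init_conf (length ?b) ?c"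
    by (rule reaches_straight) (auto simp: init_conf_def)
  have "\<exists>c'. reaches orc Q R x ?c (9 * length x + 1) c' \<and> ready 12 (val_of_nats x) c'"
    by (intro read_loop[OF assms]) (auto simp: init_conf_def)
  then obtain c' where c': "reaches orc Q R x ?c (9 * length x + 1) c'" "ready 12 (val_of_nats x) c'"
    by blast
  have "length ?b + (9 * length x + 1) = 9 * length x + 4" by simp
  then show ?thesis using reaches_trans[OF 1 c'(1)] c'(2) by metis
qed

text \<open>All later programs are built through this interface. The running time is exact because
  the configuration reached is halted and none before it is.\<close>

theorem machine_correct:
  assumes "evals orc Q p (val_of_nats x) (Atom y) t"
  shows "outputs orc (machine p) x y" "run_time orc (machine p) x = 9 * length x + 4 + t"
    "queries orc (machine p) x \<subseteq> Q"
proof -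
  let ?R = "machine p" and ?T = "9 * length x + 4 + t"
  have ca: "code_at ?R 0 read_code" "code_at ?R 12 (compile 12 p)"
    unfolding machine_def code_at_def
    by (auto, rule exI[of _ read_code], simp add: read_code_def cons_code_def)
  obtain c1 where c1: "reaches orc Q ?R x init_conf (9 * length x + 4) c1" "ready 12 (val_of_nats x) c1"
    using read_correct[OF ca(1)] by blast
  obtain c2 where c2: "reaches orc Q ?R x c1 t c2" "ready (12 + length (compile 12 p)) (Atom y) c2"
    using compile_correct[OF assms ca(2) c1(2)] by blast
  have r: "reaches orc Q ?R x init_conf ?T c2" by (rule reaches_trans[OF c1(1) c2(1)])
  have len: "length ?R = 12 + length (compile 12 p)" by (simp add: machine_def read_code_def cons_code_def)
  have fin: "conf_at orc ?R x ?T = c2" using r by (simp add: reaches_def conf_at_def)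
  have h: "halted ?R (conf_at orc ?R x ?T)" unfolding fin using c2(2) len by (simp add: ready_def halted_def)
  have nh: "\<not> halted ?R (conf_at orc ?R x i)" if "i < ?T" for i
    using r that by (auto simp: reaches_def conf_at_def allowed_step_def)
  show rt: "run_time orc ?R x = ?T"
    unfolding run_time_def by (rule Least_equality[where P = "\<lambda>t. halted ?R (conf_at orc ?R x t)", OF h]) (use nh not_less in blast)
  show "outputs orc ?R x y" unfolding outputs_def halts_def rt fin using h c2(2) by (auto simp: ready_def)
  show "queries orc ?R x \<subseteq> Q"
    using r unfolding queries_def rt by (auto simp: reaches_def allowed_step_def conf_at_def)
qed

section \<open>Functions computable in polynomial time relative to a bound\<close>

class enc =
  fixes enc :: "'a \<Rightarrow> val"

instantiation nat :: enc
begin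
definition "enc (n::nat) = Atom n"
instance ..
end

instantiation bool :: enc
begin
definition "enc (b::bool) = Atom (of_bool b)"
instance ..
end

instantiation prod :: (enc, enc) enc
begin
definition "enc z = Cell (enc (fst z)) (enc (snd z))"
instance ..
end

instantiation list :: (enc) enc
begin
primrec enc_list :: "'a list \<Rightarrow> val" where
  "enc_list [] = Atom 0"
| "enc_list (x # xs) = Cell (enc x) (enc_list xs)"
instance ..
end

lemma enc_Pair [simp]: "enc (a, b) = Cell (enc a) (enc b)"
  by (simp add: enc_prod_def)

lemma enc_nats: "enc (ns :: nat list) = val_of_nats ns"
  by (induction ns) (auto simp: enc_nat_def)

primrec vsize :: "val \<Rightarrow> nat" where
  "vsize (Atom n) = 1"
| "vsize (Cell a b) = vsize a + vsize b + 1"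

definition sz :: "'a::enc \<Rightarrow> nat" where "sz x = vsize (enc x)"

lemma sz_nat [simp]: "sz (n::nat) = 1" by (simp add: sz_def enc_nat_def)
lemma sz_bool [simp]: "sz (b::bool) = 1" by (simp add: sz_def enc_bool_def)
lemma sz_Pair [simp]: "sz (a, b) = sz a + sz b + 1" by (simp add: sz_def)
lemma sz_Nil [simp]: "sz ([]::'a::enc list) = 1" by (simp add: sz_def)
lemma sz_Cons [simp]: "sz (x # xs) = sz x + sz xs + 1" by (simp add: sz_def)
lemma sz_prod: "sz z = sz (fst z) + sz (snd z) + 1" by (simp add: sz_def enc_prod_def)

lemma vsize_pos: "1 \<le> vsize v" by (induction v) auto
lemma sz_pos: "1 \<le> sz x" unfolding sz_def by (rule vsize_pos)

lemma sz_append: "sz (xs @ ys) + 1 = sz xs + sz ys"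
  by (induction xs) auto

lemma length_le_sz: "length xs < sz xs"
  by (induction xs) auto

lemma sz_member: "x \<in> set xs \<Longrightarrow> sz x < sz xs"
  by (induction xs) auto

lemma sz_rev [simp]: "sz (rev xs) = sz xs"
proof (induction xs)
  case (Cons a xs)
  then show ?case using sz_append[of "rev xs" "[a]"] by simp
qed simp

lemma sz_drop: "sz (drop i xs) \<le> sz xs"
  using sz_append[of "take i xs" "drop i xs"] sz_pos[of "take i xs"] by simp

lemma sz_take: "sz (take i xs) \<le> sz xs"
  using sz_append[of "take i xs" "drop i xs"] sz_pos[of "drop i xs"] by simp

lemma sz_filter: "sz (filter P xs) \<le> sz xs"
  by (induction xs) auto

lemma sz_list_le: "(\<And>x. x \<in> set xs \<Longrightarrow> sz x \<le> b) \<Longrightarrow> sz xs \<le> length xs * (b + 1) + 1"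
  by (induction xs) force+

lemma sz_concat: "sz (concat xss) \<le> sz xss"
proof (induction xss)
  case (Cons a xss)
  then show ?case using sz_append[of a "concat xss"] by simp
qed simp

text \<open>A pure power of a base that is at least 2 avoids coefficients: constants, sums and
  products are absorbed by the exponent. \<open>D\<close> restricts the claim to the inputs for
  which a program is meant.\<close>

definition pb :: "('a::enc \<Rightarrow> bool) \<Rightarrow> ('a \<Rightarrow> nat) \<Rightarrow> ('a \<Rightarrow> nat) \<Rightarrow> bool" where
  "pb D B T \<longleftrightarrow> (\<exists>c. \<forall>x. D x \<longrightarrow> T x \<le> (sz x + B x + 2) ^ c)"

lemma pb_mono: "pb D B T \<Longrightarrow> (\<And>x. D x \<Longrightarrow> T' x \<le> T x) \<Longrightarrow> pb D B T'"
  unfolding pb_def by (meson le_trans)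

lemma pb_dom: "pb D B T \<Longrightarrow> (\<And>x. D' x \<Longrightarrow> D x) \<Longrightarrow> pb D' B T"
  unfolding pb_def by blast

lemma pb_const: "pb D B (\<lambda>_. k)"
  unfolding pb_def
proof (intro exI allI impI)
  fix x
  have "k \<le> 2 ^ k" using less_exp[of k] by simp
  also have "\<dots> \<le> (sz x + B x + 2) ^ k" by (intro power_mono) auto
  finally show "k \<le> (sz x + B x + 2) ^ k" .
qed

lemma pb_add: assumes "pb D B S" "pb D B T" shows "pb D B (\<lambda>x. S x + T x)"
proof -
  obtain c d where c: "\<And>x. D x \<Longrightarrow> S x \<le> (sz x + B x + 2) ^ c"
    and d: "\<And>x. D x \<Longrightarrow> T x \<le> (sz x + B x + 2) ^ d"
    using assms unfolding pb_def by blast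
  have "S x + T x \<le> (sz x + B x + 2) ^ (c + d + 1)" if "D x" for x
  proof -
    let ?m = "sz x + B x + 2"
    have "?m ^ c \<le> ?m ^ (c + d)" "?m ^ d \<le> ?m ^ (c + d)" by (intro power_increasing; simp)+
    then have "S x + T x \<le> 2 * ?m ^ (c + d)" using c[OF that] d[OF that] by linarith
    also have "\<dots> \<le> ?m * ?m ^ (c + d)" by (intro mult_right_mono) auto
    finally show ?thesis by simp
  qed
  then show ?thesis unfolding pb_def by blast
qed

lemma pb_mult: assumes "pb D B S" "pb D B T" shows "pb D B (\<lambda>x. S x * T x)"
proof -
  obtain c d where c: "\<And>x. D x \<Longrightarrow> S x \<le> (sz x + B x + 2) ^ c"
    and d: "\<And>x. D x \<Longrightarrow> T x \<le> (sz x + B x + 2) ^ d"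
    using assms unfolding pb_def by blast
  have "S x * T x \<le> (sz x + B x + 2) ^ (c + d)" if "D x" for x
    unfolding power_add using c[OF that] d[OF that] by (intro mult_mono) auto
  then show ?thesis unfolding pb_def by blast
qed

lemma pb_power: assumes "pb D B S" shows "pb D B (\<lambda>x. S x ^ n)"
proof -
  obtain c where c: "\<And>x. D x \<Longrightarrow> S x \<le> (sz x + B x + 2) ^ c"
    using assms unfolding pb_def by blast
  have "S x ^ n \<le> (sz x + B x + 2) ^ (c * n)" if "D x" for x
    unfolding power_mult using c[OF that] by (intro power_mono) auto
  then show ?thesis unfolding pb_def by blast
qed

lemma pb_sz: "pb D B sz" unfolding pb_def by (intro exI[of _ 1]) auto
lemma pb_B: "pb D B B" unfolding pb_def by (intro exI[of _ 1]) auto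
lemma pb_Suc: "pb D B T \<Longrightarrow> pb D B (\<lambda>x. Suc (T x))"
  using pb_add[OF _ pb_const[of D B 1]] by simp

lemma pb_comp:
  assumes T: "pb D' B' T" and s: "pb D B (\<lambda>x. sz (f x))" and b: "pb D B (\<lambda>x. B' (f x))"
    and D: "\<And>x. D x \<Longrightarrow> D' (f x)"
  shows "pb D B (\<lambda>x. T (f x))"
proof -
  obtain c where c: "\<And>x. D' x \<Longrightarrow> T x \<le> (sz x + B' x + 2) ^ c"
    using T unfolding pb_def by blast
  have "pb D B (\<lambda>x. (sz (f x) + B' (f x) + 2) ^ c)"
    by (intro pb_power pb_add pb_const s b)
  then show ?thesis by (rule pb_mono) (rule c[OF D])
qed

lemmas pb_intros = pb_const pb_add pb_mult pb_power pb_sz pb_B pb_Suc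

section \<open>Cost calculus for programs without queries\<close>

definition runs :: "prog \<Rightarrow> val \<Rightarrow> val \<Rightarrow> nat \<Rightarrow> bool" where
  "runs p v w T \<longleftrightarrow> (\<exists>t\<le>T. evals no_oracle {} p v w t)"

lemma runs_mono: "runs p v w T \<Longrightarrow> T \<le> T' \<Longrightarrow> runs p v w T'"
  unfolding runs_def by (meson le_trans)

lemma runs_seq: "runs p v w S \<Longrightarrow> runs q w u T \<Longrightarrow> runs (PSeq p q) v u (S + T)"
  unfolding runs_def by (meson add_mono evals.Seq)

lemma runs_pair: "runs p v a S \<Longrightarrow> runs q v b T \<Longrightarrow> runs (PPair p q) v (Cell a b) (S + T + 22)"
  unfolding runs_def by (meson add_mono evals.Pair order_refl)

lemma runs_id: "runs PId v v 0" and runs_const: "runs (PConst n) v (Atom n) 1"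
  and runs_fst: "runs PFst (Cell a b) a 1" and runs_snd: "runs PSnd (Cell a b) b 2"
  and runs_add: "runs PAdd (Cell (Atom m) (Atom n)) (Atom (m + n)) 4"
  and runs_sub: "runs PSub (Cell (Atom m) (Atom n)) (Atom (m - n)) 4"
  unfolding runs_def by (blast intro: evals.intros)+

lemma runs_if:
  assumes "is_zero c \<Longrightarrow> runs p v w T" "\<not> is_zero c \<Longrightarrow> runs q v w T"
  shows "runs (PIf p q) (Cell c v) w (T + 5)"
proof (cases "is_zero c")
  case True
  then obtain t where "t \<le> T" "evals no_oracle {} p v w t" using assms(1) by (auto simp: runs_def)
  then show ?thesis using evals.IfZ[OF True] unfolding runs_def by (intro exI[of _ "t + 4"]) auto
next
  case False
  then obtain t where "t \<le> T" "evals no_oracle {} q v w t" using assms(2) by (auto simp: runs_def)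
  then show ?thesis using evals.IfN[OF False] unfolding runs_def by (intro exI[of _ "t + 5"]) auto
qed

lemma runs_while:
  assumes "\<And>i. i < n \<Longrightarrow> \<not> is_zero (c i) \<and> runs p (Cell (c i) (v i)) (Cell (c (Suc i)) (v (Suc i))) T"
    and "is_zero (c n)"
  shows "runs (PWhile p) (Cell (c 0) (v 0)) (Cell (c n) (v n)) (n * (T + 3) + 2)"
  using assms
proof (induction n arbitrary: c v)
  case 0
  show ?case unfolding runs_def by (intro exI[of _ 2] conjI evals.WhileZ 0) simp
next
  case (Suc n)
  have "runs (PWhile p) (Cell (c 1) (v 1)) (Cell (c (Suc n)) (v (Suc n))) (n * (T + 3) + 2)"
    using Suc.IH[of "\<lambda>i. c (Suc i)" "\<lambda>i. v (Suc i)"] Suc.prems by simp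
  then obtain t where t: "t \<le> n * (T + 3) + 2"
    "evals no_oracle {} (PWhile p) (Cell (c 1) (v 1)) (Cell (c (Suc n)) (v (Suc n))) t"
    by (auto simp: runs_def)
  obtain s where s: "s \<le> T" "evals no_oracle {} p (Cell (c 0) (v 0)) (Cell (c 1) (v 1)) s"
    using Suc.prems(1)[of 0] by (auto simp: runs_def)
  have "evals no_oracle {} (PWhile p) (Cell (c 0) (v 0)) (Cell (c (Suc n)) (v (Suc n))) (s + t + 3)"
    using Suc.prems(1)[of 0] by (intro evals.WhileN[OF _ s(2) t(2)]) auto
  then show ?case unfolding runs_def using s t by (intro exI[of _ "s + t + 3"]) auto
qed

text \<open>
  The bound \<open>B\<close> is not available to the program; it stands for quantities such as the running time
  of a simulated machine. Since sizes count every number as one unit, \<open>sz (f x)\<close> must be bounded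
  separately.
\<close>

definition cmp :: "('a::enc \<Rightarrow> bool) \<Rightarrow> ('a \<Rightarrow> nat) \<Rightarrow> ('a \<Rightarrow> 'b::enc) \<Rightarrow> bool" where
  "cmp D B f \<longleftrightarrow> (\<exists>p T. pb D B T \<and> pb D B (\<lambda>x. sz (f x)) \<and>
     (\<forall>x. D x \<longrightarrow> runs p (enc x) (enc (f x)) (T x)))"

lemma cmpI:
  "pb D B T \<Longrightarrow> pb D B (\<lambda>x. sz (f x)) \<Longrightarrow> (\<And>x. D x \<Longrightarrow> runs p (enc x) (enc (f x)) (T x)) \<Longrightarrow> cmp D B f"
  unfolding cmp_def by blast

lemma cmpE:
  assumes "cmp D B f"
  obtains p T where "pb D B T" "pb D B (\<lambda>x. sz (f x))" "\<And>x. D x \<Longrightarrow> runs p (enc x) (enc (f x)) (T x)"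
  using assms unfolding cmp_def by blast

lemma cmp_size: "cmp D B f \<Longrightarrow> pb D B (\<lambda>x. sz (f x))"
  unfolding cmp_def by blast

lemma cmp_cong: "cmp D B f \<Longrightarrow> (\<And>x. D x \<Longrightarrow> f x = g x) \<Longrightarrow> cmp D B g"
proof -
  assume f: "cmp D B f" and eq: "\<And>x. D x \<Longrightarrow> f x = g x"
  obtain p T where p: "pb D B T" "pb D B (\<lambda>x. sz (f x))"
    "\<And>x. D x \<Longrightarrow> runs p (enc x) (enc (f x)) (T x)" using f by (rule cmpE) blast
  show ?thesis
  proof (rule cmpI[OF p(1)])
    show "pb D B (\<lambda>x. sz (g x))" by (rule pb_mono[OF p(2)]) (simp add: eq)
    show "runs p (enc x) (enc (g x)) (T x)" if "D x" for x using p(3)[OF that] eq[OF that] by simp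
  qed
qed

lemma cmp_dom: assumes "cmp D B f" "\<And>x. D' x \<Longrightarrow> D x" shows "cmp D' B f"
proof -
  obtain p T where p: "pb D B T" "pb D B (\<lambda>x. sz (f x))"
    "\<And>x. D x \<Longrightarrow> runs p (enc x) (enc (f x)) (T x)" using assms(1) by (rule cmpE) blast
  show ?thesis
    by (rule cmpI[OF pb_dom[OF p(1) assms(2)] pb_dom[OF p(2) assms(2)] p(3)[OF assms(2)]])
qed

text \<open>The second program is analysed relative to its own argument \<open>f x\<close>, so the
  size of \<open>f x\<close> and its bound \<open>B' (f x)\<close> must both be polynomial in the
  size of \<open>x\<close> and in \<open>B x\<close>.\<close>

lemma cmp_comp:
  assumes g: "cmp D' B' g" and f: "cmp D B f"
    and D: "\<And>x. D x \<Longrightarrow> D' (f x)" and b: "pb D B (\<lambda>x. B' (f x))"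
  shows "cmp D B (\<lambda>x. g (f x))"
proof -
  obtain p T where p: "pb D B T" "pb D B (\<lambda>x. sz (f x))"
    "\<And>x. D x \<Longrightarrow> runs p (enc x) (enc (f x)) (T x)" using f by (rule cmpE) blast
  obtain q S where q: "pb D' B' S" "pb D' B' (\<lambda>x. sz (g x))"
    "\<And>x. D' x \<Longrightarrow> runs q (enc x) (enc (g x)) (S x)" using g by (rule cmpE) blast
  show ?thesis
  proof (rule cmpI)
    show "pb D B (\<lambda>x. T x + S (f x))" by (intro pb_add p(1) pb_comp[OF q(1) p(2) b D])
    show "pb D B (\<lambda>x. sz (g (f x)))" by (rule pb_comp[OF q(2) p(2) b D])
    fix x assume "D x"
    then show "runs (PSeq p q) (enc x) (enc (g (f x))) (T x + S (f x))"
      by (intro runs_seq[OF p(3) q(3)] D)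
  qed
qed

abbreviation ptime :: "('a::enc \<Rightarrow> 'b::enc) \<Rightarrow> bool" where
  "ptime f \<equiv> cmp (\<lambda>_. True) (\<lambda>_. 0) f"

lemma ptime_comp: "ptime g \<Longrightarrow> cmp D B f \<Longrightarrow> cmp D B (\<lambda>x. g (f x))"
  by (rule cmp_comp) (auto intro: pb_const)

lemma cmp_id: "cmp D B (\<lambda>x. x)"
  by (rule cmpI[OF pb_const[of D B 0] pb_sz]) (rule runs_id)

lemma cmp_pair: assumes "cmp D B f" "cmp D B g" shows "cmp D B (\<lambda>x. (f x, g x))"
proof -
  obtain p T where p: "pb D B T" "pb D B (\<lambda>x. sz (f x))"
    "\<And>x. D x \<Longrightarrow> runs p (enc x) (enc (f x)) (T x)" using assms(1) by (rule cmpE) blast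
  obtain q S where q: "pb D B S" "pb D B (\<lambda>x. sz (g x))"
    "\<And>x. D x \<Longrightarrow> runs q (enc x) (enc (g x)) (S x)" using assms(2) by (rule cmpE) blast
  show ?thesis
    by (rule cmpI[of D B "\<lambda>x. T x + S x + 22" _ "PPair p q"])
      (auto intro!: pb_intros p q runs_pair)
qed

lemma ptime_comp2:
  "ptime (\<lambda>z. g (fst z) (snd z)) \<Longrightarrow> cmp D B f1 \<Longrightarrow> cmp D B f2 \<Longrightarrow> cmp D B (\<lambda>x. g (f1 x) (f2 x))"
  using ptime_comp[OF _ cmp_pair, of "\<lambda>z. g (fst z) (snd z)" D B f1 f2] by simp

lemma ptime_comp3:
  "ptime (\<lambda>z. g (fst z) (fst (snd z)) (snd (snd z))) \<Longrightarrow> cmp D B f1 \<Longrightarrow> cmp D B f2 \<Longrightarrow> cmp D B f3 \<Longrightarrow>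
   cmp D B (\<lambda>x. g (f1 x) (f2 x) (f3 x))"
  using ptime_comp[OF _ cmp_pair[OF _ cmp_pair], of "\<lambda>z. g (fst z) (fst (snd z)) (snd (snd z))" D B f1 f2 f3]
  by simp

lemma ptime_comp4:
  "ptime (\<lambda>z. g (fst z) (fst (snd z)) (fst (snd (snd z))) (snd (snd (snd z)))) \<Longrightarrow>
   cmp D B f1 \<Longrightarrow> cmp D B f2 \<Longrightarrow> cmp D B f3 \<Longrightarrow> cmp D B f4 \<Longrightarrow>
   cmp D B (\<lambda>x. g (f1 x) (f2 x) (f3 x) (f4 x))"
  using ptime_comp[OF _ cmp_pair[OF _ cmp_pair[OF _ cmp_pair]],
    of "\<lambda>z. g (fst z) (fst (snd z)) (fst (snd (snd z))) (snd (snd (snd z)))" D B f1 f2 f3 f4]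
  by simp

lemma runs_enc_const: "\<exists>p T. \<forall>v. runs p v (enc a) T"
proof -
  have "\<exists>p T. \<forall>v. runs p v w T" for w
  proof (induction w)
    case (Atom n)
    then show ?case using runs_const by blast
  next
    case (Cell w1 w2)
    then show ?case using runs_pair by metis
  qed
  then show ?thesis .
qed

lemma cmp_const: "cmp D B (\<lambda>_. a)"
proof -
  obtain p T where "\<And>v. runs p v (enc a) T" using runs_enc_const by blast
  then show ?thesis by (intro cmpI[of D B "\<lambda>_. T" _ p]) (auto intro: pb_const)
qed

lemma ptime_fst: "ptime fst"
proof (rule cmpI)
  show "pb (\<lambda>_. True) (\<lambda>_. 0) (\<lambda>_. 1)" by (rule pb_const)
  show "pb (\<lambda>_. True) (\<lambda>_. 0) (\<lambda>z::'a \<times> 'b. sz (fst z))"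
    by (rule pb_mono[OF pb_sz]) (simp add: sz_prod)
  show "runs PFst (enc z) (enc (fst z)) 1" for z :: "'a \<times> 'b"
    unfolding enc_prod_def by (rule runs_fst)
qed

lemma ptime_snd: "ptime snd"
proof (rule cmpI)
  show "pb (\<lambda>_. True) (\<lambda>_. 0) (\<lambda>_. 2)" by (rule pb_const)
  show "pb (\<lambda>_. True) (\<lambda>_. 0) (\<lambda>z::'a \<times> 'b. sz (snd z))"
    by (rule pb_mono[OF pb_sz]) (simp add: sz_prod)
  show "runs PSnd (enc z) (enc (snd z)) 2" for z :: "'a \<times> 'b"
    unfolding enc_prod_def by (rule runs_snd)
qed

lemmas cmp_fst = ptime_comp[OF ptime_fst]
lemmas cmp_snd = ptime_comp[OF ptime_snd]

text \<open>Each branch is analysed only where its condition holds. This admits partial operations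
  such as \<open>hd\<close> behind a test.\<close>

lemma cmp_if:
  assumes "cmp D B b" "cmp (\<lambda>x. D x \<and> b x) B f" "cmp (\<lambda>x. D x \<and> \<not> b x) B g"
  shows "cmp D B (\<lambda>x. if b x then f x else g x)"
proof -
  obtain r R where r: "pb D B R" "\<And>x. D x \<Longrightarrow> runs r (enc x) (enc (b x)) (R x)"
    using assms(1) by (rule cmpE) blast
  obtain p T where p: "pb (\<lambda>x. D x \<and> b x) B T" "pb (\<lambda>x. D x \<and> b x) B (\<lambda>x. sz (f x))"
    "\<And>x. D x \<and> b x \<Longrightarrow> runs p (enc x) (enc (f x)) (T x)" using assms(2) by (rule cmpE) blast
  obtain q S where q: "pb (\<lambda>x. D x \<and> \<not> b x) B S" "pb (\<lambda>x. D x \<and> \<not> b x) B (\<lambda>x. sz (g x))"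
    "\<And>x. D x \<and> \<not> b x \<Longrightarrow> runs q (enc x) (enc (g x)) (S x)" using assms(3) by (rule cmpE) blast
  have join: "pb D B (\<lambda>x. if b x then U x else V x)"
    if UV: "pb (\<lambda>x. D x \<and> b x) B U" "pb (\<lambda>x. D x \<and> \<not> b x) B V" for U V
  proof -
    obtain c d where c: "\<And>x. D x \<and> b x \<Longrightarrow> U x \<le> (sz x + B x + 2) ^ c"
      and d: "\<And>x. D x \<and> \<not> b x \<Longrightarrow> V x \<le> (sz x + B x + 2) ^ d"
      using UV unfolding pb_def by metis
    have le: "(sz x + B x + 2) ^ c \<le> (sz x + B x + 2) ^ (c + d)"
      "(sz x + B x + 2) ^ d \<le> (sz x + B x + 2) ^ (c + d)" for x by (intro power_increasing; simp)+
    have "(if b x then U x else V x) \<le> (sz x + B x + 2) ^ (c + d)" if "D x" for x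
      using order.trans[OF c le(1)] order.trans[OF d le(2)] that by presburger
    then show ?thesis unfolding pb_def by blast
  qed
  have 1: "pb D B (\<lambda>x. sz (if b x then f x else g x))"
    using join[OF p(2) q(2)] by (rule pb_mono) auto
  show ?thesis
  proof (rule cmpI[OF _ 1])
    show "pb D B (\<lambda>x. R x + 0 + 22 + ((if b x then T x else S x) + 5))"
      by (intro pb_intros join p q r)
    fix x assume x: "D x"
    show "runs (PSeq (PPair r PId) (PIf q p)) (enc x) (enc (if b x then f x else g x))
      (R x + 0 + 22 + ((if b x then T x else S x) + 5))"
      by (rule runs_seq[OF runs_pair[OF r(2)[OF x] runs_id]], rule runs_if)
        (use x p(3) q(3) in \<open>auto simp: enc_bool_def\<close>)
  qed
qed

lemma ptime_add: "ptime (\<lambda>z. fst z + snd z :: nat)"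
proof (rule cmpI)
  show "pb (\<lambda>_. True) (\<lambda>_. 0) (\<lambda>_. 4)" by (rule pb_const)
qed (auto simp: enc_prod_def enc_nat_def intro: runs_add pb_const)

lemma ptime_sub: "ptime (\<lambda>z. fst z - snd z :: nat)"
proof (rule cmpI)
  show "pb (\<lambda>_. True) (\<lambda>_. 0) (\<lambda>_. 4)" by (rule pb_const)
qed (auto simp: enc_prod_def enc_nat_def intro: runs_sub pb_const)

lemmas cmp_add = ptime_comp2[OF ptime_add]
lemmas cmp_sub = ptime_comp2[OF ptime_sub]

lemma cmp_is_zero:
  assumes "cmp D B f" "\<And>x. D x \<Longrightarrow> b x = is_zero (enc (f x))"
  shows "cmp D B b"
proof -
  obtain p T where p: "pb D B T" "\<And>x. D x \<Longrightarrow> runs p (enc x) (enc (f x)) (T x)"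
    using assms(1) by (rule cmpE) blast
  show ?thesis
  proof (rule cmpI)
    show "pb D B (\<lambda>x. T x + 0 + 22 + (1 + 5))" by (intro pb_intros p)
    show "pb D B (\<lambda>x. sz (b x))" by (simp add: pb_const)
    fix x assume x: "D x"
    show "runs (PSeq (PPair p PId) (PIf (PConst 1) (PConst 0))) (enc x) (enc (b x)) (T x + 0 + 22 + (1 + 5))"
      by (rule runs_seq[OF runs_pair[OF p(2)[OF x] runs_id]], rule runs_if)
        (use assms(2)[OF x] runs_const in \<open>auto simp: enc_bool_def\<close>)
  qed
qed

lemma cmp_null: "cmp D B f \<Longrightarrow> cmp D B (\<lambda>x. f x = [])"
proof (erule cmp_is_zero)
  show "(f x = []) = is_zero (enc (f x))" for x by (cases "f x") auto
qed

lemma cmp_zero: "cmp D B f \<Longrightarrow> cmp D B (\<lambda>x. f x = (0::nat))"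
  by (erule cmp_is_zero) (simp add: enc_nat_def)

lemma cmp_not: "cmp D B b \<Longrightarrow> cmp D B (\<lambda>x. \<not> b x)"
  by (erule cmp_is_zero) (simp add: enc_bool_def)

lemma cmp_le: "cmp D B f \<Longrightarrow> cmp D B g \<Longrightarrow> cmp D B (\<lambda>x. f x \<le> (g x :: nat))"
  by (rule cmp_cong[OF cmp_zero[OF cmp_sub]]) auto

lemma cmp_less: "cmp D B f \<Longrightarrow> cmp D B g \<Longrightarrow> cmp D B (\<lambda>x. f x < (g x :: nat))"
  by (rule cmp_cong[OF cmp_not[OF cmp_le, of D B g f]]) auto

lemma cmp_conj:
  "cmp D B a \<Longrightarrow> cmp (\<lambda>x. D x \<and> a x) B b \<Longrightarrow> cmp D B (\<lambda>x. a x \<and> b x)"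
  by (rule cmp_cong[OF cmp_if[of D B a b "\<lambda>_. False"]]) (auto intro: cmp_const)

lemma cmp_disj:
  "cmp D B a \<Longrightarrow> cmp (\<lambda>x. D x \<and> \<not> a x) B b \<Longrightarrow> cmp D B (\<lambda>x. a x \<or> b x)"
  by (rule cmp_cong[OF cmp_if[of D B a "\<lambda>_. True" b]]) (auto intro: cmp_const)

lemma cmp_imp:
  "cmp D B a \<Longrightarrow> cmp (\<lambda>x. D x \<and> a x) B b \<Longrightarrow> cmp D B (\<lambda>x. a x \<longrightarrow> b x)"
  by (rule cmp_cong[OF cmp_if[of D B a b "\<lambda>_. True"]]) (auto intro: cmp_const)

lemma cmp_of_bool: "cmp D B b \<Longrightarrow> cmp D B (\<lambda>x. of_bool (b x) :: nat)"
  by (rule cmp_cong[OF cmp_if[of D B b "\<lambda>_. 1" "\<lambda>_. 0"]]) (auto intro: cmp_const cmp_dom)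

lemma cmp_Cons: assumes "cmp D B f" "cmp D B g" shows "cmp D B (\<lambda>x. f x # g x)"
proof -
  obtain p T where p: "pb D B T" "pb D B (\<lambda>x. sz (f x, g x))"
    "\<And>x. D x \<Longrightarrow> runs p (enc x) (enc (f x, g x)) (T x)" using cmp_pair[OF assms] by (rule cmpE) blast
  show ?thesis
    by (rule cmpI[OF p(1)]) (use p(2,3) in auto)
qed

lemma cmp_hd: assumes "cmp D B f" "\<And>x. D x \<Longrightarrow> f x \<noteq> []" shows "cmp D B (\<lambda>x. hd (f x))"
proof -
  obtain p T where p: "pb D B T" "pb D B (\<lambda>x. sz (f x))"
    "\<And>x. D x \<Longrightarrow> runs p (enc x) (enc (f x)) (T x)" using assms(1) by (rule cmpE) blast
  have e: "enc (f x) = Cell (enc (hd (f x))) (enc (tl (f x)))" if "D x" for x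
    using assms(2)[OF that] by (cases "f x") auto
  show ?thesis
  proof (rule cmpI[of D B "\<lambda>x. T x + 1"])
    show "pb D B (\<lambda>x. sz (hd (f x)))"
      by (rule pb_mono[OF p(2)]) (rule less_imp_le[OF sz_member[OF hd_in_set[OF assms(2)]]])
    show "runs (PSeq p PFst) (enc x) (enc (hd (f x))) (T x + 1)" if "D x" for x
      by (rule runs_seq[OF p(3)[OF that, unfolded e[OF that]] runs_fst])
  qed (intro pb_intros p)
qed

lemma cmp_tl: assumes "cmp D B f" "\<And>x. D x \<Longrightarrow> f x \<noteq> []" shows "cmp D B (\<lambda>x. tl (f x))"
proof -
  obtain p T where p: "pb D B T" "pb D B (\<lambda>x. sz (f x))"
    "\<And>x. D x \<Longrightarrow> runs p (enc x) (enc (f x)) (T x)" using assms(1) by (rule cmpE) blast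
  have e: "enc (f x) = Cell (enc (hd (f x))) (enc (tl (f x)))" if "D x" for x
    using assms(2)[OF that] by (cases "f x") auto
  show ?thesis
  proof (rule cmpI[of D B "\<lambda>x. T x + 2"])
    show "pb D B (\<lambda>x. sz (tl (f x)))"
      using sz_drop[of 1] by (intro pb_mono[OF p(2)]) (simp add: drop_Suc)
    show "runs (PSeq p PSnd) (enc x) (enc (tl (f x))) (T x + 2)" if "D x" for x
      by (rule runs_seq[OF p(3)[OF that, unfolded e[OF that]] runs_snd])
  qed (intro pb_intros p)
qed

text \<open>Iterating a step of polynomial cost can explode, so \<open>S\<close> has to bound all
  states of the run directly in terms of the original input, and \<open>N\<close> the number of
  iterations.\<close>

lemma cmp_while:
  assumes init: "cmp D B init" and step: "cmp Ds Bs st" and cond: "cmp Ds Bs cn"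
    and Ds: "\<And>x i. D x \<Longrightarrow> i \<le> N x \<Longrightarrow> Ds ((st ^^ i) (init x))"
    and cn: "\<And>x i. D x \<Longrightarrow> i < N x \<Longrightarrow> cn ((st ^^ i) (init x))"
    and cn': "\<And>x. D x \<Longrightarrow> \<not> cn ((st ^^ N x) (init x))"
    and N: "pb D B N" and S: "pb D B S"
    and Sz: "\<And>x i. D x \<Longrightarrow> i \<le> N x \<Longrightarrow> sz ((st ^^ i) (init x)) \<le> S x"
    and Bs: "\<And>x i. D x \<Longrightarrow> i \<le> N x \<Longrightarrow> Bs ((st ^^ i) (init x)) \<le> S x"
  shows "cmp D B (\<lambda>x. (st ^^ N x) (init x))"
proof -
  obtain p0 T0 where p0: "pb D B T0" "pb D B (\<lambda>x. sz (init x))"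
    "\<And>x. D x \<Longrightarrow> runs p0 (enc x) (enc (init x)) (T0 x)" using init by (rule cmpE) blast
  obtain p T where p: "pb Ds Bs T" "\<And>x. Ds x \<Longrightarrow> runs p (enc x) (enc (st x)) (T x)"
    using step by (rule cmpE) blast
  obtain q V where q: "pb Ds Bs V" "\<And>x. Ds x \<Longrightarrow> runs q (enc x) (enc (cn x)) (V x)"
    using cond by (rule cmpE) blast
  obtain c d where c: "\<And>x. Ds x \<Longrightarrow> T x \<le> (sz x + Bs x + 2) ^ c"
    and d: "\<And>x. Ds x \<Longrightarrow> V x \<le> (sz x + Bs x + 2) ^ d"
    using p(1) q(1) unfolding pb_def by blast
  define W where "W x = (S x + S x + 2) ^ c" for x
  define Y where "Y x = (S x + S x + 2) ^ d" for x
  have W: "runs p (enc ((st ^^ i) (init x))) (enc ((st ^^ Suc i) (init x))) (W x)"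
    if "D x" "i \<le> N x" for x i
  proof -
    note a = Ds[OF that] Sz[OF that] Bs[OF that]
    have "T ((st ^^ i) (init x)) \<le> W x"
      unfolding W_def by (rule order.trans[OF c[OF a(1)]], rule power_mono) (use a in auto)
    then show ?thesis using p(2)[OF a(1)] by (auto intro: runs_mono)
  qed
  have Y: "runs q (enc ((st ^^ i) (init x))) (enc (cn ((st ^^ i) (init x)))) (Y x)"
    if "D x" "i \<le> N x" for x i
  proof -
    note a = Ds[OF that] Sz[OF that] Bs[OF that]
    have "V ((st ^^ i) (init x)) \<le> Y x"
      unfolding Y_def by (rule order.trans[OF d[OF a(1)]], rule power_mono) (use a in auto)
    then show ?thesis using q(2)[OF a(1)] by (auto intro: runs_mono)
  qed
  \<comment> \<open>A loop state pairs the current test value with the data: the body drops the old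
    test value, steps, and tests anew.\<close>
  let ?body = "PSeq PSnd (PSeq p (PPair q PId))"
  let ?TB = "\<lambda>x. 2 + (W x + (Y x + 0 + 22))"
  show ?thesis
  proof (rule cmpI)
    show "pb D B (\<lambda>x. T0 x + ((Y x + 0 + 22) + ((N x * (?TB x + 3) + 2) + 2)))"
      unfolding W_def Y_def by (intro pb_intros p0 N S)
    show "pb D B (\<lambda>x. sz ((st ^^ N x) (init x)))" by (rule pb_mono[OF S]) (simp add: Sz)
    fix x assume x: "D x"
    let ?v = "\<lambda>i. enc ((st ^^ i) (init x))" and ?c = "\<lambda>i. enc (cn ((st ^^ i) (init x)))"
    have "runs (PWhile ?body) (Cell (?c 0) (?v 0)) (Cell (?c (N x)) (?v (N x))) (N x * (?TB x + 3) + 2)"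
    proof (rule runs_while[where c = ?c and v = ?v])
      fix i assume i: "i < N x"
      have "runs ?body (Cell (?c i) (?v i)) (Cell (?c (Suc i)) (?v (Suc i))) (?TB x)"
        by (rule runs_seq[OF runs_snd runs_seq[OF W runs_pair[OF Y runs_id]]]) (use x i in auto)
      then show "\<not> is_zero (?c i) \<and> runs ?body (Cell (?c i) (?v i)) (Cell (?c (Suc i)) (?v (Suc i))) (?TB x)"
        using cn[OF x i] by (simp add: enc_bool_def)
    qed (use cn'[OF x] in \<open>simp add: enc_bool_def\<close>)
    then show "runs (PSeq p0 (PSeq (PPair q PId) (PSeq (PWhile ?body) PSnd))) (enc x) (enc ((st ^^ N x) (init x)))
      (T0 x + ((Y x + 0 + 22) + ((N x * (?TB x + 3) + 2) + 2)))"
      by (intro runs_seq[OF p0(3)[OF x]] runs_seq[OF runs_pair[OF _ runs_id]] runs_seq[OF _ runs_snd])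
         (use Y[OF x, of 0] in auto)
  qed
qed

lemma cmp_fold:
  fixes g :: "'a::enc \<Rightarrow> 'b::enc \<Rightarrow> 's::enc \<Rightarrow> 's"
  assumes xs: "cmp D B xs" and init: "cmp D B init"
    and g: "cmp Dg Bg (\<lambda>z. g (fst z) (fst (snd z)) (snd (snd z)))"
    and Dg: "\<And>x i. D x \<Longrightarrow> i < length (xs x) \<Longrightarrow> Dg (x, xs x ! i, fold (g x) (take i (xs x)) (init x))"
    and S: "pb D B S"
    and Sz: "\<And>x i. D x \<Longrightarrow> i \<le> length (xs x) \<Longrightarrow> sz (fold (g x) (take i (xs x)) (init x)) \<le> S x"
    and Bg: "\<And>x i. D x \<Longrightarrow> i < length (xs x) \<Longrightarrow> Bg (x, xs x ! i, fold (g x) (take i (xs x)) (init x)) \<le> S x"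
  shows "cmp D B (\<lambda>x. fold (g x) (xs x) (init x))"
proof -
  define st where "st s = (tl (fst s), (fst (snd s), g (fst (snd s)) (hd (fst s)) (snd (snd s))))"
    for s :: "'b list \<times> ('a \<times> 's)"
  define ini where "ini x = (xs x, (x, init x))" for x
  \<comment> \<open>Stepping on the empty list is the identity, so only nonempty lists have to
    satisfy the domain condition of \<open>g\<close>.\<close>
  define st' where "st' s = (if fst s = [] then s else st s)" for s
  define Ds where "Ds s \<longleftrightarrow> fst s \<noteq> [] \<longrightarrow> Dg (fst (snd s), hd (fst s), snd (snd s))"
    for s :: "'b list \<times> ('a \<times> 's)"
  define Bs where "Bs s = (if fst s = [] then 0 else Bg (fst (snd s), hd (fst s), snd (snd s)))"
    for s :: "'b list \<times> ('a \<times> 's)"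
  have it: "i \<le> length (xs x) \<Longrightarrow>
    (st' ^^ i) (ini x) = (drop i (xs x), (x, fold (g x) (take i (xs x)) (init x)))" for i x
  proof (induction i)
    case (Suc i)
    then have "drop i (xs x) = xs x ! i # drop (Suc i) (xs x)" by (simp add: Cons_nth_drop_Suc)
    then show ?case using Suc by (simp add: st'_def st_def take_Suc_conv_app_nth)
  qed (simp add: ini_def)
  have 1: "cmp D B ini" unfolding ini_def by (intro cmp_pair xs init cmp_id)
  have cst: "cmp (\<lambda>s. Ds s \<and> fst s \<noteq> []) Bs st" unfolding st_def
  proof (intro cmp_pair cmp_tl cmp_fst cmp_snd cmp_id)
    show "cmp (\<lambda>s. Ds s \<and> fst s \<noteq> []) Bs (\<lambda>s. g (fst (snd s)) (hd (fst s)) (snd (snd s)))"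
    proof (rule cmp_comp[OF g, of "\<lambda>s. Ds s \<and> fst s \<noteq> []" Bs "\<lambda>s. (fst (snd s), hd (fst s), snd (snd s))", simplified])
      show "cmp (\<lambda>s. Ds s \<and> fst s \<noteq> []) Bs (\<lambda>s. (fst (snd s), hd (fst s), snd (snd s)))"
        by (intro cmp_pair cmp_hd cmp_fst cmp_snd cmp_id) auto
      show "pb (\<lambda>s. Ds s \<and> fst s \<noteq> []) Bs (\<lambda>s. Bg (fst (snd s), hd (fst s), snd (snd s)))"
        by (rule pb_mono[OF pb_B]) (auto simp: Bs_def)
    qed (auto simp: Ds_def)
  qed auto
  have 2: "cmp Ds Bs st'" unfolding st'_def
    by (intro cmp_if cmp_null cmp_fst cmp_id cst)
  have 3: "cmp Ds Bs (\<lambda>s. fst s \<noteq> [])" by (intro cmp_not cmp_null cmp_fst cmp_id)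
  have "cmp D B (\<lambda>x. (st' ^^ length (xs x)) (ini x))"
  proof (rule cmp_while[OF 1 2 3])
    show "pb D B (\<lambda>x. length (xs x))" using cmp_size[OF xs]
      by (rule pb_mono) (simp add: length_le_sz less_imp_le)
    show "pb D B (\<lambda>x. sz (xs x) + sz x + S x + 2)" by (intro pb_intros cmp_size[OF xs] S)
    fix x i assume x: "D x" and i: "i \<le> length (xs x)"
    show "sz ((st' ^^ i) (ini x)) \<le> sz (xs x) + sz x + S x + 2"
      using Sz[OF x i] sz_drop[of i "xs x"] by (simp add: it[OF i])
    show "Ds ((st' ^^ i) (ini x))" using Dg[OF x] by (auto simp: it[OF i] Ds_def hd_drop_conv_nth)
    show "Bs ((st' ^^ i) (ini x)) \<le> sz (xs x) + sz x + S x + 2"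
      using Bg[OF x, of i] by (auto simp: it[OF i] Bs_def hd_drop_conv_nth)
  qed (auto simp: it)
  then have "cmp D B (\<lambda>x. snd (snd ((st' ^^ length (xs x)) (ini x))))" by (intro cmp_snd)
  then show ?thesis by (rule cmp_cong) (simp add: it)
qed

text \<open>An element of \<open>L x\<close> is smaller than \<open>L x\<close> itself, so a bound
  in terms of the pair \<open>(x, y)\<close> becomes one in terms of \<open>x\<close>, uniformly in
  \<open>y\<close>.\<close>

lemma pb_binder:
  assumes T: "pb (\<lambda>z. D (fst z) \<and> snd z \<in> set (L (fst z))) (\<lambda>z. B (fst z)) T" and L: "cmp D B L"
  obtains S where "pb D B S" "\<And>x y. D x \<Longrightarrow> y \<in> set (L x) \<Longrightarrow> T (x, y) \<le> S x"
proof -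
  obtain c where c: "\<And>z. D (fst z) \<and> snd z \<in> set (L (fst z)) \<Longrightarrow> T z \<le> (sz z + B (fst z) + 2) ^ c"
    using T unfolding pb_def by blast
  show thesis
  proof (rule that)
    show "pb D B (\<lambda>x. (sz x + sz (L x) + 1 + B x + 2) ^ c)"
      by (intro pb_intros cmp_size[OF L])
    fix x y assume "D x" "y \<in> set (L x)"
    then have "T (x, y) \<le> (sz (x, y) + B x + 2) ^ c" using c[of "(x, y)"] by simp
    also have "\<dots> \<le> (sz x + sz (L x) + 1 + B x + 2) ^ c"
      using sz_member[OF \<open>y \<in> set (L x)\<close>] by (intro power_mono) auto
    finally show "T (x, y) \<le> (sz x + sz (L x) + 1 + B x + 2) ^ c" .
  qed
qed

lemma cmp_weaken_ctx:
  assumes "cmp (\<lambda>z. D (fst z) \<and> snd z \<in> set (L (fst z))) (\<lambda>z. B (fst z)) (\<lambda>z. F (fst z) (snd z))"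
  shows "cmp (\<lambda>z. D (fst z) \<and> fst (snd z) \<in> set (L (fst z))) (\<lambda>z. B (fst z)) (\<lambda>z. F (fst z) (fst (snd z)))"
  using cmp_comp[OF assms, of "\<lambda>z. D (fst z) \<and> fst (snd z) \<in> set (L (fst z))" "\<lambda>z. B (fst z)" "\<lambda>z. (fst z, fst (snd z))"]
  by (simp add: cmp_pair cmp_fst cmp_snd cmp_id pb_B)

lemma cmp_rev: assumes "cmp D B f" shows "cmp D B (\<lambda>x. rev (f x))"
proof -
  have "cmp D B (\<lambda>x. fold (\<lambda>y acc. y # acc) (f x) [])"
  proof (rule cmp_fold[where Dg = "\<lambda>_. True" and Bg = "\<lambda>_. 0" and S = "\<lambda>x. sz (f x)"])
    fix x i
    show "sz (fold (\<lambda>y acc. y # acc) (take i (f x)) []) \<le> sz (f x)"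
      using sz_take[of i "f x"] by (simp add: fold_Cons_rev[unfolded fun_eq_iff])
  qed (auto intro!: assms cmp_const cmp_Cons cmp_fst cmp_snd cmp_id cmp_size[OF assms])
  then show ?thesis by (simp add: fold_Cons_rev[unfolded fun_eq_iff])
qed

lemma fold_rev_map: "fold (\<lambda>y acc. F y # acc) ys acc = rev (map F ys) @ acc"
  by (induction ys arbitrary: acc) auto

lemma fold_rev_filter: "fold (\<lambda>y acc. if P y then y # acc else acc) ys acc = rev (filter P ys) @ acc"
  by (induction ys arbitrary: acc) auto

lemma cmp_map:
  assumes L: "cmp D B L"
    and F: "cmp (\<lambda>z. D (fst z) \<and> snd z \<in> set (L (fst z))) (\<lambda>z. B (fst z)) (\<lambda>z. F (fst z) (snd z))"
  shows "cmp D B (\<lambda>x. map (F x) (L x))"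
proof -
  obtain S where S: "pb D B S" "\<And>x y. D x \<Longrightarrow> y \<in> set (L x) \<Longrightarrow> sz (F x y) \<le> S x"
    using pb_binder[OF cmp_size[OF F] L] by (metis fst_conv snd_conv)
  have "cmp D B (\<lambda>x. fold (\<lambda>y acc. F x y # acc) (L x) [])"
  proof (rule cmp_fold[where Dg = "\<lambda>z. D (fst z) \<and> fst (snd z) \<in> set (L (fst z))"
        and Bg = "\<lambda>z. B (fst z)" and S = "\<lambda>x. (sz (L x) * (S x + 1) + 1) + B x"])
    show "pb D B (\<lambda>x. (sz (L x) * (S x + 1) + 1) + B x)" by (intro pb_intros cmp_size[OF L] S)
    fix x i assume x: "D x"
    have "sz (fold (\<lambda>y acc. F x y # acc) (take i (L x)) []) \<le> length (take i (L x)) * (S x + 1) + 1"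
      unfolding fold_rev_map append_Nil2 sz_rev using S(2)[OF x]
      by (intro order.trans[OF sz_list_le[of _ "S x"]]) (auto dest: in_set_takeD)
    also have "\<dots> \<le> sz (L x) * (S x + 1) + 1"
      using length_le_sz[of "L x"] by (intro add_mono mult_mono) auto
    finally show "sz (fold (\<lambda>y acc. F x y # acc) (take i (L x)) []) \<le> (sz (L x) * (S x + 1) + 1) + B x" by simp
  qed (auto intro!: L cmp_const cmp_Cons cmp_snd cmp_id cmp_weaken_ctx[OF F])
  from cmp_rev[OF this] show ?thesis by (simp add: fold_rev_map rev_map)
qed

lemma cmp_filter:
  assumes L: "cmp D B L"
    and P: "cmp (\<lambda>z. D (fst z) \<and> snd z \<in> set (L (fst z))) (\<lambda>z. B (fst z)) (\<lambda>z. P (fst z) (snd z))"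
  shows "cmp D B (\<lambda>x. filter (P x) (L x))"
proof -
  have "cmp D B (\<lambda>x. fold (\<lambda>y acc. if P x y then y # acc else acc) (L x) [])"
  proof (rule cmp_fold[where Dg = "\<lambda>z. D (fst z) \<and> fst (snd z) \<in> set (L (fst z))"
        and Bg = "\<lambda>z. B (fst z)" and S = "\<lambda>x. sz (L x) + B x"])
    show "pb D B (\<lambda>x. sz (L x) + B x)" by (intro pb_intros cmp_size[OF L])
    fix x i
    show "sz (fold (\<lambda>y acc. if P x y then y # acc else acc) (take i (L x)) []) \<le> sz (L x) + B x"
      unfolding fold_rev_filter append_Nil2 sz_rev
      using sz_filter[of "P x" "take i (L x)"] sz_take[of i "L x"] by linarith
  qed (auto intro!: L cmp_const cmp_Cons cmp_fst cmp_snd cmp_id cmp_if cmp_weaken_ctx[OF P])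
  from cmp_rev[OF this] show ?thesis by (simp add: fold_rev_filter rev_filter)
qed

lemma ptime_append: "ptime (\<lambda>z. fst z @ (snd z :: 'a::enc list))"
proof -
  have "ptime (\<lambda>z. fold (\<lambda>y acc. y # acc) (rev (fst z)) (snd z :: 'a list))"
  proof (rule cmp_fold[where Dg = "\<lambda>_. True" and Bg = "\<lambda>_. 0" and S = sz])
    fix z :: "'a list \<times> 'a list" and i
    show "sz (fold (\<lambda>y acc. y # acc) (take i (rev (fst z))) (snd z)) \<le> sz z"
      using sz_take[of i "rev (fst z)"] sz_append[of "rev (take i (rev (fst z)))" "snd z"]
      by (simp add: fold_Cons_rev[unfolded fun_eq_iff] sz_prod)
  qed (auto intro!: cmp_const cmp_Cons cmp_fst cmp_snd cmp_id cmp_rev pb_sz)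
  then show ?thesis by (simp add: fold_Cons_rev[unfolded fun_eq_iff])
qed

lemmas cmp_append = ptime_comp2[OF ptime_append]

lemma fold_append_concat: "fold (\<lambda>y acc. acc @ y) xs acc = acc @ concat xs"
  by (induction xs arbitrary: acc) auto

lemma cmp_concat: assumes "cmp D B f" shows "cmp D B (\<lambda>x. concat (f x))"
proof -
  have "cmp D B (\<lambda>x. fold (\<lambda>y acc. acc @ y) (f x) [])"
  proof (rule cmp_fold[where Dg = "\<lambda>_. True" and Bg = "\<lambda>_. 0" and S = "\<lambda>x. sz (f x)"])
    fix x i
    show "sz (fold (\<lambda>y acc. acc @ y) (take i (f x)) []) \<le> sz (f x)"
      using sz_concat[of "take i (f x)"] sz_take[of i "f x"] by (simp add: fold_append_concat)
  qed (auto intro!: assms cmp_const cmp_append cmp_fst cmp_snd cmp_id cmp_size[OF assms])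
  then show ?thesis by (simp add: fold_append_concat)
qed

lemma cmp_Suc: "cmp D B f \<Longrightarrow> cmp D B (\<lambda>x. Suc (f x))"
  by (rule cmp_cong[OF cmp_add[OF _ cmp_const[of _ _ 1]]]) auto

lemma cmp_length: assumes "cmp D B f" shows "cmp D B (\<lambda>x. length (f x))"
proof -
  have "cmp D B (\<lambda>x. fold (\<lambda>y n. Suc n) (f x) 0)"
    by (rule cmp_fold[where Dg = "\<lambda>_. True" and Bg = "\<lambda>_. 0" and S = "\<lambda>x. 1"])
      (auto intro!: assms cmp_const cmp_Suc cmp_snd cmp_id pb_const)
  moreover have "fold (\<lambda>y n. Suc n) xs k = length xs + k" for xs :: "'b list" and k
    by (induction xs arbitrary: k) auto
  ultimately show ?thesis by simp
qed

lemma cmp_sum_list: assumes "cmp D B f" shows "cmp D B (\<lambda>x. sum_list (f x) :: nat)"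
proof -
  have "cmp D B (\<lambda>x. fold (\<lambda>y n. y + n) (f x) (0::nat))"
    by (rule cmp_fold[where Dg = "\<lambda>_. True" and Bg = "\<lambda>_. 0" and S = "\<lambda>x. 1"])
      (auto intro!: assms cmp_const cmp_add cmp_snd cmp_fst cmp_id pb_const)
  moreover have "fold (\<lambda>y n. y + n) xs k = sum_list xs + k" for xs and k :: nat
    by (induction xs arbitrary: k) auto
  ultimately show ?thesis by simp
qed

text \<open>The value of \<open>f\<close> has to be bounded as well: as a number it has size one,
  but the list has \<open>f x\<close> entries.\<close>

lemma cmp_upt: assumes f: "cmp D B f" and b: "pb D B f" shows "cmp D B (\<lambda>x. [0..<f x])"
proof -
  define st where "st s = (fst s - 1, (fst s - 1) # snd s)" for s :: "nat \<times> nat list"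
  have it: "i \<le> n \<Longrightarrow> (st ^^ i) (n, []) = (n - i, [n - i..<n])" for i n
  proof (induction i)
    case (Suc i)
    then have "(n - Suc i) # [n - i..<n] = [n - Suc i..<n]"
      using upt_conv_Cons[of "n - Suc i" n] by (simp add: Suc_diff_Suc Suc_le_lessD)
    then show ?case using Suc by (simp add: st_def)
  qed simp
  have sz_upt: "sz [a..<b] \<le> 2 * b + 1" for a b
    by (rule order.trans[OF sz_list_le[of _ 1]]) auto
  have "cmp D B (\<lambda>x. (st ^^ f x) (f x, []))"
  proof (rule cmp_while[where Ds = "\<lambda>_. True" and Bs = "\<lambda>_. 0" and cn = "\<lambda>s. fst s \<noteq> 0" and S = "\<lambda>x. 2 * f x + 3"])
    show "cmp D B (\<lambda>x. (f x, []))" by (intro cmp_pair f cmp_const)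
    show "cmp (\<lambda>_. True) (\<lambda>_. 0) st" unfolding st_def
      by (intro cmp_pair cmp_sub cmp_fst cmp_snd cmp_const cmp_id cmp_Cons)
    show "pb D B (\<lambda>x. 2 * f x + 3)" by (intro pb_intros b)
    show "sz ((st ^^ i) (f x, [])) \<le> 2 * f x + 3" if "i \<le> f x" for x i
      using sz_upt[of "f x - i" "f x"] by (simp add: it[OF that])
  qed (auto simp: it intro!: cmp_less cmp_const cmp_fst cmp_id b)
  from cmp_snd[OF this] show ?thesis by (rule cmp_cong) (simp add: it)
qed

lemma cmp_nth:
  assumes L: "cmp D B L" and i: "cmp D B n" and lt: "\<And>x. D x \<Longrightarrow> n x < length (L x)"
  shows "cmp D B (\<lambda>x. L x ! n x)"
proof -
  define st where "st s = (fst s - 1, tl (snd s))" for s :: "nat \<times> 'b list"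
  have it: "i \<le> k \<Longrightarrow> (st ^^ i) (k, xs) = (k - i, drop i xs)" for i k and xs :: "'b list"
    by (induction i) (auto simp: st_def drop_Suc tl_drop)
  have "cmp D B (\<lambda>x. (st ^^ n x) (n x, L x))"
  proof (rule cmp_while[where Ds = "\<lambda>s. snd s \<noteq> []" and Bs = "\<lambda>_. 0" and cn = "\<lambda>s. fst s \<noteq> 0" and S = "\<lambda>x. sz (L x) + 2"])
    show "cmp D B (\<lambda>x. (n x, L x))" by (intro cmp_pair assms)
    show "cmp (\<lambda>s. snd s \<noteq> []) (\<lambda>_. 0) st" unfolding st_def
      by (intro cmp_pair cmp_sub cmp_fst cmp_snd cmp_const cmp_id cmp_tl) auto
    show "pb D B (\<lambda>x. sz (L x) + 2)" by (intro pb_intros cmp_size[OF L])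
    show "pb D B n" using cmp_size[OF L]
      by (rule pb_mono) (metis length_le_sz less_imp_le less_trans lt)
    show "sz ((st ^^ i) (n x, L x)) \<le> sz (L x) + 2" if "i \<le> n x" for x i
      using sz_drop[of i "L x"] by (simp add: it[OF that])
    show "snd ((st ^^ i) (n x, L x)) \<noteq> []" if "D x" "i \<le> n x" for x i
      using lt[OF that(1)] that(2) by (simp add: it)
  qed (auto simp: it intro!: cmp_less cmp_const cmp_fst cmp_id)
  from cmp_snd[OF this] have "cmp D B (\<lambda>x. drop (n x) (L x))" by (rule cmp_cong) (simp add: it)
  from cmp_hd[OF this] have "cmp D B (\<lambda>x. hd (drop (n x) (L x)))" using lt by (simp add: not_le)
  then show ?thesis by (rule cmp_cong) (simp add: hd_drop_conv_nth lt)
qed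

text \<open>A total variant of \<open>nth\<close>: the default removes the length condition when
  programs are composed.\<close>

definition nthd :: "'a \<Rightarrow> 'a list \<Rightarrow> nat \<Rightarrow> 'a" where
  "nthd d xs i = (if i < length xs then xs ! i else d)"

lemma cmp_nthd:
  assumes "cmp D B d" "cmp D B L" "cmp D B n"
  shows "cmp D B (\<lambda>x. nthd (d x) (L x) (n x))"
  unfolding nthd_def
proof (intro cmp_if cmp_less cmp_length assms)
  show "cmp (\<lambda>x. D x \<and> n x < length (L x)) B (\<lambda>x. L x ! n x)"
    by (intro cmp_nth cmp_dom[OF assms(2)] cmp_dom[OF assms(3)]) auto
  show "cmp (\<lambda>x. D x \<and> \<not> n x < length (L x)) B d" by (rule cmp_dom[OF assms(1)]) auto
qed

lemma cmp_Bex: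
  assumes "cmp D B L"
    "cmp (\<lambda>z. D (fst z) \<and> snd z \<in> set (L (fst z))) (\<lambda>z. B (fst z)) (\<lambda>z. P (fst z) (snd z))"
  shows "cmp D B (\<lambda>x. \<exists>y\<in>set (L x). P x y)"
  by (rule cmp_cong[OF cmp_not[OF cmp_null[OF cmp_filter[OF assms]]]]) (auto simp: filter_empty_conv)

lemma cmp_Ball:
  assumes "cmp D B L"
    "cmp (\<lambda>z. D (fst z) \<and> snd z \<in> set (L (fst z))) (\<lambda>z. B (fst z)) (\<lambda>z. P (fst z) (snd z))"
  shows "cmp D B (\<lambda>x. \<forall>y\<in>set (L x). P x y)"
  by (rule cmp_cong[OF cmp_null[OF cmp_filter[OF assms(1) cmp_not[OF assms(2)]]]]) (auto simp: filter_empty_conv)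

lemma cmp_let:
  assumes f: "cmp D B f"
    and G: "cmp (\<lambda>z. D (fst z) \<and> snd z = f (fst z)) (\<lambda>z. B (fst z)) (\<lambda>z. G (fst z) (snd z))"
  shows "cmp D B (\<lambda>x. let y = f x in G x y)"
  using cmp_comp[OF G cmp_pair[OF cmp_id f]] by (simp add: pb_B Let_def)

text \<open>There is no multiplication instruction. Adding \<open>g x\<close> repeatedly takes
  \<open>f x\<close> rounds, hence the bound on the value of \<open>f\<close>.\<close>

lemma cmp_mult: assumes "cmp D B f" "cmp D B g" "pb D B f" shows "cmp D B (\<lambda>x. f x * g x :: nat)"
proof -
  have "cmp D B (\<lambda>x. fold (\<lambda>y n. n + g x) [0..<f x] 0)"
  proof (rule cmp_fold[where Dg = "\<lambda>z. D (fst z)" and Bg = "\<lambda>z. B (fst z)" and S = "\<lambda>x. 1 + B x"])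
    have "cmp (\<lambda>z. D (fst z)) (\<lambda>z. B (fst z)) (\<lambda>z. g (fst z))"
      by (rule cmp_comp[OF assms(2) cmp_fst[OF cmp_id]]) (auto intro: pb_B)
    then show "cmp (\<lambda>z. D (fst z)) (\<lambda>z. B (fst z)) (\<lambda>z. snd (snd z) + g (fst z))"
      by (intro cmp_add cmp_snd cmp_id)
  qed (auto intro!: cmp_upt assms cmp_const pb_Suc pb_B)
  moreover have "fold (\<lambda>y n. n + a) xs k = k + length xs * a" for xs :: "nat list" and k a :: nat
    by (induction xs arbitrary: k) auto
  ultimately show ?thesis by simp
qed

text \<open>Equality is computed differently on each type, so its computability is made a property
  of the type, from which membership and removal of duplicates follow.\<close>

definition ptime_eq :: "'a::enc itself \<Rightarrow> bool" where
  "ptime_eq _ \<longleftrightarrow> ptime (\<lambda>z. fst z = (snd z :: 'a))"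

lemma cmp_eq_gen:
  "ptime_eq TYPE('b::enc) \<Longrightarrow> cmp D B f \<Longrightarrow> cmp D B g \<Longrightarrow> cmp D B (\<lambda>x. f x = (g x :: 'b))"
  unfolding ptime_eq_def by (rule ptime_comp2)

lemma ptime_eq_nat: "ptime_eq TYPE(nat)"
  unfolding ptime_eq_def
  by (rule cmp_cong[OF cmp_conj[OF cmp_le[of _ _ fst snd] cmp_le[of _ _ snd fst]]]) (auto intro!: cmp_fst cmp_snd cmp_id)

lemma ptime_eq_prod: "ptime_eq TYPE('a::enc) \<Longrightarrow> ptime_eq TYPE('b::enc) \<Longrightarrow> ptime_eq TYPE('a \<times> 'b)"
  unfolding ptime_eq_def[of "TYPE('a \<times> 'b)"] prod_eq_iff
  by (intro cmp_conj cmp_eq_gen cmp_fst cmp_snd cmp_id)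

lemma ptime_eq_list: assumes "ptime_eq TYPE('a::enc)" shows "ptime_eq TYPE('a list)"
proof -
  have "ptime (\<lambda>z::'a list \<times> 'a list. length (fst z) = length (snd z) \<and>
      (\<forall>i\<in>set [0..<length (fst z)]. fst z ! i = snd z ! i))"
  proof (intro cmp_conj cmp_Ball cmp_eq_gen[OF assms] cmp_eq_gen[OF ptime_eq_nat] cmp_upt cmp_nth cmp_length cmp_fst cmp_snd cmp_id)
    show "pb (\<lambda>x. True \<and> length (fst x) = length (snd x)) (\<lambda>_. 0) (\<lambda>x::'a list \<times> 'a list. length (fst x))"
    proof (rule pb_mono[OF pb_sz])
      show "length (fst x) \<le> sz x" for x :: "'a list \<times> 'a list"
        using length_le_sz[of "fst x"] by (simp add: sz_prod)
    qed
  qed auto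
  note 1 = this
  show ?thesis unfolding ptime_eq_def
  proof (rule cmp_cong[OF 1])
    fix z :: "'a list \<times> 'a list"
    show "(length (fst z) = length (snd z) \<and> (\<forall>i\<in>set [0..<length (fst z)]. fst z ! i = snd z ! i)) =
      (fst z = snd z)" by (subst list_eq_iff_nth_eq) auto
  qed
qed

lemma cmp_member_gen:
  assumes eq: "ptime_eq TYPE('b::enc)" and "cmp D B a" "cmp D B L"
  shows "cmp D B (\<lambda>x. (a x :: 'b) \<in> set (L x))"
proof -
  have "ptime (\<lambda>z::'b \<times> 'b list. \<exists>y\<in>set (snd z). y = fst z)"
    by (intro cmp_Bex cmp_eq_gen[OF eq] cmp_fst cmp_snd cmp_id)
  then have "ptime (\<lambda>z::'b \<times> 'b list. fst z \<in> set (snd z))" by (rule cmp_cong) auto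
  from ptime_comp[OF this cmp_pair[OF assms(2,3)]] show ?thesis by simp
qed

lemma fold_remdups: "distinct acc \<Longrightarrow>
   distinct (fold (\<lambda>y acc. if y \<in> set acc then acc else y # acc) xs acc) \<and>
   set (fold (\<lambda>y acc. if y \<in> set acc then acc else y # acc) xs acc) = set xs \<union> set acc"
  by (induction xs arbitrary: acc) auto

definition dedup :: "'a list \<Rightarrow> 'a list" where
  "dedup xs = fold (\<lambda>y acc. if y \<in> set acc then acc else y # acc) xs []"

lemma dedup [simp]: "distinct (dedup xs)" "set (dedup xs) = set xs"
  using fold_remdups[of "[]" xs] by (auto simp: dedup_def)

lemma sz_fold_dedup: "sz (fold (\<lambda>y acc. if y \<in> set acc then acc else y # acc) xs acc) \<le> sz xs + sz acc"
proof (induction xs arbitrary: acc)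
  case (Cons a xs)
  show ?case using Cons[of acc] Cons[of "a # acc"] by auto
qed simp

lemma ptime_dedup: assumes eq: "ptime_eq TYPE('a::enc)" shows "ptime (dedup :: 'a list \<Rightarrow> _)"
  unfolding dedup_def
proof (rule cmp_fold[where Dg = "\<lambda>_. True" and Bg = "\<lambda>_. 0" and S = "\<lambda>x. sz x + 1"])
  fix x :: "'a list" and i
  show "sz (fold (\<lambda>y acc. if y \<in> set acc then acc else y # acc) (take i x) []) \<le> sz x + 1"
    using sz_fold_dedup[of "take i x" "[]"] sz_take[of i x] by simp
qed (auto intro!: cmp_const cmp_Cons cmp_fst cmp_snd cmp_id cmp_if cmp_member_gen[OF eq] pb_intros)

lemmas ptime_eqs = ptime_eq_nat ptime_eq_prod[OF ptime_eq_nat ptime_eq_nat] ptime_eq_list[OF ptime_eq_nat]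
lemmas cmp_eq = ptime_eqs[THEN cmp_eq_gen]
lemmas cmp_member = ptime_eqs[THEN cmp_member_gen]
lemmas cmp_dedup = ptime_eqs[THEN ptime_dedup, THEN ptime_comp]

lemmas cmp_basic = cmp_const cmp_id cmp_fst cmp_snd cmp_pair cmp_add cmp_sub cmp_Suc cmp_le cmp_less
  cmp_not cmp_conj cmp_disj cmp_imp cmp_if cmp_of_bool cmp_Cons cmp_append cmp_concat cmp_length
  cmp_map cmp_filter cmp_Bex cmp_Ball cmp_eq cmp_member cmp_nthd cmp_rev cmp_sum_list cmp_dedup

section \<open>Invariance under isomorphism\<close>

definition relabel :: "('a \<Rightarrow> 'b) \<Rightarrow> 'a graph \<Rightarrow> 'b graph" where
  "relabel f G = (f ` verts G, (\<lambda>e. f ` e) ` edges G)"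

lemma simple_graph_edge_subset: "simple_graph G \<Longrightarrow> e \<in> edges G \<Longrightarrow> e \<subseteq> verts G"
  unfolding simple_graph_def by fastforce

lemma simple_graph_edgeD:
  assumes "simple_graph G" "{u, v} \<in> edges G" shows "u \<noteq> v" "u \<in> verts G" "v \<in> verts G"
  using assms unfolding simple_graph_def by (metis doubleton_eq_iff)+

lemma relabel_edge_iff:
  assumes "simple_graph G" "inj_on f (verts G)" "u \<in> verts G" "v \<in> verts G"
  shows "{f u, f v} \<in> edges (relabel f G) \<longleftrightarrow> {u, v} \<in> edges G"
proof
  assume "{f u, f v} \<in> edges (relabel f G)"
  then obtain e where e: "e \<in> edges G" "{f u, f v} = f ` e" by (auto simp: relabel_def)
  then have "f ` {u, v} = f ` e" by simp
  then have "{u, v} = e"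
    using inj_on_image_eq_iff[OF assms(2), of "{u, v}" e] assms simple_graph_edge_subset[OF assms(1) e(1)]
    by blast
  then show "{u, v} \<in> edges G" using e by simp
next
  assume "{u, v} \<in> edges G"
  then have "f ` {u, v} \<in> edges (relabel f G)" unfolding relabel_def snd_conv by (rule imageI)
  then show "{f u, f v} \<in> edges (relabel f G)" by simp
qed

lemma relabel_edgeE:
  assumes "simple_graph G" "{x, y} \<in> edges (relabel f G)"
  obtains u v where "{u, v} \<in> edges G" "x = f u" "y = f v"
proof -
  obtain e where e: "e \<in> edges G" "{x, y} = f ` e" using assms(2) by (auto simp: relabel_def)
  obtain a b where ab: "e = {a, b}" using e(1) assms(1) by (auto simp: simple_graph_def)
  then have "{x, y} = {f a, f b}" using e by simp
  then have "x = f a \<and> y = f b \<or> x = f b \<and> y = f a" by (metis doubleton_eq_iff)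
  then show thesis using that e(1) ab by (metis insert_commute)
qed

definition iso_invariant :: "('a graph \<Rightarrow> nat) \<Rightarrow> bool" where
  "iso_invariant \<Phi> \<longleftrightarrow>
     (\<forall>G f. simple_graph G \<longrightarrow> inj_on f (verts G) \<longrightarrow> \<Phi> (relabel f G) = \<Phi> G)"

lemma max_degree_relabel:
  assumes G: "simple_graph G" and f: "inj_on f (verts G)"
  shows "max_degree (relabel f G) = max_degree G"
proof -
  have "degree (relabel f G) (f v) = degree G v" if v: "v \<in> verts G" for v
  proof -
    have "{e \<in> edges (relabel f G). f v \<in> e} = (\<lambda>e. f ` e) ` {e \<in> edges G. v \<in> e}"
      unfolding relabel_def snd_conv
      using inj_on_image_mem_iff[OF f v simple_graph_edge_subset[OF G]] by auto
    moreover have "inj_on (\<lambda>e. f ` e) {e \<in> edges G. v \<in> e}"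
      using inj_on_image_eq_iff[OF f] simple_graph_edge_subset[OF G] by (auto intro!: inj_onI)
    ultimately show ?thesis by (simp add: degree_def card_image)
  qed
  then have "degree (relabel f G) ` f ` verts G = degree G ` verts G" by force
  then show ?thesis by (simp add: max_degree_def relabel_def)
qed

text \<open>Walks map forward along \<open>f\<close>. Conversely, a walk that starts at an image
  stays among images, since edges of the relabelled graph come from edges of \<open>G\<close>, and
  so it lifts back.\<close>

lemma num_components_relabel:
  assumes G: "simple_graph G" and f: "inj_on f (verts G)"
  shows "num_components (relabel f G) = num_components G"
proof -
  define E where "E = {(a, b). {a, b} \<in> edges G}"
  define E' where "E' = {(a, b). {a, b} \<in> edges (relabel f G)}"
  have V': "verts (relabel f G) = f ` verts G" by (simp add: relabel_def)
  have 1: "(f u, f v) \<in> E'\<^sup>*" if "(u, v) \<in> E\<^sup>*" for u v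
    using that
  proof induction
    case (step y z)
    then have "(f y, f z) \<in> E'"
      using relabel_edge_iff[OF G f] simple_graph_edgeD[OF G] by (simp add: E_def E'_def)
    then show ?case using step by (meson rtrancl.rtrancl_into_rtrancl)
  qed simp
  have 2: "\<exists>v\<in>verts G. y = f v \<and> (u, v) \<in> E\<^sup>*" if "(f u, y) \<in> E'\<^sup>*" "u \<in> verts G" for u y
    using that
  proof induction
    case (step y z)
    then obtain v where v: "v \<in> verts G" "y = f v" "(u, v) \<in> E\<^sup>*" by blast
    have "{y, z} \<in> edges (relabel f G)" using step(2) by (simp add: E'_def)
    then obtain a b where ab: "{a, b} \<in> edges G" "y = f a" "z = f b" by (rule relabel_edgeE[OF G])
    have "a = v" using ab v simple_graph_edgeD(2)[OF G ab(1)] f by (auto dest: inj_onD)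
    then have "(u, b) \<in> E\<^sup>*" using v(3) ab(1) by (auto simp: E_def intro: rtrancl_into_rtrancl)
    then show ?case using simple_graph_edgeD(3)[OF G ab(1)] ab(3) by blast
  qed auto
  have cl: "connected_rel (relabel f G) `` {f u} = f ` (connected_rel G `` {u})" if u: "u \<in> verts G" for u
    using u 1 2[OF _ u] unfolding connected_rel_def V' E_def[symmetric] E'_def[symmetric] by (auto, blast)
  have "f ` verts G // connected_rel (relabel f G) = (\<lambda>X. f ` X) ` (verts G // connected_rel G)"
    unfolding quotient_def using cl by auto
  moreover have "inj_on (\<lambda>X. f ` X) (verts G // connected_rel G)"
  proof (rule inj_onI)
    fix X Y assume "X \<in> verts G // connected_rel G" "Y \<in> verts G // connected_rel G" "f ` X = f ` Y"
    moreover have "X \<subseteq> verts G" if "X \<in> verts G // connected_rel G" for X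
      using that by (auto simp: quotient_def connected_rel_def)
    ultimately show "X = Y" using inj_on_image_eq_iff[OF f] by metis
  qed
  ultimately show ?thesis unfolding num_components_def V' by (simp add: card_image)
qed

lemma chromatic_number_relabel:
  assumes G: "simple_graph G" and f: "inj_on f (verts G)"
  shows "chromatic_number (relabel f G) = chromatic_number G"
proof -
  have "(\<exists>h. proper_coloring (relabel f G) q h) \<longleftrightarrow> (\<exists>h. proper_coloring G q h)" for q
  proof
    assume "\<exists>h. proper_coloring (relabel f G) q h"
    then obtain h where h: "proper_coloring (relabel f G) q h" by blast
    have "proper_coloring G q (h \<circ> f)"
      unfolding proper_coloring_def
    proof (intro conjI allI impI)
      show "h \<circ> f \<in> verts G \<rightarrow> {..<q}" using h by (auto simp: proper_coloring_def relabel_def)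
      fix u v assume "{u, v} \<in> edges G"
      then have "{f u, f v} \<in> edges (relabel f G)"
        using relabel_edge_iff[OF G f] simple_graph_edgeD[OF G] by blast
      then show "(h \<circ> f) u \<noteq> (h \<circ> f) v" using h by (auto simp: proper_coloring_def)
    qed
    then show "\<exists>h. proper_coloring G q h" by blast
  next
    assume "\<exists>h. proper_coloring G q h"
    then obtain h where h: "proper_coloring G q h" by blast
    let ?h = "\<lambda>y. h (the_inv_into (verts G) f y)"
    have "proper_coloring (relabel f G) q ?h"
      unfolding proper_coloring_def
    proof (intro conjI allI impI)
      show "?h \<in> verts (relabel f G) \<rightarrow> {..<q}"
        using h f by (auto simp: proper_coloring_def relabel_def the_inv_into_f_f)
      fix x y assume "{x, y} \<in> edges (relabel f G)"
      then obtain u v where uv: "{u, v} \<in> edges G" "x = f u" "y = f v" by (rule relabel_edgeE[OF G])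
      then show "?h x \<noteq> ?h y"
        using h simple_graph_edgeD[OF G uv(1)] by (auto simp: proper_coloring_def the_inv_into_f_f[OF f])
    qed
    then show "\<exists>h. proper_coloring (relabel f G) q h" by blast
  qed
  then show ?thesis by (simp add: chromatic_number_def)
qed

text \<open>Numbering the parameters lets the three cases share one query program that receives
  \<open>ph\<close> as data. Every index from 2 on means the chromatic number.\<close>

definition parameter_of :: "nat \<Rightarrow> 'a graph \<Rightarrow> nat" where
  "parameter_of ph = (if ph = 0 then max_degree else if ph = 1 then num_components else chromatic_number)"

lemma parameter_of_iso_invariant: "iso_invariant (parameter_of ph :: 'a graph \<Rightarrow> nat)"
  unfolding iso_invariant_def parameter_of_def
  by (simp add: max_degree_relabel num_components_relabel chromatic_number_relabel)

lemma induced_simple: "simple_graph G \<Longrightarrow> A \<subseteq> verts G \<Longrightarrow> simple_graph (induced G A)"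
  unfolding simple_graph_def induced_def
  by (auto intro: finite_subset) (metis insert_subset)

lemma relabel_induced:
  assumes G: "simple_graph G" and f: "inj_on f (verts G)" and A: "A \<subseteq> verts G"
  shows "induced (relabel f G) (f ` A) = relabel f (induced G A)"
proof -
  have "f ` e \<subseteq> f ` A \<longleftrightarrow> e \<subseteq> A" if "e \<in> edges G" for e
    using inj_on_image_mem_iff[OF f _ A] simple_graph_edge_subset[OF G that] by blast
  then show ?thesis unfolding induced_def relabel_def by auto
qed

text \<open>Deleting colour classes can leave a vertex set that is no initial segment. The query
  then contains a renumbered copy, which this invariance makes harmless.\<close>

lemma ind_sub_relabel:
  assumes inv: "iso_invariant \<Phi>" and G: "simple_graph G" and f: "inj_on f (verts G)"
  shows "ind_sub \<Phi> k (relabel f G) = ind_sub \<Phi> k G"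
proof -
  have "bij_betw (\<lambda>A. f ` A) {A. A \<subseteq> verts G \<and> card A = k} {A. A \<subseteq> f ` verts G \<and> card A = k}"
  proof (rule bij_betw_imageI)
    show "inj_on (\<lambda>A. f ` A) {A. A \<subseteq> verts G \<and> card A = k}"
      by (rule inj_on_subset[OF inj_on_image_Pow[OF f]]) auto
    show "(\<lambda>A. f ` A) ` {A. A \<subseteq> verts G \<and> card A = k} = {A. A \<subseteq> f ` verts G \<and> card A = k}"
    proof (intro equalityI subsetI)
      fix A assume "A \<in> {A. A \<subseteq> f ` verts G \<and> card A = k}"
      then have A: "A \<subseteq> f ` verts G" "card A = k" by auto
      obtain B where B: "B \<subseteq> verts G" "A = f ` B" using A(1) by (meson subset_image_iff)
      then show "A \<in> (\<lambda>A. f ` A) ` {A. A \<subseteq> verts G \<and> card A = k}"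
        using A(2) card_image[OF inj_on_subset[OF f B(1)]] by auto
    next
      fix A assume "A \<in> (\<lambda>A. f ` A) ` {A. A \<subseteq> verts G \<and> card A = k}"
      then obtain B where B: "B \<subseteq> verts G" "card B = k" "A = f ` B" by auto
      then show "A \<in> {A. A \<subseteq> f ` verts G \<and> card A = k}"
        using card_image[OF inj_on_subset[OF f B(1)]] by auto
    qed
  qed
  then have "ind_sub \<Phi> k (relabel f G) = (\<Sum>A | A \<subseteq> verts G \<and> card A = k. \<Phi> (induced (relabel f G) (f ` A)))"
    unfolding ind_sub_def by (subst sum.reindex_bij_betw[symmetric]) (auto simp: relabel_def)
  also have "\<dots> = ind_sub \<Phi> k G"
    unfolding ind_sub_def
  proof (rule sum.cong)
    fix A assume "A \<in> {A. A \<subseteq> verts G \<and> card A = k}"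
    then have A: "A \<subseteq> verts G" by simp
    have "verts (induced G A) = A" by (simp add: induced_def)
    then show "\<Phi> (induced (relabel f G) (f ` A)) = \<Phi> (induced G A)"
      using inv induced_simple[OF G A] inj_on_subset[OF f A]
      unfolding iso_invariant_def relabel_induced[OF G f A] by metis
  qed simp
  finally show ?thesis .
qed

section \<open>Alternating sums over subsets\<close>

lemma sum_Pow_insert:
  assumes "finite A" "e \<notin> A"
  shows "(\<Sum>T\<in>Pow (insert e A). f T) = (\<Sum>T\<in>Pow A. f T + f (insert e T) :: int)"
proof -
  have "Pow A \<inter> insert e ` Pow A = {}" using assms by auto
  moreover have "inj_on (insert e) (Pow A)" using assms by (auto intro!: inj_onI)
  ultimately show ?thesis
    using assms by (simp add: Pow_insert sum.union_disjoint sum.reindex sum.distrib)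
qed

text \<open>The terms for \<open>T\<close> and \<open>insert e T\<close> have equal values and
  opposite signs.\<close>

lemma alternating_sum_cancel:
  assumes "finite A" "e \<in> A" "\<And>T. T \<subseteq> A \<Longrightarrow> e \<notin> T \<Longrightarrow> f (insert e T) = (f T :: int)"
  shows "(\<Sum>T\<in>Pow A. (-1) ^ card T * f T) = 0"
proof -
  have A: "A = insert e (A - {e})" using assms(2) by auto
  have "(\<Sum>T\<in>Pow A. (-1) ^ card T * f T) =
      (\<Sum>T\<in>Pow (A - {e}). (-1) ^ card T * f T + (-1) ^ card (insert e T) * f (insert e T))"
    by (subst A, subst sum_Pow_insert) (use assms(1) in auto)
  also have "\<dots> = 0"
  proof (rule sum.neutral, rule ballI)
    fix T assume T: "T \<in> Pow (A - {e})"
    then have "finite T" "e \<notin> T" using assms(1) finite_subset by auto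
    then show "(-1) ^ card T * f T + (-1) ^ card (insert e T) * f (insert e T) = 0"
      using assms(3)[of T] T by (simp add: subset_Diff_insert)
  qed
  finally show ?thesis .
qed

lemma alternating_sum_const:
  assumes "finite A" shows "(\<Sum>T\<in>Pow A. (-1) ^ card T * (c::int)) = (if A = {} then c else 0)"
proof (cases "A = {}")
  case False
  then obtain e where "e \<in> A" by auto
  then show ?thesis using alternating_sum_cancel[OF assms, of e "\<lambda>_. c"] False by simp
qed simp

lemma alternating_sum_subset:
  assumes "finite A"
  shows "(\<Sum>T\<in>Pow A. (-1) ^ card T * (if T \<subseteq> B then c else 0)) = (if A \<inter> B = {} then c else (0::int))"
proof -
  have "(\<Sum>T\<in>Pow A. (-1) ^ card T * (if T \<subseteq> B then c else 0)) = (\<Sum>T\<in>Pow (A \<inter> B). (-1) ^ card T * c)"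
    by (rule sum.mono_neutral_cong_right) (use assms in auto)
  then show ?thesis using alternating_sum_const[of "A \<inter> B" c] assms by simp
qed

section \<open>The pattern graphs\<close>

text \<open>
  Colours \<open>i < k\<close> and \<open>k \<le> j < 2k\<close> are the two sides of the tested bipartite graph. The fixed edges
  towards the special colours \<open>2k\<close> and \<open>2k + 1\<close> are chosen such that the parameter, as a function of
  the set of present test pairs, has alternating sum \<open>\<plusminus>1\<close>.
\<close>

definition fixed_arc :: "nat \<Rightarrow> nat \<Rightarrow> nat \<Rightarrow> nat \<Rightarrow> bool" where
  "fixed_arc ph k c d \<longleftrightarrow>
     (if ph = 0 then c < k \<and> d = k + k
      else if ph = 1 then c < k \<and> d = k + k \<or> k \<le> c \<and> c < k + k \<and> d = Suc (k + k)
      else c < k + k \<and> d = k + k)"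

definition fixed_edge :: "nat \<Rightarrow> nat \<Rightarrow> nat \<Rightarrow> nat \<Rightarrow> bool" where
  "fixed_edge ph k c d \<longleftrightarrow> fixed_arc ph k c d \<or> fixed_arc ph k d c"

definition test_pairs :: "nat \<Rightarrow> (nat \<times> nat) set" where
  "test_pairs k = {..<k} \<times> {k..<k + k}"

definition pattern :: "nat \<Rightarrow> nat \<Rightarrow> nat \<Rightarrow> (nat \<times> nat) set \<Rightarrow> nat graph" where
  "pattern ph k n S =
     ({..<n}, {{c, d} | c d. c < n \<and> d < n \<and> (fixed_edge ph k c d \<or> (c, d) \<in> S)})"

lemma fixed_edge_sym: "fixed_edge ph k c d \<longleftrightarrow> fixed_edge ph k d c"
  by (auto simp: fixed_edge_def)

lemma fixed_edge_irrefl: "\<not> fixed_edge ph k c c"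
  by (auto simp: fixed_edge_def fixed_arc_def)

lemma finite_test_pairs: "finite (test_pairs k)" by (simp add: test_pairs_def)

lemma pattern_verts: "verts (pattern ph k n S) = {..<n}" by (simp add: pattern_def)

lemma pattern_edge:
  "{c, d} \<in> edges (pattern ph k n S) \<longleftrightarrow>
     c < n \<and> d < n \<and> (fixed_edge ph k c d \<or> (c, d) \<in> S \<or> (d, c) \<in> S)"
  unfolding pattern_def by (auto simp: doubleton_eq_iff fixed_edge_sym)

lemma pattern_simple: "S \<subseteq> test_pairs k \<Longrightarrow> simple_graph (pattern ph k n S)"
  unfolding simple_graph_def pattern_def using fixed_edge_irrefl
  by (fastforce simp: test_pairs_def)

section \<open>Values of the three parameters on patterns\<close>

lemma degree_neighbours:
  assumes "simple_graph G" shows "degree G v = card {u. {v, u} \<in> edges G}"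
proof -
  have "{e \<in> edges G. v \<in> e} = (\<lambda>u. {v, u}) ` {u. {v, u} \<in> edges G}"
  proof (intro equalityI subsetI)
    fix e assume e: "e \<in> {e \<in> edges G. v \<in> e}"
    then obtain a b where "e = {a, b}" using assms unfolding simple_graph_def by blast
    then show "e \<in> (\<lambda>u. {v, u}) ` {u. {v, u} \<in> edges G}" using e by (auto simp: insert_commute)
  qed auto
  moreover have "inj_on (\<lambda>u. {v, u}) {u. {v, u} \<in> edges G}"
    by (auto intro!: inj_onI simp: doubleton_eq_iff)
  ultimately show ?thesis by (simp add: degree_def card_image)
qed

text \<open>All rows are joined to the hub \<open>k + k\<close>, whose degree \<open>k\<close> is a
  lower bound. Columns have degree at most \<open>k\<close>, and a row exceeds \<open>k\<close> only
  if all its \<open>k\<close> test pairs are present, owing to its extra hub edge.\<close>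

lemma max_degree_pattern:
  assumes S: "S \<subseteq> test_pairs k" and n: "k + k < n" and k: "0 < k"
  shows "max_degree (pattern 0 k n S) = k + of_bool (\<exists>i<k. \<forall>j\<in>{k..<k + k}. (i, j) \<in> S)"
proof -
  let ?G = "pattern 0 k n S" and ?full = "\<exists>i<k. \<forall>j\<in>{k..<k + k}. (i, j) \<in> S"
  note dn = degree_neighbours[OF pattern_simple[OF S]]
  have row: "degree ?G v = Suc (card {d. (v, d) \<in> S})" if "v < k" for v
  proof -
    have "{u. {v, u} \<in> edges ?G} = insert (k + k) {d. (v, d) \<in> S}"
      using that n S by (auto simp: pattern_edge fixed_edge_def fixed_arc_def test_pairs_def)
    moreover have "{d. (v, d) \<in> S} \<subseteq> {k..<k + k}" using S by (auto simp: test_pairs_def)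
    then have "finite {d. (v, d) \<in> S}" "k + k \<notin> {d. (v, d) \<in> S}" using finite_subset by auto
    ultimately show ?thesis by (simp add: dn)
  qed
  have sub: "{d. (v, d) \<in> S} \<subseteq> {k..<k + k}" for v using S by (auto simp: test_pairs_def)
  have hub: "degree ?G (k + k) = k"
  proof -
    have "{u. {k + k, u} \<in> edges ?G} = {..<k}"
      using n S by (auto simp: pattern_edge fixed_edge_def fixed_arc_def test_pairs_def)
    then show ?thesis by (simp add: dn)
  qed
  have col: "degree ?G v \<le> k" if "\<not> v < k" for v
  proof -
    have "{u. {v, u} \<in> edges ?G} \<subseteq> {..<k}"
      using n S that by (auto simp: pattern_edge fixed_edge_def fixed_arc_def test_pairs_def)
    then have "card {u. {v, u} \<in> edges ?G} \<le> card {..<k}" by (intro card_mono) auto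
    then show ?thesis by (simp add: dn)
  qed
  have ub: "degree ?G v \<le> k + of_bool ?full" for v
  proof (cases "v < k")
    case True
    show ?thesis
    proof (cases "{d. (v, d) \<in> S} = {k..<k + k}")
      case True2: True
      then have ?full using True by blast
      then show ?thesis using row[OF True] True2 by simp
    next
      case False
      then have "card {d. (v, d) \<in> S} < card {k..<k + k}" using sub by (intro psubset_card_mono) auto
      then show ?thesis using row[OF True] by simp
    qed
  qed (use col trans_le_add1 in blast)
  have "Max (degree ?G ` {..<n}) = k + of_bool ?full"
  proof (rule Max_eqI)
    show "k + of_bool ?full \<in> degree ?G ` {..<n}"
    proof (cases ?full)
      case True
      then obtain i where i: "i < k" "\<forall>j\<in>{k..<k + k}. (i, j) \<in> S" by blast
      then have "{d. (i, d) \<in> S} = {k..<k + k}" using sub by blast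
      then have "degree ?G i = Suc k" using row[OF i(1)] by simp
      then show ?thesis using True i(1) n by (intro image_eqI[of _ _ i]) auto
    next
      case False
      then show ?thesis using hub n by (intro image_eqI[of _ _ "k + k"]) auto
    qed
    show "y \<le> k + of_bool ?full" if "y \<in> degree ?G ` {..<n}" for y using that ub by blast
  qed simp
  then show ?thesis using n by (auto simp: max_degree_def pattern_verts)
qed

lemma card_quotient_label:
  assumes r: "r \<subseteq> V \<times> V" "\<And>u v. u \<in> V \<Longrightarrow> v \<in> V \<Longrightarrow> (u, v) \<in> r \<longleftrightarrow> f u = f v"
  shows "card (V // r) = card (f ` V)"
proof -
  have c: "r `` {u} = {v \<in> V. f v = f u}" if "u \<in> V" for u using r that by auto
  have "V // r = (\<lambda>y. {v \<in> V. f v = y}) ` f ` V" using c by (auto simp: quotient_def image_iff)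
  moreover have "inj_on (\<lambda>y. {v \<in> V. f v = y}) (f ` V)" by (auto intro!: inj_onI)
  ultimately show ?thesis by (simp add: card_image)
qed

text \<open>Rows form a star around \<open>k + k\<close> and columns one around
  \<open>Suc (k + k)\<close>; any single test edge merges the two stars. The remaining colours are
  isolated.\<close>

lemma num_components_pattern:
  assumes S: "S \<subseteq> test_pairs k" and n: "Suc (k + k) < n" and k: "0 < k"
  shows "num_components (pattern 1 k n S) = n - Suc (k + k) + of_bool (S = {})"
proof -
  let ?G = "pattern 1 k n S"
  define E where "E = {(a, b). {a, b} \<in> edges ?G}"
  \<comment> \<open>A representative of the component of \<open>v\<close>: the centre of its star,
    or \<open>k + k\<close> once the stars are merged, and \<open>v\<close> itself if it is
    isolated.\<close>
  define lab where "lab v = (if v < k \<or> v = k + k then k + k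
    else if v < k + k \<or> v = Suc (k + k) then (if S = {} then Suc (k + k) else k + k) else v)" for v
  have symE: "sym E" by (auto simp: E_def sym_def insert_commute)
  have symEs: "sym (E\<^sup>*)" by (rule sym_rtrancl[OF symE])
  have Eiff: "(a, b) \<in> E \<longleftrightarrow> a < n \<and> b < n \<and> (fixed_edge 1 k a b \<or> (a, b) \<in> S \<or> (b, a) \<in> S)" for a b
    by (simp add: E_def pattern_edge)
  have step: "lab a = lab b" if "(a, b) \<in> E" for a b
    using that S by (auto simp: Eiff fixed_edge_def fixed_arc_def lab_def test_pairs_def split: if_splits)
  have pres: "(a, b) \<in> E\<^sup>* \<Longrightarrow> lab a = lab b" for a b
    by (induction rule: rtrancl_induct) (auto dest: step)
  have A: "(v, k + k) \<in> E\<^sup>*" if "v < k" for v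
    using that n by (intro r_into_rtrancl) (auto simp: Eiff fixed_edge_def fixed_arc_def)
  have B: "(v, Suc (k + k)) \<in> E\<^sup>*" if "k \<le> v" "v < k + k" for v
    using that n by (intro r_into_rtrancl) (auto simp: Eiff fixed_edge_def fixed_arc_def)
  have C: "(Suc (k + k), k + k) \<in> E\<^sup>*" if "S \<noteq> {}"
  proof -
    obtain p where "p \<in> S" using \<open>S \<noteq> {}\<close> by blast
    then obtain a b where ab: "(a, b) \<in> S" "a < k" "k \<le> b" "b < k + k"
      using S by (cases p) (auto simp: test_pairs_def)
    have "(Suc (k + k), b) \<in> E\<^sup>*" using B[OF ab(3,4)] symEs by (meson symD)
    also have "(b, a) \<in> E" using ab n by (simp add: Eiff)
    also have "(a, k + k) \<in> E\<^sup>*" by (rule A[OF ab(2)])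
    finally show ?thesis .
  qed
  have tolab: "(v, lab v) \<in> E\<^sup>*" for v
    unfolding lab_def using A[of v] B[of v] C rtrancl_trans[of v "Suc (k + k)" E "k + k"]
    by (cases "S = {}") auto
  have "(u, v) \<in> connected_rel ?G \<longleftrightarrow> lab u = lab v" if "u \<in> {..<n}" "v \<in> {..<n}" for u v
    using that pres[of u v] tolab[of u] tolab[of v] symEs
    unfolding connected_rel_def pattern_verts E_def[symmetric]
    by simp (metis rtrancl_trans symD)
  then have "num_components ?G = card (lab ` {..<n})"
    unfolding num_components_def pattern_verts
    by (intro card_quotient_label) (auto simp: connected_rel_def pattern_verts)
  also have "lab ` {..<n} = {k + k} \<union> (if S = {} then {Suc (k + k)} else {}) \<union> {Suc (Suc (k + k))..<n}"
  proof (intro equalityI subsetI)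
    fix y assume "y \<in> {k + k} \<union> (if S = {} then {Suc (k + k)} else {}) \<union> {Suc (Suc (k + k))..<n}"
    then have "y < n \<and> lab y = y" using n by (auto simp: lab_def split: if_splits)
    then show "y \<in> lab ` {..<n}" by (metis imageI lessThan_iff)
  qed (use n in \<open>auto simp: lab_def split: if_splits\<close>)
  also have "card \<dots> = n - Suc (k + k) + of_bool (S = {})"
    using n by (auto simp: card_insert_if)
  finally show ?thesis .
qed

text \<open>The hub \<open>k + k\<close> is adjacent to all rows and columns. Two colours suffice
  without test edges, whereas any test edge forms a triangle with the hub; three always suffice
  since the test edges are bipartite.\<close>

lemma chromatic_number_pattern:
  assumes S: "S \<subseteq> test_pairs k" and n: "k + k < n" and k: "0 < k" and ph: "ph \<noteq> 0" "ph \<noteq> 1"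
  shows "chromatic_number (pattern ph k n S) = 2 + of_bool (S \<noteq> {})"
  unfolding chromatic_number_def
proof (rule Least_equality)
  let ?f = "\<lambda>v. if v < k then 1 else if v < k + k then (if S = {} then 1 else 2) else (0::nat)"
  have "proper_coloring (pattern ph k n S) (2 + of_bool (S \<noteq> {})) ?f"
    unfolding proper_coloring_def pattern_verts pattern_edge
    using S k ph by (auto simp: fixed_edge_def fixed_arc_def test_pairs_def)
  then show "\<exists>f. proper_coloring (pattern ph k n S) (2 + of_bool (S \<noteq> {})) f" by blast
  fix q assume "\<exists>f. proper_coloring (pattern ph k n S) q f"
  then obtain f where f: "\<And>v. v < n \<Longrightarrow> f v < q" "\<And>u v. {u, v} \<in> edges (pattern ph k n S) \<Longrightarrow> f u \<noteq> f v"
    unfolding proper_coloring_def pattern_verts by (auto simp: Pi_iff)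
  have hub: "f v \<noteq> f (k + k)" if "v < k + k" for v
    using that n ph by (intro f(2)) (auto simp: pattern_edge fixed_edge_def fixed_arc_def)
  show "2 + of_bool (S \<noteq> {}) \<le> q"
  proof (cases "S = {}")
    case True
    then show ?thesis using hub[of 0] f(1)[of 0] f(1)[of "k + k"] k n by auto
  next
    case False
    then obtain p where "p \<in> S" by blast
    then obtain a b where ab: "(a, b) \<in> S" "a < k" "k \<le> b" "b < k + k"
      using S by (cases p) (auto simp: test_pairs_def)
    have "f a \<noteq> f b" using ab n by (intro f(2)) (auto simp: pattern_edge)
    then show ?thesis using False hub[of a] hub[of b] f(1)[of a] f(1)[of b] f(1)[of "k + k"] ab n by auto
  qed
qed

lemma alternating_sum_full:
  assumes "finite K" shows "(\<Sum>T\<in>Pow K. (-1) ^ card T * (of_bool (T = K) :: int)) = (-1) ^ card K"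
proof -
  have "(\<Sum>T\<in>Pow K. (-1) ^ card T * (of_bool (T = K) :: int)) = (\<Sum>T\<in>{K}. (-1) ^ card T)"
    by (rule sum.mono_neutral_cong_right) (use assms in auto)
  then show ?thesis by simp
qed

text \<open>The indicator of "all rows are hit" is itself expanded by inclusion-exclusion over the missed rows.\<close>

lemma alternating_sum_rows:
  assumes "finite C" "C \<noteq> {}"
  shows "(\<Sum>T\<in>Pow ({..<k} \<times> C). (-1) ^ card T * (of_bool (\<forall>i<k. \<exists>j\<in>C. (i, j) \<in> T) :: int)) = (-1) ^ k"
proof -
  let ?K = "{..<k} \<times> C"
  have ind: "(of_bool (\<forall>i<k. \<exists>j\<in>C. (i, j) \<in> T) :: int) =
      (\<Sum>J\<in>Pow {..<k}. (-1) ^ card J * (if T \<subseteq> - (J \<times> C) then 1 else 0))" if "T \<subseteq> ?K" for T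
  proof -
    have "(\<Sum>J\<in>Pow {..<k}. (-1) ^ card J * (if T \<subseteq> - (J \<times> C) then 1 else 0 :: int)) =
        (\<Sum>J\<in>Pow {..<k}. (-1) ^ card J * (if J \<subseteq> {i. \<forall>j\<in>C. (i, j) \<notin> T} then 1 else 0))"
      by (rule sum.cong) auto
    also have "\<dots> = (if {..<k} \<inter> {i. \<forall>j\<in>C. (i, j) \<notin> T} = {} then 1 else 0)"
      by (rule alternating_sum_subset) simp
    finally show ?thesis by auto
  qed
  have "(\<Sum>T\<in>Pow ?K. (-1) ^ card T * (of_bool (\<forall>i<k. \<exists>j\<in>C. (i, j) \<in> T) :: int)) =
      (\<Sum>T\<in>Pow ?K. \<Sum>J\<in>Pow {..<k}. (-1) ^ card J * ((-1) ^ card T * (if T \<subseteq> - (J \<times> C) then 1 else 0)))"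
    using ind by (intro sum.cong refl) (simp add: sum_distrib_left mult.left_commute)
  also have "\<dots> = (\<Sum>J\<in>Pow {..<k}. (-1) ^ card J * (\<Sum>T\<in>Pow ?K. (-1) ^ card T * (if T \<subseteq> - (J \<times> C) then 1 else 0)))"
    by (subst sum.swap) (simp add: sum_distrib_left)
  also have "\<dots> = (\<Sum>J\<in>Pow {..<k}. (-1) ^ card J * of_bool (J = {..<k}))"
  proof (rule sum.cong[OF refl])
    fix J assume J: "J \<in> Pow {..<k}"
    have "(\<Sum>T\<in>Pow ?K. (-1) ^ card T * (if T \<subseteq> - (J \<times> C) then 1 else 0 :: int)) =
        (if ?K \<inter> - (J \<times> C) = {} then 1 else 0)"
      by (rule alternating_sum_subset) (use assms in auto)
    \<comment> \<open>As \<open>C\<close> is nonempty, the rows in \<open>J\<close> cover the whole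
      rectangle only if \<open>J\<close> contains every row.\<close>
    also have "\<dots> = of_bool (J = {..<k})" using J assms(2) by auto
    finally show "(-1) ^ card J * (\<Sum>T\<in>Pow ?K. (-1) ^ card T * (if T \<subseteq> - (J \<times> C) then 1 else 0 :: int)) =
      (-1) ^ card J * of_bool (J = {..<k})" by simp
  qed
  also have "\<dots> = (-1) ^ card {..<k}" by (rule alternating_sum_full) simp
  finally show ?thesis by simp
qed

text \<open>If a pair is missing from \<open>S\<close>, deleting it changes nothing and the terms
  cancel. For complete \<open>S\<close> the parameter is a constant plus or minus an indicator of
  \<open>T\<close>: that every row is hit for the maximum degree, that \<open>T\<close> is
  everything for the other two. The constant cancels because \<open>test_pairs k\<close> is
  nonempty, and the indicator contributes a sign. The sign \<open>e\<close> does not depend on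
  \<open>S\<close>, so it is common to all selections.\<close>

theorem pattern_alternating_sum:
  assumes n: "Suc (k + k) < n" and k: "0 < k"
  obtains e :: int where "\<bar>e\<bar> = 1"
    "\<And>S. S \<subseteq> test_pairs k \<Longrightarrow>
      (\<Sum>T\<in>Pow (test_pairs k). (-1) ^ card T * int (parameter_of ph (pattern ph k n (S - T)))) =
      e * of_bool (S = test_pairs k)"
proof -
  let ?K = "test_pairs k"
  have fin: "finite ?K" by (rule finite_test_pairs)
  have ne: "?K \<noteq> {}" using k by (auto simp: test_pairs_def)
  have cst: "(\<Sum>T\<in>Pow ?K. (-1) ^ card T * (c::int)) = 0" for c using alternating_sum_const[OF fin] ne by simp
  define F where "F S = int (parameter_of ph (pattern ph k n S))" for S
  have zero: "(\<Sum>T\<in>Pow ?K. (-1) ^ card T * F (S - T)) = 0" if SK: "S \<subseteq> ?K" "S \<noteq> ?K" for S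
  proof -
    obtain e where e: "e \<in> ?K" "e \<notin> S" using SK by blast
    then have "S - insert e T = S - T" for T by blast
    then show ?thesis using alternating_sum_cancel[OF fin e(1), of "\<lambda>T. F (S - T)"] by simp
  qed
  have "\<exists>e::int. \<bar>e\<bar> = 1 \<and> (\<Sum>T\<in>Pow ?K. (-1) ^ card T * F (?K - T)) = e"
  proof -
    consider "ph = 0" | "ph = 1" | "ph \<noteq> 0" "ph \<noteq> 1" by blast
    then show ?thesis
    proof cases
      case 1
      have "F (?K - T) = int (Suc k) - of_bool (\<forall>i<k. \<exists>j\<in>{k..<k + k}. (i, j) \<in> T)" if "T \<subseteq> ?K" for T
      proof -
        have "F (?K - T) = int (k + of_bool (\<exists>i<k. \<forall>j\<in>{k..<k + k}. (i, j) \<in> ?K - T))"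
          using n k by (simp add: F_def 1 parameter_of_def max_degree_pattern)
        also have "(\<exists>i<k. \<forall>j\<in>{k..<k + k}. (i, j) \<in> ?K - T) \<longleftrightarrow> \<not> (\<forall>i<k. \<exists>j\<in>{k..<k + k}. (i, j) \<in> T)"
          by (auto simp: test_pairs_def)
        finally show ?thesis by auto
      qed
      then have "(\<Sum>T\<in>Pow ?K. (-1) ^ card T * F (?K - T)) =
          (\<Sum>T\<in>Pow ?K. (-1) ^ card T * int (Suc k)) -
          (\<Sum>T\<in>Pow ?K. (-1) ^ card T * of_bool (\<forall>i<k. \<exists>j\<in>{k..<k + k}. (i, j) \<in> T))"
        unfolding sum_subtractf[symmetric] by (intro sum.cong) (auto simp: right_diff_distrib)
      also have "\<dots> = - ((-1) ^ k)"
        using cst alternating_sum_rows[of "{k..<k + k}" k] k by (simp add: test_pairs_def)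
      finally show ?thesis by (simp add: power_abs)
    next
      case 2
      have "F (?K - T) = int (n - Suc (k + k)) + of_bool (T = ?K)" if "T \<subseteq> ?K" for T
      proof -
        have "F (?K - T) = int (n - Suc (k + k) + of_bool (?K - T = {}))"
          using n k num_components_pattern[of "?K - T" k n] by (simp add: F_def 2 parameter_of_def)
        also have "(?K - T = {}) \<longleftrightarrow> T = ?K" using that by blast
        finally show ?thesis by simp
      qed
      then have "(\<Sum>T\<in>Pow ?K. (-1) ^ card T * F (?K - T)) =
          (\<Sum>T\<in>Pow ?K. (-1) ^ card T * int (n - Suc (k + k))) + (\<Sum>T\<in>Pow ?K. (-1) ^ card T * of_bool (T = ?K))"
        unfolding sum.distrib[symmetric] by (intro sum.cong) (auto simp: distrib_left)
      then have "(\<Sum>T\<in>Pow ?K. (-1) ^ card T * F (?K - T)) = (-1) ^ card ?K"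
        by (simp add: cst alternating_sum_full[OF fin])
      then show ?thesis by (simp add: power_abs)
    next
      case 3
      have "F (?K - T) = 3 - of_bool (T = ?K)" if "T \<subseteq> ?K" for T
      proof -
        have "F (?K - T) = int (2 + of_bool (?K - T \<noteq> {}))"
          using n k chromatic_number_pattern[of "?K - T" k n ph] 3 by (simp add: F_def parameter_of_def)
        also have "(?K - T \<noteq> {}) \<longleftrightarrow> T \<noteq> ?K" using that by blast
        finally show ?thesis by simp
      qed
      then have "(\<Sum>T\<in>Pow ?K. (-1) ^ card T * F (?K - T)) =
          (\<Sum>T\<in>Pow ?K. (-1) ^ card T * 3) - (\<Sum>T\<in>Pow ?K. (-1) ^ card T * of_bool (T = ?K))"
        unfolding sum_subtractf[symmetric] by (intro sum.cong) (auto simp: right_diff_distrib)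
      then have "(\<Sum>T\<in>Pow ?K. (-1) ^ card T * F (?K - T)) = - ((-1) ^ card ?K)"
        unfolding cst alternating_sum_full[OF fin] by simp
      then show ?thesis by (simp add: power_abs)
    qed
  qed
  then obtain e :: int where "\<bar>e\<bar> = 1" "(\<Sum>T\<in>Pow ?K. (-1) ^ card T * F (?K - T)) = e" by blast
  then show thesis using that[of e] zero unfolding F_def by auto
qed

section \<open>Counting by inclusion-exclusion\<close>

definition colored_graph ::
    "nat \<Rightarrow> nat \<Rightarrow> nat set \<Rightarrow> (nat \<Rightarrow> nat) \<Rightarrow> (nat \<Rightarrow> nat \<Rightarrow> bool) \<Rightarrow> (nat \<times> nat) set \<Rightarrow> nat graph" where
  "colored_graph ph k V c M T = (V, {{u, v} | u v. u \<in> V \<and> v \<in> V \<and>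
     (fixed_edge ph k (c u) (c v) \<or> (c u, c v) \<in> test_pairs k - T \<and> M u v)})"

definition transversals :: "nat set \<Rightarrow> (nat \<Rightarrow> nat) \<Rightarrow> nat \<Rightarrow> nat set set" where
  "transversals V c n = {A. A \<subseteq> V \<and> card A = n \<and> c ` A = {..<n}}"

lemma colored_graph_simple: "finite V \<Longrightarrow> simple_graph (colored_graph ph k V c M T)"
  unfolding simple_graph_def colored_graph_def using fixed_edge_irrefl
  by (fastforce simp: test_pairs_def)

text \<open>Replacing every vertex by its colour turns a transversal into a pattern in which the cut
  pairs \<open>T\<close> appear as a set difference, the form needed for the alternating
  sum.\<close>

lemma relabel_transversal:
  assumes A: "A \<in> transversals V c n"
  shows "relabel c (induced (colored_graph ph k V c M T) A) =
    pattern ph k n ({(c u, c v) | u v. u \<in> A \<and> v \<in> A \<and> (c u, c v) \<in> test_pairs k \<and> M u v} - T)"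
proof -
  have AV: "A \<subseteq> V" and cA: "c ` A = {..<n}" using A by (auto simp: transversals_def)
  have lt: "c u < n" if "u \<in> A" for u using that cA by auto
  have ex: "\<exists>u\<in>A. c u = i" if "i < n" for i using that cA by (metis imageE lessThan_iff)
  let ?S = "{(c u, c v) | u v. u \<in> A \<and> v \<in> A \<and> (c u, c v) \<in> test_pairs k \<and> M u v}"
  have "(\<lambda>e. c ` e) ` edges (induced (colored_graph ph k V c M T) A) = edges (pattern ph k n (?S - T))"
  proof (intro equalityI subsetI)
    fix x assume "x \<in> (\<lambda>e. c ` e) ` edges (induced (colored_graph ph k V c M T) A)"
    then obtain u v where uv: "u \<in> A" "v \<in> A" "x = {c u, c v}"
      "fixed_edge ph k (c u) (c v) \<or> (c u, c v) \<in> test_pairs k - T \<and> M u v"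
      unfolding induced_def colored_graph_def by auto
    then have "fixed_edge ph k (c u) (c v) \<or> (c u, c v) \<in> ?S - T" by blast
    then show "x \<in> edges (pattern ph k n (?S - T))"
      unfolding uv(3) pattern_edge using lt uv by blast
  next
    fix x assume "x \<in> edges (pattern ph k n (?S - T))"
    then obtain i j where ij: "x = {i, j}" "i < n" "j < n" "fixed_edge ph k i j \<or> (i, j) \<in> ?S - T"
      unfolding pattern_def by auto
    have "\<exists>u v. u \<in> A \<and> v \<in> A \<and> i = c u \<and> j = c v \<and>
      (fixed_edge ph k (c u) (c v) \<or> (c u, c v) \<in> test_pairs k - T \<and> M u v)"
    proof (cases "fixed_edge ph k i j")
      case True then show ?thesis using ex[OF ij(2)] ex[OF ij(3)] by blast
    next
      case False then show ?thesis using ij(4) by blast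
    qed
    then obtain u v where uv: "u \<in> A" "v \<in> A" "i = c u" "j = c v"
      "fixed_edge ph k (c u) (c v) \<or> (c u, c v) \<in> test_pairs k - T \<and> M u v" by blast
    then have "{u, v} \<in> edges (induced (colored_graph ph k V c M T) A)"
      unfolding induced_def colored_graph_def using AV by auto
    then have "c ` {u, v} \<in> (\<lambda>e. c ` e) ` edges (induced (colored_graph ph k V c M T) A)" by (rule imageI)
    then show "x \<in> (\<lambda>e. c ` e) ` edges (induced (colored_graph ph k V c M T) A)" by (simp add: ij(1) uv(3,4))
  qed
  then show ?thesis using cA by (simp add: relabel_def induced_def pattern_def)
qed

text \<open>After the sums are exchanged, each transversal contributes the same sign if all its test
  pairs are compatible and nothing otherwise. The absolute value therefore counts without
  cancellation.\<close>

theorem colored_alternating_sum: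
  assumes n: "Suc (k + k) < n" and k: "0 < k" and V: "finite V"
  shows "\<bar>\<Sum>T\<in>Pow (test_pairs k). (-1) ^ card T *
      int (\<Sum>A\<in>transversals V c n. parameter_of ph (induced (colored_graph ph k V c M T) A))\<bar> =
    int (card {A \<in> transversals V c n. \<forall>u\<in>A. \<forall>v\<in>A. (c u, c v) \<in> test_pairs k \<longrightarrow> M u v})"
proof -
  let ?K = "test_pairs k"
  define hit where "hit A = {(c u, c v) | u v. u \<in> A \<and> v \<in> A \<and> (c u, c v) \<in> ?K \<and> M u v}" for A
  obtain e :: int where e: "\<bar>e\<bar> = 1" "\<And>S. S \<subseteq> ?K \<Longrightarrow>
      (\<Sum>T\<in>Pow ?K. (-1) ^ card T * int (parameter_of ph (pattern ph k n (S - T)))) = e * of_bool (S = ?K)"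
    using pattern_alternating_sum[OF n k] by blast
  have fin: "finite (transversals V c n)" using V by (auto simp: transversals_def)
  have par: "parameter_of ph (induced (colored_graph ph k V c M T) A) = parameter_of ph (pattern ph k n (hit A - T))"
    if A: "A \<in> transversals V c n" for A T
  proof -
    have AV: "A \<subseteq> V" and cA: "c ` A = {..<n}" "card A = n" using A by (auto simp: transversals_def)
    have "inj_on c A" using cA V AV by (intro eq_card_imp_inj_on) (auto intro: finite_subset)
    moreover have "simple_graph (induced (colored_graph ph k V c M T) A)"
      by (rule induced_simple[OF colored_graph_simple[OF V]]) (simp add: colored_graph_def AV)
    moreover have "verts (induced (colored_graph ph k V c M T) A) = A" by (simp add: induced_def)
    ultimately show ?thesis
      using parameter_of_iso_invariant[of ph] unfolding iso_invariant_def hit_def relabel_transversal[OF A, symmetric]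
      by metis
  qed
  have "(\<Sum>T\<in>Pow ?K. (-1) ^ card T *
      int (\<Sum>A\<in>transversals V c n. parameter_of ph (induced (colored_graph ph k V c M T) A))) =
    (\<Sum>T\<in>Pow ?K. \<Sum>A\<in>transversals V c n. (-1) ^ card T * int (parameter_of ph (pattern ph k n (hit A - T))))"
    by (simp add: par sum_distrib_left)
  also have "\<dots> = (\<Sum>A\<in>transversals V c n. e * of_bool (hit A = ?K))"
    by (subst sum.swap, intro sum.cong refl e(2)) (auto simp: hit_def)
  also have "\<dots> = e * int (card {A \<in> transversals V c n. hit A = ?K})"
    using fin by (simp add: sum_distrib_left[symmetric] Int_def)
  also have "{A \<in> transversals V c n. hit A = ?K} =
      {A \<in> transversals V c n. \<forall>u\<in>A. \<forall>v\<in>A. (c u, c v) \<in> ?K \<longrightarrow> M u v}"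
  proof (rule Collect_cong, rule conj_cong[OF refl])
    fix A assume A: "A \<in> transversals V c n"
    have AV: "A \<subseteq> V" and cA: "c ` A = {..<n}" "card A = n" using A by (auto simp: transversals_def)
    have inj: "inj_on c A" using cA V AV by (intro eq_card_imp_inj_on) (auto intro: finite_subset)
    show "hit A = ?K \<longleftrightarrow> (\<forall>u\<in>A. \<forall>v\<in>A. (c u, c v) \<in> ?K \<longrightarrow> M u v)"
    proof
      assume h: "hit A = ?K"
      show "\<forall>u\<in>A. \<forall>v\<in>A. (c u, c v) \<in> ?K \<longrightarrow> M u v"
      proof (intro ballI impI)
        fix u v assume uv: "u \<in> A" "v \<in> A" "(c u, c v) \<in> ?K"
        then have "(c u, c v) \<in> hit A" using h by simp
        then obtain u' v' where "u' \<in> A" "v' \<in> A" "c u = c u'" "c v = c v'" "M u' v'"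
          unfolding hit_def by blast
        then show "M u v" using uv inj by (metis inj_onD)
      qed
    next
      assume h: "\<forall>u\<in>A. \<forall>v\<in>A. (c u, c v) \<in> ?K \<longrightarrow> M u v"
      show "hit A = ?K"
      proof (intro equalityI subsetI)
        fix p assume p: "p \<in> ?K"
        then have "fst p < n" "snd p < n" using n by (auto simp: test_pairs_def)
        then obtain u v where "u \<in> A" "v \<in> A" "c u = fst p" "c v = snd p"
          using cA(1) by (metis imageE lessThan_iff)
        moreover have "p = (fst p, snd p)" by simp
        ultimately show "p \<in> hit A" unfolding hit_def using h p
          by (intro CollectI exI[of _ u] exI[of _ v]) metis
      qed (auto simp: hit_def)
    qed
  qed
  finally show ?thesis using e(1) by (simp add: abs_mult)
qed

text \<open>Inclusion-exclusion over missed colours: an \<open>n\<close>-set survives the deletion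
  of the classes in \<open>J\<close> if and only if \<open>J\<close> avoids its colours, so its
  signed contributions cancel unless it uses all \<open>n\<close> colours.\<close>

lemma uncolored_alternating_sum:
  assumes V: "finite V" "verts G = V" "c \<in> V \<rightarrow> {..<n}"
  shows "(\<Sum>J\<in>Pow {..<n}. (-1) ^ card J * int (ind_sub \<Phi> n (induced G {v \<in> V. c v \<notin> J}))) =
    int (\<Sum>A\<in>transversals V c n. \<Phi> (induced G A))"
proof -
  let ?S = "{A. A \<subseteq> V \<and> card A = n}"
  have fin: "finite ?S" using V by simp
  have 1: "int (ind_sub \<Phi> n (induced G {v \<in> V. c v \<notin> J})) =
      (\<Sum>A\<in>?S. if J \<subseteq> - (c ` A) then int (\<Phi> (induced G A)) else 0)" for J
  proof -
    have "ind_sub \<Phi> n (induced G {v \<in> V. c v \<notin> J}) =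
        (\<Sum>A | A \<subseteq> {v \<in> V. c v \<notin> J} \<and> card A = n. \<Phi> (induced G A))"
      unfolding ind_sub_def by (intro sum.cong) (auto simp: induced_def intro!: arg_cong[where f = \<Phi>])
    also have "int \<dots> = (\<Sum>A\<in>?S. if J \<subseteq> - (c ` A) then int (\<Phi> (induced G A)) else 0)"
      unfolding of_nat_sum by (rule sum.mono_neutral_cong_left) (use V in auto)
    finally show ?thesis .
  qed
  have "(\<Sum>J\<in>Pow {..<n}. (-1) ^ card J * int (ind_sub \<Phi> n (induced G {v \<in> V. c v \<notin> J}))) =
      (\<Sum>A\<in>?S. \<Sum>J\<in>Pow {..<n}. (-1) ^ card J * (if J \<subseteq> - (c ` A) then int (\<Phi> (induced G A)) else 0))"
    unfolding 1 sum_distrib_left by (rule sum.swap)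
  also have "\<dots> = (\<Sum>A\<in>?S. if {..<n} \<inter> - (c ` A) = {} then int (\<Phi> (induced G A)) else 0)"
    by (intro sum.cong refl alternating_sum_subset) simp
  also have "\<dots> = (\<Sum>A\<in>transversals V c n. int (\<Phi> (induced G A)))"
  proof (rule sum.mono_neutral_cong_right[OF fin])
    show "transversals V c n \<subseteq> ?S" by (auto simp: transversals_def)
    show "\<forall>A\<in>?S - transversals V c n. (if {..<n} \<inter> - (c ` A) = {} then int (\<Phi> (induced G A)) else 0) = 0"
    proof
      fix A assume A: "A \<in> ?S - transversals V c n"
      then have "c ` A \<noteq> {..<n}" "c ` A \<subseteq> {..<n}" using V by (auto simp: transversals_def)
      then show "(if {..<n} \<inter> - (c ` A) = {} then int (\<Phi> (induced G A)) else 0) = 0" by auto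
    qed
  qed (auto simp: transversals_def)
  finally show ?thesis by simp
qed


section \<open>Query graphs given by vertex lists\<close>

definition graph_of_list :: "('a \<Rightarrow> 'a \<Rightarrow> bool) \<Rightarrow> 'a list \<Rightarrow> nat graph" where
  "graph_of_list adj vs = ({..<length vs},
     {{u, v} | u v. u < length vs \<and> v < length vs \<and> adj (vs ! u) (vs ! v)})"

lemma graph_of_list_edge:
  assumes "\<And>p q. adj p q = adj q p"
  shows "{u, v} \<in> edges (graph_of_list adj vs) \<longleftrightarrow> u < length vs \<and> v < length vs \<and> adj (vs ! u) (vs ! v)"
  using assms by (auto simp: graph_of_list_def doubleton_eq_iff)

lemma encode_graph_of_list:
  assumes "\<And>p q. adj p q = adj q p"
  shows "encode_graph (graph_of_list adj vs) =
    length vs # concat (map (\<lambda>p. map (\<lambda>q. of_bool (adj p q)) vs) vs)"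
proof -
  let ?n = "length vs"
  have "map (\<lambda>v. if {u, v} \<in> edges (graph_of_list adj vs) then 1 else 0) [0..<?n] =
      map (\<lambda>q. of_bool (adj (vs ! u) q) :: nat) vs" if "u < ?n" for u
    using that by (intro nth_equalityI) (auto simp: graph_of_list_edge[OF assms])
  then have "map (\<lambda>u. map (\<lambda>v. if {u, v} \<in> edges (graph_of_list adj vs) then 1 else 0) [0..<?n]) [0..<?n] =
      map (\<lambda>p. map (\<lambda>q. of_bool (adj p q) :: nat) vs) vs"
    by (intro nth_equalityI) auto
  moreover have "card (verts (graph_of_list adj vs)) = ?n" by (simp add: graph_of_list_def)
  ultimately show ?thesis by (simp add: encode_graph_def Let_def)
qed

text \<open>The list \<open>js P\<close> of surviving positions is the renumbering: its
  \<open>i\<close>-th entry is the old name of the new vertex \<open>i\<close>.\<close>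

lemma graph_of_list_filter:
  fixes vs :: "'a list"
  defines "js P \<equiv> filter (\<lambda>u. P (vs ! u)) [0..<length vs]"
  shows "relabel (\<lambda>i. js P ! i) (graph_of_list adj (filter P vs)) =
      induced (graph_of_list adj vs) {u \<in> {..<length vs}. P (vs ! u)}"
    and "inj_on (\<lambda>i. js P ! i) (verts (graph_of_list adj (filter P vs)))"
proof -
  have fl: "filter P vs = map (\<lambda>u. vs ! u) (js P)"
  proof -
    have "filter P vs = filter P (map (\<lambda>u. vs ! u) [0..<length vs])" by (simp add: map_nth)
    then show ?thesis by (simp add: filter_map js_def o_def)
  qed
  let ?m = "length (js P)"
  have set_js: "set (js P) = {u \<in> {..<length vs}. P (vs ! u)}" by (auto simp: js_def)
  have dist: "distinct (js P)" by (simp add: js_def)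
  have img: "(\<lambda>i. js P ! i) ` {..<?m} = set (js P)" by (auto simp: set_conv_nth)
  have lt: "js P ! i < length vs \<and> P (vs ! (js P ! i))" if "i < ?m" for i
    using nth_mem[OF that] set_js by auto
  show "inj_on (\<lambda>i. js P ! i) (verts (graph_of_list adj (filter P vs)))"
    using dist by (auto simp: graph_of_list_def fl inj_on_def nth_eq_iff_index_eq)
  have "(\<lambda>e. (\<lambda>i. js P ! i) ` e) ` edges (graph_of_list adj (filter P vs)) =
      {e \<in> edges (graph_of_list adj vs). e \<subseteq> set (js P)}"
  proof (intro equalityI subsetI)
    fix e assume "e \<in> (\<lambda>e. (\<lambda>i. js P ! i) ` e) ` edges (graph_of_list adj (filter P vs))"
    then obtain i j where "i < ?m" "j < ?m" "adj (vs ! (js P ! i)) (vs ! (js P ! j))" "e = {js P ! i, js P ! j}"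
      unfolding graph_of_list_def fl by auto
    then show "e \<in> {e \<in> edges (graph_of_list adj vs). e \<subseteq> set (js P)}"
      using lt by (auto simp: graph_of_list_def)
  next
    fix e assume "e \<in> {e \<in> edges (graph_of_list adj vs). e \<subseteq> set (js P)}"
    then obtain u v where uv: "e = {u, v}" "adj (vs ! u) (vs ! v)" "u \<in> set (js P)" "v \<in> set (js P)"
      unfolding graph_of_list_def by auto
    then obtain i j where ij: "i < ?m" "j < ?m" "u = js P ! i" "v = js P ! j" by (auto simp: in_set_conv_nth)
    then have "{i, j} \<in> edges (graph_of_list adj (filter P vs))"
      unfolding graph_of_list_def fl snd_conv using uv(2) ij
      by (intro CollectI exI[of _ i] exI[of _ j]) simp
    then have "(\<lambda>i. js P ! i) ` {i, j} \<in> (\<lambda>e. (\<lambda>i. js P ! i) ` e) ` edges (graph_of_list adj (filter P vs))"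
      by (rule imageI)
    then show "e \<in> (\<lambda>e. (\<lambda>i. js P ! i) ` e) ` edges (graph_of_list adj (filter P vs))"
      by (simp add: uv(1) ij)
  qed
  then show "relabel (\<lambda>i. js P ! i) (graph_of_list adj (filter P vs)) =
      induced (graph_of_list adj vs) {u \<in> {..<length vs}. P (vs ! u)}"
    unfolding relabel_def induced_def set_js[symmetric] img[symmetric]
    by (simp add: graph_of_list_def fl)
qed

text \<open>
  A list \<open>Z\<close> of colour pairs describes a query: an off-diagonal entry cuts the edges between two
  colours, a diagonal entry \<open>(c, c)\<close> deletes the vertices of colour \<open>c\<close>.
\<close>

definition query_arc :: "nat \<Rightarrow> ('a \<Rightarrow> 'a \<Rightarrow> bool) \<Rightarrow> (nat \<times> nat) list \<Rightarrow> nat \<times> 'a \<Rightarrow> nat \<times> 'a \<Rightarrow> bool" where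
  "query_arc k M Z p q \<longleftrightarrow> fst p < k \<and> k \<le> fst q \<and> fst q < k + k \<and> (fst p, fst q) \<notin> set Z \<and> M (snd p) (snd q)"

definition query_adj ::
    "nat \<Rightarrow> nat \<Rightarrow> ('a \<Rightarrow> 'a \<Rightarrow> bool) \<Rightarrow> (nat \<times> nat) list \<Rightarrow> nat \<times> 'a \<Rightarrow> nat \<times> 'a \<Rightarrow> bool" where
  "query_adj ph k M Z p q \<longleftrightarrow>
     fixed_edge ph k (fst p) (fst q) \<or> query_arc k M Z p q \<or> query_arc k M Z q p"

definition query_verts :: "(nat \<times> nat) list \<Rightarrow> (nat \<times> 'a) list \<Rightarrow> (nat \<times> 'a) list" where
  "query_verts Z vl = filter (\<lambda>p. (fst p, fst p) \<notin> set Z) vl"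

definition query_graph ::
    "nat \<Rightarrow> nat \<Rightarrow> ('a \<Rightarrow> 'a \<Rightarrow> bool) \<Rightarrow> (nat \<times> 'a) list \<Rightarrow> (nat \<times> nat) list \<Rightarrow> nat graph" where
  "query_graph ph k M vl Z = graph_of_list (query_adj ph k M Z) (query_verts Z vl)"

definition cut_items :: "nat \<Rightarrow> (nat \<times> nat) list" where
  "cut_items k = List.product [0..<k] [k..<k + k]"

definition delete_items :: "nat \<Rightarrow> (nat \<times> nat) list" where
  "delete_items n = map (\<lambda>c. (c, c)) [0..<n]"

lemma query_adj_sym: "query_adj ph k M Z p q = query_adj ph k M Z q p"
  unfolding query_adj_def using fixed_edge_sym by blast

lemma graph_of_list_colored:
  "graph_of_list (query_adj ph k M Z) vl =
    colored_graph ph k {..<length vl} (\<lambda>u. fst (vl ! u)) (\<lambda>u v. M (snd (vl ! u)) (snd (vl ! v))) (set Z)"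
proof -
  let ?a = "\<lambda>u v. fixed_edge ph k (fst (vl ! u)) (fst (vl ! v))"
  let ?b = "\<lambda>u v. query_arc k M Z (vl ! u) (vl ! v)"
  have b: "?b u v \<longleftrightarrow> (fst (vl ! u), fst (vl ! v)) \<in> test_pairs k - set Z \<and> M (snd (vl ! u)) (snd (vl ! v))" for u v
    by (auto simp: query_arc_def test_pairs_def)
  have "{{u, v} | u v. u < length vl \<and> v < length vl \<and> (?a u v \<or> ?b u v \<or> ?b v u)} =
      {{u, v} | u v. u < length vl \<and> v < length vl \<and> (?a u v \<or> ?b u v)}"
  proof (intro equalityI subsetI)
    fix e assume "e \<in> {{u, v} | u v. u < length vl \<and> v < length vl \<and> (?a u v \<or> ?b u v \<or> ?b v u)}"
    then obtain u v where uv: "e = {u, v}" "u < length vl" "v < length vl" "?a u v \<or> ?b u v \<or> ?b v u" by blast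
    show "e \<in> {{u, v} | u v. u < length vl \<and> v < length vl \<and> (?a u v \<or> ?b u v)}"
    proof (cases "?a u v \<or> ?b u v")
      case False
      then have "e = {v, u}" "?b v u" using uv by auto
      then show ?thesis using uv(2,3) by blast
    qed (use uv in blast)
  qed blast
  then show ?thesis by (simp add: graph_of_list_def colored_graph_def query_adj_def b)
qed

text \<open>A program enumerates sublists rather than subsets. Distinctness makes the two
  correspond, with the sign read off the length.\<close>

lemma sum_list_subseqs:
  fixes F :: "'b set \<Rightarrow> int"
  assumes "distinct xs"
  shows "(\<Sum>Z\<leftarrow>subseqs xs. (-1) ^ length Z * F (set Z)) = (\<Sum>X\<in>Pow (set xs). (-1) ^ card X * F X)"
proof -
  have "(\<Sum>Z\<leftarrow>subseqs xs. (-1) ^ length Z * F (set Z)) = (\<Sum>Z\<leftarrow>subseqs xs. (-1) ^ card (set Z) * F (set Z))"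
    using assms by (intro arg_cong[where f = sum_list] map_cong refl)
      (metis distinct_card subseqs_distinctD)
  also have "\<dots> = sum_list (map (\<lambda>X. (-1) ^ card X * F X) (map set (subseqs xs)))" by (simp add: o_def)
  also have "\<dots> = (\<Sum>X\<in>set (map set (subseqs xs)). (-1) ^ card X * F X)"
    using distinct_set_subseqs[OF assms] by (rule sum_list_distinct_conv_sum_set)
  finally show ?thesis using subseqs_powset[of xs] by simp
qed

section \<open>Transversals as choice functions, and the value of the signed query sums\<close>

definition solutions :: "nat \<Rightarrow> nat \<Rightarrow> ('a \<Rightarrow> 'a \<Rightarrow> bool) \<Rightarrow> (nat \<times> 'a) list \<Rightarrow> (nat \<Rightarrow> 'a) set" where
  "solutions k n M vl = {f \<in> PiE {..<n} (\<lambda>c. {a. (c, a) \<in> set vl}). \<forall>i<k. \<forall>j\<in>{k..<k + k}. M (f i) (f j)}"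

text \<open>As \<open>vl\<close> is distinct, a position is the same as a pair of colour and choice.
  The transversal of \<open>f\<close> consists of the positions of the pairs \<open>(i, f i)\<close>
  with \<open>i < n\<close>.\<close>

lemma card_transversals_solutions:
  assumes vl: "distinct vl" and n: "k + k \<le> n"
  defines "c \<equiv> \<lambda>u. fst (vl ! u)"
  shows "card {A \<in> transversals {..<length vl} c n. \<forall>u\<in>A. \<forall>v\<in>A. (c u, c v) \<in> test_pairs k \<longrightarrow>
      M (snd (vl ! u)) (snd (vl ! v))} = card (solutions k n M vl)"
proof -
  let ?X = "{A \<in> transversals {..<length vl} c n. \<forall>u\<in>A. \<forall>v\<in>A. (c u, c v) \<in> test_pairs k \<longrightarrow>
      M (snd (vl ! u)) (snd (vl ! v))}"
  define h where "h f = {u \<in> {..<length vl}. c u < n \<and> f (c u) = snd (vl ! u)}" for f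
  have h: "inj_on c (h f) \<and> c ` h f = {..<n}" if f: "f \<in> PiE {..<n} (\<lambda>c. {a. (c, a) \<in> set vl})" for f
  proof
    show "inj_on c (h f)"
    proof (rule inj_onI)
      fix u v assume uv: "u \<in> h f" "v \<in> h f" "c u = c v"
      then have "vl ! u = vl ! v" by (auto simp: h_def c_def prod_eq_iff)
      then show "u = v" using uv vl by (auto simp: h_def nth_eq_iff_index_eq)
    qed
    show "c ` h f = {..<n}"
    proof (intro equalityI subsetI)
      fix i assume i: "i \<in> {..<n}"
      then have "(i, f i) \<in> set vl" using f by auto
      then obtain u where "u < length vl" "vl ! u = (i, f i)" by (metis in_set_conv_nth)
      then show "i \<in> c ` h f" using i by (intro image_eqI[of _ _ u]) (auto simp: h_def c_def)
    qed (auto simp: h_def)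
  qed
  have "bij_betw h (solutions k n M vl) ?X"
  proof (rule bij_betw_imageI)
    show "inj_on h (solutions k n M vl)"
    proof (rule inj_onI)
      fix f g assume fg: "f \<in> solutions k n M vl" "g \<in> solutions k n M vl" "h f = h g"
      show "f = g"
      proof (rule PiE_ext)
        show "f \<in> PiE {..<n} (\<lambda>c. {a. (c, a) \<in> set vl})" "g \<in> PiE {..<n} (\<lambda>c. {a. (c, a) \<in> set vl})"
          using fg by (auto simp: solutions_def)
        fix i assume i: "i \<in> {..<n}"
        have "c ` h f = {..<n}" using h fg(1) by (auto simp: solutions_def)
        then obtain u where "u \<in> h f" "c u = i" using i by (metis imageE)
        moreover from this have "u \<in> h g" using fg(3) by simp
        ultimately show "f i = g i" by (simp add: h_def)
      qed
    qed
    show "h ` solutions k n M vl = ?X"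
    proof (intro equalityI subsetI)
      fix A assume "A \<in> h ` solutions k n M vl"
      then obtain f where f: "f \<in> solutions k n M vl" "A = h f" by blast
      then have hf: "inj_on c A" "c ` A = {..<n}" using h by (auto simp: solutions_def)
      have "A \<in> transversals {..<length vl} c n"
        unfolding transversals_def using hf card_image[OF hf(1)] by (auto simp: f(2) h_def)
      moreover have "M (snd (vl ! u)) (snd (vl ! v))" if "u \<in> A" "v \<in> A" "(c u, c v) \<in> test_pairs k" for u v
      proof -
        have "f (c u) = snd (vl ! u)" "f (c v) = snd (vl ! v)" using that by (auto simp: f(2) h_def)
        moreover have "M (f (c u)) (f (c v))" using f(1) that(3) by (auto simp: solutions_def test_pairs_def)
        ultimately show ?thesis by simp
      qed
      ultimately show "A \<in> ?X" by blast
    next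
      fix A assume A: "A \<in> ?X"
      then have A1: "A \<subseteq> {..<length vl}" "card A = n" "c ` A = {..<n}" by (auto simp: transversals_def)
      have inj: "inj_on c A" using A1 by (intro eq_card_imp_inj_on) (auto intro: finite_subset)
      define f where "f = (\<lambda>i\<in>{..<n}. snd (vl ! the_inv_into A c i))"
      have fc: "f (c u) = snd (vl ! u)" if "u \<in> A" for u
        using that A1(3) inj by (auto simp: f_def the_inv_into_f_f)
      have ex: "\<exists>u\<in>A. c u = i" if "i < n" for i using that A1(3) by (metis imageE lessThan_iff)
      have "f \<in> PiE {..<n} (\<lambda>c. {a. (c, a) \<in> set vl})"
      proof
        fix i assume "i \<in> {..<n}"
        then obtain u where u: "u \<in> A" "c u = i" using ex by auto
        then have "(i, f i) = vl ! u" using fc[of u] by (auto simp: c_def)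
        then show "f i \<in> {a. (i, a) \<in> set vl}" using u A1(1) by (metis lessThan_iff mem_Collect_eq nth_mem subsetD)
      qed (auto simp: f_def)
      moreover have "M (f i) (f j)" if "i < k" "j \<in> {k..<k + k}" for i j
      proof -
        have "i < n" "j < n" using that n by auto
        then obtain u v where "u \<in> A" "c u = i" "v \<in> A" "c v = j" using ex by meson
        then show ?thesis using A fc[of u] fc[of v] that by (auto simp: test_pairs_def)
      qed
      ultimately have fs: "f \<in> solutions k n M vl" by (auto simp: solutions_def)
      have "A \<subseteq> h f" using A1 fc by (auto simp: h_def)
      moreover have "card (h f) = n" using h fs card_image[of c "h f"] by (auto simp: solutions_def)
      ultimately have "A = h f" using A1(2) by (intro card_subset_eq) (auto simp: h_def)
      then show "A \<in> h ` solutions k n M vl" using fs by blast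
    qed
  qed
  then show ?thesis by (rule bij_betw_same_card[symmetric])
qed

lemma cut_delete_items: "set (cut_items k) = test_pairs k" "distinct (cut_items k)"
  "set (delete_items n) = (\<lambda>c. (c, c)) ` {..<n}" "distinct (delete_items n)"
  "set (cut_items k) \<inter> set (delete_items n) = {}"
  by (auto simp: cut_items_def delete_items_def test_pairs_def distinct_product distinct_map inj_on_def)

text \<open>A coloured count ranges over transversals by definition, so only the cuts remain to be
  summed over.\<close>

theorem cp_query_count:
  assumes n: "Suc (k + k) < n" and k: "0 < k" and vl: "distinct vl"
  shows "\<bar>\<Sum>Z\<leftarrow>subseqs (cut_items k). (-1) ^ length Z *
      int (\<Sum>A\<in>transversals {..<length vl} (\<lambda>u. fst (vl ! u)) n.
        parameter_of ph (induced (query_graph ph k M vl Z) A))\<bar> = int (card (solutions k n M vl))"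
proof -
  let ?c = "\<lambda>u. fst (vl ! u)" and ?M = "\<lambda>u v. M (snd (vl ! u)) (snd (vl ! v))"
  have "query_verts Z vl = vl" if "Z \<in> set (subseqs (cut_items k))" for Z
  proof -
    have "set Z \<subseteq> test_pairs k" using that subseqs_powset[of "cut_items k"] cut_delete_items(1)[of k] by auto
    then show ?thesis by (auto simp: query_verts_def test_pairs_def filter_id_conv)
  qed
  then have "(\<Sum>Z\<leftarrow>subseqs (cut_items k). (-1) ^ length Z *
      int (\<Sum>A\<in>transversals {..<length vl} ?c n. parameter_of ph (induced (query_graph ph k M vl Z) A))) =
    (\<Sum>Z\<leftarrow>subseqs (cut_items k). (-1) ^ length Z *
      int (\<Sum>A\<in>transversals {..<length vl} ?c n.
        parameter_of ph (induced (colored_graph ph k {..<length vl} ?c ?M (set Z)) A)))"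
    by (intro arg_cong[where f = sum_list] map_cong refl) (simp add: query_graph_def graph_of_list_colored)
  also have "\<dots> = (\<Sum>T\<in>Pow (test_pairs k). (-1) ^ card T *
      int (\<Sum>A\<in>transversals {..<length vl} ?c n.
        parameter_of ph (induced (colored_graph ph k {..<length vl} ?c ?M T) A)))"
    using sum_list_subseqs[OF cut_delete_items(2), of "\<lambda>T. int (\<Sum>A\<in>transversals {..<length vl} ?c n.
        parameter_of ph (induced (colored_graph ph k {..<length vl} ?c ?M T) A))" k]
    unfolding cut_delete_items(1) .
  also have "\<bar>\<dots>\<bar> = int (card (solutions k n M vl))"
    using colored_alternating_sum[OF n k, where V = "{..<length vl}" and c = ?c and ph = ph and M = ?M]
      card_transversals_solutions[OF vl, of k n M] n by simp
  finally show ?thesis .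
qed

text \<open>Cuts lie off the diagonal and deletions on it, so every set of items splits uniquely
  into a part \<open>T\<close> and a part \<open>J\<close>, and the sign factors. The inner sum over
  \<open>J\<close> isolates the transversals, the outer one over \<open>T\<close> tests
  them.\<close>

theorem query_count:
  assumes n: "Suc (k + k) < n" and k: "0 < k" and vl: "distinct vl" "\<And>p. p \<in> set vl \<Longrightarrow> fst p < n"
  shows "\<bar>\<Sum>Z\<leftarrow>subseqs (cut_items k @ delete_items n). (-1) ^ length Z *
      int (ind_sub (parameter_of ph) n (query_graph ph k M vl Z))\<bar> = int (card (solutions k n M vl))"
proof -
  let ?c = "\<lambda>u. fst (vl ! u)" and ?M = "\<lambda>u v. M (snd (vl ! u)) (snd (vl ! v))" and ?V = "{..<length vl}"
  let ?G = "\<lambda>T. colored_graph ph k ?V ?c ?M T"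
  have ind: "ind_sub (parameter_of ph) n (query_graph ph k M vl Z) =
      ind_sub (parameter_of ph) n (induced (?G (set Z)) {v \<in> ?V. (?c v, ?c v) \<notin> set Z})" for Z
  proof -
    let ?P = "\<lambda>p::nat \<times> 'a. (fst p, fst p) \<notin> set Z" and ?adj = "query_adj ph k M Z"
    have s: "simple_graph (graph_of_list ?adj (filter ?P vl))"
      unfolding graph_of_list_colored by (rule colored_graph_simple) simp
    have "ind_sub (parameter_of ph) n (induced (graph_of_list ?adj vl) {u \<in> ?V. ?P (vl ! u)}) =
        ind_sub (parameter_of ph) n (graph_of_list ?adj (filter ?P vl))"
      unfolding graph_of_list_filter(1)[where vs = vl and P = ?P and adj = ?adj, symmetric]
      by (rule ind_sub_relabel[OF parameter_of_iso_invariant s graph_of_list_filter(2)])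
    then show ?thesis
      by (simp add: query_graph_def query_verts_def graph_of_list_colored[of ph k M Z vl, symmetric])
  qed
  define F where "F X = int (ind_sub (parameter_of ph) n (induced (?G X) {v \<in> ?V. (?c v, ?c v) \<notin> X}))" for X
  have "(\<Sum>Z\<leftarrow>subseqs (cut_items k @ delete_items n). (-1) ^ length Z *
      int (ind_sub (parameter_of ph) n (query_graph ph k M vl Z))) =
    (\<Sum>Z\<leftarrow>subseqs (cut_items k @ delete_items n). (-1) ^ length Z * F (set Z))"
    by (simp only: ind F_def)
  also have "\<dots> = (\<Sum>X\<in>Pow (test_pairs k \<union> set (delete_items n)). (-1) ^ card X * F X)"
    using sum_list_subseqs[of "cut_items k @ delete_items n" F] cut_delete_items[of k] cut_delete_items(4,5)[of n]
      cut_delete_items(5)[of k n] by (simp add: Int_commute)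
  also have "\<dots> = (\<Sum>(T, J)\<in>Pow (test_pairs k) \<times> Pow {..<n}. (-1) ^ card (T \<union> (\<lambda>c. (c, c)) ` J) * F (T \<union> (\<lambda>c. (c, c)) ` J))"
  proof (rule sum.reindex_bij_witness[where
        i = "\<lambda>(T, J). T \<union> (\<lambda>c. (c, c)) ` J" and j = "\<lambda>X. (X \<inter> test_pairs k, {c. (c, c) \<in> X})"])
    fix X assume X: "X \<in> Pow (test_pairs k \<union> set (delete_items n))"
    have "(c, c) \<notin> test_pairs k" for c by (auto simp: test_pairs_def)
    then show "(case (X \<inter> test_pairs k, {c. (c, c) \<in> X}) of (T, J) \<Rightarrow> T \<union> (\<lambda>c. (c, c)) ` J) = X"
      "(X \<inter> test_pairs k, {c. (c, c) \<in> X}) \<in> Pow (test_pairs k) \<times> Pow {..<n}"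
      using X by (auto simp: cut_delete_items)
    then show "(case (X \<inter> test_pairs k, {c. (c, c) \<in> X}) of (T, J) \<Rightarrow>
        (-1) ^ card (T \<union> (\<lambda>c. (c, c)) ` J) * F (T \<union> (\<lambda>c. (c, c)) ` J)) = (-1) ^ card X * F X"
      by simp
  next
    fix p assume "p \<in> Pow (test_pairs k) \<times> Pow {..<n}"
    then obtain T J where p: "p = (T, J)" "T \<subseteq> test_pairs k" "J \<subseteq> {..<n}" by auto
    have "(c, c) \<notin> T" for c using p(2) by (auto simp: test_pairs_def)
    then show "((case p of (T, J) \<Rightarrow> T \<union> (\<lambda>c. (c, c)) ` J) \<inter> test_pairs k,
        {c. (c, c) \<in> (case p of (T, J) \<Rightarrow> T \<union> (\<lambda>c. (c, c)) ` J)}) = p"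
      "(case p of (T, J) \<Rightarrow> T \<union> (\<lambda>c. (c, c)) ` J) \<in> Pow (test_pairs k \<union> set (delete_items n))"
      using p by (auto simp: test_pairs_def cut_delete_items)
  qed
  also have "\<dots> = (\<Sum>T\<in>Pow (test_pairs k). (-1) ^ card T * (\<Sum>J\<in>Pow {..<n}. (-1) ^ card J *
      int (ind_sub (parameter_of ph) n (induced (?G T) {v \<in> ?V. ?c v \<notin> J}))))"
    unfolding sum.cartesian_product[symmetric]
  proof (rule sum.cong[OF refl])
    fix T assume T: "T \<in> Pow (test_pairs k)"
    have nd: "(c, c) \<notin> T" for c using T by (auto simp: test_pairs_def)
    have fT: "finite T" using T finite_test_pairs finite_subset by auto
    show "(\<Sum>J\<in>Pow {..<n}. (-1) ^ card (T \<union> (\<lambda>c. (c, c)) ` J) * F (T \<union> (\<lambda>c. (c, c)) ` J)) =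
      (-1) ^ card T * (\<Sum>J\<in>Pow {..<n}. (-1) ^ card J *
      int (ind_sub (parameter_of ph) n (induced (?G T) {v \<in> ?V. ?c v \<notin> J})))"
      unfolding sum_distrib_left
    proof (rule sum.cong[OF refl])
      fix J assume "J \<in> Pow {..<n}"
      then have fJ: "finite J" by (auto intro: finite_subset)
      have "card (T \<union> (\<lambda>c. (c, c)) ` J) = card T + card J"
        using fT fJ nd by (subst card_Un_disjoint) (auto simp: card_image inj_on_def)
      moreover have "?G (T \<union> (\<lambda>c. (c, c)) ` J) = ?G T"
      proof -
        have "test_pairs k - (T \<union> (\<lambda>c. (c, c)) ` J) = test_pairs k - T" by (auto simp: test_pairs_def)
        then show ?thesis by (simp add: colored_graph_def)
      qed
      moreover have "(c, c) \<in> T \<union> (\<lambda>c. (c, c)) ` J \<longleftrightarrow> c \<in> J" for c using nd by auto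
      ultimately show "(-1) ^ card (T \<union> (\<lambda>c. (c, c)) ` J) * F (T \<union> (\<lambda>c. (c, c)) ` J) = (-1) ^ card T * ((-1) ^ card J *
        int (ind_sub (parameter_of ph) n (induced (?G T) {v \<in> ?V. ?c v \<notin> J})))"
        unfolding F_def by (simp add: power_add)
    qed
  qed
  also have "\<dots> = (\<Sum>T\<in>Pow (test_pairs k). (-1) ^ card T *
      int (\<Sum>A\<in>transversals ?V ?c n. parameter_of ph (induced (?G T) A)))"
    using vl(2) by (intro sum.cong refl arg_cong2[where f = "(*)"] uncolored_alternating_sum)
      (auto simp: colored_graph_def)
  also have "\<bar>\<dots>\<bar> = int (card (solutions k n M vl))"
    using colored_alternating_sum[OF n k, where V = ?V and c = ?c and ph = ph and M = ?M]
      card_transversals_solutions[OF vl(1), of k n M] n by simp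
  finally show ?thesis .
qed

section \<open>Encodings\<close>

lemma encode_graph_product:
  "encode_graph G = (let n = card (verts G) in
     n # map (\<lambda>p. of_bool ({fst p, snd p} \<in> edges G)) (List.product [0..<n] [0..<n]))"
proof -
  have "concat (map (\<lambda>u. map (\<lambda>v. if {u, v} \<in> edges G then 1 else 0 :: nat) ys) xs) =
      map (\<lambda>p. of_bool ({fst p, snd p} \<in> edges G)) (List.product xs ys)" for xs ys
    by (induction xs) (auto simp: o_def)
  then show ?thesis by (simp add: encode_graph_def Let_def)
qed

text \<open>The leading vertex count fixes the length of the matrix, so graph encodings are
  prefix-free. This makes the concatenated encodings of coloured graphs decodable.\<close>

lemma encode_graph_append_inj:
  assumes G: "input_graph G" "input_graph G'" and eq: "encode_graph G @ r = encode_graph G' @ r'"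
  shows "G = G' \<and> r = r'"
proof -
  obtain n n' where n: "verts G = {..<n}" "verts G' = {..<n'}" using G by (auto simp: input_graph_def)
  have nn: "n' = n" using eq n by (simp add: encode_graph_product Let_def)
  let ?P = "List.product [0..<n] [0..<n]"
  have "map (\<lambda>p. of_bool ({fst p, snd p} \<in> edges G)) ?P @ r =
      map (\<lambda>p. of_bool ({fst p, snd p} \<in> edges G') :: nat) ?P @ r'"
    using eq n nn by (simp add: encode_graph_product Let_def)
  then have 1: "map (\<lambda>p. of_bool ({fst p, snd p} \<in> edges G)) ?P =
      map (\<lambda>p. of_bool ({fst p, snd p} \<in> edges G') :: nat) ?P" and r: "r = r'"
    by (auto simp: append_eq_append_conv)
  have 2: "{u, v} \<in> edges G \<longleftrightarrow> {u, v} \<in> edges G'" if "u < n" "v < n" for u v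
  proof -
    have "(u, v) \<in> set ?P" using that by simp
    then have "of_bool ({u, v} \<in> edges G) = (of_bool ({u, v} \<in> edges G') :: nat)"
      using 1 unfolding map_eq_conv by (metis fst_conv snd_conv)
    then show ?thesis unfolding of_bool_eq_iff .
  qed
  have "e \<in> edges G \<longleftrightarrow> e \<in> edges G'" for e
  proof -
    have "\<exists>u v. e = {u, v} \<and> u < n \<and> v < n" if "e \<in> edges G \<or> e \<in> edges G'"
      using that G n nn unfolding input_graph_def simple_graph_def by (metis lessThan_iff)
    then show ?thesis using 2 by blast
  qed
  then show ?thesis using n nn r by (auto simp: prod_eq_iff)
qed

lemma encode_graph_inj: "input_graph G \<Longrightarrow> input_graph G' \<Longrightarrow> encode_graph G = encode_graph G' \<Longrightarrow> G = G'"
  using encode_graph_append_inj[of G G' "[]" "[]"] by simp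

text \<open>\<open>oracle_for\<close> selects an answer by a definite description; injectivity of
  the encoding makes it well defined.\<close>

lemma oracle_IndSub:
  assumes "input_graph G"
  shows "oracle_for (IndSub_problem \<Phi>) (n # encode_graph G) = ind_sub \<Phi> n G"
  unfolding oracle_for_def
proof (rule the_equality)
  show "\<exists>j\<in>instances (IndSub_problem \<Phi>). encode (IndSub_problem \<Phi>) j = n # encode_graph G \<and>
      ind_sub \<Phi> n G = answer (IndSub_problem \<Phi>) j"
    using assms by (intro bexI[of _ "(n, G)"]) (auto simp: IndSub_problem_def)
  fix y assume "\<exists>j\<in>instances (IndSub_problem \<Phi>). encode (IndSub_problem \<Phi>) j = n # encode_graph G \<and>
      y = answer (IndSub_problem \<Phi>) j"
  then obtain G' where "input_graph G'" "encode_graph G' = encode_graph G" "y = ind_sub \<Phi> n G'"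
    by (auto simp: IndSub_problem_def)
  then show "y = ind_sub \<Phi> n G" using encode_graph_inj[OF _ assms] by blast
qed

text \<open>The encoding forgets the colouring outside the vertices of \<open>G\<close>, so it does
  not determine the instance. The count, however, depends only on the colours of vertices.\<close>

lemma oracle_cpIndSub:
  assumes I: "input_colored_graph (H, G, c)"
  shows "oracle_for (cpIndSub_problem \<Phi>) (encode_colored_graph (H, G, c)) = cp_ind_sub \<Phi> H G c"
  unfolding oracle_for_def
proof (rule the_equality)
  show "\<exists>j\<in>instances (cpIndSub_problem \<Phi>). encode (cpIndSub_problem \<Phi>) j = encode_colored_graph (H, G, c) \<and>
      cp_ind_sub \<Phi> H G c = answer (cpIndSub_problem \<Phi>) j"
    using I by (intro bexI[of _ "(H, G, c)"]) (auto simp: cpIndSub_problem_def)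
  fix y assume "\<exists>j\<in>instances (cpIndSub_problem \<Phi>).
    encode (cpIndSub_problem \<Phi>) j = encode_colored_graph (H, G, c) \<and> y = answer (cpIndSub_problem \<Phi>) j"
  then obtain H' G' c' where j: "input_colored_graph (H', G', c')"
    "encode_colored_graph (H', G', c') = encode_colored_graph (H, G, c)" "y = cp_ind_sub \<Phi> H' G' c'"
    by (auto simp: cpIndSub_problem_def)
  have g: "input_graph H" "input_graph H'" "input_graph G" "input_graph G'"
    using I j(1) by (auto simp: input_colored_graph_def)
  have "encode_graph H' @ encode_graph G' @ map c' [0..<card (verts G')] =
      encode_graph H @ encode_graph G @ map c [0..<card (verts G)]"
    using j(2) by (simp only: encode_colored_graph_def prod.case)
  from encode_graph_append_inj[OF g(2,1) this]
  have e1: "H' = H" "encode_graph G' @ map c' [0..<card (verts G')] = encode_graph G @ map c [0..<card (verts G)]"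
    by blast+
  have e2: "G' = G" "map c' [0..<card (verts G')] = map c [0..<card (verts G)]"
    using encode_graph_append_inj[OF g(4,3) e1(2)] by blast+
  obtain m where "verts G = {..<m}" using g(3) unfolding input_graph_def by blast
  then have V: "verts G = {..<card (verts G)}" by simp
  have "c' u = c u" if "u \<in> verts G" for u
  proof -
    have "u < card (verts G)" using that V by (metis lessThan_iff)
    then show ?thesis using e2(2) unfolding e2(1) map_eq_conv by simp
  qed
  note cc = this
  have "colorful H G c' A \<longleftrightarrow> colorful H G c A" for A
  proof (cases "A \<subseteq> verts G")
    case True
    then have "c' ` A = c ` A" by (intro image_cong refl cc) (rule subsetD)
    then show ?thesis by (simp add: colorful_def)
  qed (simp add: colorful_def)
  then show "y = cp_ind_sub \<Phi> H G c" using j(3) e1 e2 by (simp add: cp_ind_sub_def)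
qed

section \<open>Computing the queries\<close>

text \<open>A class index with a payload: one vertex in the clique reduction, one literal for each
  clause of a group in the lower bound.\<close>

type_synonym choice = "nat \<times> nat list"

text \<open>Both copies of a class range over the same choices. Every colour from
  \<open>k + k\<close> on has a single dummy, so the total number of colours can be padded without
  changing the number of solutions.\<close>

definition color_domain :: "nat \<Rightarrow> choice list \<Rightarrow> nat \<Rightarrow> choice list" where
  "color_domain k ws c = (if c < k then filter (\<lambda>w. fst w = c) ws
     else if c < k + k then filter (\<lambda>w. fst w = c - k) ws else [(0, [])])"

definition vertex_list :: "nat \<Rightarrow> nat list \<Rightarrow> choice list \<Rightarrow> (nat \<times> choice) list" where
  "vertex_list k cs ws = concat (map (\<lambda>c. map (\<lambda>w. (c, w)) (color_domain k ws c)) cs)"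

definition matrix_code :: "nat \<Rightarrow> nat \<Rightarrow> (choice \<times> choice) list \<Rightarrow> (nat \<times> choice) list \<Rightarrow> (nat \<times> nat) list \<Rightarrow> nat list" where
  "matrix_code ph k al vs Z =
     length vs # concat (map (\<lambda>p. map (\<lambda>q. of_bool (query_adj ph k (\<lambda>a b. (a, b) \<in> set al) Z p q)) vs) vs)"

text \<open>\<open>pre\<close> carries the parameter word of an uncoloured instance and is empty
  when the parameter is fixed. The colour graph is complete, so the homomorphism condition merely
  says that adjacent vertices differ in colour.\<close>

definition query_code ::
    "bool \<Rightarrow> nat list \<Rightarrow> nat \<Rightarrow> nat \<Rightarrow> nat list \<Rightarrow> choice list \<Rightarrow> (choice \<times> choice) list \<Rightarrow> (nat \<times> nat) list \<Rightarrow> nat list" where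
  "query_code cp pre ph k cs ws al Z =
     (if cp then (length cs # concat (map (\<lambda>a. map (\<lambda>b. of_bool (a \<noteq> b)) cs) cs)) @
        matrix_code ph k al (query_verts Z (vertex_list k cs ws)) Z @ map fst (vertex_list k cs ws)
      else pre @ matrix_code ph k al (query_verts Z (vertex_list k cs ws)) Z)"

lemma ptime_eq_choice: "ptime_eq TYPE(choice)"
  by (intro ptime_eq_prod ptime_eq_list ptime_eq_nat)

lemmas cmp_member_choices = cmp_member_gen[OF ptime_eq_prod[OF ptime_eq_choice ptime_eq_choice]]

lemma ptime_query_adj:
  "ptime (\<lambda>z :: ((nat \<times> nat) \<times> (choice \<times> choice) list \<times> (nat \<times> nat) list) \<times> ((nat \<times> choice) \<times> (nat \<times> choice)).
     query_adj (fst (fst (fst z))) (snd (fst (fst z))) (\<lambda>a b. (a, b) \<in> set (fst (snd (fst z)))) (snd (snd (fst z)))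
       (fst (snd z)) (snd (snd z)))"
  unfolding query_adj_def query_arc_def fixed_edge_def fixed_arc_def
  by (intro cmp_basic cmp_member_choices)

lemma cmp_query_adj:
  assumes "cmp D B ph" "cmp D B k" "cmp D B al" "cmp D B Z" "cmp D B p" "cmp D B q"
  shows "cmp D B (\<lambda>x. query_adj (ph x) (k x) (\<lambda>a b. (a, b) \<in> set (al x)) (Z x) (p x :: nat \<times> choice) (q x))"
  using ptime_comp[OF ptime_query_adj
      cmp_pair[OF cmp_pair[OF cmp_pair[OF assms(1,2)] cmp_pair[OF assms(3,4)]] cmp_pair[OF assms(5,6)]]]
  by simp

lemma ptime_vertex_list:
  "ptime (\<lambda>z. vertex_list (fst z) (fst (snd z)) (snd (snd z)))"
  unfolding vertex_list_def color_domain_def by (intro cmp_basic)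

lemmas cmp_vertex_list = ptime_comp3[OF ptime_vertex_list]

lemma ptime_query_code:
  "ptime (\<lambda>z. query_code (fst z) (fst (snd z)) (fst (snd (snd z))) (fst (snd (snd (snd z))))
     (fst (snd (snd (snd (snd z))))) (fst (snd (snd (snd (snd (snd z))))))
     (fst (snd (snd (snd (snd (snd (snd z))))))) (snd (snd (snd (snd (snd (snd (snd z))))))))"
  unfolding query_code_def matrix_code_def query_verts_def
  by (intro cmp_basic cmp_query_adj cmp_vertex_list)

lemma cmp_query_code:
  assumes "cmp D B cp" "cmp D B pre" "cmp D B ph" "cmp D B k" "cmp D B cs" "cmp D B ws" "cmp D B al" "cmp D B Z"
  shows "cmp D B (\<lambda>x. query_code (cp x) (pre x) (ph x) (k x) (cs x) (ws x) (al x) (Z x))"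
  using ptime_comp[OF ptime_query_code cmp_pair[OF assms(1) cmp_pair[OF assms(2) cmp_pair[OF assms(3)
    cmp_pair[OF assms(4) cmp_pair[OF assms(5) cmp_pair[OF assms(6) cmp_pair[OF assms(7,8)]]]]]]]] by simp

section \<open>Correctness of the queries\<close>

definition cliques_of :: "nat \<Rightarrow> (choice \<times> choice) set \<Rightarrow> choice list \<Rightarrow> (nat \<Rightarrow> choice) set" where
  "cliques_of k R ws =
     {g \<in> PiE {..<k} (\<lambda>i. {w \<in> set ws. fst w = i}). \<forall>i<k. \<forall>j<k. (g i, g j) \<in> R}"

lemma vertex_list_mem: "(c, w) \<in> set (vertex_list k cs ws) \<longleftrightarrow> c \<in> set cs \<and> w \<in> set (color_domain k ws c)"
  by (auto simp: vertex_list_def)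

lemma vertex_list_distinct: "distinct cs \<Longrightarrow> distinct ws \<Longrightarrow> distinct (vertex_list k cs ws)"
  unfolding vertex_list_def
  by (induction cs) (auto simp: distinct_map inj_on_def color_domain_def)

text \<open>Inside a class only equal choices are compatible, so the second copy of a class repeats
  the first, and the test between the two sides becomes a test of all pairs within the first. The
  special colours offer no choice.\<close>

lemma card_solutions:
  assumes n: "k + k \<le> n"
    and diag: "\<And>a b. (a, b) \<in> R \<Longrightarrow> fst a = fst b \<Longrightarrow> a = b"
  shows "card (solutions k n (\<lambda>a b. (a, b) \<in> R) (vertex_list k [0..<n] ws)) = card (cliques_of k R ws)"
proof -
  let ?V = "vertex_list k [0..<n] ws" and ?S = "solutions k n (\<lambda>a b. (a, b) \<in> R) (vertex_list k [0..<n] ws)"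
  define h where "h f = restrict f {..<k}" for f :: "nat \<Rightarrow> choice"
  have D: "f c \<in> set (color_domain k ws c)" if "f \<in> ?S" "c < n" for f c
    using that by (auto simp: solutions_def PiE_iff vertex_list_mem)
  have twin: "f (k + i) = f i" if f: "f \<in> ?S" and i: "i < k" for f i
  proof -
    have "(f i, f (k + i)) \<in> R" using f i by (simp add: solutions_def)
    moreover have "fst (f i) = i" "fst (f (k + i)) = i"
      using D[OF f, of i] D[OF f, of "k + i"] i n by (auto simp: color_domain_def)
    ultimately show ?thesis using diag by metis
  qed
  have "bij_betw h ?S (cliques_of k R ws)"
  proof (rule bij_betw_imageI)
    show "inj_on h ?S"
    proof (rule inj_onI)
      fix f g assume fg: "f \<in> ?S" "g \<in> ?S" "h f = h g"
      have small: "f c = g c" if "c < k" for c using fg(3) that unfolding h_def by (metis lessThan_iff restrict_apply')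
      have "f c = g c" if c: "c < n" for c
      proof -
        consider "c < k" | i where "c = k + i" "i < k" | "\<not> c < k + k"
          by (metis add_less_cancel_left le_iff_add not_less)
        then show ?thesis
        proof cases
          case 2 then show ?thesis using twin[OF fg(1)] twin[OF fg(2)] small by simp
        next
          case 3 then show ?thesis using D[OF fg(1) c] D[OF fg(2) c] by (simp add: color_domain_def)
        qed (rule small)
      qed
      then show "f = g" using fg(1,2) by (auto simp: solutions_def intro: PiE_ext)
    qed
    show "h ` ?S = cliques_of k R ws"
    proof (intro equalityI subsetI)
      fix g assume "g \<in> h ` ?S"
      then obtain f where f: "f \<in> ?S" "g = h f" by blast
      have "f i \<in> {w \<in> set ws. fst w = i}" if "i < k" for i
        using D[OF f(1), of i] that n by (simp add: color_domain_def)
      moreover have "(f i, f j) \<in> R" if "i < k" "j < k" for i j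
      proof -
        have "(f i, f (k + j)) \<in> R" using f(1) that by (simp add: solutions_def)
        then show ?thesis using twin[OF f(1) that(2)] by simp
      qed
      ultimately show "g \<in> cliques_of k R ws" by (simp add: f(2) h_def cliques_of_def)
    next
      fix g assume g: "g \<in> cliques_of k R ws"
      define f where "f = (\<lambda>c\<in>{..<n}. if c < k then g c else if c < k + k then g (c - k) else (0, []))"
      have gD: "g i \<in> set ws \<and> fst (g i) = i" if "i < k" for i using g that by (auto simp: cliques_of_def PiE_iff)
      have "f \<in> ?S"
      proof -
        have "f c \<in> set (color_domain k ws c)" if "c < n" for c
          using that gD[of c] gD[of "c - k"] by (auto simp: f_def color_domain_def)
        moreover have "(f i, f j) \<in> R" if "i < k" "j \<in> {k..<k + k}" for i j
          using that g n by (auto simp: f_def cliques_of_def)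
        ultimately show ?thesis by (auto simp: solutions_def PiE_iff vertex_list_mem f_def)
      qed
      moreover have "h f = g" using g n by (auto simp: h_def f_def cliques_of_def PiE_iff fun_eq_iff extensional_def)
      ultimately show "g \<in> h ` ?S" by blast
    qed
  qed
  then show ?thesis by (rule bij_betw_same_card)
qed

definition query_items :: "bool \<Rightarrow> nat \<Rightarrow> nat \<Rightarrow> (nat \<times> nat) list" where
  "query_items cp k n = (if cp then cut_items k else cut_items k @ delete_items n)"

abbreviation the_graph :: "nat \<Rightarrow> nat \<Rightarrow> nat \<Rightarrow> choice list \<Rightarrow> (choice \<times> choice) list \<Rightarrow> (nat \<times> nat) list \<Rightarrow> nat graph" where
  "the_graph ph k n ws al Z \<equiv> query_graph ph k (\<lambda>a b. (a, b) \<in> set al) (vertex_list k [0..<n] ws) Z"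

abbreviation the_clique :: "nat \<Rightarrow> nat graph" where
  "the_clique n \<equiv> graph_of_list (\<noteq>) [0..<n]"

abbreviation the_coloring :: "nat \<Rightarrow> nat \<Rightarrow> choice list \<Rightarrow> nat \<Rightarrow> nat" where
  "the_coloring k n ws \<equiv> \<lambda>u. fst (vertex_list k [0..<n] ws ! u)"

lemma query_graph_input: "input_graph (query_graph ph k M vl Z)"
proof -
  have "simple_graph (query_graph ph k M vl Z)"
    unfolding query_graph_def graph_of_list_colored by (rule colored_graph_simple) simp
  then show ?thesis unfolding input_graph_def by (auto simp: query_graph_def graph_of_list_def)
qed

lemma the_clique_input: "input_graph (the_clique n)"
  unfolding input_graph_def simple_graph_def graph_of_list_def by force

lemma the_clique_edge: "{u, v} \<in> edges (the_clique n) \<longleftrightarrow> u < n \<and> v < n \<and> u \<noteq> v"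
  by (subst graph_of_list_edge) auto

lemma query_code_plain:
  "query_code False pre ph k [0..<n] ws al Z = pre @ encode_graph (the_graph ph k n ws al Z)"
  unfolding query_code_def matrix_code_def query_graph_def
  by (simp add: encode_graph_of_list query_adj_sym)

lemma query_verts_cut:
  assumes "Z \<in> set (subseqs (cut_items k))" shows "query_verts Z vl = vl"
proof -
  have "set Z \<subseteq> test_pairs k" using assms subseqs_powset[of "cut_items k"] cut_delete_items(1)[of k] by auto
  then show ?thesis by (auto simp: query_verts_def test_pairs_def filter_id_conv)
qed

lemma query_code_colored:
  assumes "Z \<in> set (subseqs (cut_items k))"
  shows "query_code True pre ph k [0..<n] ws al Z =
    encode_colored_graph (the_clique n, the_graph ph k n ws al Z, the_coloring k n ws)"
proof -
  let ?vl = "vertex_list k [0..<n] ws"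
  have v: "verts (the_graph ph k n ws al Z) = {..<length ?vl}"
    by (simp add: query_graph_def graph_of_list_def query_verts_cut[OF assms])
  have m: "map fst ?vl = map (the_coloring k n ws) [0..<length ?vl]"
    by (rule nth_equalityI) auto
  show ?thesis
    unfolding query_code_def matrix_code_def encode_colored_graph_def prod.case v card_lessThan m
    unfolding query_graph_def
    by (subst (1 2) encode_graph_of_list) (auto simp: query_adj_sym)
qed

lemma the_colored_input:
  assumes Z: "Z \<in> set (subseqs (cut_items k))" and n: "Suc (k + k) < n"
  shows "input_colored_graph (the_clique n, the_graph ph k n ws al Z, the_coloring k n ws)"
proof -
  let ?vl = "vertex_list k [0..<n] ws"
  have v: "query_verts Z ?vl = ?vl" by (rule query_verts_cut[OF Z])
  have c: "the_coloring k n ws u < n" if "u < length ?vl" for u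
    using vertex_list_mem[of "fst (?vl ! u)" "snd (?vl ! u)" k "[0..<n]" ws] nth_mem[OF that] by simp
  have ne: "the_coloring k n ws u \<noteq> the_coloring k n ws v"
    if "query_adj ph k (\<lambda>a b. (a, b) \<in> set al) Z (?vl ! u) (?vl ! v)" for u v
    using that fixed_edge_irrefl by (auto simp: query_adj_def query_arc_def)
  have "graph_hom (the_graph ph k n ws al Z) (the_clique n) (the_coloring k n ws)"
    unfolding graph_hom_def the_clique_edge query_graph_def v
    using c ne ne[THEN not_sym] by (auto simp: graph_of_list_def doubleton_eq_iff Pi_iff)
  then show ?thesis by (simp add: input_colored_graph_def query_graph_input the_clique_input)
qed

lemma cp_ind_sub_transversals:
  assumes "Z \<in> set (subseqs (cut_items k))"
  shows "cp_ind_sub \<Phi> (the_clique n) (the_graph ph k n ws al Z) (the_coloring k n ws) =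
    (\<Sum>A\<in>transversals {..<length (vertex_list k [0..<n] ws)} (the_coloring k n ws) n. \<Phi> (induced (the_graph ph k n ws al Z) A))"
  unfolding cp_ind_sub_def transversals_def colorful_def query_graph_def query_verts_cut[OF assms]
  by (simp add: graph_of_list_def)

text \<open>The absolute value hides the unknown common sign and avoids negative numbers.\<close>

definition signed_total :: "(nat \<times> nat) list list \<Rightarrow> nat list \<Rightarrow> nat" where
  "signed_total Zs ys = nat \<bar>\<Sum>p\<leftarrow>zip Zs ys. (-1) ^ length (fst p) * int (snd p)\<bar>"

lemma signed_total_map:
  "signed_total Zs (map F Zs) = nat \<bar>\<Sum>Z\<leftarrow>Zs. (-1) ^ length Z * int (F Z)\<bar>"
  unfolding signed_total_def zip_map2 by (simp add: zip_same_conv_map o_def)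

text \<open>\<open>orc\<close> is kept abstract: it is the oracle in the hardness reduction and a
  simulated program in the lower bound.\<close>

theorem queries_correct:
  assumes k: "0 < k" and n: "Suc (k + k) < n" and ws: "distinct ws"
    and diag: "\<And>a b. (a, b) \<in> set al \<Longrightarrow> fst a = fst b \<Longrightarrow> a = b"
    and orc: "\<And>Z. \<not> cp \<Longrightarrow> orc (pre @ encode_graph (the_graph ph k n ws al Z)) =
        ind_sub (parameter_of ph) n (the_graph ph k n ws al Z)"
      "\<And>Z. cp \<Longrightarrow> Z \<in> set (subseqs (cut_items k)) \<Longrightarrow>
        orc (encode_colored_graph (the_clique n, the_graph ph k n ws al Z, the_coloring k n ws)) =
        cp_ind_sub (parameter_of ph) (the_clique n) (the_graph ph k n ws al Z) (the_coloring k n ws)"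
  shows "signed_total (subseqs (query_items cp k n))
      (map orc (map (query_code cp pre ph k [0..<n] ws al) (subseqs (query_items cp k n)))) =
    card (cliques_of k (set al) ws)"
proof -
  let ?M = "\<lambda>a b. (a, b) \<in> set al" and ?vl = "vertex_list k [0..<n] ws"
  have vl: "distinct ?vl" "\<And>p. p \<in> set ?vl \<Longrightarrow> fst p < n"
    using vertex_list_distinct[OF _ ws, of "[0..<n]"] by (auto simp: vertex_list_mem)
  have card: "card (solutions k n ?M ?vl) = card (cliques_of k (set al) ws)"
    using n by (intro card_solutions diag) auto
  show ?thesis
  proof (cases cp)
    case True
    have "map orc (map (query_code cp pre ph k [0..<n] ws al) (subseqs (query_items cp k n))) =
      map (\<lambda>Z. \<Sum>A\<in>transversals {..<length ?vl} (\<lambda>u. fst (?vl ! u)) n.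
        parameter_of ph (induced (query_graph ph k ?M ?vl Z) A)) (subseqs (cut_items k))"
      using True orc(2) by (simp add: query_items_def query_code_colored cp_ind_sub_transversals)
    then show ?thesis
      using cp_query_count[OF n k vl(1), of ph ?M] True
      by (simp only: signed_total_map query_items_def if_True card nat_int)
  next
    case False
    have "map orc (map (query_code cp pre ph k [0..<n] ws al) (subseqs (query_items cp k n))) =
      map (\<lambda>Z. ind_sub (parameter_of ph) n (query_graph ph k ?M ?vl Z)) (subseqs (query_items cp k n))"
      using False orc(1) by (simp add: query_code_plain)
    then show ?thesis
      using query_count[OF n k vl, of ph ?M] False
      by (simp only: signed_total_map query_items_def if_False card nat_int)
  qed
qed

text \<open>Terms of even and odd sign are summed separately, and \<open>(a - b) + (b - a)\<close>
  with truncated subtraction is the absolute difference. Parity is found by toggling a bit along the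
  list, as there is no division.\<close>

lemma cmp_signed_total:
  assumes "cmp D B Zs" "cmp D B ys"
  shows "cmp D B (\<lambda>x. signed_total (Zs x) (ys x))"
proof -
  define par where "par Z = fold (\<lambda>_ b. 1 - b) Z (0::nat)" for Z :: "(nat \<times> nat) list"
  have par: "par Z = length Z mod 2" for Z
  proof -
    have "b < 2 \<Longrightarrow> fold (\<lambda>_ b. 1 - b) Z b = (length Z + b) mod 2" for b :: nat
    proof (induction Z arbitrary: b)
      case (Cons a Z)
      have "(length Z + (1 - b)) mod 2 = (length (a # Z) + b) mod 2"
        using Cons.prems by (cases "b = 0") (auto simp: less_2_cases_iff)
      then show ?case using Cons.IH[of "1 - b"] by simp
    qed simp
    from this[of 0] show ?thesis by (simp add: par_def)
  qed
  have "ptime par" unfolding par_def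
    by (rule cmp_fold[where Dg = "\<lambda>_. True" and Bg = "\<lambda>_. 0" and S = "\<lambda>_. 1"])
      (auto intro!: cmp_basic pb_const simp del: One_nat_def)
  note cpar = ptime_comp[OF this]
  define tot where "tot e z = sum_list (map (\<lambda>i. if par (nthd [] (fst z) i) = e then nthd 0 (snd z) i else 0)
    [0..<length (snd z)])" for e and z :: "(nat \<times> nat) list list \<times> nat list"
  have pt: "ptime (tot e)" for e unfolding tot_def
  proof (intro cmp_basic cmp_upt cpar)
    show "pb (\<lambda>_. True) (\<lambda>_. 0) (\<lambda>x::(nat \<times> nat) list list \<times> nat list. length (snd x))"
      using length_le_sz less_imp_le by (intro pb_mono[OF cmp_size[OF ptime_snd]]) blast
  qed
  have tot: "tot e (Zs, ys) = (\<Sum>p\<leftarrow>zip Zs ys. if length (fst p) mod 2 = e then snd p else 0)"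
    if "length ys \<le> length Zs" for e and Zs :: "(nat \<times> nat) list list" and ys
  proof -
    have "map (\<lambda>i. if par (nthd [] Zs i) = e then nthd 0 ys i else 0) [0..<length ys] =
      map (\<lambda>p. if length (fst p) mod 2 = e then snd p else 0) (zip Zs ys)"
      using that by (intro nth_equalityI) (auto simp: nthd_def par)
    then show ?thesis by (simp only: tot_def fst_conv snd_conv)
  qed
  \<comment> \<open>\<open>zip\<close> stops at the shorter list, whereas \<open>tot\<close> runs
    over all of its second list; truncation reconciles the two.\<close>
  have *: "tot e (Zs, take (length Zs) ys) = (\<Sum>p\<leftarrow>zip Zs ys. if length (fst p) mod 2 = e then snd p else 0)"
    for e and Zs :: "(nat \<times> nat) list list" and ys
  proof -
    have "zip Zs (take (length Zs) ys) = zip Zs ys" by (rule nth_equalityI) auto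
    then show ?thesis using tot[of "take (length Zs) ys" Zs e] by simp
  qed
  have st: "signed_total Zs ys = (tot 0 (Zs, take (length Zs) ys) - tot 1 (Zs, take (length Zs) ys)) +
      (tot 1 (Zs, take (length Zs) ys) - tot 0 (Zs, take (length Zs) ys))" for Zs ys
  proof -
    have "(\<Sum>p\<leftarrow>zs. (-1) ^ length (fst p) * int (snd p)) =
      int (\<Sum>p\<leftarrow>zs. if length (fst p) mod 2 = 0 then snd p else 0) -
      int (\<Sum>p\<leftarrow>zs. if length (fst p) mod 2 = 1 then snd p else 0)" for zs :: "((nat \<times> nat) list \<times> nat) list"
    proof (induction zs)
      case (Cons p zs)
      show ?case using Cons by (cases "even (length (fst p))") (auto simp: even_iff_mod_2_eq_zero odd_iff_mod_2_eq_one)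
    qed simp
    note alt = this
    have "nat \<bar>int a - int b\<bar> = (a - b) + (b - a)" for a b by auto
    then show ?thesis unfolding signed_total_def * alt .
  qed
  have tk: "take n ys = map (\<lambda>i. nthd 0 ys i) (filter (\<lambda>i. i < n) [0..<length ys])" for n and ys :: "nat list"
  proof -
    have "filter (\<lambda>i. i < n) [0..<m] = [0..<min n m]" for m by (induction m) (auto simp: min_def le_Suc_eq)
    then show ?thesis by (intro nth_equalityI) (auto simp: nthd_def)
  qed
  have ptk: "ptime (\<lambda>z :: (nat \<times> nat) list list \<times> nat list. (fst z, take (length (fst z)) (snd z)))"
    unfolding tk
  proof (intro cmp_basic cmp_upt)
    show "pb (\<lambda>_. True) (\<lambda>_. 0) (\<lambda>x::(nat \<times> nat) list list \<times> nat list. length (snd x))"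
      using length_le_sz less_imp_le by (intro pb_mono[OF cmp_size[OF ptime_snd]]) blast
  qed
  have "ptime (\<lambda>z. signed_total (fst z) (snd z))" unfolding st
    by (intro cmp_add cmp_sub ptime_comp[OF pt ptk])
  from ptime_comp2[OF this assms] show ?thesis .
qed

lemma fold_subseqs: "fold (\<lambda>x xss. map ((#) x) xss @ xss) (rev xs) [[]] = subseqs xs"
  by (induction xs) (auto simp: Let_def)

lemma sz_subseqs: "zs \<in> set (subseqs ys) \<Longrightarrow> sz zs \<le> sz ys"
proof (induction ys arbitrary: zs)
  case (Cons a ys)
  from Cons.prems consider "zs \<in> set (subseqs ys)" | zs' where "zs' \<in> set (subseqs ys)" "zs = a # zs'"
    by (auto simp: Let_def)
  then show ?case
  proof cases
    case 1 then show ?thesis using Cons.IH[of zs] by simp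
  next
    case 2 then show ?thesis using Cons.IH[of zs'] by simp
  qed
qed simp

text \<open>The output is exponential in the length of the list, so \<open>2 ^ length (f x)\<close>
  has to be covered by the bound. In the clique reduction it is bounded in terms of the
  parameter.\<close>

lemma cmp_subseqs:
  assumes f: "cmp D B f" and b: "pb D B (\<lambda>x. 2 ^ length (f x))"
  shows "cmp D B (\<lambda>x. subseqs (f x))"
proof -
  have "cmp D B (\<lambda>x. fold (\<lambda>y xss. map ((#) y) xss @ xss) (rev (f x)) [[]])"
  proof (rule cmp_fold[where Dg = "\<lambda>_. True" and Bg = "\<lambda>_. 0" and S = "\<lambda>x. 2 ^ length (f x) * (sz (f x) + 1) + 1"])
    show "pb D B (\<lambda>x. 2 ^ length (f x) * (sz (f x) + 1) + 1)" by (intro pb_intros b cmp_size[OF f])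
    show "ptime (\<lambda>z. map ((#) (fst (snd z))) (snd (snd z)) @ snd (snd z))" by (intro cmp_basic)
    fix x i assume i: "i \<le> length (rev (f x))"
    let ?ys = "rev (take i (rev (f x)))"
    have suf: "?ys = drop (length (f x) - i) (f x)" by (simp add: take_rev)
    have "sz (subseqs ?ys) \<le> length (subseqs ?ys) * (sz (f x) + 1) + 1"
      by (rule sz_list_le) (simp only: suf, rule order.trans[OF sz_subseqs sz_drop])
    also have "\<dots> \<le> 2 ^ length (f x) * (sz (f x) + 1) + 1"
      by (intro add_mono mult_mono) (auto simp: length_subseqs suf)
    finally show "sz (fold (\<lambda>y xss. map ((#) y) xss @ xss) (take i (rev (f x))) [[]]) \<le>
        2 ^ length (f x) * (sz (f x) + 1) + 1"
      using fold_subseqs[of ?ys] by simp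
  qed (auto intro!: cmp_rev f cmp_const)
  then show ?thesis by (simp only: fold_subseqs)
qed

lemma cmp_product: "cmp D B f \<Longrightarrow> cmp D B g \<Longrightarrow> cmp D B (\<lambda>x. List.product (f x) (g x))"
proof -
  have "ptime (\<lambda>z. List.product (fst z) (snd z))"
    unfolding product_concat_map by (intro cmp_basic)
  then show "cmp D B f \<Longrightarrow> cmp D B g \<Longrightarrow> cmp D B (\<lambda>x. List.product (f x) (g x))" by (rule ptime_comp2)
qed

section \<open>Asking a list of queries\<close>

text \<open>Answers are accumulated at the front and hence come out in reverse order; the final
  evaluation turns them round again.\<close>

definition ask_all :: prog where
  "ask_all = PSeq (PPair PId (PConst 0))
     (PSeq (PWhile (PPair (PSeq PFst PSnd) (PPair (PSeq PFst (PSeq PFst PAsk)) PSnd))) PSnd)"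

lemma ask_all_loop:
  "set qs \<subseteq> Q \<Longrightarrow> \<exists>t. t \<le> 100 * sz qs \<and>
    evals orc Q (PWhile (PPair (PSeq PFst PSnd) (PPair (PSeq PFst (PSeq PFst PAsk)) PSnd)))
      (Cell (enc qs) (enc acc)) (Cell (Atom 0) (enc (rev (map orc qs) @ acc))) t"
proof (induction qs arbitrary: acc)
  case Nil
  then show ?case using evals.WhileZ[of "Atom 0"] by (intro exI[of _ 2]) auto
next
  case (Cons q qs)
  let ?b = "PPair (PSeq PFst PSnd) (PPair (PSeq PFst (PSeq PFst PAsk)) PSnd)"
  obtain t where t: "t \<le> 100 * sz qs" "evals orc Q (PWhile ?b) (Cell (enc qs) (enc (orc q # acc)))
      (Cell (Atom 0) (enc (rev (map orc qs) @ orc q # acc))) t"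
    using Cons.IH[of "orc q # acc"] Cons.prems by auto
  have ask: "evals orc Q PAsk (enc q) (enc (orc q)) (6 * length q + 2)"
    using evals.Ask[of q Q orc] Cons.prems by (simp add: enc_nats enc_nat_def)
  have "evals orc Q ?b (Cell (enc (q # qs)) (enc acc)) (Cell (enc qs) (enc (orc q # acc)))
      ((1 + 2) + ((1 + (1 + (6 * length q + 2))) + 2 + 22) + 22)"
    unfolding enc_list.simps
    by (rule evals.Pair[OF evals.Seq[OF evals.Fst evals.Snd]
      evals.Pair[OF evals.Seq[OF evals.Fst evals.Seq[OF evals.Fst ask]] evals.Snd]])
  then have "evals orc Q (PWhile ?b) (Cell (enc (q # qs)) (enc acc)) (Cell (Atom 0) (enc (rev (map orc qs) @ orc q # acc)))
      (((1 + 2) + ((1 + (1 + (6 * length q + 2))) + 2 + 22) + 22) + t + 3)"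
    by (intro evals.WhileN[OF _ _ t(2)]) auto
  moreover have "((1 + 2) + ((1 + (1 + (6 * length q + 2))) + 2 + 22) + 22) + t + 3 \<le> 100 * sz (q # qs)"
    using t(1) length_le_sz[of q] by simp
  ultimately show ?case by (intro exI conjI) auto
qed

lemma ask_all:
  assumes "set qs \<subseteq> Q"
  shows "\<exists>t. t \<le> 100 * sz qs + 25 \<and> evals orc Q ask_all (enc qs) (enc (rev (map orc qs))) t"
proof -
  obtain t where t: "t \<le> 100 * sz qs"
    "evals orc Q (PWhile (PPair (PSeq PFst PSnd) (PPair (PSeq PFst (PSeq PFst PAsk)) PSnd)))
      (Cell (enc qs) (enc [])) (Cell (Atom 0) (enc (rev (map orc qs)))) t"
    using ask_all_loop[OF assms, of orc "[]"] by auto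
  have "evals orc Q ask_all (enc qs) (enc (rev (map orc qs))) ((0 + 1 + 22) + (t + 2))"
    unfolding ask_all_def
    by (rule evals.Seq[OF evals.Pair[OF evals.Id evals.Const] evals.Seq[OF t(2)[unfolded enc_list.simps(1)] evals.Snd]])
  then show ?thesis using t(1) by (intro exI conjI) auto
qed

lemma computableI:
  assumes "cmp (\<lambda>x. \<exists>k. x = [k]) B h" shows "computable (\<lambda>k. h [k])"
proof -
  obtain p T where p: "\<And>x. \<exists>k. x = [k] \<Longrightarrow> runs p (enc x) (enc (h x)) (T x)"
    using assms by (rule cmpE) blast
  have "outputs no_oracle (machine p) [n] (h [n])" for n
  proof -
    obtain t where "evals no_oracle {} p (enc [n]) (enc (h [n])) t" using p[of "[n]"] by (auto simp: runs_def)
    then show ?thesis using machine_correct(1)[of no_oracle "{}" p "[n]" "h [n]" t]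
      by (simp add: enc_nats enc_nat_def)
  qed
  then show ?thesis unfolding computable_def by blast
qed

text \<open>A reduction must exhibit a computable bound in the parameter. Repeated doubling yields
  the power of two: numbers have unit size, so only the number of rounds must be polynomially
  bounded.\<close>

lemma computable_exponential: "computable (\<lambda>k. 2 ^ (((k + 2) * (k + 2) + a) * c + b))"
proof -
  let ?D = "\<lambda>x::nat list. \<exists>k. x = [k]"
  define E where "E x = ((nthd 0 x 0 + 2) * (nthd 0 x 0 + 2) + a) * c + b" for x :: "nat list"
  have k: "cmp ?D (\<lambda>x. nthd 0 x 0) (\<lambda>x. nthd 0 x 0 + 2)" by (intro cmp_basic)
  have E: "cmp ?D (\<lambda>x. nthd 0 x 0) E" "pb ?D (\<lambda>x. nthd 0 x 0) E"
    unfolding E_def by (intro cmp_basic cmp_mult k pb_intros)+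
  have "cmp ?D (\<lambda>x. nthd 0 x 0) (\<lambda>x. fold (\<lambda>_ m. m + m) [0..<E x] (1::nat))"
    by (rule cmp_fold[where Dg = "\<lambda>_. True" and Bg = "\<lambda>_. 0" and S = "\<lambda>_. 1"])
      (auto intro!: cmp_upt E cmp_basic pb_const simp del: One_nat_def)
  from computableI[OF this]
  have "computable (\<lambda>k. fold (\<lambda>_ m. m + m) [0..<E [k]] (1::nat))" .
  moreover have "fold (\<lambda>_ m. m + m) xs m = m * 2 ^ length xs" for xs :: "nat list" and m :: nat
    by (induction xs arbitrary: m) auto
  ultimately show ?thesis by (simp add: E_def nthd_def)
qed

lemma computable_double: "computable (\<lambda>k. k + k + 2)"
proof -
  have "cmp (\<lambda>x. \<exists>k. x = [k]) (\<lambda>_. 0) (\<lambda>x. nthd 0 x 0 + nthd 0 x 0 + 2 :: nat)" by (intro cmp_basic)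
  from computableI[OF this] show ?thesis by (simp add: nthd_def)
qed

lemma sz_nats: "sz (xs :: nat list) = 2 * length xs + 1"
  by (induction xs) auto

text \<open>A non-adaptive reduction: compute all queries, ask them, combine the answers. As
  \<open>B\<close> is bounded in terms of the parameter alone, a bound polynomial in the size and in
  \<open>B\<close> splits into a function of the parameter times a power of the input
  length.\<close>

lemma fpt_reduction:
  fixes Q :: "'j counting_problem" and fin :: "nat list \<times> nat list \<Rightarrow> nat"
  assumes qs: "cmp D B qs" and fin: "cmp (\<lambda>z. D (fst z)) (\<lambda>z. B (fst z)) fin"
    and D: "\<And>k G. input_graph G \<Longrightarrow> D (k # encode_graph G)"
    and B: "\<And>k G. input_graph G \<Longrightarrow> B (k # encode_graph G) \<le> 2 ^ ((k + 2) * (k + 2))"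
    and ok: "\<And>k G q. input_graph G \<Longrightarrow> q \<in> set (qs (k # encode_graph G)) \<Longrightarrow>
      \<exists>j\<in>instances Q. encode Q j = q \<and> parameter Q j \<le> k + k + 2"
    and ans: "\<And>k G. input_graph G \<Longrightarrow>
      fin (k # encode_graph G, rev (map (oracle_for Q) (qs (k # encode_graph G)))) = num_cliques k G"
  shows "sharp_W1_hard Q"
proof -
  let ?orc = "oracle_for Q"
  obtain p T where p: "pb D B T" "pb D B (\<lambda>x. sz (qs x))" "\<And>x. D x \<Longrightarrow> runs p (enc x) (enc (qs x)) (T x)"
    using qs by (rule cmpE) blast
  obtain p' T' where p': "pb (\<lambda>z. D (fst z)) (\<lambda>z. B (fst z)) T'"
    "\<And>z. D (fst z) \<Longrightarrow> runs p' (enc z) (enc (fin z)) (T' z)" using fin by (rule cmpE) blast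
  define pair where "pair x = (x, rev (map ?orc (qs x)))" for x
  have szp: "sz (pair x) \<le> sz x + 2 * sz (qs x) + 2" for x
    using length_le_sz[of "qs x"] by (simp add: pair_def sz_nats)
  have T2: "pb D B (\<lambda>x. T' (pair x))"
  proof (rule pb_comp[OF p'(1)])
    show "pb D B (\<lambda>x. sz (pair x))"
      by (rule pb_mono[OF _ szp]) (intro pb_intros p(2))
  qed (auto simp: pair_def intro: pb_B)
  define W where "W x = (0 + (T x + (100 * sz (qs x) + 25)) + 22) + T' (pair x)" for x
  have "pb D B W" unfolding W_def by (intro pb_intros p T2)
  then obtain c where c: "\<And>x. D x \<Longrightarrow> W x \<le> (sz x + B x + 2) ^ c" unfolding pb_def by blast
  let ?P = "PSeq (PPair PId (PSeq p ask_all)) p'"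
  have run: "\<exists>t\<le>W x. evals ?orc (set (qs x)) ?P (enc x) (enc (fin (pair x))) t" if x: "D x" for x
  proof -
    obtain t1 where t1: "t1 \<le> T x" "evals ?orc (set (qs x)) p (enc x) (enc (qs x)) t1"
      using p(3)[OF x] evals_empty_change_oracle evals_mono unfolding runs_def by (metis empty_subsetI)
    obtain t2 where t2: "t2 \<le> 100 * sz (qs x) + 25"
      "evals ?orc (set (qs x)) ask_all (enc (qs x)) (enc (rev (map ?orc (qs x)))) t2"
      using ask_all[of "qs x" "set (qs x)" ?orc] by blast
    have "D (fst (pair x))" using x by (simp add: pair_def)
    then obtain t3 where t3: "t3 \<le> T' (pair x)" "evals ?orc (set (qs x)) p' (enc (pair x)) (enc (fin (pair x))) t3"
      using p'(2) evals_empty_change_oracle evals_mono unfolding runs_def by (metis empty_subsetI)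
    have "evals ?orc (set (qs x)) ?P (enc x) (enc (fin (pair x))) ((0 + (t1 + t2) + 22) + t3)"
      by (rule evals.Seq[OF _ t3(2)], simp only: pair_def enc_Pair)
        (rule evals.Pair[OF evals.Id evals.Seq[OF t1(2) t2(2)]])
    then show ?thesis using t1 t2 t3 unfolding W_def by (intro exI conjI) auto
  qed
  have main: "outputs ?orc (machine ?P) (encode Clique_problem i) (answer Clique_problem i) \<and>
      run_time ?orc (machine ?P) (encode Clique_problem i) \<le>
        2 ^ (((parameter Clique_problem i + 2) * (parameter Clique_problem i + 2) + 3) * c + 4) *
          length (encode Clique_problem i) ^ Suc c \<and>
      (\<forall>q\<in>queries ?orc (machine ?P) (encode Clique_problem i).
        \<exists>j\<in>instances Q. encode Q j = q \<and> parameter Q j \<le> parameter Clique_problem i + parameter Clique_problem i + 2)"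
    if i: "i \<in> instances Clique_problem" for i
  proof -
    obtain k G where kG: "i = (k, G)" "input_graph G" using i by (auto simp: Clique_problem_def)
    let ?x = "k # encode_graph G"
    have e: "encode Clique_problem i = ?x" "answer Clique_problem i = num_cliques k G" "parameter Clique_problem i = k"
      by (auto simp: Clique_problem_def kG)
    note Dx = D[OF kG(2), of k]
    obtain t where t: "t \<le> W ?x" "evals ?orc (set (qs ?x)) ?P (enc ?x) (enc (fin (pair ?x))) t"
      using run[OF Dx] by blast
    have "fin (pair ?x) = num_cliques k G" using ans[OF kG(2)] by (simp add: pair_def)
    then have ev: "evals ?orc (set (qs ?x)) ?P (val_of_nats ?x) (Atom (num_cliques k G)) t"
      using t(2) by (simp only: enc_nats enc_nat_def)
    note mc = machine_correct[OF ev]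
    let ?l = "length ?x" and ?m = "(k + 2) * (k + 2)"
    have l: "1 \<le> ?l" by simp
    have "sz ?x + B ?x + 2 \<le> 2 * ?l + 3 + 2 ^ ?m" using B[OF kG(2), of k] unfolding sz_nats by linarith
    also have "\<dots> \<le> ?l * (5 + 2 ^ ?m)"
    proof -
      have "1 * 2 ^ ?m \<le> ?l * 2 ^ ?m" using l by (intro mult_right_mono) auto
      then show ?thesis using l unfolding distrib_left by linarith
    qed
    also have "\<dots> \<le> ?l * 2 ^ (?m + 3)"
    proof -
      have "(1::nat) \<le> 2 ^ ?m" by simp
      moreover have "5 + a \<le> a * 2 ^ 3" if "1 \<le> a" for a :: nat using that by simp
      ultimately have "5 + 2 ^ ?m \<le> (2::nat) ^ (?m + 3)" unfolding power_add by blast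
      then show ?thesis by (rule mult_left_mono) simp
    qed
    finally have "(sz ?x + B ?x + 2) ^ c \<le> (?l * 2 ^ (?m + 3)) ^ c" by (rule power_mono) simp
    from order.trans[OF t(1) order.trans[OF c[OF Dx] this]]
    have W: "t \<le> ?l ^ c * 2 ^ ((?m + 3) * c)" by (simp only: power_mult_distrib power_mult)
    have one: "1 \<le> ?l ^ c" "(1::nat) \<le> 2 ^ ((?m + 3) * c)" by simp_all
    let ?N = "?l ^ c * 2 ^ ((?m + 3) * c)"
    have N: "1 \<le> ?N" using mult_le_mono[OF one] by (simp only: mult_1)
    have "9 * ?l + 4 + t \<le> 13 * (?l * ?N) + ?l * ?N"
    proof -
      have "?l * 1 \<le> ?l * ?N" using N by (intro mult_left_mono) auto
      moreover have "1 * ?N \<le> ?l * ?N" using l by (intro mult_right_mono) auto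
      ultimately show ?thesis using W l by linarith
    qed
    \<comment> \<open>The factor 14 is rounded up to a power of two to fit the shape of the
      computable bound.\<close>
    also have "\<dots> \<le> 2 ^ 4 * (?l * ?N)" by simp
    also have "\<dots> = 2 ^ ((?m + 3) * c + 4) * ?l ^ Suc c" by (simp only: power_add power_Suc mult_ac)
    finally have "run_time ?orc (machine ?P) ?x \<le> 2 ^ ((?m + 3) * c + 4) * ?l ^ Suc c" unfolding mc(2) .
    moreover have "\<exists>j\<in>instances Q. encode Q j = q \<and> parameter Q j \<le> k + k + 2"
      if "q \<in> queries ?orc (machine ?P) ?x" for q
      using ok[OF kG(2)] mc(3) that by blast
    ultimately show ?thesis unfolding e using mc(1) by blast
  qed
  show ?thesis
    unfolding sharp_W1_hard_def fpt_turing_reducible_def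
    by (rule exI[of _ "machine ?P"], rule exI[of _ "\<lambda>k. 2 ^ (((k + 2) * (k + 2) + 3) * c + 4)"],
        rule exI[of _ "\<lambda>k. k + k + 2"], rule exI[of _ "Suc c"])
      (use main computable_exponential computable_double in blast)
qed

section \<open>Hardness for \<open>#W[1]\<close>\<close>

definition clique_values :: "nat list \<Rightarrow> nat list \<Rightarrow> choice list" where
  "clique_values ks ns = concat (map (\<lambda>i. map (\<lambda>v. (i, [v])) ns) ks)"

text \<open>The input consists of \<open>k\<close>, the number of vertices and the matrix row by
  row, hence the offset 2.\<close>

definition edge_list :: "nat list \<Rightarrow> nat list \<Rightarrow> (nat \<times> nat) list" where
  "edge_list ns x = map (\<lambda>i. nthd (0, 0) (List.product ns ns) i)
     (filter (\<lambda>i. nthd 0 x (i + 2) = 1) [0..<length (List.product ns ns)])"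

text \<open>Vertices must increase with the class index, so each clique is represented by one choice
  function rather than by all its orderings.\<close>

definition before :: "(nat \<times> nat) list \<Rightarrow> choice \<Rightarrow> choice \<Rightarrow> bool" where
  "before es a b \<longleftrightarrow> fst a < fst b \<and> nthd 0 (snd a) 0 < nthd 0 (snd b) 0 \<and>
     (nthd 0 (snd a) 0, nthd 0 (snd b) 0) \<in> set es"

definition clique_pairs :: "(nat \<times> nat) list \<Rightarrow> choice list \<Rightarrow> (choice \<times> choice) list" where
  "clique_pairs es ws = filter (\<lambda>p. fst p = snd p \<or> before es (fst p) (snd p) \<or> before es (snd p) (fst p))
     (List.product ws ws)"

text \<open>The ranges are passed as lists rather than numbers: the cost is then polynomial in the
  size of the arguments, without a bound on numerical values.\<close>

definition items_code :: "bool \<Rightarrow> nat list \<Rightarrow> nat list \<Rightarrow> (nat \<times> nat) list" where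
  "items_code cp ks cs = (if cp then List.product ks (map (\<lambda>i. length ks + i) ks)
     else List.product ks (map (\<lambda>i. length ks + i) ks) @ map (\<lambda>c. (c, c)) cs)"

lemma items_code: "items_code cp [0..<k] [0..<n] = query_items cp k n"
proof -
  have "map (\<lambda>i. k + i) [0..<k] = [k..<k + k]" by (rule nth_equalityI) auto
  then show ?thesis by (simp add: items_code_def query_items_def cut_items_def delete_items_def)
qed

lemma edge_list:
  assumes "input_graph G" "verts G = {..<n}"
  shows "set (edge_list [0..<n] (k # encode_graph G)) = {(u, v). u < n \<and> v < n \<and> {u, v} \<in> edges G}"
proof -
  let ?P = "List.product [0..<n] [0..<n]"
  have enc: "encode_graph G = n # map (\<lambda>p. of_bool ({fst p, snd p} \<in> edges G)) ?P"
    using assms by (simp add: encode_graph_product Let_def)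
  have x: "nthd 0 (k # encode_graph G) (i + 2) = of_bool ({fst (?P ! i), snd (?P ! i)} \<in> edges G)" if "i < length ?P" for i
    using that by (simp add: enc nthd_def nth_append)
  have "set (edge_list [0..<n] (k # encode_graph G)) =
      (\<lambda>i. ?P ! i) ` {i. i < length ?P \<and> {fst (?P ! i), snd (?P ! i)} \<in> edges G}"
  proof -
    have "filter (\<lambda>i. nthd 0 (k # encode_graph G) (i + 2) = 1) [0..<length ?P] =
        filter (\<lambda>i. {fst (?P ! i), snd (?P ! i)} \<in> edges G) [0..<length ?P]"
      by (rule filter_cong[OF refl]) (use x in \<open>simp only: set_upt atLeastLessThan_iff of_bool_eq_1_iff\<close>)
    then show ?thesis unfolding edge_list_def by (auto simp: nthd_def)
  qed
  also have "\<dots> = {p \<in> set ?P. {fst p, snd p} \<in> edges G}"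
  proof -
    have "(\<lambda>i. xs ! i) ` {i. i < length xs \<and> R (xs ! i)} = {p \<in> set xs. R p}"
      for xs :: "(nat \<times> nat) list" and R
      by (force simp: in_set_conv_nth)
    from this[of ?P "\<lambda>p. {fst p, snd p} \<in> edges G"] show ?thesis .
  qed
  also have "\<dots> = {(u, v). u < n \<and> v < n \<and> {u, v} \<in> edges G}" by (auto simp only: set_product set_upt) auto
  finally show ?thesis .
qed

lemma clique_values: "set (clique_values [0..<k] [0..<n]) = {(i, [v]) | i v. i < k \<and> v < n}"
  "distinct (clique_values [0..<k] [0..<n])"
proof -
  show "distinct (clique_values [0..<k] [0..<n])"
    unfolding clique_values_def by (induction k) (auto simp: distinct_map inj_on_def)
qed (auto simp: clique_values_def)

text \<open>The choice function of a clique is its increasing enumeration. Sorting the vertex set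
  recovers it, which makes the map to vertex sets injective.\<close>

lemma card_cliques_of_graph:
  fixes k :: nat
  assumes G: "input_graph G" "verts G = {..<n}"
  defines "es \<equiv> edge_list [0..<n] (k # encode_graph G)" and "ws \<equiv> clique_values [0..<k] [0..<n]"
  shows "card (cliques_of k (set (clique_pairs es ws)) ws) = num_cliques k G"
proof -
  have es: "(u, v) \<in> set es \<longleftrightarrow> u < n \<and> v < n \<and> {u, v} \<in> edges G" for u v
    using edge_list[OF G, of k] unfolding es_def by auto
  define h where "h g i = nthd 0 (snd (g i)) 0" for g :: "nat \<Rightarrow> choice" and i
  let ?C = "cliques_of k (set (clique_pairs es ws)) ws"
  let ?N = "{A. A \<subseteq> verts G \<and> card A = k \<and> (\<forall>u\<in>A. \<forall>v\<in>A. u \<noteq> v \<longrightarrow> {u, v} \<in> edges G)}"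
  have pr: "(a, b) \<in> set (clique_pairs es ws) \<longleftrightarrow>
      a \<in> set ws \<and> b \<in> set ws \<and> (a = b \<or> before es a b \<or> before es b a)" for a b
    by (auto simp: clique_pairs_def)
  have C: "g \<in> ?C \<longleftrightarrow> g \<in> extensional {..<k} \<and> (\<forall>i<k. g i = (i, [h g i]) \<and> h g i < n) \<and>
      (\<forall>i j. i < j \<and> j < k \<longrightarrow> h g i < h g j \<and> {h g i, h g j} \<in> edges G)" (is "_ \<longleftrightarrow> ?R g") for g
  proof
    assume g: "g \<in> ?C"
    have 1: "g i = (i, [h g i]) \<and> h g i < n" if "i < k" for i
    proof -
      have "g i \<in> set ws" "fst (g i) = i" using g that by (auto simp: cliques_of_def PiE_iff)
      then show ?thesis by (auto simp: ws_def clique_values h_def nthd_def)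
    qed
    have 2: "h g i < h g j \<and> {h g i, h g j} \<in> edges G" if "i < j" "j < k" for i j
    proof -
      have f: "fst (g i) = i" "fst (g j) = j" using 1[of i] 1[of j] that by (metis fst_conv less_trans)+
      have "(g i, g j) \<in> set (clique_pairs es ws)" using g that by (auto simp: cliques_of_def)
      then have "before es (g i) (g j)" using f that unfolding pr by (auto simp: before_def)
      then show ?thesis by (auto simp: before_def es h_def)
    qed
    show "?R g" using 1 2 g by (auto simp: cliques_of_def PiE_iff)
  next
    assume R: "?R g"
    have w: "g i \<in> set ws \<and> fst (g i) = i" if "i < k" for i
    proof -
      have "g i = (i, [h g i])" "h g i < n" using R that by blast+
      then show ?thesis using that unfolding ws_def clique_values by (metis (mono_tags, lifting) fst_conv mem_Collect_eq)
    qed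
    have b: "before es (g i) (g j)" if "i < j" "j < k" for i j
    proof -
      have "h g i < h g j" "{h g i, h g j} \<in> edges G" "h g i < n" "h g j < n"
        using R that by (meson less_trans)+
      moreover have "fst (g i) = i" "fst (g j) = j" using w that by (meson less_trans)+
      ultimately show ?thesis using that by (simp add: before_def es h_def)
    qed
    have "(g i, g j) \<in> set (clique_pairs es ws)" if "i < k" "j < k" for i j
      unfolding pr using w[OF that(1)] w[OF that(2)] b[of i j] b[of j i] that by (metis linorder_neqE_nat)
    then show "g \<in> ?C" using R w by (auto simp: cliques_of_def PiE_iff)
  qed
  have sorted: "sorted_list_of_set (h g ` {..<k}) = map (h g) [0..<k] \<and> inj_on (h g) {..<k}" if "g \<in> ?C" for g
  proof -
    have mono: "h g i < h g j" if "i < j" "j < k" for i j using C[of g] \<open>g \<in> ?C\<close> that by blast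
    have inj: "inj_on (h g) {..<k}"
      by (rule inj_onI) (metis lessThan_iff linorder_neqE_nat mono less_irrefl)
    have "sorted (map (h g) [0..<k])"
      using mono by (auto simp: sorted_iff_nth_mono_less intro: less_imp_le)
    moreover have "distinct (map (h g) [0..<k])" using inj by (simp add: distinct_map atLeast0LessThan)
    ultimately show ?thesis using inj
      by (intro conjI sorted_distinct_set_unique) (auto simp: atLeast0LessThan)
  qed
  have "bij_betw (\<lambda>g. h g ` {..<k}) ?C ?N"
  proof (rule bij_betw_imageI)
    show "inj_on (\<lambda>g. h g ` {..<k}) ?C"
    proof (rule inj_onI)
      fix f g assume fg: "f \<in> ?C" "g \<in> ?C" "h f ` {..<k} = h g ` {..<k}"
      have "map (h f) [0..<k] = map (h g) [0..<k]"
        using conjunct1[OF sorted[OF fg(1)]] conjunct1[OF sorted[OF fg(2)]] unfolding fg(3) by (rule trans[OF sym])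
      then have e: "h f i = h g i" if "i < k" for i using that by simp
      have ext: "f \<in> extensional {..<k}" "g \<in> extensional {..<k}"
        and fi: "\<And>i. i < k \<Longrightarrow> f i = (i, [h f i])" and gi: "\<And>i. i < k \<Longrightarrow> g i = (i, [h g i])"
        using fg(1,2) unfolding C by blast+
      show "f = g"
        by (rule extensionalityI[OF ext]) (metis e fi gi lessThan_iff)
    qed
    show "(\<lambda>g. h g ` {..<k}) ` ?C = ?N"
    proof (intro equalityI subsetI)
      fix A assume "A \<in> (\<lambda>g. h g ` {..<k}) ` ?C"
      then obtain g where g: "g \<in> ?C" "A = h g ` {..<k}" by blast
      have R: "\<And>i. i < k \<Longrightarrow> h g i < n" "\<And>i j. i < j \<Longrightarrow> j < k \<Longrightarrow> {h g i, h g j} \<in> edges G"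
        using C[of g] g(1) by blast+
      have "{h g i, h g j} \<in> edges G" if "i < k" "j < k" "i \<noteq> j" for i j
        using R(2)[of i j] R(2)[of j i] that by (metis insert_commute linorder_neqE_nat)
      then show "A \<in> ?N" using R(1) sorted[OF g(1)] G by (auto simp: g(2) card_image)
    next
      fix A assume "A \<in> ?N"
      then have A: "A \<subseteq> {..<n}" "card A = k" "\<And>u v. u \<in> A \<Longrightarrow> v \<in> A \<Longrightarrow> u \<noteq> v \<Longrightarrow> {u, v} \<in> edges G" using G by auto
      have fin: "finite A" using A(1) finite_subset by blast
      define xs where "xs = sorted_list_of_set A"
      have xs: "length xs = k" "set xs = A" "sorted_wrt (<) xs" using fin A(2) by (auto simp: xs_def)
      define g where "g = (\<lambda>i\<in>{..<k}. (i, [xs ! i]) :: choice)"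
      have hg: "h g i = xs ! i" if "i < k" for i using that by (simp add: h_def g_def nthd_def)
      have lt: "xs ! i < xs ! j" if "i < j" "j < k" for i j using xs that by (auto simp: sorted_wrt_iff_nth_less)
      have mem: "xs ! i \<in> A" if "i < k" for i using xs that nth_mem by blast
      have "?R g"
      proof (intro conjI allI impI)
        show "g \<in> extensional {..<k}" by (simp add: g_def)
        fix i assume i: "i < k"
        show "g i = (i, [h g i])" using hg[OF i] i by (simp add: g_def)
        show "h g i < n" using hg[OF i] mem[OF i] A(1) by auto
      next
        fix i j assume "i < j \<and> j < k"
        then have ij: "i < j" "j < k" "i < k" by auto
        show "h g i < h g j" using lt ij hg by simp
        show "{h g i, h g j} \<in> edges G" using A(3)[OF mem mem] ij lt[of i j] hg by simp
      qed
      then have "g \<in> ?C" using C by blast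
      moreover have "h g ` {..<k} = A"
        using hg xs(1,2) by (auto simp: image_iff set_conv_nth)
      ultimately show "A \<in> (\<lambda>g. h g ` {..<k}) ` ?C" by blast
    qed
  qed
  then show ?thesis unfolding num_cliques_def by (rule bij_betw_same_card)
qed


section \<open>The reduction from counting cliques as a program\<close>

lemma cmp_upt_length: "cmp D B f \<Longrightarrow> cmp D B (\<lambda>x. [0..<length (f x)])"
  by (rule cmp_upt[OF cmp_length]) (auto intro!: pb_mono[OF cmp_size] less_imp_le length_le_sz)

lemma ptime_clique_values: "ptime (\<lambda>z. clique_values (fst z) (snd z))"
  unfolding clique_values_def by (intro cmp_basic)

lemma ptime_edge_list: "ptime (\<lambda>z. edge_list (fst z) (snd z))"
  unfolding edge_list_def by (intro cmp_basic cmp_product cmp_upt_length)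

lemma ptime_clique_pairs: "ptime (\<lambda>z. clique_pairs (fst z) (snd z))"
  unfolding clique_pairs_def before_def
  by (intro cmp_basic cmp_product cmp_eq_gen[OF ptime_eq_choice])

lemma ptime_items_code: "ptime (\<lambda>z. items_code (fst z) (fst (snd z)) (snd (snd z)))"
  unfolding items_code_def by (intro cmp_basic cmp_product)

definition clique_queries :: "bool \<Rightarrow> nat \<Rightarrow> nat list \<Rightarrow> nat list \<Rightarrow> nat list \<Rightarrow> nat list \<Rightarrow> (nat \<times> nat) list list \<Rightarrow> nat list list" where
  "clique_queries cp ph ks ns cs x Zs =
     map (\<lambda>Z. query_code cp [length cs] ph (length ks) cs (clique_values ks ns)
       (clique_pairs (edge_list ns x) (clique_values ks ns)) Z) Zs"

lemma ptime_clique_queries: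
  "ptime (\<lambda>z. clique_queries cp ph (fst z) (fst (snd z)) (fst (snd (snd z))) (fst (snd (snd (snd z)))) (snd (snd (snd (snd z)))))"
  unfolding clique_queries_def
  by (intro cmp_basic cmp_query_code ptime_comp2[OF ptime_clique_values] ptime_comp2[OF ptime_edge_list]
      ptime_comp2[OF ptime_clique_pairs])

lemma length_query_items: "length (query_items cp k (k + k + 2)) \<le> (k + 2) * (k + 2)"
  by (auto simp: query_items_def cut_items_def delete_items_def)

text \<open>With \<open>2 * k + 2\<close> colours, \<open>k\<close> for each side and two special
  ones, there are at most \<open>(k + 2) ^ 2\<close> items, which bounds the number of queries by
  \<open>2 ^ ((k + 2) ^ 2)\<close>. The parameter is a single word whose value may exceed the input
  size, so the cases \<open>k = 0\<close> and \<open>k > n\<close> are answered without queries;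
  otherwise \<open>k\<close> is at most the number of vertices.\<close>

theorem W1_hard_generic:
  fixes Q :: "'j counting_problem" and ph :: nat
  assumes pl: "\<And>G n. \<not> cp \<Longrightarrow> input_graph G \<Longrightarrow> oracle_for Q (n # encode_graph G) = ind_sub (parameter_of ph) n G \<and>
      (\<exists>j\<in>instances Q. encode Q j = n # encode_graph G \<and> parameter Q j = n)"
    and col: "\<And>H G c. cp \<Longrightarrow> input_colored_graph (H, G, c) \<Longrightarrow>
      oracle_for Q (encode_colored_graph (H, G, c)) = cp_ind_sub (parameter_of ph) H G c \<and>
      (\<exists>j\<in>instances Q. encode Q j = encode_colored_graph (H, G, c) \<and> parameter Q j = card (verts H))"
  shows "sharp_W1_hard Q"
proof -
  define D where "D x \<longleftrightarrow> (\<exists>k G. input_graph G \<and> x = k # encode_graph G)" for x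
  define k where "k x = nthd 0 x 0" for x :: "nat list"
  define n where "n x = nthd 0 x 1" for x :: "nat list"
  define B where "B x = (2::nat) ^ ((k x + 2) * (k x + 2))" for x
  define D2 where "D2 x \<longleftrightarrow> D x \<and> (k x \<noteq> 0 \<and> k x \<le> n x)" for x
  define ks where "ks x = [0..<k x]" for x
  define ns where "ns x = [0..<n x]" for x
  define cs where "cs x = [0..<k x + k x + 2]" for x
  define Zs where "Zs x = subseqs (items_code cp (ks x) (cs x))" for x
  have kn: "k (j # encode_graph G) = j" "n (j # encode_graph G) = card (verts G)" for j G
    by (simp_all add: k_def n_def nthd_def encode_graph_def Let_def)
  have "n x \<le> sz x" if Dx: "D x" for x
  proof -
    obtain j G where jG: "input_graph G" "x = j # encode_graph G" using Dx unfolding D_def by blast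
    have "card (verts G) \<le> Suc (card (verts G) * card (verts G))" by (cases "card (verts G)") auto
    then show ?thesis unfolding jG(2) kn(2) sz_nats by (simp add: encode_graph_product Let_def)
  qed
  then have pn: "pb D2 B n" by (intro pb_mono[OF pb_sz]) (auto simp: D2_def)
  have pk: "pb D2 B k" by (rule pb_mono[OF pn]) (simp add: D2_def)
  have ck: "cmp D' B' k" and cn: "cmp D' B' n" for D' B' unfolding k_def n_def by (intro cmp_basic)+
  have cks: "cmp D2 B ks" unfolding ks_def by (intro cmp_upt ck pk)
  have cns: "cmp D2 B ns" unfolding ns_def by (intro cmp_upt cn pn)
  have ccs: "cmp D2 B cs" unfolding cs_def by (intro cmp_upt cmp_basic ck pb_intros pk)
  have items: "items_code cp (ks x) (cs x) = query_items cp (k x) (k x + k x + 2)" for x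
    unfolding ks_def cs_def by (rule items_code)
  have cZs: "cmp D2 B Zs" unfolding Zs_def
  proof (rule cmp_subseqs)
    show "cmp D2 B (\<lambda>x. items_code cp (ks x) (cs x))"
      by (intro ptime_comp3[OF ptime_items_code] cmp_const cks ccs)
    show "pb D2 B (\<lambda>x. 2 ^ length (items_code cp (ks x) (cs x)))"
    proof (rule pb_mono[OF pb_B])
      fix x show "2 ^ length (items_code cp (ks x) (cs x)) \<le> B x"
        unfolding items B_def by (intro power_increasing length_query_items) simp
    qed
  qed
  define qs where "qs x = (if k x \<noteq> 0 \<and> k x \<le> n x
    then clique_queries cp ph (ks x) (ns x) (cs x) x (Zs x) else [])" for x
  define fin where "fin z = (if k (fst z) = 0 then 1 else if k (fst z) \<noteq> 0 \<and> k (fst z) \<le> n (fst z)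
    then signed_total (Zs (fst z)) (rev (snd z)) else 0)" for z :: "nat list \<times> nat list"
  have act: "cmp D' B' (\<lambda>x. k x \<noteq> 0 \<and> k x \<le> n x)" for D' B' by (intro cmp_basic ck cn)
  have cqs: "cmp D B qs" unfolding qs_def
  proof (rule cmp_if[OF act])
    show "cmp (\<lambda>x. D x \<and> (k x \<noteq> 0 \<and> k x \<le> n x)) B (\<lambda>x. clique_queries cp ph (ks x) (ns x) (cs x) x (Zs x))"
      using ptime_comp[OF ptime_clique_queries[of cp ph]
        cmp_pair[OF cks cmp_pair[OF cns cmp_pair[OF ccs cmp_pair[OF cmp_id cZs]]]]]
      by (simp add: D2_def[abs_def])
  qed (rule cmp_const)
  have lift: "cmp (\<lambda>z. E (fst z)) (\<lambda>z. B (fst z)) (\<lambda>z::nat list \<times> nat list. f (fst z))" if "cmp E B f"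
    for E and f :: "nat list \<Rightarrow> (nat \<times> nat) list list"
    by (rule cmp_comp[OF that cmp_fst[OF cmp_id]]) (auto intro: pb_B)
  have cfin: "cmp (\<lambda>z. D (fst z)) (\<lambda>z. B (fst z)) fin" unfolding fin_def
  proof (intro cmp_if cmp_const cmp_conj cmp_not cmp_eq cmp_le ptime_comp[OF ck] ptime_comp[OF cn] cmp_fst cmp_id
      cmp_signed_total cmp_rev cmp_snd)
    show "cmp (\<lambda>x. (D (fst x) \<and> k (fst x) \<noteq> 0) \<and> k (fst x) \<noteq> 0 \<and> k (fst x) \<le> n (fst x)) (\<lambda>z. B (fst z))
        (\<lambda>x::nat list \<times> nat list. Zs (fst x))"
      by (rule cmp_dom[OF lift[OF cZs]]) (auto simp: D2_def)
  qed
  have Bb: "B (j # encode_graph G) \<le> 2 ^ ((j + 2) * (j + 2))" for j G by (simp only: B_def kn)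
  have qform: "qs (j # encode_graph G) = (let N = j + j + 2; ws = clique_values [0..<j] [0..<card (verts G)];
        al = clique_pairs (edge_list [0..<card (verts G)] (j # encode_graph G)) ws in
      map (query_code cp [N] ph j [0..<N] ws al) (subseqs (query_items cp j N)))" if "j \<noteq> 0" "j \<le> card (verts G)" for j G
    using that items[of "j # encode_graph G"] unfolding qs_def kn Zs_def ks_def ns_def cs_def clique_queries_def Let_def
    by simp
  show ?thesis
  proof (rule fpt_reduction[OF cqs cfin])
    fix j G assume G: "input_graph G"
    show "D (j # encode_graph G)" using G unfolding D_def by blast
    show "B (j # encode_graph G) \<le> 2 ^ ((j + 2) * (j + 2))" by (rule Bb)
    show "\<exists>i\<in>instances Q. encode Q i = q \<and> parameter Q i \<le> j + j + 2" if q: "q \<in> set (qs (j # encode_graph G))" for q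
    proof -
      have j: "j \<noteq> 0" "j \<le> card (verts G)" using q unfolding qs_def kn by (auto split: if_splits)
      define ws where "ws = clique_values [0..<j] [0..<card (verts G)]"
      define al where "al = clique_pairs (edge_list [0..<card (verts G)] (j # encode_graph G)) ws"
      obtain Z where Z: "Z \<in> set (subseqs (query_items cp j (j + j + 2)))"
        "q = query_code cp [j + j + 2] ph j [0..<j + j + 2] ws al Z"
        using q unfolding qform[OF j] Let_def ws_def[symmetric] al_def[symmetric] by auto
      show ?thesis
      proof (cases cp)
        case True
        then have Z': "Z \<in> set (subseqs (cut_items j))" using Z(1) by (simp add: query_items_def)
        have "q = encode_colored_graph (the_clique (j + j + 2), the_graph ph j (j + j + 2) ws al Z, the_coloring j (j + j + 2) ws)"
          unfolding Z(2) eqTrueI[OF True] by (rule query_code_colored[OF Z'])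
        moreover have "card (verts (the_clique (j + j + 2))) = j + j + 2" by (simp add: graph_of_list_def)
        moreover have "input_colored_graph
            (the_clique (j + j + 2), the_graph ph j (j + j + 2) ws al Z, the_coloring j (j + j + 2) ws)"
          by (rule the_colored_input[OF Z']) simp
        ultimately show ?thesis using col[OF True] by (metis order_refl)
      next
        case False
        have "q = (j + j + 2) # encode_graph (the_graph ph j (j + j + 2) ws al Z)"
          unfolding Z(2) using False by (simp only: query_code_plain append.simps)
        then show ?thesis using pl[OF False query_graph_input] by (metis order_refl)
      qed
    qed
    show "fin (j # encode_graph G, rev (map (oracle_for Q) (qs (j # encode_graph G)))) = num_cliques j G"
    proof (cases "j = 0")
      case True
      have "{A. A \<subseteq> verts G \<and> card A = 0 \<and> (\<forall>u\<in>A. \<forall>v\<in>A. u \<noteq> v \<longrightarrow> {u, v} \<in> edges G)} = {{}}"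
      proof -
        have fV: "finite (verts G)" using G by (simp add: input_graph_def simple_graph_def)
        have e: "A = {}" if "A \<subseteq> verts G" "card A = 0" for A
          using card_0_eq[OF finite_subset[OF that(1) fV]] that(2) by simp
        show ?thesis by (intro equalityI subsetI; clarsimp simp: e)
      qed
      then show ?thesis using True by (simp add: fin_def kn num_cliques_def)
    next
      case j0: False
      obtain m where m: "verts G = {..<m}" using G by (auto simp: input_graph_def)
      show ?thesis
      proof (cases "j \<le> card (verts G)")
        case False
        have "card A \<noteq> j" if "A \<subseteq> verts G" for A using card_mono[of "verts G" A] that False m by auto
        then have "{A. A \<subseteq> verts G \<and> card A = j \<and> (\<forall>u\<in>A. \<forall>v\<in>A. u \<noteq> v \<longrightarrow> {u, v} \<in> edges G)} = {}" by blast
        then have "num_cliques j G = 0" unfolding num_cliques_def by (simp only: card.empty)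
        then show ?thesis using j0 False by (simp add: fin_def kn)
      next
        case True
        have mm: "card (verts G) = m" by (simp add: m)
        define N where "N = j + j + 2"
        define ws where "ws = clique_values [0..<j] [0..<m]"
        define al where "al = clique_pairs (edge_list [0..<m] (j # encode_graph G)) ws"
        have diag: "a = b" if "(a, b) \<in> set al" "fst a = fst b" for a b
          using that by (auto simp: al_def clique_pairs_def before_def)
        have "fin (j # encode_graph G, rev (map (oracle_for Q) (qs (j # encode_graph G)))) =
            signed_total (subseqs (query_items cp j N)) (map (oracle_for Q)
              (map (query_code cp [N] ph j [0..<N] ws al) (subseqs (query_items cp j N))))"
          using j0 True items[of "j # encode_graph G"]
          unfolding qform[OF j0 True] fin_def fst_conv snd_conv kn Zs_def mm Let_def ws_def al_def N_def
          by simp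
        also have "\<dots> = card (cliques_of j (set al) ws)"
        proof (rule queries_correct)
          show "distinct ws" unfolding ws_def by (rule clique_values)
          show "oracle_for Q ([N] @ encode_graph (the_graph ph j N ws al Z)) =
              ind_sub (parameter_of ph) N (the_graph ph j N ws al Z)" if "\<not> cp" for Z
            unfolding append.simps by (rule conjunct1[OF pl[OF that query_graph_input]])
          show "oracle_for Q (encode_colored_graph (the_clique N, the_graph ph j N ws al Z, the_coloring j N ws)) =
              cp_ind_sub (parameter_of ph) (the_clique N) (the_graph ph j N ws al Z) (the_coloring j N ws)"
            if "cp" "Z \<in> set (subseqs (cut_items j))" for Z
            by (rule conjunct1[OF col[OF that(1) the_colored_input[OF that(2)]]]) (simp add: N_def)
        qed (use j0 diag in \<open>auto simp: N_def\<close>)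
        also have "\<dots> = num_cliques j G"
          unfolding al_def ws_def by (rule card_cliques_of_graph[OF G m])
        finally show ?thesis .
      qed
    qed
  qed
qed

theorem W1_hard_IndSub: "sharp_W1_hard (IndSub_problem (parameter_of ph))"
proof (rule W1_hard_generic[where cp = False and ph = ph])
  fix G n assume G: "input_graph G"
  show "oracle_for (IndSub_problem (parameter_of ph)) (n # encode_graph G) = ind_sub (parameter_of ph) n G \<and>
      (\<exists>j\<in>instances (IndSub_problem (parameter_of ph)).
        encode (IndSub_problem (parameter_of ph)) j = n # encode_graph G \<and> parameter (IndSub_problem (parameter_of ph)) j = n)"
    using oracle_IndSub[OF G] G by (intro conjI bexI[of _ "(n, G)"]) (auto simp: IndSub_problem_def)
qed simp

theorem W1_hard_cpIndSub: "sharp_W1_hard (cpIndSub_problem (parameter_of ph))"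
proof (rule W1_hard_generic[where cp = True and ph = ph])
  fix H G c assume I: "input_colored_graph (H, G, c)"
  show "oracle_for (cpIndSub_problem (parameter_of ph)) (encode_colored_graph (H, G, c)) = cp_ind_sub (parameter_of ph) H G c \<and>
      (\<exists>j\<in>instances (cpIndSub_problem (parameter_of ph)).
        encode (cpIndSub_problem (parameter_of ph)) j = encode_colored_graph (H, G, c) \<and>
        parameter (cpIndSub_problem (parameter_of ph)) j = card (verts H))"
    using oracle_cpIndSub[OF I] I by (intro conjI bexI[of _ "(H, G, c)"]) (auto simp: cpIndSub_problem_def)
qed simp

section \<open>Sparsification\<close>

text \<open>
  Clauses are sets of literals. If many clauses of size \<open>c\<close> share a heart \<open>H\<close>, then either the heart
  or all petals \<open>D - H\<close> must be satisfied. Small hearts are used first; this keeps the number of added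
  2-clauses per literal bounded, so that a weighted count of added clauses grows along every branch.
\<close>

definition hits :: "'a set \<Rightarrow> 'a set set \<Rightarrow> bool" where
  "hits X F \<longleftrightarrow> (\<forall>C\<in>F. C \<inter> X \<noteq> {})"

definition add_clauses :: "'a set set \<Rightarrow> 'a set set \<Rightarrow> 'a set set" where
  "add_clauses F P = P \<union> {D \<in> F. \<not> (\<exists>C\<in>P. C \<subseteq> D)}"

definition flower :: "'a set set \<Rightarrow> nat \<Rightarrow> 'a set \<Rightarrow> 'a set set" where
  "flower F c H = {D \<in> F. card D = c \<and> H \<subseteq> D}"

definition petals :: "'a set set \<Rightarrow> nat \<Rightarrow> 'a set \<Rightarrow> 'a set set" where
  "petals F c H = (\<lambda>D. D - H) ` flower F c H"

lemma hits_add: "hits X (add_clauses F P) \<longleftrightarrow> hits X F \<and> hits X P"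
proof
  assume h: "hits X (add_clauses F P)"
  then have P: "hits X P" by (simp add: hits_def add_clauses_def)
  have "D \<inter> X \<noteq> {}" if "D \<in> F" for D
  proof (cases "\<exists>C\<in>P. C \<subseteq> D")
    case True
    then obtain C where "C \<in> P" "C \<subseteq> D" by blast
    moreover from this have "C \<inter> X \<noteq> {}" using P by (simp add: hits_def)
    ultimately show ?thesis by blast
  next
    case False
    then have "D \<in> add_clauses F P" using that by (simp add: add_clauses_def)
    then show ?thesis using h by (simp add: hits_def)
  qed
  then show "hits X F \<and> hits X P" using P by (simp add: hits_def)
qed (auto simp: hits_def add_clauses_def)

text \<open>If the heart is missed, every clause of the flower has to be hit in its petal.\<close>

lemma hits_branch:
  "hits X F \<longleftrightarrow> hits X (add_clauses F {H}) \<or> hits X (add_clauses F (petals F c H))"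
proof -
  have "hits X {H} \<or> hits X (petals F c H)" if F: "hits X F"
  proof (cases "H \<inter> X = {}")
    case True
    have "(D - H) \<inter> X \<noteq> {}" if "D \<in> F" for D
    proof -
      have "D \<inter> X \<noteq> {}" using F that by (simp add: hits_def)
      then show ?thesis using True by blast
    qed
    then show ?thesis by (auto simp: hits_def petals_def flower_def)
  qed (simp add: hits_def)
  then show ?thesis unfolding hits_add by blast
qed

locale sparsify =
  fixes th :: nat and L :: "'a set" and Orig :: "'a set set"
  assumes th: "1 \<le> th" and finL: "finite L"
begin

definition two_free :: "'a set set \<Rightarrow> bool" where
  "two_free F \<longleftrightarrow> (\<forall>y. card (flower F 2 {y}) < th)"

definition pair_free :: "'a set set \<Rightarrow> bool" where
  "pair_free F \<longleftrightarrow> (\<forall>H. card H = 2 \<longrightarrow> card (flower F 3 H) < th)"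

text \<open>The order of the cases matters. With a single-literal heart of 3-clauses the petals are
  2-clauses; \<open>two_free\<close> and \<open>pair_free\<close> then limit how many 2-clauses a
  literal can lie in. The larger threshold compensates for a new 2-clause counting only 1 in
  \<open>progress\<close>, against \<open>4 * th\<close> for a unit.\<close>

definition branching :: "'a set set \<Rightarrow> nat \<Rightarrow> 'a set \<Rightarrow> bool" where
  "branching F c H \<longleftrightarrow>
     c = 2 \<and> card H = 1 \<and> th \<le> card (flower F 2 H) \<or>
     c = 3 \<and> card H = 2 \<and> th \<le> card (flower F 3 H) \<and> two_free F \<or>
     c = 3 \<and> card H = 1 \<and> 2 * th * th \<le> card (flower F 3 H) \<and> two_free F \<and> pair_free F"

definition new_pairs :: "'a set set \<Rightarrow> 'a set set" where
  "new_pairs F = {D \<in> F - Orig. card D = 2}"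

definition units :: "'a set set \<Rightarrow> 'a set set" where
  "units F = {D \<in> F. card D = 1}"

text \<open>A new unit clause may absorb up to \<open>2 * th\<close> added 2-clauses; the weight
  \<open>4 * th\<close> leaves a net gain of \<open>2 * th\<close>.\<close>

definition progress :: "'a set set \<Rightarrow> nat" where
  "progress F = 4 * th * card (units F) + card (new_pairs F)"

text \<open>Clauses form an antichain and each original clause still contains a present one;
  together this makes derived clauses genuinely new. The degree bound \<open>2 * th\<close> allows
  \<open>th\<close> for the 2-clauses already present and \<open>th\<close> for those added in one
  step.\<close>

definition inv :: "'a set set \<Rightarrow> bool" where
  "inv F \<longleftrightarrow> (\<forall>D\<in>F. D \<subseteq> L \<and> card D \<le> 3) \<and> (\<forall>C\<in>F. \<forall>D\<in>F. C \<subseteq> D \<longrightarrow> C = D) \<and>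
     (\<forall>D\<in>Orig. \<exists>C\<in>F. C \<subseteq> D) \<and> (\<forall>y. card {D \<in> new_pairs F. y \<in> D} \<le> 2 * th)"

lemma inv_finite: "inv F \<Longrightarrow> finite F"
  using finL by (auto simp: inv_def intro: finite_subset[of F "Pow L"])

lemma card_units_le: assumes "inv F" shows "card (units F) \<le> card L"
proof -
  have "units F \<subseteq> (\<lambda>y. {y}) ` L" using assms by (fastforce simp: units_def inv_def card_1_singleton_iff)
  then have "card (units F) \<le> card ((\<lambda>y. {y}) ` L)" by (intro card_mono finite_imageI finL)
  then show ?thesis using card_image_le[OF finL] le_trans by blast
qed

lemma card_cover:
  assumes "\<And>D. D \<in> A \<Longrightarrow> D \<subseteq> L \<and> D \<noteq> {}" "\<And>y. card {D \<in> A. y \<in> D} \<le> m"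
  shows "card A \<le> card L * m"
proof -
  have fA: "finite A" using assms(1) finL by (intro finite_subset[of A "Pow L"]) auto
  have "A \<subseteq> (\<Union>y\<in>L. {D \<in> A. y \<in> D})" using assms(1) by blast
  then have "card A \<le> card (\<Union>y\<in>L. {D \<in> A. y \<in> D})" using fA finL by (intro card_mono) auto
  also have "\<dots> \<le> (\<Sum>y\<in>L. card {D \<in> A. y \<in> D})" by (rule card_UN_le[OF finL])
  also have "\<dots> \<le> (\<Sum>y\<in>L. m)" by (intro sum_mono assms(2))
  finally show ?thesis by simp
qed

lemma progress_le: assumes "inv F" shows "progress F \<le> 6 * th * card L"
proof -
  have "card (new_pairs F) \<le> card L * (2 * th)"
    using assms by (intro card_cover) (auto simp: inv_def new_pairs_def)
  moreover have "4 * th * card (units F) \<le> 4 * th * card L"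
    by (rule mult_le_mono2[OF card_units_le[OF assms]])
  moreover have "6 * th * card L = 4 * th * card L + card L * (2 * th)" by simp
  ultimately show ?thesis unfolding progress_def by linarith
qed

text \<open>Members of \<open>P\<close> have equal size, hence are pairwise incomparable. They lie
  strictly inside clauses of the antichain \<open>F\<close>, so no clause of \<open>F\<close> is
  contained in one of them.\<close>

lemma add_inv:
  assumes F: "inv F" and P: "\<And>C. C \<in> P \<Longrightarrow> card C = s" and s: "s \<le> 3"
    and sub: "\<And>C. C \<in> P \<Longrightarrow> \<exists>D\<in>F. C \<subset> D"
    and deg: "\<And>y. card {D \<in> new_pairs (add_clauses F P). y \<in> D} \<le> 2 * th"
  shows "inv (add_clauses F P)"
proof -
  have anti: "\<And>C D. C \<in> F \<Longrightarrow> D \<in> F \<Longrightarrow> C \<subseteq> D \<Longrightarrow> C = D" and L: "\<And>D. D \<in> F \<Longrightarrow> D \<subseteq> L \<and> card D \<le> 3"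
    and O: "\<And>D. D \<in> Orig \<Longrightarrow> \<exists>C\<in>F. C \<subseteq> D" using F by (auto simp: inv_def)
  have noF: "\<not> E \<subseteq> C" if "C \<in> P" "E \<in> F" for C E using sub[OF that(1)] anti that(2) by blast
  have PP: "C = D" if "C \<in> P" "D \<in> P" "C \<subseteq> D" for C D
  proof (rule card_subset_eq[OF _ that(3)])
    show "finite D" using sub[OF that(2)] L finL by (meson finite_subset psubset_imp_subset)
    show "card C = card D" using P that by simp
  qed
  have n1: "D \<subseteq> L \<and> card D \<le> 3" if "D \<in> add_clauses F P" for D
    using that L sub P s unfolding add_clauses_def by blast
  have n2: "C = D" if "C \<in> add_clauses F P" "D \<in> add_clauses F P" "C \<subseteq> D" for C D
  proof (cases "D \<in> P")
    case True
    then show ?thesis using that(1,3) PP[of C D] noF[of D C] by (auto simp: add_clauses_def)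
  next
    case False
    then have "D \<in> F" "C \<notin> P" using that(2,3) by (auto simp: add_clauses_def)
    then show ?thesis using that(1,3) anti[of C D] by (auto simp: add_clauses_def)
  qed
  have n3: "\<exists>C\<in>add_clauses F P. C \<subseteq> D" if "D \<in> Orig" for D
    using O[OF that] unfolding add_clauses_def by blast
  show ?thesis unfolding inv_def by (intro conjI ballI allI impI n2 n3 deg) (simp_all add: n1)
qed

text \<open>An original clause contains a present clause. If \<open>C\<close> were original, that
  clause would lie strictly inside \<open>D\<close>, against the antichain property.\<close>

lemma new_clause:
  assumes F: "inv F" and sub: "\<exists>D\<in>F. C \<subset> D"
  shows "C \<notin> F" "C \<notin> Orig"
proof -
  obtain D where D: "D \<in> F" "C \<subset> D" using sub by blast
  have anti: "\<And>C D. C \<in> F \<Longrightarrow> D \<in> F \<Longrightarrow> C \<subseteq> D \<Longrightarrow> C = D"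
    and O: "\<And>D. D \<in> Orig \<Longrightarrow> \<exists>C\<in>F. C \<subseteq> D" using F by (auto simp: inv_def)
  show "C \<notin> F" using anti[of C D] D by blast
  show "C \<notin> Orig"
  proof
    assume "C \<in> Orig"
    then obtain C' where "C' \<in> F" "C' \<subseteq> C" using O by blast
    then show False using anti[of C' D] D by blast
  qed
qed

text \<open>Each unit removes only those added 2-clauses that contain its literal, at most
  \<open>2 * th\<close> by the invariant, and no existing unit is lost.\<close>

lemma add_units:
  assumes F: "inv F" and P: "\<And>C. C \<in> P \<Longrightarrow> card C = 1" and fin: "finite P"
    and sub: "\<And>C. C \<in> P \<Longrightarrow> \<exists>D\<in>F. C \<subset> D"
  shows "inv (add_clauses F P)" "progress F + 2 * th * card P \<le> progress (add_clauses F P)"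
proof -
  have fF: "finite F" by (rule inv_finite[OF F])
  have sing: "\<exists>y. C = {y}" if "C \<in> P" for C using P[OF that] by (auto simp: card_1_singleton_iff)
  have T: "new_pairs (add_clauses F P) = new_pairs F - (\<Union>C\<in>P. {D \<in> new_pairs F. C \<subseteq> D})"
    using P by (auto simp: new_pairs_def add_clauses_def)
  have deg: "card {D \<in> new_pairs F. y \<in> D} \<le> 2 * th" for y using F by (simp add: inv_def)
  have fT: "finite (new_pairs F)" using fF by (simp add: new_pairs_def)
  have "card {D \<in> new_pairs (add_clauses F P). y \<in> D} \<le> 2 * th" for y
    using card_mono[of "{D \<in> new_pairs F. y \<in> D}" "{D \<in> new_pairs (add_clauses F P). y \<in> D}"] deg[of y] fT T
    by (auto intro: le_trans)
  then show "inv (add_clauses F P)" by (intro add_inv[OF F P _ sub]) auto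
  have "card (\<Union>C\<in>P. {D \<in> new_pairs F. C \<subseteq> D}) \<le> (\<Sum>C\<in>P. card {D \<in> new_pairs F. C \<subseteq> D})"
    by (rule card_UN_le[OF fin])
  also have "\<dots> \<le> (\<Sum>C\<in>P. 2 * th)"
  proof (rule sum_mono)
    fix C assume "C \<in> P"
    then obtain y where "C = {y}" using sing by blast
    then show "card {D \<in> new_pairs F. C \<subseteq> D} \<le> 2 * th" using deg[of y] by simp
  qed
  finally have T2: "card (new_pairs F) \<le> card (new_pairs (add_clauses F P)) + 2 * th * card P"
    unfolding T using diff_card_le_card_Diff[of "\<Union>C\<in>P. {D \<in> new_pairs F. C \<subseteq> D}" "new_pairs F"] fT fin
    by (simp add: mult.commute)
  have "units F \<union> P \<subseteq> units (add_clauses F P)"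
  proof
    fix D assume D: "D \<in> units F \<union> P"
    have "\<not> C \<subseteq> D" if "C \<in> P" "D \<in> units F" for C
    proof
      assume "C \<subseteq> D"
      then have "C = D" using P[OF that(1)] that(2) by (auto simp: units_def card_1_singleton_iff)
      then show False using new_clause(1)[OF F sub[OF that(1)]] that(2) by (auto simp: units_def)
    qed
    then show "D \<in> units (add_clauses F P)" using D P by (auto simp: units_def add_clauses_def)
  qed
  moreover have "units F \<inter> P = {}" using new_clause(1)[OF F sub] by (auto simp: units_def)
  moreover have "finite (units (add_clauses F P))" "finite (units F)"
    using fF fin by (auto simp: units_def add_clauses_def)
  ultimately have "card (units F) + card P \<le> card (units (add_clauses F P))"
    using fin by (metis card_Un_disjoint card_mono)
  from mult_le_mono2[OF this, of "4 * th"]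
  have "4 * th * card (units F) + 4 * th * card P \<le> 4 * th * card (units (add_clauses F P))"
    unfolding add_mult_distrib2 .
  moreover have "4 * th * card P = 2 * th * card P + 2 * th * card P" by simp
  ultimately show "progress F + 2 * th * card P \<le> progress (add_clauses F P)"
    using T2 unfolding progress_def by linarith
qed

text \<open>A 2-clause can only absorb larger clauses here, so no unit and no 2-clause disappears
  and the added ones count in full. Their degree is at most \<open>th\<close>, on top of fewer than
  \<open>th\<close> present ones.\<close>

lemma add_pairs:
  assumes F: "inv F" and P: "\<And>C. C \<in> P \<Longrightarrow> card C = 2" and fin: "finite P"
    and sub: "\<And>C. C \<in> P \<Longrightarrow> \<exists>D\<in>F. C \<subset> D"
    and two: "two_free F" and deg: "\<And>y. card {C \<in> P. y \<in> C} \<le> th"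
  shows "inv (add_clauses F P)" "progress F + card P \<le> progress (add_clauses F P)"
proof -
  have fF: "finite F" by (rule inv_finite[OF F])
  have "card {D \<in> new_pairs (add_clauses F P). y \<in> D} \<le> 2 * th" for y
  proof -
    have "{D \<in> new_pairs (add_clauses F P). y \<in> D} \<subseteq> flower F 2 {y} \<union> {C \<in> P. y \<in> C}"
      by (auto simp: new_pairs_def add_clauses_def flower_def)
    moreover have "finite (flower F 2 {y} \<union> {C \<in> P. y \<in> C})" using fF fin by (simp add: flower_def)
    ultimately have "card {D \<in> new_pairs (add_clauses F P). y \<in> D} \<le> card (flower F 2 {y} \<union> {C \<in> P. y \<in> C})"
      by (rule card_mono[rotated])
    also have "\<dots> \<le> card (flower F 2 {y}) + card {C \<in> P. y \<in> C}" by (rule card_Un_le)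
    also have "\<dots> \<le> 2 * th" using two deg[of y] by (simp add: two_free_def add_mono less_imp_le mult_2)
    finally show ?thesis .
  qed
  then show "inv (add_clauses F P)" by (intro add_inv[OF F P _ sub]) auto
  have fP: "finite C" if "C \<in> P" for C using P[OF that] card.infinite by fastforce
  have keep: "\<not> C \<subseteq> D" if C: "C \<in> P" and D: "D \<in> F" "card D \<le> 2" "finite D" for C D
  proof
    assume CD: "C \<subseteq> D"
    then have "card C \<le> card D" using D by (intro card_mono)
    then have "C = D" using P[OF C] D CD by (intro card_subset_eq) auto
    then show False using new_clause(1)[OF F sub[OF C]] D by simp
  qed
  have finD: "finite D" if "D \<in> F" for D using F that finL by (auto simp: inv_def intro: finite_subset)
  have "units F \<subseteq> units (add_clauses F P)"
    using keep finD by (auto simp: units_def add_clauses_def)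
  then have u: "card (units F) \<le> card (units (add_clauses F P))"
    using fF fin by (intro card_mono) (auto simp: units_def add_clauses_def)
  have "new_pairs F \<union> P \<subseteq> new_pairs (add_clauses F P)"
    using keep finD P new_clause(2)[OF F sub] by (auto simp: new_pairs_def add_clauses_def)
  moreover have "new_pairs F \<inter> P = {}" using new_clause(1)[OF F sub] by (auto simp: new_pairs_def)
  moreover have "finite (new_pairs (add_clauses F P))" "finite (new_pairs F)"
    using fF fin by (auto simp: new_pairs_def add_clauses_def)
  ultimately have "card (new_pairs F) + card P \<le> card (new_pairs (add_clauses F P))"
    using fin by (metis card_Un_disjoint card_mono)
  then show "progress F + card P \<le> progress (add_clauses F P)"
    using mult_le_mono2[OF u, of "4 * th"] unfolding progress_def by linarith
qed

text \<open>The branches are deliberately unbalanced: the heart may gain only 1, the petals gain at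
  least \<open>2 * th * th\<close>. Single-literal petals gain \<open>2 * th\<close> each and number
  at least \<open>th\<close>; two-literal petals gain 1 each but number at least
  \<open>2 * th * th\<close>.\<close>

theorem branching_progress:
  assumes F: "inv F" and b: "branching F c H"
  shows "inv (add_clauses F {H})" "inv (add_clauses F (petals F c H))"
    "progress F + 1 \<le> progress (add_clauses F {H})"
    "progress F + 2 * th * th \<le> progress (add_clauses F (petals F c H))"
proof -
  have fF: "finite F" by (rule inv_finite[OF F])
  have cH: "1 \<le> card H" "card H < c" "c \<le> 3" and fl: "th \<le> card (flower F c H)"
    using b th by (auto simp: branching_def intro: order.trans[of th "2 * th * th"])
  have "flower F c H \<noteq> {}" using fl th by (metis card.empty not_one_le_zero order.trans)
  then obtain D0 where D0: "D0 \<in> F" "card D0 = c" "H \<subseteq> D0" by (auto simp: flower_def)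
  have subH: "\<exists>D\<in>F. H \<subset> D" using D0 cH by (metis less_irrefl psubsetI)
  have fH: "finite H" using cH card.infinite by fastforce
  have finD: "finite D" if "D \<in> F" for D using F that finL by (auto simp: inv_def intro: finite_subset)
  have fp: "finite (petals F c H)" using fF by (simp add: petals_def flower_def)
  have inj: "inj_on (\<lambda>D. D - H) (flower F c H)" by (rule inj_onI) (auto simp: flower_def)
  then have cp: "card (petals F c H) = card (flower F c H)" by (simp add: petals_def card_image)
  have pet: "card C = c - card H \<and> (\<exists>D\<in>F. C \<subset> D)" if C: "C \<in> petals F c H" for C
  proof -
    obtain D where D: "D \<in> F" "card D = c" "H \<subseteq> D" "C = D - H" using C by (auto simp: petals_def flower_def)
    have "H \<noteq> {}" using cH by auto
    then have "C \<subset> D" using D by blast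
    moreover have "card C = c - card H" using D fH by (simp add: card_Diff_subset)
    ultimately show ?thesis using D(1) by blast
  qed
  have thH: "card {C \<in> {H}. y \<in> C} \<le> th" for y
  proof -
    have "card {C \<in> {H}. y \<in> C} \<le> card {H}" by (rule card_mono) auto
    then show ?thesis using th by simp
  qed
  have left: "inv (add_clauses F {H}) \<and> progress F + 1 \<le> progress (add_clauses F {H})"
  proof (cases "card H = 1")
    case True
    then show ?thesis using add_units[OF F, of "{H}"] subH th by auto
  next
    case False
    then have "card H = 2" "two_free F" using b by (auto simp: branching_def)
    then show ?thesis using add_pairs[OF F, of "{H}"] subH thH by auto
  qed
  have right: "inv (add_clauses F (petals F c H)) \<and>
      progress F + 2 * th * th \<le> progress (add_clauses F (petals F c H))"
  proof (cases "c - card H = 1")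
    case True
    then have a: "inv (add_clauses F (petals F c H))"
      "progress F + 2 * th * card (petals F c H) \<le> progress (add_clauses F (petals F c H))"
      using add_units[OF F, of "petals F c H"] pet fp by auto
    moreover have "2 * th * th \<le> 2 * th * card (petals F c H)" using fl cp by (intro mult_left_mono) auto
    ultimately show ?thesis by linarith
  next
    case False
    then have r: "c = 3" "card H = 1" "2 * th * th \<le> card (flower F c H)" "two_free F" "pair_free F"
      using b by (auto simp: branching_def)
    obtain h where h: "H = {h}" using r(2) by (auto simp: card_1_singleton_iff)
    have "card {C \<in> petals F c H. y \<in> C} \<le> th" for y
    proof (cases "y = h")
      case True
      then have "{C \<in> petals F c H. y \<in> C} = {}" by (auto simp: petals_def h)
      then show ?thesis by (simp only: card.empty)
    next
      case False
      \<comment> \<open>A petal through \<open>y\<close> comes from a clause containing both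
        \<open>h\<close> and \<open>y\<close>, and \<open>pair_free\<close> bounds the number of
        those.\<close>
      have "{C \<in> petals F c H. y \<in> C} \<subseteq> (\<lambda>D. D - H) ` flower F 3 {h, y}"
        using r(1) by (auto simp: petals_def flower_def h)
      then have "card {C \<in> petals F c H. y \<in> C} \<le> card ((\<lambda>D. D - H) ` flower F 3 {h, y})"
        using fF by (intro card_mono) (auto simp: flower_def)
      also have "\<dots> \<le> card (flower F 3 {h, y})" using fF by (intro card_image_le) (simp add: flower_def)
      also have "\<dots> \<le> th" using r(5) False by (auto simp: pair_free_def less_imp_le)
      finally show ?thesis .
    qed
    then have "inv (add_clauses F (petals F c H))"
      "progress F + card (petals F c H) \<le> progress (add_clauses F (petals F c H))"
      using add_pairs[OF F, of "petals F c H"] pet fp r by auto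
    then show ?thesis using r(3) cp by linarith
  qed
  show "inv (add_clauses F {H})" "inv (add_clauses F (petals F c H))"
    "progress F + 1 \<le> progress (add_clauses F {H})"
    "progress F + 2 * th * th \<le> progress (add_clauses F (petals F c H))"
    using left right by auto
qed

text \<open>Without a branching heart, every literal has bounded degree in the clauses of each size.
  The leading 1 accounts for the empty clause.\<close>

theorem sparse_leaf:
  assumes F: "inv F" and leaf: "\<And>c H. H \<subseteq> L \<Longrightarrow> \<not> branching F c H"
  shows "card F \<le> 1 + card L * (1 + th + 2 * th * th)"
proof -
  have DL: "D \<subseteq> L" "card D \<le> 3" if "D \<in> F" for D using F that by (auto simp: inv_def)
  have finD: "finite D" if "D \<in> F" for D using DL[OF that] finL finite_subset by blast
  have out: "flower F c H = {}" if "\<not> H \<subseteq> L" for c H using that DL by (auto simp: flower_def)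
  \<comment> \<open>A nonempty flower puts its heart inside \<open>L\<close>, where
    \<open>leaf\<close> applies.\<close>
  have key: "card (flower F c H) < m" if "1 \<le> m" "m \<le> card (flower F c H) \<Longrightarrow> branching F c H" for m c H
  proof (rule ccontr)
    assume "\<not> card (flower F c H) < m"
    then have m: "m \<le> card (flower F c H)" by simp
    then have "flower F c H \<noteq> {}" using that(1) by (metis card.empty not_one_le_zero order.trans)
    then have "H \<subseteq> L" using out by blast
    then show False using leaf that(2)[OF m] by blast
  qed
  have two: "two_free F"
    unfolding two_free_def by (intro allI key th) (simp add: branching_def)
  have pair: "pair_free F"
    unfolding pair_free_def by (intro allI impI key th) (simp add: branching_def two)
  have three: "card (flower F 3 {y}) < 2 * th * th" for y
    using th by (intro key) (simp_all add: branching_def two pair)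
  define A where "A s = {D \<in> F. card D = s}" for s
  have fA: "finite (A s)" for s using inv_finite[OF F] by (simp add: A_def)
  have fl: "{D \<in> A s. y \<in> D} = flower F s {y}" for s y by (auto simp: A_def flower_def)
  have "F = A 0 \<union> A 1 \<union> A 2 \<union> A 3"
  proof (intro equalityI subsetI)
    fix D assume D: "D \<in> F"
    then have "card D = 0 \<or> card D = 1 \<or> card D = 2 \<or> card D = 3" using DL(2)[OF D] by linarith
    then show "D \<in> A 0 \<union> A 1 \<union> A 2 \<union> A 3" using D by (auto simp: A_def)
  qed (auto simp: A_def)
  then have "card F = card (A 0 \<union> A 1 \<union> A 2 \<union> A 3)" by (rule arg_cong)
  then have "card F \<le> card (A 0) + card (A 1) + card (A 2) + card (A 3)"
    using card_Un_le[of "A 0 \<union> A 1 \<union> A 2" "A 3"] card_Un_le[of "A 0 \<union> A 1" "A 2"] card_Un_le[of "A 0" "A 1"]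
    by linarith
  moreover have "card (A 0) \<le> 1"
  proof -
    have "A 0 \<subseteq> {{}}" using finD by (auto simp: A_def)
    then have "card (A 0) \<le> card {{}::'a set}" by (intro card_mono) auto
    then show ?thesis by simp
  qed
  moreover have "card (A 1) \<le> card L" using card_units_le[OF F] by (simp add: A_def units_def)
  moreover have "card (A 2) \<le> card L * th"
    using two DL(1) by (intro card_cover) (auto simp: fl two_free_def less_imp_le, auto simp: A_def)
  moreover have "card (A 3) \<le> card L * (2 * th * th)"
    using three DL(1) by (intro card_cover) (auto simp: fl less_imp_le, auto simp: A_def)
  ultimately show ?thesis by (simp add: algebra_simps)
qed

end

section \<open>Sparsification on lists of clauses\<close>

definition subl :: "nat list \<Rightarrow> nat list \<Rightarrow> bool" where
  "subl C D \<longleftrightarrow> (\<forall>l\<in>set C. l \<in> set D)"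

definition add_list :: "nat list list \<Rightarrow> nat list list \<Rightarrow> nat list list" where
  "add_list F P = P @ filter (\<lambda>D. \<not> (\<exists>C\<in>set P. subl C D)) F"

definition flower_list :: "nat list list \<Rightarrow> nat \<Rightarrow> nat list \<Rightarrow> nat list list" where
  "flower_list F c H = filter (\<lambda>D. length D = c \<and> subl H D) F"

definition petal_list :: "nat list list \<Rightarrow> nat \<Rightarrow> nat list \<Rightarrow> nat list list" where
  "petal_list F c H = map (\<lambda>D. filter (\<lambda>l. l \<notin> set H) D) (flower_list F c H)"

text \<open>Listing a clause in the order of \<open>L\<close> gives each literal set a unique list,
  so equality of clauses becomes equality of lists.\<close>

definition canon :: "nat list \<Rightarrow> nat list \<Rightarrow> nat list" where
  "canon L C = filter (\<lambda>l. l \<in> set C) L"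

definition singletons :: "nat list \<Rightarrow> nat list list" where
  "singletons L = map (\<lambda>l. [l]) L"

definition doubletons :: "nat list \<Rightarrow> nat list list" where
  "doubletons L = map (\<lambda>p. canon L [fst p, snd p]) (filter (\<lambda>p. fst p \<noteq> snd p) (List.product L L))"

definition big_hearts :: "nat \<Rightarrow> nat list list \<Rightarrow> nat \<Rightarrow> nat list list \<Rightarrow> nat list list" where
  "big_hearts t F c Hs = filter (\<lambda>H. t \<le> length (flower_list F c H)) Hs"

text \<open>The concatenation realises the priority of the three cases of \<open>branching\<close>,
  as the head is the heart that gets used. \<open>th2\<close> stands for \<open>2 * th * th\<close>
  and is supplied rather than computed.\<close>

definition pick :: "nat \<Rightarrow> nat \<Rightarrow> nat list \<Rightarrow> nat list list \<Rightarrow> (nat \<times> nat list) list" where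
  "pick th th2 L F =
     map (Pair 2) (big_hearts th F 2 (singletons L)) @ map (Pair 3) (big_hearts th F 3 (doubletons L)) @
     map (Pair 3) (big_hearts th2 F 3 (singletons L))"

text \<open>The first component holds the formulas still to be examined, the second the sparse
  leaves found so far.\<close>

definition wstep :: "nat \<Rightarrow> nat \<Rightarrow> nat list \<Rightarrow> nat list list list \<times> nat list list list \<Rightarrow> nat list list list \<times> nat list list list" where
  "wstep th th2 L s = (if pick th th2 L (hd (fst s)) = [] then (tl (fst s), hd (fst s) # snd s)
     else (add_list (hd (fst s)) [snd (hd (pick th th2 L (hd (fst s))))] #
       add_list (hd (fst s)) (petal_list (hd (fst s)) (fst (hd (pick th th2 L (hd (fst s)))))
         (snd (hd (pick th th2 L (hd (fst s)))))) # tl (fst s), snd s))"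

definition SF :: "nat list list \<Rightarrow> nat set set" where "SF F = set ` set F"

definition canonical :: "nat list \<Rightarrow> nat list list \<Rightarrow> bool" where
  "canonical L F \<longleftrightarrow> distinct F \<and> (\<forall>C\<in>set F. canon L C = C)"

lemma canonD: "canon L C = C \<Longrightarrow> distinct L \<Longrightarrow> distinct C \<and> set C \<subseteq> set L"
  by (metis canon_def distinct_filter filter_is_subset)

lemma canon_eq: "canon L C = C \<Longrightarrow> canon L D = D \<Longrightarrow> set C = set D \<Longrightarrow> C = D"
  by (metis canon_def)

lemma canon_canon: "set C \<subseteq> set L \<Longrightarrow> set (canon L C) = set C" by (auto simp: canon_def)

lemma canon_idem: "canon L (canon L C) = canon L C"
  by (auto simp: canon_def intro: filter_cong)

lemma canon_filter: "canon L D = D \<Longrightarrow> canon L (filter P D) = filter P D"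
proof -
  assume D: "canon L D = D"
  have "filter P D = filter P (filter (\<lambda>l. l \<in> set D) L)" using D by (simp add: canon_def)
  also have "\<dots> = canon L (filter P D)" by (auto simp: canon_def intro: filter_cong)
  finally show ?thesis by simp
qed

lemma canon_singleton: "distinct L \<Longrightarrow> l \<in> set L \<Longrightarrow> canon L [l] = [l]"
  by (induction L) (auto simp: canon_def filter_empty_conv)

lemma inj_set: "canonical L F \<Longrightarrow> inj_on set (set F)"
  unfolding canonical_def by (intro inj_onI) (meson canon_eq)

lemma card_SF_filter:
  assumes "canonical L F" shows "card (set ` set (filter P F)) = length (filter P F)"
proof -
  have "inj_on set (set (filter P F))" using inj_set[OF assms] by (rule inj_on_subset) auto
  then have "card (set ` set (filter P F)) = card (set (filter P F))" by (rule card_image)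
  also have "\<dots> = length (filter P F)"
    using assms by (intro distinct_card distinct_filter) (simp add: canonical_def)
  finally show ?thesis .
qed

lemma card_SF: "canonical L F \<Longrightarrow> card (SF F) = length F"
  using card_SF_filter[of L F "\<lambda>_. True"] by (simp add: SF_def)

lemma SF_flower:
  assumes L: "distinct L" and F: "canonical L F"
  shows "flower (SF F) c (set H) = set ` set (flower_list F c H)"
    "card (flower (SF F) c (set H)) = length (flower_list F c H)"
proof -
  have "card (set D) = length D" if "D \<in> set F" for D
    using F that canonD[OF _ L] by (simp add: canonical_def distinct_card)
  then show *: "flower (SF F) c (set H) = set ` set (flower_list F c H)"
    by (auto simp: flower_def SF_def flower_list_def subl_def)
  show "card (flower (SF F) c (set H)) = length (flower_list F c H)"
    unfolding * flower_list_def by (rule card_SF_filter[OF F])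
qed

lemma SF_add: "SF (add_list F P) = add_clauses (SF F) (SF P)"
proof -
  have "subl C D \<longleftrightarrow> set C \<subseteq> set D" for C D by (auto simp: subl_def)
  then show ?thesis by (auto simp: SF_def add_list_def add_clauses_def)
qed

lemma SF_single: "SF [H] = {set H}" by (simp add: SF_def)

lemma SF_petals:
  assumes "distinct L" "canonical L F" shows "SF (petal_list F c H) = petals (SF F) c (set H)"
proof -
  have "set (filter (\<lambda>l. l \<notin> set H) D) = set D - set H" for D by auto
  then show ?thesis unfolding petals_def SF_flower(1)[OF assms]
    by (simp only: SF_def petal_list_def set_map image_image)
qed

text \<open>All clauses of a flower contain the heart, so cutting it off keeps them
  distinct.\<close>

lemma canonical_petals:
  assumes "canonical L F" shows "canonical L (petal_list F c H)"
proof -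
  have "inj_on (\<lambda>D. filter (\<lambda>l. l \<notin> set H) D) (set (flower_list F c H))"
  proof (rule inj_onI)
    fix C D assume CD: "C \<in> set (flower_list F c H)" "D \<in> set (flower_list F c H)"
      "filter (\<lambda>l. l \<notin> set H) C = filter (\<lambda>l. l \<notin> set H) D"
    have "set C - set H = set D - set H" using arg_cong[OF CD(3), of set] by auto
    moreover have "set H \<subseteq> set C" "set H \<subseteq> set D" using CD by (auto simp: flower_list_def subl_def)
    ultimately have "set C = set D" by blast
    then show "C = D" using CD assms canon_eq[of L C D] by (auto simp: flower_list_def canonical_def)
  qed
  then show ?thesis
    using assms canon_filter unfolding canonical_def petal_list_def
    by (auto simp: distinct_map flower_list_def)
qed

lemma canonical_add:
  assumes "canonical L F" "canonical L P" "set ` set P \<inter> set ` set F = {}"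
  shows "canonical L (add_list F P)"
  using assms unfolding canonical_def add_list_def by auto

definition good_formula :: "nat \<Rightarrow> nat list \<Rightarrow> nat set set \<Rightarrow> nat list list \<Rightarrow> bool" where
  "good_formula th L Orig F \<longleftrightarrow> canonical L F \<and> sparsify.inv th (set L) Orig (SF F)"

lemma mem_pick:
  assumes "(c, H) \<in> set (pick th th2 L F)" "distinct L"
  shows "canon L H = H" "set H \<subseteq> set L"
proof -
  have "canon L H = H"
    using assms canon_singleton canon_idem unfolding pick_def big_hearts_def singletons_def doubletons_def by auto
  then show "canon L H = H" "set H \<subseteq> set L" using canonD[OF _ assms(2)] by auto
qed

text \<open>If the head comes from a later list, the earlier ones are empty, which yields
  \<open>two_free\<close> and \<open>pair_free\<close>.\<close>

lemma pick_branching: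
  assumes th: "1 \<le> th" and L: "distinct L" and F: "canonical L F" and p: "pick th (2 * th * th) L F \<noteq> []"
  defines "c \<equiv> fst (hd (pick th (2 * th * th) L F))" and "H \<equiv> snd (hd (pick th (2 * th * th) L F))"
  shows "sparsify.branching th (SF F) c (set H)"
proof -
  interpret sparsify th "set L" "{}" by standard (use th in auto)
  let ?a = "big_hearts th F 2 (singletons L)" and ?b = "big_hearts th F 3 (doubletons L)"
    and ?c = "big_hearts (2 * th * th) F 3 (singletons L)"
  note fl = SF_flower(2)[OF L F]
  have DL: "D \<subseteq> set L" if "D \<in> SF F" for D
    using that F canonD[OF _ L] by (auto simp: SF_def canonical_def)
  have two: "two_free (SF F)" if a: "?a = []"
    unfolding two_free_def
  proof (intro allI, rule ccontr)
    fix y assume "\<not> card (flower (SF F) 2 {y}) < th"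
    then have m: "th \<le> card (flower (SF F) 2 {y})" by simp
    then have "flower (SF F) 2 {y} \<noteq> {}" using th by (metis card.empty not_one_le_zero order.trans)
    then have "y \<in> set L" using DL by (auto simp: flower_def)
    moreover have "th \<le> length (flower_list F 2 [y])" using m fl[of 2 "[y]"] by simp
    ultimately have "[y] \<in> set ?a" by (auto simp: big_hearts_def singletons_def)
    then show False using a by simp
  qed
  have pair: "pair_free (SF F)" if b: "?b = []"
    unfolding pair_free_def
  proof (intro allI impI, rule ccontr)
    fix K :: "nat set" assume K: "card K = 2" "\<not> card (flower (SF F) 3 K) < th"
    then have m: "th \<le> card (flower (SF F) 3 K)" by simp
    then have "flower (SF F) 3 K \<noteq> {}" using th by (metis card.empty not_one_le_zero order.trans)
    then have KL: "K \<subseteq> set L" using DL by (auto simp: flower_def)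
    obtain u v where uv: "K = {u, v}" "u \<noteq> v" using K(1) by (auto simp: card_2_iff)
    have s: "set (canon L [u, v]) = K" using canon_canon[of "[u, v]" L] KL uv by simp
    have "th \<le> length (flower_list F 3 (canon L [u, v]))" using m fl[of 3 "canon L [u, v]"] s by simp
    then have "canon L [u, v] \<in> set ?b"
      using KL uv by (force simp: big_hearts_def doubletons_def)
    then show False using b by simp
  qed
  have sub: "H \<in> set (big_hearts t F c' Hs) \<Longrightarrow> t \<le> card (flower (SF F) c' (set H)) \<and> H \<in> set Hs" for t c' Hs
    by (simp add: big_hearts_def fl)
  have s1: "card (set H) = 1" if "H \<in> set (singletons L)" using that by (auto simp: singletons_def)
  have s2: "card (set H) = 2" if "H \<in> set (doubletons L)"
  proof -
    obtain u v where "u \<in> set L" "v \<in> set L" "u \<noteq> v" "H = canon L [u, v]"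
      using \<open>H \<in> set (doubletons L)\<close> by (auto simp: doubletons_def)
    then have "set H = {u, v}" using canon_canon[of "[u, v]" L] by simp
    then show ?thesis using \<open>u \<noteq> v\<close> by simp
  qed
  consider "?a \<noteq> []" | "?a = []" "?b \<noteq> []" | "?a = []" "?b = []" "?c \<noteq> []"
    using p by (auto simp: pick_def)
  then show ?thesis
  proof cases
    case 1
    then have "c = 2" "H \<in> set ?a" by (auto simp: c_def H_def pick_def hd_map)
    then show ?thesis using sub s1 by (auto simp: branching_def)
  next
    case 2
    then have "c = 3" "H \<in> set ?b" by (auto simp: c_def H_def pick_def hd_map)
    then show ?thesis using sub s2 two[OF 2(1)] by (auto simp: branching_def)
  next
    case 3
    then have "c = 3" "H \<in> set ?c" by (auto simp: c_def H_def pick_def hd_map)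
    then show ?thesis using sub s1 two[OF 3(1)] pair[OF 3(2)] by (auto simp: branching_def)
  qed
qed

lemma pick_empty:
  assumes th: "1 \<le> th" and L: "distinct L" and F: "canonical L F" and p: "pick th (2 * th * th) L F = []"
    and K: "K \<subseteq> set L"
  shows "\<not> sparsify.branching th (SF F) c K"
proof
  interpret sparsify th "set L" "{}" by standard (use th in auto)
  assume b: "branching (SF F) c K"
  note fl = SF_flower(2)[OF L F]
  have e: "big_hearts th F 2 (singletons L) = []" "big_hearts th F 3 (doubletons L) = []"
    "big_hearts (2 * th * th) F 3 (singletons L) = []" using p by (auto simp: pick_def)
  from b consider y where "c = 2" "K = {y}" "th \<le> card (flower (SF F) 2 K)"
    | u v where "c = 3" "K = {u, v}" "u \<noteq> v" "th \<le> card (flower (SF F) 3 K)"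
    | y where "c = 3" "K = {y}" "2 * th * th \<le> card (flower (SF F) 3 K)"
    unfolding branching_def by (auto simp: card_1_singleton_iff card_2_iff)
  then show False
  proof cases
    case 1
    then have "[y] \<in> set (big_hearts th F 2 (singletons L))"
      using K fl[of 2 "[y]"] by (auto simp: big_hearts_def singletons_def)
    then show False using e by simp
  next
    case 2
    then have "set (canon L [u, v]) = K" using canon_canon[of "[u, v]" L] K by simp
    then have "th \<le> length (flower_list F 3 (canon L [u, v]))" using 2 fl[of 3 "canon L [u, v]"] by simp
    then have "canon L [u, v] \<in> set (big_hearts th F 3 (doubletons L))"
      using K 2 by (force simp: big_hearts_def doubletons_def)
    then show False using e by simp
  next
    case 3
    then have "[y] \<in> set (big_hearts (2 * th * th) F 3 (singletons L))"
      using K fl[of 3 "[y]"] by (auto simp: big_hearts_def singletons_def)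
    then show False using e by simp
  qed
qed

section \<open>The size of the branching tree\<close>

locale worklist =
  fixes th :: nat and L :: "nat list" and Orig :: "nat set set" and x :: real
  assumes th: "1 \<le> th" and L: "distinct L" and x: "1 \<le> x" "1 / x + 1 / x ^ (2 * th * th) \<le> 1"
begin

sublocale sparsify th "set L" Orig by standard (use th in auto)

abbreviation st :: "nat list list list \<times> nat list list list \<Rightarrow> nat list list list \<times> nat list list list" where
  "st \<equiv> wstep th (2 * th * th) L"

abbreviation good :: "nat list list \<Rightarrow> bool" where
  "good F \<equiv> good_formula th L Orig F"

text \<open>With \<open>d\<close> units of progress left, \<open>x ^ d\<close> bounds the number of
  leaves, since \<open>1 / x + 1 / x ^ (2 * th * th) \<le> 1\<close> is the characteristic
  inequality of a branching with gains 1 and \<open>2 * th * th\<close>. A binary tree with that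
  many leaves has \<open>2 * x ^ d - 1\<close> nodes, and each node costs one step.\<close>

definition weight :: "nat list list \<Rightarrow> real" where
  "weight F = 2 * x ^ (6 * th * length L - progress (SF F)) - 1"

definition OK :: "nat list list list \<times> nat list list list \<Rightarrow> bool" where
  "OK s \<longleftrightarrow> (\<forall>F\<in>set (fst s). good F) \<and> (\<forall>F\<in>set (snd s). good F \<and> pick th (2 * th * th) L F = [])"

definition potential :: "nat list list list \<times> nat list list list \<Rightarrow> real" where
  "potential s = sum_list (map weight (fst s))"

lemma x_pos: "0 < x" using x by linarith

lemma weight_ge: "1 \<le> weight F"
  using one_le_power[OF x(1), of "6 * th * length L - progress (SF F)"] by (simp add: weight_def)

lemma branch_good:
  assumes F: "good F" and p: "pick th (2 * th * th) L F \<noteq> []"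
  defines "c \<equiv> fst (hd (pick th (2 * th * th) L F))" and "H \<equiv> snd (hd (pick th (2 * th * th) L F))"
  shows "good (add_list F [H])" "good (add_list F (petal_list F c H))"
    "weight (add_list F [H]) + weight (add_list F (petal_list F c H)) \<le> weight F - 1"
    "hits X (SF F) \<longleftrightarrow> hits X (SF (add_list F [H])) \<or> hits X (SF (add_list F (petal_list F c H)))"
proof -
  have can: "canonical L F" and iv: "inv (SF F)" using F by (auto simp: good_formula_def)
  have br: "branching (SF F) c (set H)"
    unfolding c_def H_def by (rule pick_branching[OF th L can p])
  have mem: "(c, H) \<in> set (pick th (2 * th * th) L F)" using p by (simp add: c_def H_def)
  have H: "canon L H = H" by (rule mem_pick[OF mem L])
  have S1: "SF (add_list F [H]) = add_clauses (SF F) {set H}" by (simp add: SF_add SF_single)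
  have S2: "SF (add_list F (petal_list F c H)) = add_clauses (SF F) (petals (SF F) c (set H))"
    by (simp add: SF_add SF_petals[OF L can])
  note bp = branching_progress[OF iv br]
  have cH: "1 \<le> card (set H)" "card (set H) < c" and fl: "th \<le> card (flower (SF F) c (set H))"
    using br th by (auto simp: branching_def intro: order.trans[of th "2 * th * th"])
  then have "flower (SF F) c (set H) \<noteq> {}" using th by (metis card.empty not_one_le_zero order.trans)
  then obtain D0 where D0: "D0 \<in> SF F" "set H \<subset> D0" using cH by (auto simp: flower_def)
  have new1: "set H \<notin> SF F" using new_clause(1)[OF iv] D0 by blast
  have new2: "C \<notin> SF F" if C: "C \<in> petals (SF F) c (set H)" for C
  proof -
    obtain D where D: "D \<in> SF F" "set H \<subseteq> D" "C = D - set H" using C by (auto simp: petals_def flower_def)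
    have "set H \<noteq> {}" using cH by auto
    have "C \<noteq> D"
    proof
      assume "C = D"
      then have "set H \<inter> D = {}" using D(3) by auto
      then have "set H = {}" using D(2) by (simp add: Int_absorb2)
      with \<open>set H \<noteq> {}\<close> show False by simp
    qed
    moreover have "C \<subseteq> D" unfolding D(3) by (rule Diff_subset)
    ultimately have "C \<subset> D" by simp
    then show ?thesis using new_clause(1)[OF iv] D by blast
  qed
  have can1: "canonical L (add_list F [H])"
    using new1 H by (intro canonical_add can) (auto simp: canonical_def SF_def)
  have can2: "canonical L (add_list F (petal_list F c H))"
  proof (intro canonical_add can canonical_petals)
    show "set ` set (petal_list F c H) \<inter> set ` set F = {}"
      using new2 SF_petals[OF L can, of c H] by (auto simp: SF_def)
  qed
  show g1: "good (add_list F [H])" using can1 bp(1) by (simp add: good_formula_def S1)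
  show g2: "good (add_list F (petal_list F c H))" using can2 bp(2) by (simp add: good_formula_def S2)
  show "hits X (SF F) \<longleftrightarrow> hits X (SF (add_list F [H])) \<or> hits X (SF (add_list F (petal_list F c H)))"
    unfolding S1 S2 by (rule hits_branch)
  let ?P = "6 * th * length L" and ?p = "progress (SF F)"
  let ?p1 = "progress (SF (add_list F [H]))" and ?p2 = "progress (SF (add_list F (petal_list F c H)))"
  have cl: "card (set L) = length L" using L by (rule distinct_card)
  have b1: "?p1 \<le> ?P" using progress_le[of "SF (add_list F [H])"] g1 cl by (simp add: good_formula_def)
  have b2: "?p2 \<le> ?P" using progress_le[of "SF (add_list F (petal_list F c H))"] g2 cl by (simp add: good_formula_def)
  have p1: "?p + 1 \<le> ?p1" "?p + 2 * th * th \<le> ?p2" using bp(3,4) by (simp_all add: S1 S2)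
  let ?y = "x ^ (?P - ?p)"
  have "x ^ (?P - ?p1) * x \<le> ?y"
  proof -
    have "x ^ (Suc (?P - ?p1)) \<le> ?y" using p1(1) b1 by (intro power_increasing x) auto
    then show ?thesis by (simp add: mult.commute)
  qed
  then have e1: "x ^ (?P - ?p1) \<le> ?y / x" using x_pos by (simp add: field_simps)
  have "x ^ (?P - ?p2) * x ^ (2 * th * th) \<le> ?y"
    unfolding power_add[symmetric] using p1(2) b2 by (intro power_increasing x) auto
  then have e2: "x ^ (?P - ?p2) \<le> ?y / x ^ (2 * th * th)" using x_pos by (simp add: field_simps)
  have "?y / x + ?y / x ^ (2 * th * th) = ?y * (1 / x + 1 / x ^ (2 * th * th))" by (simp add: distrib_left)
  also have "\<dots> \<le> ?y * 1" using x_pos by (intro mult_left_mono x) simp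
  finally show "weight (add_list F [H]) + weight (add_list F (petal_list F c H)) \<le> weight F - 1"
    using e1 e2 unfolding weight_def by linarith
qed

lemma st_step:
  assumes s: "OK s" "fst s \<noteq> []"
  shows "OK (st s)" "potential (st s) \<le> potential s - 1"
    "(\<exists>F\<in>set (fst s) \<union> set (snd s). hits X (SF F)) \<longleftrightarrow>
     (\<exists>F\<in>set (fst (st s)) \<union> set (snd (st s)). hits X (SF F))"
    "length (fst (st s)) + length (snd (st s)) \<le> length (fst s) + length (snd s) + 1"
proof -
  obtain F Fs lv where s': "s = (F # Fs, lv)" using s(2) by (cases s; cases "fst s") auto
  have F: "good F" using s(1) by (simp add: OK_def s')
  have "OK (st s) \<and> potential (st s) \<le> potential s - 1 \<and>
    ((\<exists>F\<in>set (fst s) \<union> set (snd s). hits X (SF F)) \<longleftrightarrow>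
     (\<exists>F\<in>set (fst (st s)) \<union> set (snd (st s)). hits X (SF F)))"
  proof (cases "pick th (2 * th * th) L F = []")
    case True
    then have e: "st s = (Fs, F # lv)" by (simp add: wstep_def s')
    show ?thesis unfolding e using s(1) True weight_ge[of F] by (auto simp: s' OK_def potential_def)
  next
    case False
    let ?H = "snd (hd (pick th (2 * th * th) L F))" and ?c = "fst (hd (pick th (2 * th * th) L F))"
    have e: "st s = (add_list F [?H] # add_list F (petal_list F ?c ?H) # Fs, lv)"
      using False by (simp add: wstep_def s')
    note bg = branch_good[OF F False]
    show ?thesis unfolding e using s(1) bg(1-3) bg(4)[of X] by (auto simp: s' OK_def potential_def)
  qed
  then show "OK (st s)" "potential (st s) \<le> potential s - 1"
    "(\<exists>F\<in>set (fst s) \<union> set (snd s). hits X (SF F)) \<longleftrightarrow>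
     (\<exists>F\<in>set (fst (st s)) \<union> set (snd (st s)). hits X (SF F))" by blast+
  show "length (fst (st s)) + length (snd (st s)) \<le> length (fst s) + length (snd s) + 1"
    by (simp add: wstep_def s')
qed

text \<open>The potential is nonnegative and falls by at least 1 per step, so the loop stops within
  its initial value. Each step adds at most one formula, so the step count also bounds the number of
  formulas stored.\<close>

theorem worklist:
  assumes F0: "good F0"
  defines "s i \<equiv> (st ^^ i) ([F0], [])"
  obtains N where "real N \<le> 2 * x ^ (6 * th * length L)" "fst (s N) = []" "\<And>i. i < N \<Longrightarrow> fst (s i) \<noteq> []"
    "\<And>i. i \<le> N \<Longrightarrow> OK (s i)" "\<And>i. i \<le> N \<Longrightarrow> length (fst (s i)) + length (snd (s i)) \<le> i + 1"
    "\<And>X. hits X (SF F0) \<longleftrightarrow> (\<exists>F\<in>set (snd (s N)). hits X (SF F))"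
proof -
  have Suc: "s (Suc i) = st (s i)" for i by (simp add: s_def)
  have s0: "s 0 = ([F0], [])" by (simp add: s_def)
  have run: "OK (s i) \<and> potential (s i) \<le> potential (s 0) - i \<and> length (fst (s i)) + length (snd (s i)) \<le> i + 1 \<and>
     (\<forall>X. hits X (SF F0) \<longleftrightarrow> (\<exists>F\<in>set (fst (s i)) \<union> set (snd (s i)). hits X (SF F)))"
    if "\<And>j. j < i \<Longrightarrow> fst (s j) \<noteq> []" for i
    using that
  proof (induction i)
    case 0
    then show ?case using F0 by (simp add: s0 OK_def)
  next
    case (Suc i)
    have IH: "OK (s i)" "potential (s i) \<le> potential (s 0) - i" "length (fst (s i)) + length (snd (s i)) \<le> i + 1"
     "\<forall>X. hits X (SF F0) \<longleftrightarrow> (\<exists>F\<in>set (fst (s i)) \<union> set (snd (s i)). hits X (SF F))"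
      using Suc.IH Suc.prems by auto
    have ne: "fst (s i) \<noteq> []" using Suc.prems[of i] by simp
    note t = st_step[OF IH(1) ne]
    show ?case unfolding \<open>s (Suc i) = st (s i)\<close> using IH t(1,2,4) t(3) by auto
  qed
  have pot: "0 \<le> potential t" for t
    unfolding potential_def by (intro sum_list_nonneg) (clarsimp, rule order.trans[OF zero_le_one weight_ge])
  have "\<exists>i. fst (s i) = []"
  proof (rule ccontr)
    assume "\<nexists>i. fst (s i) = []"
    then have "potential (s i) \<le> potential (s 0) - i" for i using run by simp
    from this[of "nat \<lceil>potential (s 0)\<rceil> + 1"] pot[of "s (nat \<lceil>potential (s 0)\<rceil> + 1)"]
    show False using pot[of "s 0"] by linarith
  qed
  then obtain N where N: "fst (s N) = []" "\<And>i. i < N \<Longrightarrow> fst (s i) \<noteq> []"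
    using exists_least_iff[of "\<lambda>i. fst (s i) = []"] by blast
  have r: "OK (s i) \<and> potential (s i) \<le> potential (s 0) - i \<and> length (fst (s i)) + length (snd (s i)) \<le> i + 1 \<and>
     (\<forall>X. hits X (SF F0) \<longleftrightarrow> (\<exists>F\<in>set (fst (s i)) \<union> set (snd (s i)). hits X (SF F)))" if "i \<le> N" for i
    using N(2) that by (intro run) auto
  have "real N \<le> potential (s 0)" using r[of N] pot[of "s N"] by linarith
  also have "\<dots> \<le> 2 * x ^ (6 * th * length L)"
  proof -
    have "x ^ (6 * th * length L - progress (SF F0)) \<le> x ^ (6 * th * length L)"
      by (intro power_increasing x) simp
    then show ?thesis by (simp add: s0 potential_def weight_def)
  qed
  finally have bN: "real N \<le> 2 * x ^ (6 * th * length L)" .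
  have eqN: "hits X (SF F0) \<longleftrightarrow> (\<exists>F\<in>set (snd (s N)). hits X (SF F))" for X
    using r[of N] N(1) by simp
  show thesis
    by (rule that[OF bN N(1) N(2)]) (use r eqN in auto)
qed

text \<open>Intermediate formulas need not be sparse, but being duplicate-free with clauses of at
  most three literals they are of polynomial size.\<close>

lemma good_size: "good F \<Longrightarrow> length F \<le> (length L + 1) ^ 3 \<and> (\<forall>C\<in>set F. length C \<le> 3 \<and> set C \<subseteq> set L)"
proof -
  assume F: "good F"
  have can: "\<And>C. C \<in> set F \<Longrightarrow> distinct C \<and> set C \<subseteq> set L"
    using F canonD[OF _ L] by (auto simp: good_formula_def canonical_def)
  have len: "length C \<le> 3" if "C \<in> set F" for C
    using F that can[OF that] distinct_card[of C] unfolding good_formula_def inv_def SF_def by fastforce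
  have "set F \<subseteq> {C. set C \<subseteq> set L \<and> length C \<le> 3}" using can len by blast
  then have "card (set F) \<le> card {C. set C \<subseteq> set L \<and> length C \<le> 3}"
    by (intro card_mono finite_lists_length_le) auto
  also have "\<dots> = (\<Sum>i\<le>3. card (set L) ^ i)" by (rule card_lists_length_le) simp
  also have "\<dots> \<le> (length L + 1) ^ 3"
    using L by (simp add: distinct_card numeral_eq_Suc algebra_simps)
  finally have "length F \<le> (length L + 1) ^ 3"
    using F by (simp add: good_formula_def canonical_def distinct_card)
  then show ?thesis using len can by blast
qed

lemma leaf_size:
  assumes "good F" "pick th (2 * th * th) L F = []"
  shows "length F \<le> 1 + length L * (1 + th + 2 * th * th)"
proof -
  have can: "canonical L F" and iv: "inv (SF F)" using assms by (auto simp: good_formula_def)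
  have "card (SF F) \<le> 1 + card (set L) * (1 + th + 2 * th * th)"
    by (rule sparse_leaf[OF iv]) (rule pick_empty[OF th L can assms(2)])
  then show ?thesis using card_SF[OF can] L by (simp add: distinct_card)
qed

end

definition literals_of :: "nat list list \<Rightarrow> nat list" where "literals_of F = dedup (concat F)"

text \<open>Only inclusion-minimal clauses are kept, so that the invariant holds from the start with
  this formula as the original one: nothing counts as added yet.\<close>

definition initial_formula :: "nat list list \<Rightarrow> nat list list" where
  "initial_formula F = filter (\<lambda>D. \<not> (\<exists>C\<in>set (dedup (map (canon (literals_of F)) F)). subl C D \<and> C \<noteq> D))
     (dedup (map (canon (literals_of F)) F))"

lemma initial_formula:
  assumes F: "\<And>C. C \<in> set F \<Longrightarrow> length C \<le> 3" and th: "1 \<le> th"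
  shows "good_formula th (literals_of F) (SF (initial_formula F)) (initial_formula F)"
    "hits X (SF (initial_formula F)) \<longleftrightarrow> hits X (SF F)"
proof -
  let ?L = "literals_of F" and ?G = "dedup (map (canon (literals_of F)) F)" and ?I = "initial_formula F"
  interpret sparsify th "set ?L" "SF ?I" by standard (use th in auto)
  have L: "distinct ?L" "set ?L = \<Union> (set ` set F)" by (auto simp: literals_of_def)
  have cc: "canon ?L C = C" if "C \<in> set ?G" for C using that canon_idem by auto
  have I: "D \<in> set ?I \<longleftrightarrow> D \<in> set ?G \<and> \<not> (\<exists>C\<in>set ?G. subl C D \<and> C \<noteq> D)" for D
    by (simp only: initial_formula_def set_filter mem_Collect_eq)
  have can: "canonical ?L ?I" unfolding canonical_def
  proof (intro conjI ballI)
    show "distinct ?I" by (simp add: initial_formula_def)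
    show "canon ?L C = C" if "C \<in> set ?I" for C using that I cc by blast
  qed
  have SG: "set ` set ?G = SF F"
  proof -
    have "set (canon ?L C) = set C" if "C \<in> set F" for C using that L by (intro canon_canon) auto
    then show ?thesis by (auto simp: SF_def image_image)
  qed
  have IG: "set ?I \<subseteq> set ?G" using I by blast
  have ISG: "SF ?I \<subseteq> set ` set ?G" unfolding SF_def by (rule image_mono[OF IG])
  have anti: "C = D" if "C \<in> SF ?I" "D \<in> SF ?I" "C \<subseteq> D" for C D
  proof -
    obtain C' D' where CD: "C' \<in> set ?I" "D' \<in> set ?I" "C = set C'" "D = set D'" using \<open>C \<in> SF ?I\<close> \<open>D \<in> SF ?I\<close>
      by (auto simp: SF_def)
    then have "subl C' D'" using that(3) by (auto simp: subl_def)
    then have "C' = D'" using CD(1,2) I by blast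
    then show ?thesis using CD by simp
  qed
  have sub: "D \<subseteq> set ?L \<and> card D \<le> 3" if "D \<in> SF ?I" for D
  proof -
    have "D \<in> SF F" using that ISG SG by blast
    then obtain C where C: "C \<in> set F" "D = set C" by (auto simp: SF_def)
    then show ?thesis using F[of C] card_length[of C] L(2) by auto
  qed
  have "new_pairs (SF ?I) = {}" by (simp add: new_pairs_def)
  then have "inv (SF ?I)" unfolding inv_def using anti sub by simp blast
  then show "good_formula th ?L (SF ?I) ?I" using can by (simp add: good_formula_def)
  \<comment> \<open>Descent to a minimal clause shows that the dropped clauses are implied by those
    kept.\<close>
  have min: "\<exists>C\<in>set ?I. set C \<subseteq> set D" if "D \<in> set ?G" for D
    using that
  proof (induction "card (set D)" arbitrary: D rule: less_induct)
    case less
    show ?case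
    proof (cases "D \<in> set ?I")
      case False
      then obtain C where C: "C \<in> set ?G" "subl C D" "C \<noteq> D" using less.prems I by blast
      then have "set C \<noteq> set D" using canon_eq[OF cc[OF C(1)] cc[OF less.prems]] by blast
      then have "set C \<subset> set D" using C(2) by (auto simp: subl_def)
      then have "card (set C) < card (set D)" by (intro psubset_card_mono) auto
      from less.hyps[OF this C(1)] show ?thesis using \<open>set C \<subset> set D\<close> by blast
    qed blast
  qed
  have "hits X (SF ?I) \<longleftrightarrow> hits X (set ` set ?G)"
  proof
    assume h: "hits X (SF ?I)"
    show "hits X (set ` set ?G)" unfolding hits_def
    proof
      fix D assume "D \<in> set ` set ?G"
      then obtain C where "C \<in> set ?I" "set C \<subseteq> D" using min by blast
      then show "D \<inter> X \<noteq> {}" using h by (fastforce simp: hits_def SF_def)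
    qed
  next
    assume h: "hits X (set ` set ?G)"
    show "hits X (SF ?I)" unfolding hits_def
    proof
      fix C assume "C \<in> SF ?I"
      then have "C \<in> set ` set ?G" by (rule subsetD[OF ISG])
      then show "C \<inter> X \<noteq> {}" by (rule bspec[OF h[unfolded hits_def]])
    qed
  qed
  then show "hits X (SF ?I) \<longleftrightarrow> hits X (SF F)" unfolding SG .
qed

section \<open>Running a machine inside the combinator language\<close>

type_synonym icode = "nat \<times> nat \<times> nat \<times> nat"

text \<open>Tuples of uniform shape turn the simulated program into data of the simulating
  one.\<close>

fun instr_code :: "instr \<Rightarrow> icode" where
  "instr_code (Const r n) = (0, r, n, 0)"
| "instr_code (Add r s t) = (1, r, s, t)"
| "instr_code (Sub r s t) = (2, r, s, t)"
| "instr_code (Load r s) = (3, r, s, 0)"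
| "instr_code (Store r s) = (4, r, s, 0)"
| "instr_code (Input r s) = (5, r, s, 0)"
| "instr_code (InputLength r) = (6, r, 0, 0)"
| "instr_code (Jump l) = (7, l, 0, 0)"
| "instr_code (JumpZero r l) = (8, r, l, 0)"
| "instr_code (Put r) = (9, r, 0, 0)"
| "instr_code (Ask r) = (10, r, 0, 0)"

text \<open>Memory is a log of writes with the newest first, so the first match is the current value
  and unwritten registers read as 0.\<close>

definition mem_read :: "(nat \<times> nat) list \<Rightarrow> nat \<Rightarrow> nat" where
  "mem_read m r = nthd 0 (map snd (filter (\<lambda>p. fst p = r) m)) 0"

text \<open>The opcode 10 of \<open>Ask\<close> writes 0, in accordance with
  \<open>no_oracle\<close>.\<close>

definition sim_write :: "nat list \<Rightarrow> (nat \<times> nat) list \<Rightarrow> icode \<Rightarrow> (nat \<times> nat) list" where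
  "sim_write x m i = (let rd = mem_read m; op = fst i; a = fst (snd i); b = fst (snd (snd i)); c = snd (snd (snd i)) in
     if op = 0 then (a, b) # m
     else if op = 1 then (a, rd b + rd c) # m
     else if op = 2 then (a, rd b - rd c) # m
     else if op = 3 then (a, rd (rd b)) # m
     else if op = 4 then (rd a, rd b) # m
     else if op = 5 then (a, nthd 0 x (rd b)) # m
     else if op = 6 then (a, length x) # m
     else if op = 10 then (a, 0) # m
     else m)"

definition sim_pc :: "nat \<Rightarrow> (nat \<times> nat) list \<Rightarrow> icode \<Rightarrow> nat" where
  "sim_pc p m i = (if fst i = 7 then fst (snd i)
     else if fst i = 8 \<and> mem_read m (fst (snd i)) = 0 then fst (snd (snd i)) else Suc p)"

definition sim_step :: "(icode list \<times> nat list) \<times> (nat \<times> (nat \<times> nat) list) \<Rightarrow> (icode list \<times> nat list) \<times> (nat \<times> (nat \<times> nat) list)" where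
  "sim_step s = (fst s, (sim_pc (fst (snd s)) (snd (snd s)) (nthd (0, 0, 0, 0) (fst (fst s)) (fst (snd s))),
     sim_write (snd (fst s)) (snd (snd s)) (nthd (0, 0, 0, 0) (fst (fst s)) (fst (snd s)))))"

definition sim_running :: "(icode list \<times> nat list) \<times> (nat \<times> (nat \<times> nat) list) \<Rightarrow> bool" where
  "sim_running s \<longleftrightarrow> fst (snd s) < length (fst (fst s))"

definition sim_time :: "icode list \<times> nat list \<Rightarrow> nat" where
  "sim_time z = (LEAST t. \<not> sim_running ((sim_step ^^ t) (z, (0, []))))"

definition sim_result :: "icode list \<times> nat list \<Rightarrow> nat" where
  "sim_result z = mem_read (snd (snd ((sim_step ^^ sim_time z) (z, (0, []))))) 0"

definition sim_halts :: "icode list \<times> nat list \<Rightarrow> bool" where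
  "sim_halts z \<longleftrightarrow> (\<exists>t. \<not> sim_running ((sim_step ^^ t) (z, (0, []))))"

lemma mem_read_Nil: "mem_read [] = (\<lambda>_. 0)" by (simp add: mem_read_def nthd_def fun_eq_iff)

lemma mem_read_Cons: "mem_read ((a, v) # m) = (mem_read m)(a := v)"
  by (auto simp: mem_read_def nthd_def fun_eq_iff)

lemma sim_step_correct:
  assumes "pc c = p" "reg c = mem_read m" "\<not> halted P c"
  shows "sim_step ((map instr_code P, x), (p, m)) =
      ((map instr_code P, x), (pc (step no_oracle P x c), snd (snd (sim_step ((map instr_code P, x), (p, m))))))"
    "reg (step no_oracle P x c) = mem_read (snd (snd (sim_step ((map instr_code P, x), (p, m)))))"
proof -
  have p: "p < length P" using assms by (simp add: halted_def)
  have i: "nthd (0, 0, 0, 0) (map instr_code P) p = instr_code (P ! p)" using p by (simp add: nthd_def)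
  have s: "step no_oracle P x c = exec no_oracle x (P ! p) c" using assms by (simp add: step_def)
  show "sim_step ((map instr_code P, x), (p, m)) =
      ((map instr_code P, x), (pc (step no_oracle P x c), snd (snd (sim_step ((map instr_code P, x), (p, m))))))"
    unfolding s sim_step_def fst_conv snd_conv i using assms(1,2)
    by (cases "P ! p") (auto simp: sim_pc_def)
  show "reg (step no_oracle P x c) = mem_read (snd (snd (sim_step ((map instr_code P, x), (p, m)))))"
    unfolding s sim_step_def fst_conv snd_conv i using assms(1,2)
    by (cases "P ! p") (auto simp: sim_write_def Let_def mem_read_Cons nthd_def)
qed

lemma sim_conf:
  assumes "\<And>j. j < t \<Longrightarrow> \<not> halted P (conf_at no_oracle P x j)"
  shows "\<exists>m. (sim_step ^^ t) ((map instr_code P, x), (0, [])) =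
      ((map instr_code P, x), (pc (conf_at no_oracle P x t), m)) \<and> reg (conf_at no_oracle P x t) = mem_read m"
  using assms
proof (induction t)
  case 0
  then show ?case by (simp add: conf_at_def init_conf_def mem_read_Nil)
next
  case (Suc t)
  then obtain m where m: "(sim_step ^^ t) ((map instr_code P, x), (0, [])) =
      ((map instr_code P, x), (pc (conf_at no_oracle P x t), m))" "reg (conf_at no_oracle P x t) = mem_read m"
    by auto
  have n: "conf_at no_oracle P x (Suc t) = step no_oracle P x (conf_at no_oracle P x t)" by (simp add: conf_at_def)
  have "(sim_step ^^ Suc t) ((map instr_code P, x), (0, [])) =
      sim_step ((map instr_code P, x), (pc (conf_at no_oracle P x t), m))" using m(1) by simp
  then show ?case using sim_step_correct[OF refl m(2), of P x] Suc.prems[of t] unfolding n by auto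
qed

lemma sim_correct:
  assumes "outputs no_oracle P x y"
  shows "sim_halts (map instr_code P, x)" "sim_time (map instr_code P, x) = run_time no_oracle P x"
    "sim_result (map instr_code P, x) = y"
proof -
  let ?T = "run_time no_oracle P x" and ?z = "(map instr_code P, x)"
  have h: "halted P (conf_at no_oracle P x ?T)"
    unfolding run_time_def using assms by (auto simp: outputs_def halts_def intro: LeastI)
  have nh: "\<not> halted P (conf_at no_oracle P x j)" if "j < ?T" for j
    using not_less_Least[OF that[unfolded run_time_def]] .
  have run: "sim_running ((sim_step ^^ t) (?z, (0, []))) \<longleftrightarrow> \<not> halted P (conf_at no_oracle P x t)"
    "mem_read (snd (snd ((sim_step ^^ t) (?z, (0, []))))) = reg (conf_at no_oracle P x t)" if "t \<le> ?T" for t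
    using sim_conf[of t P x] nh that by (auto simp: sim_running_def halted_def)
  show "sim_halts ?z" unfolding sim_halts_def using run(1)[of ?T] h by blast
  show T: "sim_time ?z = ?T"
    unfolding sim_time_def
  proof (rule Least_equality)
    show "\<not> sim_running ((sim_step ^^ ?T) (?z, (0, [])))" using run(1)[of ?T] h by blast
    show "?T \<le> t" if "\<not> sim_running ((sim_step ^^ t) (?z, (0, [])))" for t
      using run(1)[of t] nh[of t] that by (meson less_imp_le not_le)
  qed
  show "sim_result ?z = y" unfolding sim_result_def T using run(2)[of ?T] assms by (simp add: outputs_def)
qed

lemma ptime_mem_read: "ptime (\<lambda>z. mem_read (fst z) (snd z))"
  unfolding mem_read_def by (intro cmp_basic)

lemmas cmp_mem_read = ptime_comp2[OF ptime_mem_read]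

lemma ptime_sim_step: "ptime sim_step"
  unfolding sim_step_def[abs_def] sim_pc_def sim_write_def Let_def by (intro cmp_basic cmp_mem_read)

text \<open>Numbers have unit size and the log gains at most one entry per step, so states stay
  linear in the simulated time, which serves as the bound.\<close>

lemma cmp_sim_result: "cmp sim_halts sim_time sim_result"
proof -
  have len: "length (snd (snd (sim_step s))) \<le> Suc (length (snd (snd s)))" "fst (sim_step s) = fst s" for s
    by (auto simp: sim_step_def sim_write_def Let_def)
  have lens: "length (snd (snd ((sim_step ^^ i) (z, (0, []))))) \<le> i \<and> fst ((sim_step ^^ i) (z, (0, []))) = z" for i z
  proof (induction i)
    case (Suc i)
    then show ?case using len[of "(sim_step ^^ i) (z, (0, []))"] by auto
  qed simp
  have "cmp sim_halts sim_time (\<lambda>z. (sim_step ^^ sim_time z) (z, (0, [])))"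
  proof (rule cmp_while[where Ds = "\<lambda>_. True" and Bs = "\<lambda>_. 0" and cn = sim_running
        and S = "\<lambda>z. sz z + (sim_time z * 4 + 1) + 3"])
    show "cmp sim_halts sim_time (\<lambda>z. (z, (0, [])))" by (intro cmp_basic)
    show "ptime sim_running" unfolding sim_running_def[abs_def] by (intro cmp_basic)
    show "pb sim_halts sim_time (\<lambda>z. sz z + (sim_time z * 4 + 1) + 3)" by (intro pb_intros)
    show "pb sim_halts sim_time sim_time" by (rule pb_B)
    show "sim_running ((sim_step ^^ i) (z, (0, [])))" if "i < sim_time z" for z i
      using not_less_Least[OF that[unfolded sim_time_def]] by blast
    show "\<not> sim_running ((sim_step ^^ sim_time z) (z, (0, [])))" if "sim_halts z" for z
      using that unfolding sim_halts_def sim_time_def by (rule LeastI_ex)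
    show "sz ((sim_step ^^ i) (z, (0, []))) \<le> sz z + (sim_time z * 4 + 1) + 3" if "i \<le> sim_time z" for z i
    proof -
      let ?s = "(sim_step ^^ i) (z, (0, []))"
      have "sz (snd (snd ?s)) \<le> length (snd (snd ?s)) * 4 + 1"
        using sz_list_le[of "snd (snd ?s)" 3] by (simp add: sz_prod)
      moreover have "length (snd (snd ?s)) \<le> sim_time z" using lens[of i z] that by auto
      ultimately have "sz (snd (snd ?s)) \<le> sim_time z * 4 + 1" by linarith
      moreover have "sz ?s = sz z + (1 + sz (snd (snd ?s)) + 1) + 1"
        using lens[of i z] sz_prod[of ?s] sz_prod[of "snd ?s"] by simp
      ultimately show ?thesis by linarith
    qed
  qed (auto intro: ptime_sim_step)
  then show ?thesis unfolding sim_result_def[abs_def] by (intro cmp_mem_read cmp_basic)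
qed

section \<open>Parsing formulas\<close>

lemma take_nthd: "take m xs = map (\<lambda>i. nthd d xs i) (filter (\<lambda>i. i < m) [0..<length xs])"
proof -
  have "filter (\<lambda>i. i < m) [0..<n] = [0..<min m n]" for n by (induction n) (auto simp: min_def le_Suc_eq)
  then show ?thesis by (intro nth_equalityI) (auto simp: nthd_def)
qed

lemma drop_nthd: "drop m xs = map (\<lambda>i. nthd d xs i) (filter (\<lambda>i. m \<le> i) [0..<length xs])"
proof -
  have "filter (\<lambda>i. m \<le> i) [0..<n] = [m..<n]" for n by (induction n) auto
  then show ?thesis by (intro nth_equalityI) (auto simp: nthd_def)
qed

lemma cmp_take_nats: "cmp D B m \<Longrightarrow> cmp D B f \<Longrightarrow> cmp D B (\<lambda>x. take (m x) (f x :: nat list))"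
proof -
  have "ptime (\<lambda>z. take (fst z) (snd z :: nat list))"
    unfolding take_nthd[where d = 0] by (intro cmp_basic cmp_upt_length)
  then show "cmp D B m \<Longrightarrow> cmp D B f \<Longrightarrow> cmp D B (\<lambda>x. take (m x) (f x :: nat list))" by (rule ptime_comp2)
qed

lemma cmp_drop_nats: "cmp D B m \<Longrightarrow> cmp D B f \<Longrightarrow> cmp D B (\<lambda>x. drop (m x) (f x :: nat list))"
proof -
  have "ptime (\<lambda>z. drop (fst z) (snd z :: nat list))"
    unfolding drop_nthd[where d = 0] by (intro cmp_basic cmp_upt_length)
  then show "cmp D B m \<Longrightarrow> cmp D B f \<Longrightarrow> cmp D B (\<lambda>x. drop (m x) (f x :: nat list))" by (rule ptime_comp2)
qed

definition parse_step :: "nat list \<times> nat list list \<Rightarrow> nat list \<times> nat list list" where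
  "parse_step s = (if fst s = [] then s
     else (drop (Suc (nthd 0 (fst s) 0)) (fst s), snd s @ [take (nthd 0 (fst s) 0) (drop 1 (fst s))]))"

text \<open>The input itself is the loop counter: it has at least as many words as clauses, and
  surplus steps change nothing.\<close>

definition parse :: "nat list \<Rightarrow> nat list list" where
  "parse x = snd (fold (\<lambda>_. parse_step) x (drop 1 x, []))"

lemma sz_parse_step: "sz (parse_step s) \<le> sz s"
proof (cases "fst s")
  case (Cons a r)
  have "sz (snd s @ [take a r]) + 1 = sz (snd s) + (sz (take a r) + 2)"
    using sz_append[of "snd s" "[take a r]"] by simp
  moreover have "sz (take a r) + sz (drop a r) = sz r + 1" using sz_append[of "take a r" "drop a r"] by simp
  ultimately show ?thesis using Cons by (simp add: parse_step_def nthd_def sz_prod)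
qed (simp add: parse_step_def)

lemma ptime_parse: "ptime parse"
proof -
  have "ptime (\<lambda>x. fold (\<lambda>_. parse_step) x (drop 1 x, []))"
  proof (rule cmp_fold[where Dg = "\<lambda>_. True" and Bg = "\<lambda>_. 0" and S = "\<lambda>x. sz x + 2"])
    show "ptime (\<lambda>z::nat list \<times> (nat \<times> (nat list \<times> nat list list)). parse_step (snd (snd z)))"
      unfolding parse_step_def by (intro cmp_basic cmp_take_nats cmp_drop_nats)
    have "ptime (\<lambda>x. drop 1 (x :: nat list))" by (rule cmp_drop_nats[OF cmp_const[of _ _ 1] cmp_id])
    from cmp_pair[OF this cmp_const[of _ _ "[] :: nat list list"]]
    show "ptime (\<lambda>x. (drop 1 x :: nat list, [] :: nat list list))" .
    have "sz (fold (\<lambda>_. parse_step) ys s) \<le> sz s" for ys :: "nat list" and s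
    proof (induction ys arbitrary: s)
      case (Cons y ys)
      show ?case using Cons[of "parse_step s"] sz_parse_step[of s] by simp
    qed simp
    from order.trans[OF this] show "sz (fold (\<lambda>_. parse_step) (take i x) (drop 1 x, [])) \<le> sz x + 2" for i x
      using sz_drop[of 1 x] by simp
    show "pb (\<lambda>_. True) (\<lambda>_. 0) (\<lambda>x. sz x + 2)" by (intro pb_intros)
  qed (auto intro: cmp_id)
  then show ?thesis unfolding parse_def[abs_def] by (intro cmp_snd)
qed

definition lit_code :: "nat \<times> bool \<Rightarrow> nat" where "lit_code p = 2 * fst p + of_bool (snd p)"

lemma encode_cnf_code: "encode_cnf n F = n # concat (map (\<lambda>C. length C # map lit_code C) F)"
  by (simp add: encode_cnf_def lit_code_def[abs_def] case_prod_unfold)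

lemma parse_encode: "parse (encode_cnf n F) = map (map lit_code) F"
proof -
  have fp: "fold (\<lambda>_. parse_step) xs s = (parse_step ^^ length xs) s" for xs :: "nat list" and s
    by (induction xs arbitrary: s) (auto simp: funpow_swap1)
  have "j \<ge> length F \<Longrightarrow> (parse_step ^^ j) (concat (map (\<lambda>C. length C # map lit_code C) F), acc) =
      ([], acc @ map (map lit_code) F)" for j acc
  proof (induction F arbitrary: j acc)
    case Nil
    then show ?case by (induction j) (auto simp: parse_step_def)
  next
    case (Cons C F)
    then obtain i where i: "j = Suc i" "length F \<le> i" by (cases j) auto
    have "parse_step (concat (map (\<lambda>C. length C # map lit_code C) (C # F)), acc) =
        (concat (map (\<lambda>C. length C # map lit_code C) F), acc @ [map lit_code C])"
      by (simp add: parse_step_def nthd_def)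
    then show ?case using Cons.IH[OF i(2), of "acc @ [map lit_code C]"] by (simp add: i(1) funpow_swap1)
  qed
  note run = this
  have "length F \<le> length (encode_cnf n F)"
    unfolding encode_cnf_code by (induction F) auto
  moreover have "drop 1 (encode_cnf n F) = concat (map (\<lambda>C. length C # map lit_code C) F)"
    by (simp add: encode_cnf_code)
  ultimately show ?thesis
    unfolding parse_def fp using run[of "length (encode_cnf n F)" "[]"] by (simp only: append_Nil snd_conv)
qed

section \<open>The clique problem of a sparse formula\<close>

text \<open>Round-robin by rotation: the front group receives the clause and moves to the back. This
  balances the groups without division.\<close>

definition deal :: "nat list \<Rightarrow> nat list list \<Rightarrow> nat list list list" where
  "deal ks F = fold (\<lambda>C gs. drop 1 gs @ [C # nthd [] gs 0]) F (map (\<lambda>_. []) ks)"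

lemma deal_snoc: "deal ks (F @ [C]) = drop 1 (deal ks F) @ [C # nthd [] (deal ks F) 0]"
  by (simp add: deal_def)

lemma deal_lengths:
  assumes "0 < length ks"
  shows "map length (deal ks F) = replicate (length ks - length F mod length ks) (length F div length ks) @
    replicate (length F mod length ks) (Suc (length F div length ks))"
proof (induction F rule: rev_induct)
  case Nil
  then show ?case by (simp add: deal_def map_replicate_const)
next
  case (snoc C F)
  let ?k = "length ks" and ?q = "length F div length ks" and ?r = "length F mod length ks"
  have r: "?r < ?k" using assms by simp
  then obtain j where j: "?k - ?r = Suc j" by (metis Suc_diff_Suc)
  have e: "map length (deal ks F) = ?q # replicate j ?q @ replicate ?r (Suc ?q)"
    using snoc unfolding j by simp
  then obtain g gs where g: "deal ks F = g # gs" "length g = ?q" "map length gs = replicate j ?q @ replicate ?r (Suc ?q)"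
    by (cases "deal ks F") auto
  have s: "map length (deal ks (F @ [C])) = replicate j ?q @ replicate (Suc ?r) (Suc ?q)"
    unfolding deal_snoc g(1) using g(2,3) by (simp add: nthd_def replicate_append_same)
  show ?case
  proof (cases "Suc ?r = ?k")
    case True
    then have "Suc (length F) mod ?k = 0" "Suc (length F) div ?k = Suc ?q"
      by (simp_all add: mod_Suc div_Suc)
    moreover have "j = 0" using j True by linarith
    ultimately show ?thesis unfolding s using True by simp
  next
    case False
    then have "Suc (length F) mod ?k = Suc ?r" "Suc (length F) div ?k = ?q"
      by (simp_all add: mod_Suc div_Suc)
    moreover have "?k - Suc ?r = j" using j by linarith
    ultimately show ?thesis unfolding s by simp
  qed
qed

lemma deal:
  assumes "0 < length ks"
  shows "length (deal ks F) = length ks" "g \<in> set (deal ks F) \<Longrightarrow> length g \<le> Suc (length F div length ks)"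
    "\<Union> (set ` set (deal ks F)) = set F"
proof -
  have "length (map length (deal ks F)) = length ks - length F mod length ks + length F mod length ks"
    unfolding deal_lengths[OF assms] by simp
  then show "length (deal ks F) = length ks" using assms by (simp add: less_imp_le)
  assume "g \<in> set (deal ks F)"
  then have "length g \<in> set (map length (deal ks F))" by simp
  then show "length g \<le> Suc (length F div length ks)"
    unfolding deal_lengths[OF assms] by (auto split: if_splits)
next
  show "\<Union> (set ` set (deal ks F)) = set F"
  proof (induction F rule: rev_induct)
    case Nil
    then show ?case by (auto simp: deal_def)
  next
    case (snoc C F)
    have "length (map length (deal ks F)) = length ks - length F mod length ks + length F mod length ks"
      unfolding deal_lengths[OF assms] by simp
    then have "deal ks F \<noteq> []" using assms by auto
    then obtain g gs where "deal ks F = g # gs" by (cases "deal ks F") auto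
    then show ?case using snoc by (auto simp: deal_snoc nthd_def)
  qed
qed

definition group_values :: "nat list \<Rightarrow> nat list list list \<Rightarrow> choice list" where
  "group_values ks gs = concat (map (\<lambda>i. map (Pair i) (product_lists (nthd [] gs i))) ks)"

text \<open>Complementary literals are coded \<open>2 * v\<close> and \<open>2 * v + 1\<close>, so
  successive codes are complementary only if the smaller one is even. The even literals are listed
  in advance, as there is no parity instruction.\<close>

definition clash :: "nat list \<Rightarrow> nat \<Rightarrow> nat \<Rightarrow> bool" where
  "clash ev l l' \<longleftrightarrow> l \<in> set ev \<and> l' = Suc l \<or> l' \<in> set ev \<and> l = Suc l'"

definition consistent_pairs :: "nat list \<Rightarrow> choice list \<Rightarrow> (choice \<times> choice) list" where
  "consistent_pairs ev ws = filter (\<lambda>p. (fst (fst p) = fst (snd p) \<longrightarrow> fst p = snd p) \<and>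
     \<not> (\<exists>l\<in>set (snd (fst p)). \<exists>l'\<in>set (snd (snd p)). clash ev l l')) (List.product ws ws)"

definition truth :: "(nat \<Rightarrow> bool) \<Rightarrow> nat set" where "truth a = {lit_code (v, a v) | v. True}"

lemma truth_iff: "l \<in> truth a \<longleftrightarrow> a (l div 2) = odd l"
proof
  assume "l \<in> truth a"
  then show "a (l div 2) = odd l" by (auto simp: truth_def lit_code_def)
next
  assume "a (l div 2) = odd l"
  then have "l = lit_code (l div 2, a (l div 2))" by (auto simp: lit_code_def)
  then show "l \<in> truth a" unfolding truth_def by blast
qed

lemma satisfiable_hits: "satisfiable F \<longleftrightarrow> (\<exists>a. hits (truth a) (SF (map (map lit_code) F)))"
proof -
  have "(\<exists>(v, b)\<in>set C. a v = b) \<longleftrightarrow> lit_code ` set C \<inter> truth a \<noteq> {}" for C a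
    by (force simp: truth_iff lit_code_def)
  then show ?thesis by (simp add: satisfiable_def hits_def SF_def)
qed

lemma group_values:
  "w \<in> set (group_values [0..<k] gs) \<longleftrightarrow> fst w < k \<and> list_all2 (\<lambda>l C. l \<in> set C) (snd w) (nthd [] gs (fst w))"
  by (cases w) (auto simp: group_values_def product_lists_set)

text \<open>From a clique, a variable is made true if and only if its positive literal is selected
  anywhere; consistency then makes every selected literal true. Conversely, choosing a true literal
  in each clause gives selections that never clash.\<close>

lemma leaf_cliques:
  assumes k: "0 < k" and F: "\<And>C. C \<in> set F \<Longrightarrow> set C \<subseteq> set L"
  defines "ws \<equiv> group_values [0..<k] (deal [0..<k] F)" and "ev \<equiv> filter even L"
  shows "cliques_of k (set (consistent_pairs ev ws)) ws \<noteq> {} \<longleftrightarrow> (\<exists>a. hits (truth a) (SF F))"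
proof -
  let ?gs = "deal [0..<k] F"
  have gs: "length ?gs = k" "\<Union> (set ` set ?gs) = set F" using deal[of "[0..<k]" F] k by auto
  have gi: "nthd [] ?gs i = ?gs ! i" if "i < k" for i using that gs by (simp add: nthd_def)
  have gF: "set (?gs ! i) \<subseteq> set F" if "i < k" for i using gs that nth_mem[of i ?gs] by auto
  have "\<exists>a. hits (truth a) (SF F)" if ne: "cliques_of k (set (consistent_pairs ev ws)) ws \<noteq> {}"
  proof -
    obtain g where g: "g \<in> cliques_of k (set (consistent_pairs ev ws)) ws" using ne by blast
    have gw: "g i \<in> set ws" "fst (g i) = i" if "i < k" for i using g that by (auto simp: cliques_of_def PiE_iff)
    have la: "list_all2 (\<lambda>l C. l \<in> set C) (snd (g i)) (?gs ! i)" if "i < k" for i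
      using gw[OF that] gi[OF that] unfolding ws_def group_values by simp
    have uL: "set (snd (g i)) \<subseteq> set L" if i: "i < k" for i
    proof
      fix l assume "l \<in> set (snd (g i))"
      then obtain j where j: "j < length (snd (g i))" "l = snd (g i) ! j" by (auto simp: in_set_conv_nth)
      then have "l \<in> set (?gs ! i ! j)" "?gs ! i ! j \<in> set (?gs ! i)"
        using list_all2_nthD[OF la[OF i]] list_all2_lengthD[OF la[OF i]] by auto
      then show "l \<in> set L" using gF[OF i] F by blast
    qed
    have nc: "\<not> (even l \<and> Suc l \<in> set (snd (g j)))" if "i < k" "j < k" "l \<in> set (snd (g i))" for i j l
    proof
      assume s: "even l \<and> Suc l \<in> set (snd (g j))"
      have "(g i, g j) \<in> set (consistent_pairs ev ws)" using g that by (auto simp: cliques_of_def)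
      then have "\<not> clash ev l (Suc l)" using that s by (auto simp: consistent_pairs_def)
      moreover have "l \<in> set ev" using uL[OF that(1)] that s by (auto simp: ev_def)
      ultimately show False by (simp add: clash_def)
    qed
    define a where "a v \<longleftrightarrow> (\<exists>i<k. 2 * v + 1 \<in> set (snd (g i)))" for v
    have in_truth: "l \<in> truth a" if l: "l \<in> set (snd (g i))" and i: "i < k" for l i
    proof (cases "odd l")
      case True
      then have "2 * (l div 2) + 1 = l" by simp
      then have "a (l div 2)" using l i unfolding a_def by metis
      then show ?thesis using True by (simp add: truth_iff)
    next
      case False
      then have "2 * (l div 2) + 1 = Suc l" by simp
      then have "\<not> a (l div 2)" using nc[OF i _ l] False unfolding a_def by metis
      then show ?thesis using False by (simp add: truth_iff)
    qed
    have "hits (truth a) (SF F)" unfolding hits_def SF_def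
    proof
      fix D assume "D \<in> set ` set F"
      then obtain C where C: "C \<in> set F" "D = set C" by blast
      then obtain i where i: "i < k" "C \<in> set (?gs ! i)" using gs by (metis UN_E in_set_conv_nth)
      then obtain j where j: "j < length (?gs ! i)" "?gs ! i ! j = C" by (auto simp: in_set_conv_nth)
      then have "snd (g i) ! j \<in> set C" "snd (g i) ! j \<in> set (snd (g i))"
        using list_all2_nthD2[OF la[OF i(1)]] list_all2_lengthD[OF la[OF i(1)]] by auto
      then show "D \<inter> truth a \<noteq> {}" using in_truth[OF _ i(1)] C by blast
    qed
    then show ?thesis by blast
  qed
  moreover have "cliques_of k (set (consistent_pairs ev ws)) ws \<noteq> {}" if sat: "\<exists>a. hits (truth a) (SF F)"
  proof -
    obtain a where a: "hits (truth a) (SF F)" using sat by blast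
    define ch where "ch C = (SOME l. l \<in> set C \<and> l \<in> truth a)" for C
    have ch: "ch C \<in> set C \<and> ch C \<in> truth a" if "C \<in> set F" for C
    proof -
      have "set C \<inter> truth a \<noteq> {}" using a that by (simp add: hits_def SF_def)
      then have "\<exists>l. l \<in> set C \<and> l \<in> truth a" by auto
      then show ?thesis unfolding ch_def by (rule someI_ex)
    qed
    define g where "g = (\<lambda>i\<in>{..<k}. (i, map ch (?gs ! i)))"
    have gw: "g i \<in> set ws" "fst (g i) = i" "set (snd (g i)) \<subseteq> truth a" if i: "i < k" for i
    proof -
      have "ch C \<in> set C" if "C \<in> set (?gs ! i)" for C using ch gF[OF i] that by blast
      then have "list_all2 (\<lambda>l C. l \<in> set C) (map ch (?gs ! i)) (?gs ! i)"
        by (auto simp: list_all2_conv_all_nth)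
      then show "g i \<in> set ws" using i gi[OF i] unfolding ws_def group_values by (simp add: g_def)
      show "fst (g i) = i" using i by (simp add: g_def)
      show "set (snd (g i)) \<subseteq> truth a" using i ch gF[OF i] by (auto simp: g_def)
    qed
    have ncl: "\<not> clash ev l l'" if "l \<in> truth a" "l' \<in> truth a" for l l'
      using that by (auto simp: clash_def ev_def truth_iff)
    have "(g i, g j) \<in> set (consistent_pairs ev ws)" if ij: "i < k" "j < k" for i j
    proof -
      have "fst (g i) = fst (g j) \<longrightarrow> g i = g j" using gw(2) ij by metis
      moreover have "\<not> (\<exists>l\<in>set (snd (g i)). \<exists>l'\<in>set (snd (g j)). clash ev l l')"
        using ncl gw(3)[OF ij(1)] gw(3)[OF ij(2)] by blast
      ultimately show ?thesis using gw(1)[OF ij(1)] gw(1)[OF ij(2)] by (simp add: consistent_pairs_def)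
    qed
    then have "g \<in> cliques_of k (set (consistent_pairs ev ws)) ws"
      using gw(1,2) by (auto simp: cliques_of_def PiE_iff g_def)
    then show ?thesis by blast
  qed
  ultimately show ?thesis by blast
qed

lemma group_values_distinct:
  assumes "\<And>g C. g \<in> set gs \<Longrightarrow> C \<in> set g \<Longrightarrow> distinct C"
  shows "distinct (group_values [0..<k] gs)"
proof -
  have d: "distinct (product_lists (nthd [] gs i))" for i
  proof -
    have "nthd [] gs i \<in> set gs \<or> nthd [] gs i = []" by (simp add: nthd_def)
    then show ?thesis using assms by (intro distinct_product_lists) auto
  qed
  show ?thesis unfolding group_values_def
    by (induction k) (auto simp: distinct_map inj_on_def d)
qed

lemma length_product_lists_le:
  "(\<And>C. C \<in> set g \<Longrightarrow> length C \<le> 3) \<Longrightarrow> length (product_lists g) \<le> 3 ^ length g"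
proof (induction g)
  case (Cons C g)
  have "length (product_lists (C # g)) = length C * length (product_lists g)"
    by (simp add: length_concat o_def sum_list_triv)
  also have "\<dots> \<le> 3 * 3 ^ length g" using Cons by (intro mult_mono) auto
  finally show ?case by simp
qed simp

lemma fold_product_lists:
  "fold (\<lambda>C acc. concat (map (\<lambda>l. map ((#) l) acc) C)) (rev g) [[]] = product_lists g"
  by (induction g) auto

text \<open>With three literals per clause the output can have \<open>3 ^ length (f x)\<close>
  entries, which therefore has to be covered by the bound.\<close>

lemma cmp_product_lists:
  fixes f :: "'a::enc \<Rightarrow> nat list list"
  assumes f: "cmp D B f" and three: "\<And>x C. D x \<Longrightarrow> C \<in> set (f x) \<Longrightarrow> length C \<le> 3"
    and b: "pb D B (\<lambda>x. 3 ^ length (f x))"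
  shows "cmp D B (\<lambda>x. product_lists (f x))"
proof -
  have len: "pb D B (\<lambda>x. length (f x))"
    by (rule pb_mono[OF cmp_size[OF f]]) (simp add: length_le_sz less_imp_le)
  have "cmp D B (\<lambda>x. fold (\<lambda>C acc. concat (map (\<lambda>l. map ((#) l) acc) C)) (rev (f x)) [[]])"
  proof (rule cmp_fold[where Dg = "\<lambda>_. True" and Bg = "\<lambda>_. 0"
        and S = "\<lambda>x. 3 ^ length (f x) * (2 * length (f x) + 1 + 1) + 1"])
    show "pb D B (\<lambda>x. 3 ^ length (f x) * (2 * length (f x) + 1 + 1) + 1)" by (intro pb_intros b len)
    show "ptime (\<lambda>z::'a \<times> (nat list \<times> nat list list). concat (map (\<lambda>l. map ((#) l) (snd (snd z))) (fst (snd z))))"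
      by (intro cmp_basic)
    fix x i assume x: "D x" and i: "i \<le> length (rev (f x))"
    let ?g = "rev (take i (rev (f x)))"
    have suf: "?g = drop (length (f x) - i) (f x)" by (simp add: take_rev)
    have lg: "length ?g \<le> length (f x)" by simp
    have "length C \<le> 3" if "C \<in> set ?g" for C
      using three[OF x] that unfolding suf by (meson in_set_dropD)
    then have l: "length (product_lists ?g) \<le> 3 ^ length (f x)"
      using length_product_lists_le[of ?g] lg power_increasing[of "length ?g" "length (f x)" "3::nat"]
      by (meson le_trans one_le_numeral)
    have "sz u \<le> 2 * length (f x) + 1" if "u \<in> set (product_lists ?g)" for u
      using in_set_product_lists_length[OF that] lg unfolding sz_nats by simp
    then have "sz (product_lists ?g) \<le> length (product_lists ?g) * (2 * length (f x) + 1 + 1) + 1"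
      by (rule sz_list_le)
    also have "\<dots> \<le> 3 ^ length (f x) * (2 * length (f x) + 1 + 1) + 1"
      using l by (intro add_mono mult_mono) auto
    finally show "sz (fold (\<lambda>C acc. concat (map (\<lambda>l. map ((#) l) acc) C)) (take i (rev (f x))) [[]]) \<le>
        3 ^ length (f x) * (2 * length (f x) + 1 + 1) + 1"
      using fold_product_lists[of ?g] by simp
  qed (auto intro!: cmp_rev f cmp_const)
  then show ?thesis by (simp only: fold_product_lists)
qed

lemma pb_fst:
  assumes S: "pb D B S" shows "pb (\<lambda>z. D (fst z) \<and> E z) (\<lambda>z. B (fst z)) (\<lambda>z. S (fst z))"
proof (rule pb_comp[OF S, where f = fst])
  show "pb (\<lambda>z. D (fst z) \<and> E z) (\<lambda>z. B (fst z)) (\<lambda>z. sz (fst z))"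
    by (rule pb_mono[OF pb_sz]) (simp add: sz_prod)
qed (auto intro: pb_B)

lemma cmp_fst_ctx:
  assumes f: "cmp D B f" shows "cmp (\<lambda>z. D (fst z) \<and> E z) (\<lambda>z. B (fst z)) (\<lambda>z. f (fst z))"
proof (rule cmp_comp[OF f, where f = fst])
  show "cmp (\<lambda>z. D (fst z) \<and> E z) (\<lambda>z. B (fst z)) fst"
    by (rule cmp_fst[OF cmp_id])
qed (auto intro: pb_B)

lemma cmp_group_values:
  assumes ks: "cmp D B ks" and gs: "cmp D B gs" and S: "pb D B S"
    and g: "\<And>x g. D x \<Longrightarrow> g \<in> set (gs x) \<Longrightarrow> (\<forall>C\<in>set g. length C \<le> 3) \<and> 3 ^ length g \<le> S x"
  shows "cmp D B (\<lambda>x. group_values (ks x) (gs x))"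
  unfolding group_values_def
proof (intro cmp_concat cmp_map ks cmp_pair cmp_snd cmp_fst cmp_id)
  let ?D = "\<lambda>z. D (fst z) \<and> snd z \<in> set (ks (fst z))" and ?B = "\<lambda>z. B (fst z)"
  have c: "cmp ?D ?B (\<lambda>z. nthd [] (gs (fst z)) (snd z))"
    by (intro cmp_nthd cmp_const cmp_fst_ctx gs cmp_snd cmp_id)
  have mem: "nthd [] (gs x) i \<in> set (gs x) \<or> nthd [] (gs x) i = []" for x i by (simp add: nthd_def)
  show "cmp ?D ?B (\<lambda>z. product_lists (nthd [] (gs (fst z)) (snd z)))"
  proof (rule cmp_product_lists[OF c])
    show "length C \<le> 3" if "?D z" "C \<in> set (nthd [] (gs (fst z)) (snd z))" for z C
      using g[of "fst z"] mem[of "fst z" "snd z"] that by fastforce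
    have "pb ?D ?B (\<lambda>z. S (fst z) + 1)" by (intro pb_add pb_const pb_fst S)
    then show "pb ?D ?B (\<lambda>z. 3 ^ length (nthd [] (gs (fst z)) (snd z)))"
    proof (rule pb_mono)
      fix z assume "?D z"
      then show "3 ^ length (nthd [] (gs (fst z)) (snd z)) \<le> S (fst z) + 1"
        using g[of "fst z"] mem[of "fst z" "snd z"] by (auto intro: le_SucI)
    qed
  qed
qed

text \<open>Parity is obtained by toggling a bit while counting up to the literal, so the literals
  must be bounded in value.\<close>

lemma cmp_evens:
  assumes L: "cmp D B L" and S: "pb D B S" and b: "\<And>x l. D x \<Longrightarrow> l \<in> set (L x) \<Longrightarrow> l \<le> S x"
  shows "cmp D B (\<lambda>x. filter even (L x))"
proof -
  let ?D = "\<lambda>z. D (fst z) \<and> snd z \<in> set (L (fst z))" and ?B = "\<lambda>z. B (fst z)"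
  have "pb ?D ?B snd" by (rule pb_mono[OF pb_fst[OF S]]) (simp add: b)
  then have "cmp ?D ?B (\<lambda>z. [0..<snd z])" by (intro cmp_upt cmp_snd cmp_id)
  then have "cmp ?D ?B (\<lambda>z. fold (\<lambda>_ m. 1 - m) [0..<snd z] (0::nat))"
    by (rule cmp_fold[where Dg = "\<lambda>_. True" and Bg = "\<lambda>_. 0" and S = "\<lambda>_. 1"])
      (auto intro!: cmp_basic pb_const simp del: One_nat_def)
  then have "cmp ?D ?B (\<lambda>z. fold (\<lambda>_ m. 1 - m) [0..<snd z] (0::nat) = 0)" by (intro cmp_basic)
  from cmp_filter[OF L this]
  have "cmp D B (\<lambda>x. filter (\<lambda>l. fold (\<lambda>_ m. 1 - m) [0..<l] (0::nat) = 0) (L x))" .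
  moreover have "fold (\<lambda>_ m. 1 - m) [0..<l] (0::nat) = l mod 2" for l
    by (induction l) (auto simp: mod_Suc)
  ultimately show ?thesis by (simp add: even_iff_mod_2_eq_zero)
qed

section \<open>Polynomial-time computability of the sparsification and grouping steps\<close>

lemma ptime_add_list: "ptime (\<lambda>z. add_list (fst z) (snd z))"
  unfolding add_list_def subl_def by (intro cmp_basic)

lemma ptime_flower_list: "ptime (\<lambda>z. flower_list (fst z) (fst (snd z)) (snd (snd z)))"
  unfolding flower_list_def subl_def by (intro cmp_basic)

lemmas cmp_flower_list = ptime_comp3[OF ptime_flower_list]

lemma ptime_petal_list: "ptime (\<lambda>z. petal_list (fst z) (fst (snd z)) (snd (snd z)))"
  unfolding petal_list_def by (intro cmp_basic cmp_flower_list)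

lemma ptime_canon: "ptime (\<lambda>z. canon (fst z) (snd z))"
  unfolding canon_def by (intro cmp_basic)

lemma ptime_singletons: "ptime singletons" and ptime_doubletons: "ptime doubletons"
  unfolding singletons_def[abs_def] doubletons_def[abs_def]
  by (intro cmp_basic cmp_product ptime_comp2[OF ptime_canon])+

lemma ptime_big_hearts:
  "ptime (\<lambda>z. big_hearts (fst z) (fst (snd z)) (fst (snd (snd z))) (snd (snd (snd z))))"
  unfolding big_hearts_def by (intro cmp_basic cmp_flower_list)

lemma ptime_pick: "ptime (\<lambda>z. pick (fst z) (fst (snd z)) (fst (snd (snd z))) (snd (snd (snd z))))"
  unfolding pick_def
  by (intro cmp_basic ptime_comp4[OF ptime_big_hearts] ptime_comp[OF ptime_singletons] ptime_comp[OF ptime_doubletons])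

lemma ptime_initial_formula: "ptime initial_formula" and ptime_literals_of: "ptime literals_of"
  unfolding initial_formula_def[abs_def] literals_of_def[abs_def] subl_def
  by (intro cmp_basic ptime_comp2[OF ptime_canon])+

lemma ptime_deal: "ptime (\<lambda>z. deal (fst z) (snd z))"
  unfolding deal_def
proof (rule cmp_fold[where Dg = "\<lambda>_. True" and Bg = "\<lambda>_. 0" and S = "\<lambda>z. 3 * sz z"])
  have d1: "drop 1 gs = map (\<lambda>i. nthd [] gs i) (filter (\<lambda>i. 1 \<le> i) [0..<length gs])" for gs :: "nat list list list"
    by (rule drop_nthd)
  show "ptime (\<lambda>z::(nat list \<times> nat list list) \<times> nat list \<times> nat list list list.
      drop 1 (snd (snd z)) @ [fst (snd z) # nthd [] (snd (snd z)) 0])"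
    unfolding d1 by (intro cmp_basic cmp_upt_length)
  show "ptime snd" by (rule ptime_snd)
  show "ptime (\<lambda>x::nat list \<times> nat list list. map (\<lambda>_. [] :: nat list list) (fst x))" by (intro cmp_basic)
  show "pb (\<lambda>_. True) (\<lambda>_. 0) (\<lambda>z. 3 * sz z)" by (intro pb_intros)
  fix z :: "nat list \<times> nat list list" and i
  have st: "sz (drop 1 gs @ [C # nthd [] gs 0]) \<le> sz gs + sz C + 3" for gs :: "nat list list list" and C
  proof (cases gs)
    case (Cons g gs')
    then show ?thesis using sz_append[of gs' "[C # g]"] by (simp add: nthd_def)
  qed (simp add: nthd_def)
  have "sz (fold (\<lambda>C gs. drop 1 gs @ [C # nthd [] gs 0]) F gs) \<le> sz gs + 3 * sz F" for F and gs :: "nat list list list"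
  proof (induction F arbitrary: gs)
    case (Cons C F)
    show ?case using Cons[of "drop 1 gs @ [C # nthd [] gs 0]"] st[of gs C] by simp
  qed simp
  from this[of "take i (snd z)" "map (\<lambda>_. []) (fst z)"]
  have "sz (fold (\<lambda>C gs. drop 1 gs @ [C # nthd [] gs 0]) (take i (snd z)) (map (\<lambda>_. []) (fst z))) \<le>
      sz (map (\<lambda>_. [] :: nat list list) (fst z)) + 3 * sz (snd z)" using sz_take[of i "snd z"] by linarith
  moreover have "sz (map (\<lambda>_. [] :: nat list list) ks) = sz ks" for ks :: "nat list" by (induction ks) auto
  ultimately show "sz (fold (\<lambda>C gs. drop 1 gs @ [C # nthd [] gs 0]) (take i (snd z)) (map (\<lambda>_. []) (fst z))) \<le> 3 * sz z"
    by (simp add: sz_prod)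
qed auto

lemma ptime_consistent_pairs: "ptime (\<lambda>z. consistent_pairs (fst z) (snd z))"
  unfolding consistent_pairs_def clash_def
  by (intro cmp_basic cmp_product cmp_eq_gen[OF ptime_eq_choice])

section \<open>The sparsifier as a program\<close>

type_synonym wstate = "(nat \<times> nat \<times> nat list) \<times> (nat list list list \<times> nat list list list)"

text \<open>The constants travel with the state, since a loop body sees nothing else.\<close>

definition wloop :: "wstate \<Rightarrow> wstate" where
  "wloop q = (fst q, if fst (snd q) = [] then snd q
     else wstep (fst (fst q)) (fst (snd (fst q))) (snd (snd (fst q))) (snd q))"

definition wstart :: "(nat \<times> nat \<times> nat list) \<times> nat list list \<Rightarrow> wstate" where
  "wstart z = (fst z, ([snd z], []))"

definition sparse_time :: "(nat \<times> nat \<times> nat list) \<times> nat list list \<Rightarrow> nat" where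
  "sparse_time z = (LEAST i. fst (snd ((wloop ^^ i) (wstart z))) = [])"

definition sparse_leaves :: "(nat \<times> nat \<times> nat list) \<times> nat list list \<Rightarrow> nat list list list" where
  "sparse_leaves z = snd (snd ((wloop ^^ sparse_time z) (wstart z)))"

definition sparsifiable :: "real \<Rightarrow> nat set set \<Rightarrow> (nat \<times> nat \<times> nat list) \<times> nat list list \<Rightarrow> bool" where
  "sparsifiable x Orig z \<longleftrightarrow> worklist (fst (fst z)) (snd (snd (fst z))) x \<and>
     fst (snd (fst z)) = 2 * fst (fst z) * fst (fst z) \<and>
     good_formula (fst (fst z)) (snd (snd (fst z))) Orig (snd z)"

lemma ptime_wloop: "ptime wloop"
  unfolding wloop_def[abs_def] wstep_def
  by (intro cmp_pair cmp_if cmp_null cmp_Cons cmp_tl cmp_hd cmp_fst cmp_snd cmp_id cmp_const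
      ptime_comp4[OF ptime_pick] ptime_comp2[OF ptime_add_list] ptime_comp3[OF ptime_petal_list]) auto

lemma sparse_run:
  assumes "sparsifiable x Orig z"
  defines "th \<equiv> fst (fst z)" and "L \<equiv> snd (snd (fst z))"
  shows "real (sparse_time z) \<le> 2 * x ^ (6 * th * length L)"
    "\<And>i. i < sparse_time z \<Longrightarrow> fst (snd ((wloop ^^ i) (wstart z))) \<noteq> []"
    "fst (snd ((wloop ^^ sparse_time z) (wstart z))) = []"
    "\<And>i. i \<le> sparse_time z \<Longrightarrow> fst ((wloop ^^ i) (wstart z)) = fst z \<and>
       worklist.OK th L Orig (snd ((wloop ^^ i) (wstart z))) \<and>
       length (fst (snd ((wloop ^^ i) (wstart z)))) + length (snd (snd ((wloop ^^ i) (wstart z)))) \<le> i + 1"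
    "hits X (SF (snd z)) \<longleftrightarrow> (\<exists>F\<in>set (sparse_leaves z). hits X (SF F))"
proof -
  interpret worklist th L Orig x using assms(1) by (simp add: sparsifiable_def th_def L_def)
  have g: "good (snd z)" and th2: "fst (snd (fst z)) = 2 * th * th"
    using assms(1) by (auto simp: sparsifiable_def th_def L_def)
  obtain N where N: "real N \<le> 2 * x ^ (6 * th * length L)" "fst ((st ^^ N) ([snd z], [])) = []"
    "\<And>i. i < N \<Longrightarrow> fst ((st ^^ i) ([snd z], [])) \<noteq> []"
    "\<And>i. i \<le> N \<Longrightarrow> OK ((st ^^ i) ([snd z], []))"
    "\<And>i. i \<le> N \<Longrightarrow> length (fst ((st ^^ i) ([snd z], []))) + length (snd ((st ^^ i) ([snd z], []))) \<le> i + 1"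
    "\<And>X. hits X (SF (snd z)) \<longleftrightarrow> (\<exists>F\<in>set (snd ((st ^^ N) ([snd z], []))). hits X (SF F))"
  proof (rule worklist[OF g], goal_cases)
    case (1 N)
    show ?case by (rule 1(1)[OF 1(2-7)])
  qed
  have it: "i \<le> N \<Longrightarrow> (wloop ^^ i) (wstart z) = (fst z, (st ^^ i) ([snd z], []))" for i
  proof (induction i)
    case (Suc i)
    then show ?case using N(3)[of i] th2 by (simp add: wloop_def th_def L_def)
  qed (simp add: wstart_def)
  have T: "sparse_time z = N" unfolding sparse_time_def
  proof (rule Least_equality)
    show "fst (snd ((wloop ^^ N) (wstart z))) = []" using N(2) it[of N] by simp
    show "N \<le> i" if "fst (snd ((wloop ^^ i) (wstart z))) = []" for i
    proof (rule ccontr)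
      assume "\<not> N \<le> i"
      then show False using that N(3)[of i] it[of i] by simp
    qed
  qed
  show "real (sparse_time z) \<le> 2 * x ^ (6 * th * length L)" using N(1) T by simp
  show "fst (snd ((wloop ^^ i) (wstart z))) \<noteq> []" if "i < sparse_time z" for i
    using N(3)[of i] it[of i] that by (simp add: T)
  show "fst (snd ((wloop ^^ sparse_time z) (wstart z))) = []" using N(2) it[of N] by (simp add: T)
  show "fst ((wloop ^^ i) (wstart z)) = fst z \<and> OK (snd ((wloop ^^ i) (wstart z))) \<and>
       length (fst (snd ((wloop ^^ i) (wstart z)))) + length (snd (snd ((wloop ^^ i) (wstart z)))) \<le> i + 1"
    if "i \<le> sparse_time z" for i
    using N(4,5)[of i] it[of i] that by (simp add: T)
  show "hits X (SF (snd z)) \<longleftrightarrow> (\<exists>F\<in>set (sparse_leaves z). hits X (SF F))"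
    using N(6) it[of N] by (simp add: sparse_leaves_def T)
qed

text \<open>After \<open>i\<close> steps at most \<open>i + 1\<close> formulas are stored, each of
  polynomial size, so states are polynomial in the number of steps, which is the bound.\<close>

lemma cmp_sparse_leaves: "cmp (\<lambda>z. \<exists>x Orig. sparsifiable x Orig z) sparse_time sparse_leaves"
proof -
  let ?D = "\<lambda>z. \<exists>x Orig. sparsifiable x Orig z"
  define M where "M z = (length (snd (snd (fst z))) + 1) ^ 3 * (7 + 1) + 1"
    for z :: "(nat \<times> nat \<times> nat list) \<times> nat list list"
  have lenL: "pb ?D sparse_time (\<lambda>z. length (snd (snd (fst z))))"
  proof (rule pb_mono[OF pb_sz])
    fix z :: "(nat \<times> nat \<times> nat list) \<times> nat list list"
    show "length (snd (snd (fst z))) \<le> sz z"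
      using length_le_sz[of "snd (snd (fst z))"] sz_prod[of z] sz_prod[of "fst z"] sz_prod[of "snd (fst z)"] by linarith
  qed
  have "cmp ?D sparse_time (\<lambda>z. (wloop ^^ sparse_time z) (wstart z))"
  proof (rule cmp_while[where Ds = "\<lambda>_. True" and Bs = "\<lambda>_. 0" and cn = "\<lambda>q. fst (snd q) \<noteq> []"
        and S = "\<lambda>z. sz z + 2 * ((sparse_time z + 1) * (M z + 1) + 1) + 2"])
    show "cmp ?D sparse_time wstart" unfolding wstart_def by (intro cmp_basic)
    show "ptime wloop" by (rule ptime_wloop)
    show "ptime (\<lambda>q::wstate. fst (snd q) \<noteq> [])" by (intro cmp_not cmp_null cmp_basic)
    show "pb ?D sparse_time (\<lambda>z. sz z + 2 * ((sparse_time z + 1) * (M z + 1) + 1) + 2)"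
      unfolding M_def by (intro pb_intros lenL)
    show "pb ?D sparse_time sparse_time" by (rule pb_B)
    fix z i
    assume D: "?D z"
    then obtain x Orig where s: "sparsifiable x Orig z" by blast
    note run = sparse_run[OF s]
    show "fst (snd ((wloop ^^ i) (wstart z))) \<noteq> []" if "i < sparse_time z" by (rule run(2)[OF that])
    show "\<not> fst (snd ((wloop ^^ sparse_time z) (wstart z))) \<noteq> []" using run(3) by simp
    assume i: "i \<le> sparse_time z"
    interpret worklist "fst (fst z)" "snd (snd (fst z))" Orig x using s by (simp add: sparsifiable_def)
    let ?q = "(wloop ^^ i) (wstart z)"
    have r: "fst ?q = fst z" "OK (snd ?q)" "length (fst (snd ?q)) + length (snd (snd ?q)) \<le> i + 1"
      using run(4)[OF i] by blast+
    have szF: "sz F \<le> M z" if F: "good F" for F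
    proof -
      note gs = good_size[OF F]
      have "sz C \<le> 7" if "C \<in> set F" for C using gs that unfolding sz_nats by auto
      then have "sz F \<le> length F * (7 + 1) + 1" by (rule sz_list_le)
      also have "\<dots> \<le> M z" unfolding M_def using gs by (intro add_mono mult_mono) auto
      finally show ?thesis .
    qed
    have sl: "sz Fs \<le> (sparse_time z + 1) * (M z + 1) + 1"
      if "\<And>F. F \<in> set Fs \<Longrightarrow> good F" "length Fs \<le> sparse_time z + 1" for Fs
    proof -
      have "sz Fs \<le> length Fs * (M z + 1) + 1" using szF that(1) by (intro sz_list_le) blast
      also have "\<dots> \<le> (sparse_time z + 1) * (M z + 1) + 1" using that(2) by (intro add_mono mult_mono) auto
      finally show ?thesis .
    qed
    have "sz (fst (snd ?q)) \<le> (sparse_time z + 1) * (M z + 1) + 1"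
      "sz (snd (snd ?q)) \<le> (sparse_time z + 1) * (M z + 1) + 1"
      using r(2,3) i by (intro sl; auto simp: OK_def)+
    moreover have "sz (fst z) \<le> sz z" using sz_prod[of z] by simp
    ultimately show "sz ?q \<le> sz z + 2 * ((sparse_time z + 1) * (M z + 1) + 1) + 2"
      using sz_prod[of ?q] sz_prod[of "snd ?q"] unfolding r(1) mult_2 by (simp only: ac_simps)
  qed auto
  then show ?thesis unfolding sparse_leaves_def[abs_def] by (intro cmp_snd)
qed

section \<open>Deciding satisfiability with a program for the counting problem\<close>

type_synonym config =
  "icode list \<times> (bool \<times> (nat \<times> (nat list \<times> (nat list \<times> (nat \<times> nat) list list))))"

text \<open>All that depends on the solver \<open>A\<close> and on \<open>n\<close>, including the
  list of cuts and deletions to ask for, is data prepared beforehand, so the deciding program is the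
  same for all of them. Two sides of \<open>k\<close> colours and two special colours must fit into
  \<open>n\<close>, hence \<open>k\<close> is half of \<open>n - 2\<close>, rounded down.\<close>

definition config :: "program \<Rightarrow> bool \<Rightarrow> nat \<Rightarrow> nat \<Rightarrow> config" where
  "config A cp ph n = (map instr_code A, (cp, (ph, ([0..<(n - 2) div 2], ([0..<n],
     subseqs (query_items cp ((n - 2) div 2) n))))))"

definition leaf_groups :: "config \<times> (nat list \<times> nat list list) \<Rightarrow> nat list list list" where
  "leaf_groups y = deal (fst (snd (snd (snd (fst y))))) (snd (snd y))"

definition leaf_values :: "config \<times> (nat list \<times> nat list list) \<Rightarrow> choice list" where
  "leaf_values y = group_values (fst (snd (snd (snd (fst y))))) (leaf_groups y)"

definition leaf_queries :: "config \<times> (nat list \<times> nat list list) \<Rightarrow> nat list list" where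
  "leaf_queries y = (let ws = leaf_values y in let al = consistent_pairs (fst (snd y)) ws in
     map (\<lambda>Z. query_code (fst (snd (fst y))) [] (fst (snd (snd (fst y)))) (length (fst (snd (snd (snd (fst y))))))
       (fst (snd (snd (snd (snd (fst y)))))) ws al Z) (snd (snd (snd (snd (snd (fst y)))))))"

definition leaf_sat :: "config \<times> (nat list \<times> nat list list) \<Rightarrow> bool" where
  "leaf_sat y \<longleftrightarrow> signed_total (snd (snd (snd (snd (snd (fst y))))))
     (map (\<lambda>q. sim_result (fst (fst y), q)) (leaf_queries y)) \<noteq> 0"

text \<open>\<open>b\<close> covers the two exponential quantities of a leaf: the number of choices
  of a group and the time of the simulated solver.\<close>

definition leaf_ok :: "config \<times> (nat list \<times> nat list list) \<Rightarrow> nat \<Rightarrow> bool" where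
  "leaf_ok y b \<longleftrightarrow> (\<forall>g\<in>set (leaf_groups y). (\<forall>C\<in>set g. length C \<le> 3) \<and> 3 ^ length g \<le> b) \<and>
     (\<forall>q\<in>set (leaf_queries y). sim_halts (fst (fst y), q) \<and> sim_time (fst (fst y), q) \<le> b)"

text \<open>The least bound is only a parameter of the running time and never computed.\<close>

definition leaf_bound :: "config \<times> (nat list \<times> nat list list) \<Rightarrow> nat" where
  "leaf_bound y = (LEAST b. leaf_ok y b)"

lemma leaf_bound: "\<exists>b. leaf_ok y b \<Longrightarrow> leaf_ok y (leaf_bound y)"
  unfolding leaf_bound_def by (rule LeastI_ex)

lemma leaf_bound_le: "leaf_ok y b \<Longrightarrow> leaf_bound y \<le> b"
  unfolding leaf_bound_def by (rule Least_le)

lemma cmp_leaf_sat: "cmp (\<lambda>y. \<exists>b. leaf_ok y b) leaf_bound leaf_sat"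
proof -
  let ?D = "\<lambda>y. \<exists>b. leaf_ok y b"
  have gs: "cmp ?D leaf_bound leaf_groups"
    unfolding leaf_groups_def[abs_def] by (intro ptime_comp2[OF ptime_deal] cmp_fst cmp_snd cmp_id)
  have ws: "cmp ?D leaf_bound leaf_values" unfolding leaf_values_def[abs_def]
  proof (rule cmp_group_values[OF _ gs pb_B])
    show "cmp ?D leaf_bound (\<lambda>y. fst (snd (snd (snd (fst y)))))" by (intro cmp_fst cmp_snd cmp_id)
    show "(\<forall>C\<in>set g. length C \<le> 3) \<and> 3 ^ length g \<le> leaf_bound y"
      if D: "?D y" and g: "g \<in> set (leaf_groups y)" for y g
      using leaf_bound[OF D] g unfolding leaf_ok_def by blast
  qed
  have qs: "cmp ?D leaf_bound leaf_queries"
    unfolding leaf_queries_def[abs_def]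
  proof (rule cmp_let[OF ws], rule cmp_let)
    show "cmp (\<lambda>z. ?D (fst z) \<and> snd z = leaf_values (fst z)) (\<lambda>z. leaf_bound (fst z))
        (\<lambda>z. consistent_pairs (fst (snd (fst z))) (snd z))"
      by (intro ptime_comp2[OF ptime_consistent_pairs] cmp_fst cmp_snd cmp_id)
  qed (intro cmp_map cmp_query_code cmp_fst cmp_snd cmp_id cmp_length cmp_const)
  have "cmp ?D leaf_bound (\<lambda>y. map (\<lambda>q. sim_result (fst (fst y), q)) (leaf_queries y))"
  proof (rule cmp_map[OF qs], rule cmp_comp[OF cmp_sim_result])
    let ?E = "\<lambda>z. ?D (fst z) \<and> snd z \<in> set (leaf_queries (fst z))"
    show "cmp ?E (\<lambda>z. leaf_bound (fst z)) (\<lambda>z. (fst (fst (fst z)), snd z))"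
      by (intro cmp_pair cmp_fst cmp_snd cmp_id)
    have ok: "sim_halts (fst (fst (fst z)), snd z) \<and> sim_time (fst (fst (fst z)), snd z) \<le> leaf_bound (fst z)"
      if "?E z" for z
      using leaf_bound[of "fst z"] that unfolding leaf_ok_def by blast
    show "sim_halts (fst (fst (fst z)), snd z)" if "?E z" for z using ok[OF that] by blast
    show "pb ?E (\<lambda>z. leaf_bound (fst z)) (\<lambda>z. sim_time (fst (fst (fst z)), snd z))"
      by (rule pb_mono[OF pb_B]) (use ok in blast)
  qed
  then have "cmp ?D leaf_bound (\<lambda>y. signed_total (snd (snd (snd (snd (snd (fst y))))))
     (map (\<lambda>q. sim_result (fst (fst y), q)) (leaf_queries y)))"
    by (intro cmp_signed_total cmp_fst cmp_snd cmp_id)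
  then have "cmp ?D leaf_bound (\<lambda>y. \<not> signed_total (snd (snd (snd (snd (snd (fst y))))))
     (map (\<lambda>q. sim_result (fst (fst y), q)) (leaf_queries y)) = 0)"
    by (intro cmp_not cmp_eq cmp_const)
  then show ?thesis unfolding leaf_sat_def[abs_def] .
qed

definition sparse_input :: "(config \<times> (nat \<times> nat)) \<times> nat list \<Rightarrow> (nat \<times> nat \<times> nat list) \<times> nat list list" where
  "sparse_input z = ((fst (snd (fst z)), (snd (snd (fst z)), literals_of (parse (snd z)))),
     initial_formula (parse (snd z)))"

definition leaf_input :: "(config \<times> (nat \<times> nat)) \<times> nat list \<Rightarrow> nat list list \<Rightarrow> config \<times> (nat list \<times> nat list list)" where
  "leaf_input z F = (fst (fst z), (filter even (literals_of (parse (snd z))), F))"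

definition decide :: "(config \<times> (nat \<times> nat)) \<times> nat list \<Rightarrow> bool" where
  "decide z \<longleftrightarrow> (\<exists>F\<in>set (sparse_leaves (sparse_input z)). leaf_sat (leaf_input z F))"

text \<open>The literals are bounded for the sake of the parity computation in
  \<open>cmp_evens\<close>.\<close>

definition decide_ok :: "(config \<times> (nat \<times> nat)) \<times> nat list \<Rightarrow> nat \<Rightarrow> bool" where
  "decide_ok z b \<longleftrightarrow> (\<forall>l\<in>set (literals_of (parse (snd z))). l \<le> b) \<and>
     (\<exists>x Orig. sparsifiable x Orig (sparse_input z)) \<and> sparse_time (sparse_input z) \<le> b \<and>
     (\<forall>F\<in>set (sparse_leaves (sparse_input z)). leaf_ok (leaf_input z F) b)"

definition decide_bound :: "(config \<times> (nat \<times> nat)) \<times> nat list \<Rightarrow> nat" where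
  "decide_bound z = (LEAST b. decide_ok z b)"

lemma decide_bound: "\<exists>b. decide_ok z b \<Longrightarrow> decide_ok z (decide_bound z)"
  unfolding decide_bound_def by (rule LeastI_ex)

lemma decide_bound_le: "decide_ok z b \<Longrightarrow> decide_bound z \<le> b"
  unfolding decide_bound_def by (rule Least_le)

lemma cmp_decide: "cmp (\<lambda>z. \<exists>b. decide_ok z b) decide_bound decide"
proof -
  let ?D = "\<lambda>z. \<exists>b. decide_ok z b"
  have lit: "cmp ?D decide_bound (\<lambda>z. literals_of (parse (snd z)))"
    by (intro ptime_comp[OF ptime_literals_of] ptime_comp[OF ptime_parse] cmp_snd cmp_id)
  have ev: "cmp ?D decide_bound (\<lambda>z. filter even (literals_of (parse (snd z))))"
  proof (rule cmp_evens[OF lit pb_B])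
    show "l \<le> decide_bound z" if D: "?D z" and l: "l \<in> set (literals_of (parse (snd z)))" for z l
      using decide_bound[OF D] l unfolding decide_ok_def by blast
  qed
  have sp: "cmp ?D decide_bound (\<lambda>z. sparse_leaves (sparse_input z))"
  proof (rule cmp_comp[OF cmp_sparse_leaves])
    show "cmp ?D decide_bound sparse_input" unfolding sparse_input_def[abs_def]
      by (intro cmp_pair lit ptime_comp[OF ptime_initial_formula] ptime_comp[OF ptime_parse] cmp_fst cmp_snd cmp_id)
    show "\<exists>x Orig. sparsifiable x Orig (sparse_input z)" if D: "?D z" for z
      using decide_bound[OF D] unfolding decide_ok_def by blast
    have "sparse_time (sparse_input z) \<le> decide_bound z" if D: "?D z" for z
      using decide_bound[OF D] unfolding decide_ok_def by blast
    then show "pb ?D decide_bound (\<lambda>z. sparse_time (sparse_input z))" by (rule pb_mono[OF pb_B])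
  qed
  show ?thesis unfolding decide_def[abs_def]
  proof (rule cmp_Bex[OF sp], rule cmp_comp[OF cmp_leaf_sat])
    let ?E = "\<lambda>z. ?D (fst z) \<and> snd z \<in> set (sparse_leaves (sparse_input (fst z)))"
    show "cmp ?E (\<lambda>z. decide_bound (fst z)) (\<lambda>z. leaf_input (fst z) (snd z))"
      unfolding leaf_input_def by (intro cmp_pair cmp_fst_ctx[OF ev] cmp_fst cmp_snd cmp_id)
    have ok: "leaf_ok (leaf_input (fst z) (snd z)) (decide_bound (fst z))" if "?E z" for z
      using decide_bound[of "fst z"] that unfolding decide_ok_def by blast
    show "\<exists>b. leaf_ok (leaf_input (fst z) (snd z)) b" if "?E z" for z using ok[OF that] by blast
    show "pb ?E (\<lambda>z. decide_bound (fst z)) (\<lambda>z. leaf_bound (leaf_input (fst z) (snd z)))"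
      by (rule pb_mono[OF pb_B]) (rule leaf_bound_le[OF ok])
  qed
qed

section \<open>Solvers and the decision procedure they induce\<close>

definition solver :: "program \<Rightarrow> bool \<Rightarrow> nat \<Rightarrow> nat \<Rightarrow> (nat \<Rightarrow> real) \<Rightarrow> bool" where
  "solver A cp ph n T \<longleftrightarrow> (if cp then computes_cpIndSub_in_time A (parameter_of ph) n T
     else computes_IndSub_in_time A (parameter_of ph) n T)"

lemma length_vertex_list: "length (vertex_list k cs ws) \<le> length cs * (length ws + 1)"
proof -
  have "length (color_domain k ws c) \<le> length ws + 1" for c
    using length_filter_le[of _ ws] by (auto simp: color_domain_def le_SucI)
  then have "length (vertex_list k (c # cs) ws) \<le> length ws + 1 + length (vertex_list k cs ws)" for c cs
    by (simp add: vertex_list_def)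
  then show ?thesis
  proof (induction cs)
    case (Cons c cs)
    from Cons.IH[OF Cons.prems] Cons.prems[of c cs] show ?case by (simp only: length_Cons mult_Suc)
  qed (simp add: vertex_list_def)
qed

lemma card_the_graph: "card (verts (the_graph ph k n ws al Z)) \<le> n * (length ws + 1)"
proof -
  have "card (verts (the_graph ph k n ws al Z)) = length (query_verts Z (vertex_list k [0..<n] ws))"
    by (simp add: query_graph_def graph_of_list_def)
  also have "\<dots> \<le> length (vertex_list k [0..<n] ws)" unfolding query_verts_def by (rule length_filter_le)
  finally show ?thesis using length_vertex_list[of k "[0..<n]" ws] by simp
qed

lemma solver_plain:
  assumes "solver A False ph n T"
  shows "outputs no_oracle A (encode_graph (the_graph ph k n ws al Z)) (ind_sub (parameter_of ph) n (the_graph ph k n ws al Z))"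
    "real (run_time no_oracle A (encode_graph (the_graph ph k n ws al Z))) \<le> T (card (verts (the_graph ph k n ws al Z)))"
proof -
  have "computes_IndSub_in_time A (parameter_of ph) n T" using assms by (simp add: solver_def)
  note A = this[unfolded computes_IndSub_in_time_def, rule_format, OF query_graph_input]
  show "outputs no_oracle A (encode_graph (the_graph ph k n ws al Z)) (ind_sub (parameter_of ph) n (the_graph ph k n ws al Z))"
    by (rule A[THEN conjunct1])
  show "real (run_time no_oracle A (encode_graph (the_graph ph k n ws al Z))) \<le> T (card (verts (the_graph ph k n ws al Z)))"
    by (rule A[THEN conjunct2, THEN conjunct2])
qed

lemma solver_colored:
  fixes ws :: "choice list" and al :: "(choice \<times> choice) list"
  assumes A: "solver A True ph n T" and Z: "Z \<in> set (subseqs (cut_items k))" and n: "Suc (k + k) < n"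
  defines "I \<equiv> (the_clique n, the_graph ph k n ws al Z, the_coloring k n ws)"
  shows "outputs no_oracle A (encode_colored_graph I)
      (cp_ind_sub (parameter_of ph) (the_clique n) (the_graph ph k n ws al Z) (the_coloring k n ws))"
    "real (run_time no_oracle A (encode_colored_graph I)) \<le> T (card (verts (the_graph ph k n ws al Z)))"
proof -
  have "input_colored_graph I" unfolding I_def by (rule the_colored_input[OF Z n])
  moreover have "card (verts (the_clique n)) = n" by (simp add: graph_of_list_def)
  ultimately have I: "input_colored_graph I \<and> card (verts (the_clique n)) = n" ..
  have "computes_cpIndSub_in_time A (parameter_of ph) n T" using A by (simp add: solver_def)
  note A' = this[unfolded computes_cpIndSub_in_time_def, rule_format, OF I[unfolded I_def], folded I_def]
  show "outputs no_oracle A (encode_colored_graph I)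
      (cp_ind_sub (parameter_of ph) (the_clique n) (the_graph ph k n ws al Z) (the_coloring k n ws))"
    by (rule A'[THEN conjunct1])
  show "real (run_time no_oracle A (encode_colored_graph I)) \<le> T (card (verts (the_graph ph k n ws al Z)))"
    by (rule A'[THEN conjunct2, THEN conjunct2])
qed

context
  fixes A cp ph n T k
  assumes A: "solver A cp ph n T" and n: "4 \<le> n" and k_def: "k = (n - 2) div 2"
begin

lemma k_bounds: "0 < k" "Suc (k + k) < n"
  using n unfolding k_def by auto

lemma leaf_input_simps:
  "leaf_groups (config A cp ph n, (ev, F)) = deal [0..<k] F"
  "leaf_values (config A cp ph n, (ev, F)) = group_values [0..<k] (deal [0..<k] F)"
  "leaf_queries (config A cp ph n, (ev, F)) =
    (let ws = group_values [0..<k] (deal [0..<k] F) in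
     map (query_code cp [] ph k [0..<n] ws (consistent_pairs ev ws)) (subseqs (query_items cp k n)))"
  by (simp_all add: leaf_groups_def leaf_values_def leaf_queries_def config_def k_def Let_def)

lemma query_time:
  assumes "q \<in> set (leaf_queries (config A cp ph n, (ev, F)))"
  shows "sim_halts (map instr_code A, q)"
    "\<exists>N\<le>n * (length (leaf_values (config A cp ph n, (ev, F))) + 1). real (sim_time (map instr_code A, q)) \<le> T N"
proof -
  define ws where "ws = group_values [0..<k] (deal [0..<k] F)"
  define al where "al = consistent_pairs ev ws"
  obtain Z where Z: "Z \<in> set (subseqs (query_items cp k n))" "q = query_code cp [] ph k [0..<n] ws al Z"
    using assms unfolding leaf_input_simps Let_def ws_def al_def by auto
  let ?G = "the_graph ph k n ws al Z"
  have "\<exists>y. outputs no_oracle A q y \<and> real (run_time no_oracle A q) \<le> T (card (verts ?G))"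
  proof (cases cp)
    case True
    have Zc: "Z \<in> set (subseqs (cut_items k))" using Z(1) True by (simp add: query_items_def)
    have q: "q = encode_colored_graph (the_clique n, ?G, the_coloring k n ws)"
      using query_code_colored[OF Zc] Z(2) True by simp
    have "solver A True ph n T" using A True by simp
    note sc = solver_colored[OF this Zc k_bounds(2), where ws = ws and al = al]
    show ?thesis unfolding q using sc by blast
  next
    case False
    have q: "q = encode_graph ?G" using query_code_plain Z(2) False by simp
    have "solver A False ph n T" using A False by simp
    note sp = solver_plain[OF this, where k = k and ws = ws and al = al and Z = Z]
    show ?thesis unfolding q using sp by blast
  qed
  then obtain y where y: "outputs no_oracle A q y" "real (run_time no_oracle A q) \<le> T (card (verts ?G))" by blast
  show "sim_halts (map instr_code A, q)" by (rule sim_correct(1)[OF y(1)])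
  show "\<exists>N\<le>n * (length (leaf_values (config A cp ph n, (ev, F))) + 1). real (sim_time (map instr_code A, q)) \<le> T N"
    unfolding sim_correct(2)[OF y(1)] leaf_input_simps(2) ws_def[symmetric]
    using y(2) card_the_graph by blast
qed

lemma leaf_sat_iff:
  assumes F: "\<And>C. C \<in> set F \<Longrightarrow> distinct C \<and> set C \<subseteq> set L"
  shows "leaf_sat (config A cp ph n, (filter even L, F)) \<longleftrightarrow> (\<exists>a. hits (truth a) (SF F))"
proof -
  define ws where "ws = group_values [0..<k] (deal [0..<k] F)"
  define al where "al = consistent_pairs (filter even L) ws"
  define orc where "orc q = sim_result (map instr_code A, q)" for q
  have "distinct C" if g: "g \<in> set (deal [0..<k] F)" and C: "C \<in> set g" for g C
  proof -
    have "C \<in> \<Union> (set ` set (deal [0..<k] F))" using g C by blast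
    then show ?thesis using deal(3)[of "[0..<k]" F] k_bounds(1) F by simp
  qed
  then have ws: "distinct ws" unfolding ws_def by (rule group_values_distinct)
  have "signed_total (subseqs (query_items cp k n))
      (map orc (map (query_code cp [] ph k [0..<n] ws al) (subseqs (query_items cp k n)))) =
    card (cliques_of k (set al) ws)"
  proof (rule queries_correct[OF k_bounds ws])
    show "a = b" if "(a, b) \<in> set al" "fst a = fst b" for a b
      using that unfolding al_def consistent_pairs_def by auto
    show "orc ([] @ encode_graph (the_graph ph k n ws al Z)) = ind_sub (parameter_of ph) n (the_graph ph k n ws al Z)"
      if cp: "\<not> cp" for Z
      using sim_correct(3)[OF solver_plain(1)] A cp unfolding orc_def by simp
    show "orc (encode_colored_graph (the_clique n, the_graph ph k n ws al Z, the_coloring k n ws)) =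
        cp_ind_sub (parameter_of ph) (the_clique n) (the_graph ph k n ws al Z) (the_coloring k n ws)"
      if cp: "cp" and Z: "Z \<in> set (subseqs (cut_items k))" for Z
      using sim_correct(3)[OF solver_colored(1)[OF _ Z k_bounds(2)]] A cp unfolding orc_def by simp
  qed
  moreover have "leaf_sat (config A cp ph n, (filter even L, F)) \<longleftrightarrow> signed_total (subseqs (query_items cp k n))
      (map orc (map (query_code cp [] ph k [0..<n] ws al) (subseqs (query_items cp k n)))) \<noteq> 0"
    unfolding leaf_sat_def leaf_input_simps(3) Let_def ws_def al_def orc_def by (simp add: config_def k_def)
  \<comment> \<open>Finiteness excludes an infinite set with cardinality 0, so a nonzero count means
    that a clique exists.\<close>
  moreover have "finite (cliques_of k (set al) ws)"
    unfolding cliques_of_def by (rule finite_subset[of _ "PiE {..<k} (\<lambda>i. {w \<in> set ws. fst w = i})"])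
      (blast, intro finite_PiE, auto)
  ultimately have "leaf_sat (config A cp ph n, (filter even L, F)) \<longleftrightarrow> cliques_of k (set al) ws \<noteq> {}"
    by simp
  then show ?thesis
    using leaf_cliques[of k F L] k_bounds(1) F unfolding al_def ws_def by simp
qed

end

lemma sparse_leaves_good:
  assumes z: "sparsifiable x Orig z" and F: "F \<in> set (sparse_leaves z)"
  defines "th \<equiv> fst (fst z)" and "L \<equiv> snd (snd (fst z))"
  shows "length F \<le> 1 + length L * (1 + th + 2 * th * th)"
    "\<And>C. C \<in> set F \<Longrightarrow> distinct C \<and> set C \<subseteq> set L \<and> length C \<le> 3"
proof -
  interpret worklist th L Orig x using z by (simp add: sparsifiable_def th_def L_def)
  have "OK (snd ((wloop ^^ sparse_time z) (wstart z)))"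
    using sparse_run(4)[OF z order_refl] unfolding th_def L_def by blast
  then have g: "good F" "pick th (2 * th * th) L F = []"
    using F unfolding OK_def sparse_leaves_def by blast+
  show "length F \<le> 1 + length L * (1 + th + 2 * th * th)" by (rule leaf_size[OF g])
  show "distinct C \<and> set C \<subseteq> set L \<and> length C \<le> 3" if "C \<in> set F" for C
    using g(1) good_size[OF g(1)] canonD[OF _ L] that unfolding good_formula_def canonical_def by blast
qed

lemma length_group_values:
  assumes "\<And>g. g \<in> set gs \<Longrightarrow> (\<forall>C\<in>set g. length C \<le> 3) \<and> length g \<le> m"
  shows "length (group_values [0..<k] gs) \<le> k * 3 ^ m"
proof -
  have "length (product_lists (nthd [] gs i)) \<le> 3 ^ m" for i
  proof -
    have "nthd [] gs i \<in> set gs \<or> nthd [] gs i = []" by (simp add: nthd_def)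
    then have g: "(\<forall>C\<in>set (nthd [] gs i). length C \<le> 3) \<and> length (nthd [] gs i) \<le> m"
      using assms by (metis empty_iff list.set(1) list.size(3) zero_le)
    then have "length (product_lists (nthd [] gs i)) \<le> 3 ^ length (nthd [] gs i)"
      by (intro length_product_lists_le) blast
    also have "\<dots> \<le> 3 ^ m" using g by (intro power_increasing) auto
    finally show ?thesis .
  qed
  then have "length (group_values [0..<Suc k] gs) \<le> length (group_values [0..<k] gs) + 3 ^ m" for k
    by (simp add: group_values_def)
  note step = this
  show ?thesis
  proof (induction k)
    case (Suc k)
    then show ?case using step[of k] by (simp only: mult_Suc)
  qed (simp add: group_values_def)
qed

lemma literals_of_cnf:
  assumes F: "three_cnf n F"
  defines "L \<equiv> literals_of (parse (encode_cnf n F))"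
  shows "\<And>l. l \<in> set L \<Longrightarrow> l < 2 * n" "length L \<le> 2 * n"
proof -
  show lt: "l < 2 * n" if l: "l \<in> set L" for l
  proof -
    obtain C p where p: "C \<in> set F" "p \<in> set C" "l = lit_code p"
      using l unfolding L_def literals_of_def parse_encode by auto
    have "fst p < n" using F p unfolding three_cnf_def by (cases p) auto
    then show ?thesis unfolding p(3) lit_code_def by (cases "snd p") auto
  qed
  have "distinct L" unfolding L_def literals_of_def by simp
  then have "length L = card (set L)" by (simp add: distinct_card)
  also have "\<dots> \<le> card {..<2 * n}" by (intro card_mono) (use lt in auto)
  finally show "length L \<le> 2 * n" by simp
qed

text \<open>The condition under which \<open>x\<close> bounds the growth of a branching with gains 1
  and \<open>2 * th * th\<close>.\<close>

definition spread :: "nat \<Rightarrow> real \<Rightarrow> bool" where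
  "spread th x \<longleftrightarrow> 1 \<le> th \<and> 1 \<le> x \<and> 1 / x + 1 / x ^ (2 * th * th) \<le> 1"

context
  fixes c :: config and th x n F z
  assumes th: "spread th x" and F: "three_cnf n F"
  defines "z \<equiv> ((c, (th, 2 * th * th)), encode_cnf n F)"
begin

lemma sparsifiable_input:
  "sparsifiable x (SF (initial_formula (map (map lit_code) F))) (sparse_input z)"
  unfolding sparsifiable_def sparse_input_def z_def fst_conv snd_conv parse_encode
proof (intro conjI)
  show "worklist th (literals_of (map (map lit_code) F)) x"
    using th unfolding spread_def by unfold_locales (auto simp: literals_of_def)
  show "good_formula th (literals_of (map (map lit_code) F)) (SF (initial_formula (map (map lit_code) F)))
      (initial_formula (map (map lit_code) F))"
    by (rule initial_formula) (use F th in \<open>auto simp: three_cnf_def spread_def\<close>)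
qed simp

lemma decide_iff:
  assumes leaf: "\<And>G ev. (\<And>C. C \<in> set G \<Longrightarrow> distinct C \<and> set C \<subseteq> set (literals_of (parse (encode_cnf n F)))) \<Longrightarrow>
    leaf_sat (c, (filter even (literals_of (parse (encode_cnf n F))), G)) \<longleftrightarrow> (\<exists>a. hits (truth a) (SF G))"
  shows "decide z \<longleftrightarrow> satisfiable F"
proof -
  note sp = sparsifiable_input
  have "leaf_sat (leaf_input z G) \<longleftrightarrow> (\<exists>a. hits (truth a) (SF G))" if G: "G \<in> set (sparse_leaves (sparse_input z))" for G
  proof -
    have "leaf_input z G = (c, (filter even (literals_of (parse (encode_cnf n F))), G))"
      by (simp add: leaf_input_def z_def)
    moreover have "distinct C \<and> set C \<subseteq> set (literals_of (parse (encode_cnf n F)))" if "C \<in> set G" for C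
      using sparse_leaves_good(2)[OF sp G that] by (simp add: sparse_input_def z_def)
    ultimately show ?thesis using leaf by simp
  qed
  then have "decide z \<longleftrightarrow> (\<exists>a. \<exists>G\<in>set (sparse_leaves (sparse_input z)). hits (truth a) (SF G))"
    unfolding decide_def by blast
  also have "\<dots> \<longleftrightarrow> (\<exists>a. hits (truth a) (SF (snd (sparse_input z))))"
    using sparse_run(5)[OF sp] by simp
  also have "snd (sparse_input z) = initial_formula (map (map lit_code) F)"
    by (simp add: sparse_input_def z_def parse_encode)
  also have "(\<exists>a. hits (truth a) (SF (initial_formula (map (map lit_code) F)))) \<longleftrightarrow>
      (\<exists>a. hits (truth a) (SF (map (map lit_code) F)))"
  proof -
    have "hits X (SF (initial_formula (map (map lit_code) F))) \<longleftrightarrow> hits X (SF (map (map lit_code) F))" for X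
      by (rule initial_formula(2)[OF _ order_refl]) (use F in \<open>auto simp: three_cnf_def\<close>)
    then show ?thesis by simp
  qed
  also have "\<dots> \<longleftrightarrow> satisfiable F" by (rule satisfiable_hits[symmetric])
  finally show ?thesis .
qed

text \<open>There are at most \<open>2 * n\<close> literals over \<open>n\<close> variables, which
  turns the exponent \<open>6 * th\<close> per literal into \<open>12 * th * n\<close>.\<close>

lemma decide_ok:
  assumes lit: "2 * n \<le> b" and time: "2 * x ^ (12 * th * n) \<le> real b"
    and leaf: "\<And>G ev. length G \<le> 1 + 2 * n * (1 + th + 2 * th * th) \<Longrightarrow> (\<And>C. C \<in> set G \<Longrightarrow> length C \<le> 3) \<Longrightarrow>
      leaf_ok (c, (ev, G)) b"
  shows "decide_ok z b"
  unfolding decide_ok_def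
proof (intro conjI ballI exI)
  note sp = sparsifiable_input
  let ?L = "literals_of (parse (encode_cnf n F))"
  have L: "snd (snd (fst (sparse_input z))) = ?L" "fst (fst (sparse_input z)) = th"
    by (simp_all add: sparse_input_def z_def)
  note lits = literals_of_cnf[OF F]
  show "l \<le> b" if "l \<in> set (literals_of (parse (snd z)))" for l
    using lits(1)[of l] that lit by (simp add: z_def)
  show "sparsifiable x (SF (initial_formula (map (map lit_code) F))) (sparse_input z)" by (rule sp)
  have "real (sparse_time (sparse_input z)) \<le> 2 * x ^ (6 * th * length ?L)"
    using sparse_run(1)[OF sp] unfolding L .
  also have "\<dots> \<le> 2 * x ^ (12 * th * n)"
  proof -
    have "6 * th * length ?L \<le> 6 * th * (2 * n)" using lits(2) by (rule mult_left_mono) simp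
    then show ?thesis using th by (intro mult_left_mono power_increasing) (auto simp: spread_def)
  qed
  finally show "sparse_time (sparse_input z) \<le> b" using time by simp
  fix G assume G: "G \<in> set (sparse_leaves (sparse_input z))"
  have "length ?L * (1 + th + 2 * th * th) \<le> 2 * n * (1 + th + 2 * th * th)"
    using lits(2) by (rule mult_right_mono) simp
  then have "length G \<le> 1 + 2 * n * (1 + th + 2 * th * th)"
    using sparse_leaves_good(1)[OF sp G] unfolding L by linarith
  then have "leaf_ok (c, (filter even ?L, G)) b"
    using sparse_leaves_good(2)[OF sp G] by (intro leaf) auto
  then show "leaf_ok (leaf_input z G) b" by (simp add: leaf_input_def z_def)
qed

end

text \<open>A group has at most \<open>Suc (s div k)\<close> clauses and so at most 3 to that power
  many choices; together with one dummy per colour this bounds the number of vertices of every query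
  graph. \<open>T\<close> is required to be small at all sizes up to there, as it need not be
  monotone.\<close>

lemma solver_leaf_ok:
  assumes A: "solver A cp ph n T" and n: "4 \<le> n" and k_def: "k = (n - 2) div 2"
    and G: "length G \<le> s" "\<And>C. C \<in> set G \<Longrightarrow> length C \<le> 3"
    and three: "3 ^ Suc (s div k) \<le> b"
    and T: "\<And>N. N \<le> n * (k * 3 ^ Suc (s div k) + 1) \<Longrightarrow> T N \<le> real b"
  shows "leaf_ok (config A cp ph n, (ev, G)) b"
proof -
  note simps = leaf_input_simps[OF A n k_def]
  have k: "0 < k" by (rule k_bounds(1)[OF A n k_def])
  have g: "(\<forall>C\<in>set g. length C \<le> 3) \<and> length g \<le> Suc (s div k)" if g: "g \<in> set (deal [0..<k] G)" for g
  proof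
    have "\<Union> (set ` set (deal [0..<k] G)) = set G" using deal(3)[of "[0..<k]" G] k by simp
    then show "\<forall>C\<in>set g. length C \<le> 3" using G(2) g by blast
    have "length g \<le> Suc (length G div k)" using deal(2)[of "[0..<k]" g G] g k by simp
    then show "length g \<le> Suc (s div k)" using div_le_mono[OF G(1), of k] by linarith
  qed
  have "length (leaf_values (config A cp ph n, (ev, G))) \<le> k * 3 ^ Suc (s div k)"
    unfolding simps by (rule length_group_values[OF g])
  then have N: "n * (length (leaf_values (config A cp ph n, (ev, G))) + 1) \<le> n * (k * 3 ^ Suc (s div k) + 1)"
    by (intro mult_left_mono add_right_mono) auto
  have code: "fst (fst (config A cp ph n, (ev, G))) = map instr_code A" by (simp add: config_def)
  show ?thesis unfolding leaf_ok_def code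
  proof (intro conjI ballI)
    fix g assume "g \<in> set (leaf_groups (config A cp ph n, (ev, G)))"
    then have gs: "(\<forall>C\<in>set g. length C \<le> 3) \<and> length g \<le> Suc (s div k)" unfolding simps by (rule g)
    show "length C \<le> 3" if "C \<in> set g" for C using gs that by blast
    have "(3::nat) ^ length g \<le> 3 ^ Suc (s div k)" using gs by (intro power_increasing) auto
    then show "3 ^ length g \<le> b" using three by linarith
  next
    fix q assume q: "q \<in> set (leaf_queries (config A cp ph n, (ev, G)))"
    show "sim_halts (map instr_code A, q)" by (rule query_time(1)[OF A n k_def q])
    obtain N' where "N' \<le> n * (length (leaf_values (config A cp ph n, (ev, G))) + 1)"
      "real (sim_time (map instr_code A, q)) \<le> T N'"
      using query_time(2)[OF A n k_def q] by blast
    then have "real (sim_time (map instr_code A, q)) \<le> real b" using T[of N'] N by linarith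
    then show "sim_time (map instr_code A, q) \<le> b" by simp
  qed
qed

section \<open>The running time\<close>

text \<open>
  With \<open>x = 2 powr (\<epsilon> / (12 * th))\<close> the sparsification takes \<open>2 * x ^ (12 * th * n) = 2 * 2 powr (\<epsilon> * n)\<close>
  steps.
\<close>

lemma spread_exists:
  assumes e: "0 < (e::real)"
  shows "\<exists>th. spread th (2 powr (e / (12 * real th)))"
proof -
  define c where "c = e * ln 2 / 12"
  have c: "0 < c" using e by (simp add: c_def)
  \<comment> \<open>\<open>c \<le> th\<close> gives \<open>u \<le> 1\<close>, and
    \<open>1 / c ^ 3 \<le> th\<close> is what makes the quadratic term of \<open>exp y\<close> reach
    \<open>2 / u\<close>.\<close>
  define th where "th = nat \<lceil>max c (1 / c ^ 3)\<rceil> + 1"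
  have th: "c \<le> real th" "1 / c ^ 3 \<le> real th" "1 \<le> th" unfolding th_def by linarith+
  define u where "u = c / real th"
  have u: "0 < u" "u \<le> 1" using th c by (auto simp: u_def)
  have x: "2 powr (e / (12 * real th)) = exp u" by (simp add: powr_def u_def c_def)
  have "1 \<le> (1 + u) * (1 - u / 2)"
  proof -
    have "u * u \<le> u * 1" using u by (intro mult_left_mono) auto
    then show ?thesis by (simp add: algebra_simps)
  qed
  then have "1 / (1 + u) \<le> 1 - u / 2" using u by (simp add: field_simps)
  moreover have "1 / exp u \<le> 1 / (1 + u)" using u exp_ge_add_one_self[of u] by (intro divide_left_mono) auto
  \<comment> \<open>The slack \<open>u / 2\<close> is what the second summand may use up.\<close>
  ultimately have 1: "1 / exp u \<le> 1 - u / 2" by linarith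
  define y where "y = 2 * real th * c"
  have y0: "0 \<le> y" using c by (simp add: y_def)
  have pow: "exp u ^ (2 * th * th) = exp y"
    using th(3) by (simp add: exp_of_nat_mult[symmetric] y_def u_def)
  have "2 / u \<le> y\<^sup>2 / 2"
  proof -
    have "1 \<le> c ^ 3 * real th" using th(2) c by (simp add: field_simps)
    then have "real th * 1 \<le> real th * (c ^ 3 * real th)" by (intro mult_left_mono) auto
    then show ?thesis using c th(3) by (simp add: u_def y_def field_simps power2_eq_square power3_eq_cube)
  qed
  also have "\<dots> \<le> exp y" using exp_lower_Taylor_quadratic[OF y0] y0 by linarith
  finally have "1 / exp y \<le> 1 / (2 / u)" using u by (intro divide_left_mono) auto
  then have "1 / exp y \<le> u / 2" by simp
  then have "1 / exp u + 1 / exp u ^ (2 * th * th) \<le> 1" using 1 unfolding pow by linarith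
  then have "spread th (exp u)" using th(3) u by (simp add: spread_def)
  then show ?thesis using x by metis
qed

text \<open>The finitely many exceptional values are absorbed into the constant;
  \<open>real n + 1\<close> keeps the base at least 1, also for \<open>n = 0\<close>.\<close>

lemma bigo_powr_bound:
  assumes "T \<in> O(\<lambda>n. real n powr a)" "0 \<le> a"
  shows "\<exists>C\<ge>0. \<forall>n. T n \<le> C * (real n + 1) powr a"
proof -
  obtain c where c: "0 < c" "eventually (\<lambda>n. norm (T n) \<le> c * norm (real n powr a)) at_top"
    using assms(1) by (elim landau_o.bigE)
  then obtain m where m: "\<And>n. m \<le> n \<Longrightarrow> \<bar>T n\<bar> \<le> c * (real n powr a)"
    by (auto simp: eventually_at_top_linorder)
  let ?S = "\<Sum>i<m. \<bar>T i\<bar>"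
  have S: "0 \<le> ?S" by (intro sum_nonneg) auto
  have "T n \<le> (c + ?S) * (real n + 1) powr a" for n
  proof (cases "m \<le> n")
    case True
    have "T n \<le> c * (real n powr a)" using m[OF True] by linarith
    also have "\<dots> \<le> (c + ?S) * (real n + 1) powr a"
      using c(1) S assms(2) by (intro mult_mono powr_mono2) auto
    finally show ?thesis .
  next
    case False
    then have "T n \<le> ?S" using member_le_sum[of n "{..<m}" "\<lambda>i. \<bar>T i\<bar>"] by force
    also have "\<dots> \<le> (c + ?S) * 1" using c(1) by simp
    also have "\<dots> \<le> (c + ?S) * (real n + 1) powr a"
      using c(1) S assms(2) by (intro mult_left_mono ge_one_powr_ge_zero) auto
    finally show ?thesis .
  qed
  then show ?thesis using c(1) S by (intro exI[of _ "c + ?S"]) auto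
qed

text \<open>One step reads at most one input position, so the map from steps to positions covers the
  input.\<close>

lemma reads_whole_input_time:
  assumes "reads_whole_input P x" shows "length x \<le> run_time no_oracle P x"
proof -
  define addr where "addr t = (case P ! pc (conf_at no_oracle P x t) of
    Input r s \<Rightarrow> reg (conf_at no_oracle P x t) s | _ \<Rightarrow> 0)" for t
  have "{..<length x} \<subseteq> addr ` {..<run_time no_oracle P x}"
  proof
    fix i assume "i \<in> {..<length x}"
    then obtain t r s where t: "t < run_time no_oracle P x" "P ! pc (conf_at no_oracle P x t) = Input r s"
      "reg (conf_at no_oracle P x t) s = i"
      using assms unfolding reads_whole_input_def by blast
    have "addr t = i" using t by (simp add: addr_def)
    then show "i \<in> addr ` {..<run_time no_oracle P x}" using t(1) by auto
  qed
  from card_mono[OF _ this] card_image_le[of "{..<run_time no_oracle P x}" addr] show ?thesis by simp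
qed

text \<open>The edgeless graph on \<open>m\<close> vertices has an encoding of more than
  \<open>m * m\<close> words, all of which must be read.\<close>

lemma solver_quadratic:
  assumes A: "solver A cp ph n T" and n: "0 < n"
  shows "real m ^ 2 \<le> T m"
proof -
  let ?G = "({..<m}, {}) :: nat graph" and ?H = "({..<n}, {}) :: nat graph"
  have G: "input_graph ({..<j}, {} :: nat set set)" for j by (auto simp: input_graph_def simple_graph_def)
  have len: "length (encode_graph ?G) = Suc (m * m)"
    by (simp add: encode_graph_def length_concat comp_def sum_list_triv)
  show ?thesis
  proof (cases cp)
    case True
    have "input_colored_graph (?H, ?G, \<lambda>_. 0) \<and> card (verts ?H) = n"
      using n G by (auto simp: input_colored_graph_def graph_hom_def)
    moreover have "computes_cpIndSub_in_time A (parameter_of ph) n T" using A True by (simp add: solver_def)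
    ultimately have "reads_whole_input A (encode_colored_graph (?H, ?G, \<lambda>_. 0))"
      "real (run_time no_oracle A (encode_colored_graph (?H, ?G, \<lambda>_. 0))) \<le> T (card (verts ?G))"
      unfolding computes_cpIndSub_in_time_def by blast+
    moreover have "m * m \<le> length (encode_colored_graph (?H, ?G, \<lambda>_. 0))"
      using len by (simp add: encode_colored_graph_def)
    ultimately show ?thesis
      using reads_whole_input_time[of A "encode_colored_graph (?H, ?G, \<lambda>_. 0)"]
      by (simp add: power2_eq_square flip: of_nat_mult)
  next
    case False
    have "computes_IndSub_in_time A (parameter_of ph) n T" using A False by (simp add: solver_def)
    then have "reads_whole_input A (encode_graph ?G)"
      "real (run_time no_oracle A (encode_graph ?G)) \<le> T (card (verts ?G))"
      unfolding computes_IndSub_in_time_def using G by blast+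
    then show ?thesis
      using reads_whole_input_time[of A "encode_graph ?G"] len
      by (simp add: power2_eq_square flip: of_nat_mult)
  qed
qed

text \<open>Reading a graph takes quadratic time, which excludes small exponents.\<close>

lemma solver_exponent:
  assumes A: "solver A cp ph n T" and n: "0 < n" and T: "T \<in> O(\<lambda>n. real n powr a)" and a: "0 \<le> a"
  shows "2 \<le> a"
proof (rule ccontr)
  assume "\<not> 2 \<le> a"
  then have a2: "0 < 2 - a" by simp
  obtain C where C: "0 \<le> C" "\<And>n. T n \<le> C * (real n + 1) powr a" using bigo_powr_bound[OF T a] by blast
  \<comment> \<open>\<open>m\<close> is chosen such that its power \<open>2 - a\<close> reaches
    \<open>4 * C + 1\<close>, while the estimate below allows at most \<open>4 * C\<close>; the
    factor 4 bounds \<open>2 powr a\<close>.\<close>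
  let ?D = "4 * C + 1"
  define m where "m = nat \<lceil>?D powr (1 / (2 - a))\<rceil> + 1"
  have m: "?D powr (1 / (2 - a)) \<le> real m" "1 \<le> m" unfolding m_def by linarith+
  have "(real m) ^ 2 \<le> C * (real m + 1) powr a" using solver_quadratic[OF A n, of m] C(2)[of m] by linarith
  also have "\<dots> \<le> C * (2 * real m) powr a" using C(1) m(2) a by (intro mult_left_mono powr_mono2) auto
  also have "\<dots> = C * 2 powr a * real m powr a" by (simp add: powr_mult)
  also have "\<dots> \<le> C * 4 * real m powr a"
  proof -
    have "2 powr a \<le> 2 powr (2::real)" using a2 by (intro powr_mono) auto
    then show ?thesis using C(1) by (intro mult_right_mono mult_left_mono) auto
  qed
  finally have "real m ^ 2 / real m powr a \<le> 4 * C" using m(2) by (simp add: field_simps)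
  moreover have "real m ^ 2 / real m powr a = real m powr (2 - a)" using m(2) by (simp add: powr_diff)
  moreover have "?D \<le> real m powr (2 - a)"
  proof -
    have "?D = (?D powr (1 / (2 - a))) powr (2 - a)" using C(1) a2 by (simp add: powr_powr)
    also have "\<dots> \<le> real m powr (2 - a)" using m(1) a2 by (intro powr_mono2) auto
    finally show ?thesis .
  qed
  ultimately show False by linarith
qed

text \<open>The base 3 is replaced by \<open>4 = 2 powr 2\<close>. The factor 16 pays for the
  successor and for the summand 1 in the clause count.\<close>

lemma group_power_bound:
  fixes b n k :: nat
  assumes k: "0 < k"
  shows "(3::real) ^ Suc ((1 + 2 * n * b) div k) \<le> 16 * 2 powr (4 * real b * real n / real k)"
proof -
  let ?g = "Suc ((1 + 2 * n * b) div k)"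
  have "real ((1 + 2 * n * b) div k) \<le> real (1 + 2 * n * b) / real k" by (rule of_nat_div_le_of_nat)
  also have "\<dots> = 1 / real k + 2 * real n * real b / real k" by (simp add: add_divide_distrib)
  also have "1 / real k \<le> 1" using k by simp
  finally have g: "real ?g \<le> 2 + 2 * real n * real b / real k" by simp
  have "(3::real) ^ ?g \<le> 4 ^ ?g" by (rule power_mono) auto
  also have "\<dots> = 4 powr real ?g" by (rule powr_realpow[symmetric]) simp
  also have "\<dots> \<le> 4 powr (2 + 2 * real n * real b / real k)" using g by (rule powr_mono) simp
  also have "\<dots> = 4 powr 2 * (2 powr 2) powr (2 * real n * real b / real k)" by (simp add: powr_add)
  also have "\<dots> = 16 * 2 powr (4 * real b * real n / real k)" by (simp only: powr_powr) (simp add: mult_ac)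
  finally show ?thesis .
qed

text \<open>Up to a factor independent of \<open>m\<close>, the query graphs have at most
  \<open>Y = 2 powr (4 * b * m / k)\<close> vertices, so the solver takes time of order
  \<open>Y powr (\<alpha> * n)\<close>. As \<open>n \<le> 4 * k\<close>, the exponent of 2 is at
  most \<open>16 * b * \<alpha> * m\<close>, hence at most \<open>\<epsilon> * m\<close>. All
  factors independent of \<open>m\<close> go into \<open>M\<close>.\<close>

lemma solver_bound:
  fixes \<epsilon> \<alpha> :: real
  assumes A: "solver A cp ph n T" and n: "8 \<le> n" and k_def: "k = (n - 2) div 2"
    and T: "T \<in> O(\<lambda>m. real m powr (\<alpha> * real n))"
    and e: "0 < \<epsilon>" and a: "0 < \<alpha>" "16 * real b * \<alpha> \<le> \<epsilon>" "2 \<le> \<alpha> * real n"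
  shows "\<exists>M\<ge>0. \<forall>m x \<beta>. x = 2 powr (\<epsilon> * real m) \<longrightarrow> M * x \<le> real \<beta> \<longrightarrow>
    2 * m \<le> \<beta> \<and> 2 * x \<le> real \<beta> \<and>
    (\<forall>G ev. length G \<le> 1 + 2 * m * b \<longrightarrow> (\<forall>C\<in>set G. length C \<le> 3) \<longrightarrow> leaf_ok (config A cp ph n, (ev, G)) \<beta>)"
proof -
  have k: "0 < k" "real n \<le> 4 * real k" using n unfolding k_def by linarith+
  obtain C where C: "0 \<le> C" "\<And>N. T N \<le> C * (real N + 1) powr (\<alpha> * real n)"
    using bigo_powr_bound[OF T] a by auto
  define K where "K = real (n * (k * 16)) + real n + 1"
  define M where "M = 2 / (\<epsilon> * ln 2) + 2 + 16 + C * K powr (\<alpha> * real n)"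
  have M: "2 / (\<epsilon> * ln 2) \<le> M" "2 \<le> M" "16 \<le> M" "C * K powr (\<alpha> * real n) \<le> M" "0 \<le> M"
    using e C(1) unfolding M_def by (auto intro: add_nonneg_nonneg add_increasing2 add_increasing)
  have main: "2 * m \<le> \<beta> \<and> 2 * x \<le> real \<beta> \<and>
    (\<forall>G ev. length G \<le> 1 + 2 * m * b \<longrightarrow> (\<forall>C\<in>set G. length C \<le> 3) \<longrightarrow> leaf_ok (config A cp ph n, (ev, G)) \<beta>)"
    if x: "x = 2 powr (\<epsilon> * real m)" and \<beta>: "M * x \<le> real \<beta>" for m x \<beta>
  proof -
    have x1: "1 \<le> x" unfolding x using e by (intro ge_one_powr_ge_zero) auto
    have le: "c * x \<le> real \<beta>" if "c \<le> M" for c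
      using mult_right_mono[OF that, of x] x1 \<beta> by linarith
    have "x = exp (\<epsilon> * real m * ln 2)" by (simp add: x powr_def)
    then have "\<epsilon> * real m * ln 2 \<le> x" using exp_ge_add_one_self[of "\<epsilon> * real m * ln 2"] by linarith
    then have "real m \<le> x / (\<epsilon> * ln 2)" using e by (simp add: field_simps)
    then have "2 * real m \<le> 2 / (\<epsilon> * ln 2) * x" by simp
    then have "2 * m \<le> \<beta>" using le[OF M(1)] by linarith
    moreover have "2 * x \<le> real \<beta>" by (rule le[OF M(2)])
    moreover have "leaf_ok (config A cp ph n, (ev, G)) \<beta>"
      if G: "length G \<le> 1 + 2 * m * b" "\<forall>C\<in>set G. length C \<le> 3" for G ev
    proof (rule solver_leaf_ok[OF A _ k_def G(1)])
      show "4 \<le> n" using n by simp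
      show "length C \<le> 3" if "C \<in> set G" for C using G(2) that by blast
      let ?P = "3 ^ Suc ((1 + 2 * m * b) div k) :: nat"
      define Y where "Y = 2 powr (4 * real b * real m / real k)"
      have Y1: "1 \<le> Y" unfolding Y_def by (intro ge_one_powr_ge_zero) auto
      have P: "real ?P \<le> 16 * Y"
        using group_power_bound[OF k(1), where n = m and b = b] unfolding Y_def of_nat_power by simp
      have kb: "4 * real b / real k * (\<alpha> * real n) \<le> \<epsilon>"
      proof -
        have "real n / real k \<le> 4" using k by (simp add: field_simps)
        then have "4 * real b * \<alpha> * (real n / real k) \<le> 4 * real b * \<alpha> * 4" using a(1) by (intro mult_left_mono) auto
        then show ?thesis using a(2) by (simp add: mult_ac)
      qed
      \<comment> \<open>Since \<open>\<alpha> * n\<close> is at least 1, the same estimate bounds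
        \<open>Y\<close> itself and thereby the number of choices in a group.\<close>
      have "4 * real b / real k * 1 \<le> 4 * real b / real k * (\<alpha> * real n)"
        using a(3) by (intro mult_left_mono) auto
      then have kb1: "4 * real b / real k \<le> \<epsilon>" using kb by linarith
      have "Y \<le> x" unfolding Y_def x
        using mult_right_mono[OF kb1, of "real m"] by (intro powr_mono) auto
      then have "real ?P \<le> 16 * x" using P by linarith
      then show "?P \<le> \<beta>" using le[OF M(3)] by linarith
      have YY: "Y powr (\<alpha> * real n) \<le> x"
        unfolding Y_def x powr_powr
        using mult_right_mono[OF kb, of "real m"] by (intro powr_mono) (auto simp: mult_ac)
      show "T N \<le> real \<beta>" if N: "N \<le> n * (k * ?P + 1)" for N
      proof -
        have "real N + 1 \<le> real (n * (k * ?P + 1)) + 1" using N by linarith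
        also have "\<dots> = real (n * k) * real ?P + real n + 1" by (simp add: algebra_simps)
        also have "\<dots> \<le> real (n * k) * (16 * Y) + real n * Y + 1 * Y"
          using Y1 by (intro add_mono mult_left_mono[OF P]) (auto simp: mult_left_mono mult_le_cancel_left1)
        also have "\<dots> = K * Y" by (simp add: K_def algebra_simps)
        finally have NK: "real N + 1 \<le> K * Y" .
        have "T N \<le> C * (real N + 1) powr (\<alpha> * real n)" by (rule C(2))
        also have "\<dots> \<le> C * (K * Y) powr (\<alpha> * real n)"
          using NK C(1) a(3) by (intro mult_left_mono powr_mono2) auto
        also have "\<dots> = C * K powr (\<alpha> * real n) * Y powr (\<alpha> * real n)"
          using Y1 by (simp add: K_def powr_mult)
        also have "\<dots> \<le> C * K powr (\<alpha> * real n) * x"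
          using YY C(1) by (intro mult_left_mono) auto
        also have "\<dots> \<le> real \<beta>" by (rule le[OF M(4)])
        finally show ?thesis .
      qed
    qed
    ultimately show ?thesis by blast
  qed
  show ?thesis by (rule exI[of _ M]) (use main M(5) in blast)
qed

text \<open>
  The exponent \<open>e\<close> is that of the fixed program deciding satisfiability, to which \<open>A\<close> is merely
  data. Hence \<open>\<epsilon>\<close> and \<open>\<alpha>\<close> can be chosen independently of \<open>A\<close> and \<open>n\<close>.
\<close>

lemma solver_gives_fast_sat:
  assumes p: "\<And>z. \<exists>b. decide_ok z b \<Longrightarrow> runs p (enc z) (enc (decide z)) (W z)"
    and W: "\<And>z. \<exists>b. decide_ok z b \<Longrightarrow> W z \<le> (sz z + decide_bound z + 2) ^ e"
    and \<epsilon>: "0 < \<epsilon>" "real (e + 1) * \<epsilon> \<le> \<delta>"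
    and th: "spread th (2 powr (\<epsilon> / (12 * real th)))"
    and A: "solver A cp ph n T" and n: "8 \<le> n" and T: "T \<in> O(\<lambda>m. real m powr (\<alpha> * real n))"
    and a: "0 < \<alpha>" "16 * real (1 + th + 2 * th * th) * \<alpha> \<le> \<epsilon>" "2 \<le> \<alpha> * real n"
  shows "\<exists>P (C::real) d. \<forall>n F. three_cnf n F \<longrightarrow>
     outputs no_oracle P (encode_cnf n F) (of_bool (satisfiable F)) \<and>
     real (run_time no_oracle P (encode_cnf n F)) \<le> C * 2 powr (\<delta> * real n) * real (length (encode_cnf n F)) ^ d"
proof -
  let ?b = "1 + th + 2 * th * th" and ?c = "config A cp ph n"
  obtain M where M1: "0 \<le> M" "\<forall>m x \<beta>. x = 2 powr (\<epsilon> * real m) \<longrightarrow> M * x \<le> real \<beta> \<longrightarrow>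
    2 * m \<le> \<beta> \<and> 2 * x \<le> real \<beta> \<and>
    (\<forall>G ev. length G \<le> 1 + 2 * m * ?b \<longrightarrow> (\<forall>C\<in>set G. length C \<le> 3) \<longrightarrow> leaf_ok (?c, (ev, G)) \<beta>)"
    using solver_bound[OF A n refl T \<epsilon>(1) a] by (elim exE conjE)
  note M = M1(1) M1(2)[THEN spec, THEN spec, THEN spec, THEN mp, THEN mp, OF refl]
  let ?k = "(?c, (th, 2 * th * th))"
  \<comment> \<open>The configuration is hard-wired into the final program as a constant
    tree.\<close>
  obtain pc Tc where pc: "\<And>v. runs pc v (enc ?k) Tc" using runs_enc_const[of ?k] by blast
  let ?P = "machine (PSeq (PPair pc PId) p)"
  define Q where "Q = real (sz ?k) + M + 7"
  have Q: "1 \<le> Q" using M(1) by (simp add: Q_def)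
  have main: "outputs no_oracle ?P (encode_cnf m F) (of_bool (satisfiable F)) \<and>
     real (run_time no_oracle ?P (encode_cnf m F)) \<le>
       (35 + real Tc + Q ^ e) * 2 powr (\<delta> * real m) * real (length (encode_cnf m F)) ^ (e + 1)"
    if F: "three_cnf m F" for m F
  proof -
    let ?x = "encode_cnf m F" and ?E = "2 powr (\<epsilon> * real m)"
    let ?z = "(?k, ?x)"
    \<comment> \<open>One bound for all quantities of the run: literals, sparsification steps,
      choices of a group and solver time.\<close>
    define \<beta> where "\<beta> = nat \<lceil>M * ?E\<rceil>"
    have E1: "1 \<le> ?E" using \<epsilon>(1) by (intro ge_one_powr_ge_zero) auto
    have \<beta>: "M * ?E \<le> real \<beta>" "real \<beta> \<le> M * ?E + 1"
      using M(1) E1 unfolding \<beta>_def by (linarith, simp add: ceiling_correct le_of_int_ceiling)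
    note M' = M(2)[OF \<beta>(1)]
    have pw: "(2 powr (\<epsilon> / (12 * real th))) ^ (12 * th * m) = ?E"
    proof -
      have "1 \<le> th" using th by (simp add: spread_def)
      then show ?thesis by (simp add: powr_realpow[symmetric] powr_powr)
    qed
    have ok: "decide_ok ?z \<beta>"
    proof (rule decide_ok[OF th F])
      show "2 * m \<le> \<beta>" using M' by blast
      show "2 * (2 powr (\<epsilon> / (12 * real th))) ^ (12 * th * m) \<le> real \<beta>" unfolding pw using M' by blast
      show "leaf_ok (?c, (ev, G)) \<beta>"
        if "length G \<le> 1 + 2 * m * (1 + th + 2 * th * th)" "\<And>C. C \<in> set G \<Longrightarrow> length C \<le> 3" for G ev
        using M' that by blast
    qed
    have ex: "\<exists>b. decide_ok ?z b" using ok ..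
    have dec: "decide ?z \<longleftrightarrow> satisfiable F"
    proof (rule decide_iff[OF th F])
      fix G and ev :: nat
      assume G: "\<And>C. C \<in> set G \<Longrightarrow> distinct C \<and> set C \<subseteq> set (literals_of (parse ?x))"
      show "leaf_sat (?c, (filter even (literals_of (parse ?x)), G)) \<longleftrightarrow> (\<exists>a. hits (truth a) (SF G))"
        using n by (intro leaf_sat_iff[OF A _ refl G]) auto
    qed
    have "runs (PSeq (PPair pc PId) p) (enc ?x) (enc (decide ?z)) ((Tc + 0 + 22) + W ?z)"
      using runs_seq[OF runs_pair[OF pc runs_id] p[OF ex, unfolded enc_Pair[of ?k ?x]]] .
    then obtain t where t: "t \<le> Tc + 22 + W ?z"
      "evals no_oracle {} (PSeq (PPair pc PId) p) (val_of_nats ?x) (Atom (of_bool (satisfiable F))) t"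
      unfolding runs_def dec enc_bool_def enc_nats by auto
    note mc = machine_correct[OF t(2)]
    let ?l = "real (length ?x)"
    have l: "1 \<le> ?l" unfolding encode_cnf_def by simp
    have "real (sz ?z + decide_bound ?z + 2) \<le> Q * (?E * ?l)"
    proof -
      have "sz ?z = sz ?k + (2 * length ?x + 1) + 1" by (simp only: sz_Pair sz_nats)
      moreover have "decide_bound ?z \<le> \<beta>" by (rule decide_bound_le[OF ok])
      ultimately have "real (sz ?z + decide_bound ?z + 2) \<le> real (sz ?k) + 2 * ?l + 4 + real \<beta>" by linarith
      also have "\<dots> \<le> (real (sz ?k) + 5) * 1 + 2 * ?l + M * ?E"
        using add_left_mono[OF \<beta>(2), of "real (sz ?k) + 2 * ?l + 4"] by (simp only: mult_1_right; simp only: ac_simps)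
      also have "\<dots> \<le> (real (sz ?k) + 5) * (?E * ?l) + 2 * (?E * ?l) + M * (?E * ?l)"
      proof (intro add_mono mult_left_mono)
        show "1 \<le> ?E * ?l" using mult_mono[OF E1 l] by simp
        show "?l \<le> ?E * ?l" using mult_right_mono[OF E1, of ?l] by simp
        show "?E \<le> ?E * ?l" using mult_left_mono[OF l, of ?E] by simp
      qed (use M(1) in auto)
      also have "\<dots> = Q * (?E * ?l)" by (simp add: Q_def algebra_simps)
      finally show ?thesis .
    qed
    from power_mono[OF this, of e] have W1: "real (W ?z) \<le> Q ^ e * ?E ^ e * ?l ^ e"
    proof -
      have "real (W ?z) \<le> real ((sz ?z + decide_bound ?z + 2) ^ e)" using W[OF ex] by (simp only: of_nat_le_iff)
      also have "\<dots> \<le> (Q * (?E * ?l)) ^ e"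
        using power_mono[OF \<open>real (sz ?z + decide_bound ?z + 2) \<le> Q * (?E * ?l)\<close>, of e]
        unfolding of_nat_power by simp
      finally show ?thesis by (simp add: power_mult_distrib)
    qed
    let ?D = "2 powr (\<delta> * real m)"
    have Ee: "?E ^ e \<le> ?D" "1 \<le> ?D"
    proof -
      \<comment> \<open>The degree \<open>e\<close> multiplies \<epsilon> in the exponent, which the
        choice of \<epsilon> relative to \<open>e\<close> keeps below \<delta>.\<close>
      have "?E ^ e = 2 powr (real e * \<epsilon> * real m)" by (simp add: powr_power mult_ac)
      also have "real e * \<epsilon> * real m \<le> \<delta> * real m"
        using \<epsilon> by (intro mult_right_mono) (auto simp: algebra_simps)
      then have "2 powr (real e * \<epsilon> * real m) \<le> ?D" by (rule powr_mono) simp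
      finally show "?E ^ e \<le> ?D" .
      then show "1 \<le> ?D" using one_le_power[OF E1, of e] by linarith
    qed
    define R where "R = ?l ^ (e + 1)"
    have le: "?l ^ e \<le> R" "1 \<le> R" "?l \<le> R"
    proof -
      show "?l ^ e \<le> R" unfolding R_def by (rule power_increasing[OF _ l]) simp
      show "1 \<le> R" unfolding R_def by (rule one_le_power[OF l])
      have "?l ^ 1 \<le> R" unfolding R_def by (rule power_increasing[OF _ l]) simp
      then show "?l \<le> R" by (simp only: power_one_right)
    qed
    have DR: "R \<le> ?D * R" using mult_right_mono[OF Ee(2), of R] le(2) by simp
    have "Q ^ e * ?E ^ e * ?l ^ e \<le> Q ^ e * ?D * R"
      using Ee(1) le(1) Q by (intro mult_mono mult_left_mono) auto
    with W1 have "real (W ?z) \<le> Q ^ e * ?D * R" by (rule order.trans)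
    moreover have "9 * ?l \<le> 9 * (?D * R)" using order.trans[OF le(3) DR] by (rule mult_left_mono) simp
    moreover have "(26 + real Tc) * 1 \<le> (26 + real Tc) * (?D * R)"
      using order.trans[OF le(2) DR] by (rule mult_left_mono) simp
    moreover have "real (run_time no_oracle ?P ?x) \<le> 9 * ?l + (26 + real Tc) * 1 + real (W ?z)"
    proof -
      have "real (9 * l + 4 + t) \<le> 9 * real l + (26 + real s) * 1 + real w" if "t \<le> s + 22 + w" for l s w
        using of_nat_mono[OF that, where 'a = real] by simp
      from this[OF t(1)] show ?thesis unfolding mc(2) .
    qed
    ultimately have "real (run_time no_oracle ?P ?x) \<le> 9 * (?D * R) + (26 + real Tc) * (?D * R) + Q ^ e * ?D * R"
      by (meson add_mono order.trans)
    also have "\<dots> = (35 + real Tc + Q ^ e) * ?D * R" by (simp only: distrib_right mult.assoc)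
    finally show ?thesis using mc(1) unfolding R_def by blast
  qed
  show ?thesis by (intro exI[of _ ?P] exI[of _ "35 + real Tc + Q ^ e"] exI[of _ "e + 1"]) (intro allI impI, rule main)
qed

theorem ETH_lower_bound:
  assumes ETH
  shows "\<exists>\<alpha>::real. \<alpha> > 0 \<and> (\<forall>n\<ge>3. \<forall>cp ph.
    \<not> (\<exists>A T. T \<in> O(\<lambda>m. real m powr (\<alpha> * real n)) \<and> solver A cp ph n T))"
proof -
  obtain \<delta> where \<delta>: "0 < \<delta>" "\<not> (\<exists>P (C::real) d. \<forall>n F. three_cnf n F \<longrightarrow>
     outputs no_oracle P (encode_cnf n F) (of_bool (satisfiable F)) \<and>
     real (run_time no_oracle P (encode_cnf n F)) \<le> C * 2 powr (\<delta> * real n) * real (length (encode_cnf n F)) ^ d)"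
    using assms unfolding ETH_def by blast
  obtain p W where p: "pb (\<lambda>z. \<exists>b. decide_ok z b) decide_bound W"
    "\<And>z. \<exists>b. decide_ok z b \<Longrightarrow> runs p (enc z) (enc (decide z)) (W z)"
    using cmp_decide by (rule cmpE) blast
  obtain e where W: "\<And>z. \<exists>b. decide_ok z b \<Longrightarrow> W z \<le> (sz z + decide_bound z + 2) ^ e"
    using p(1) unfolding pb_def by blast
  define \<epsilon> where "\<epsilon> = \<delta> / real (e + 1)"
  have \<epsilon>: "0 < \<epsilon>" "real (e + 1) * \<epsilon> \<le> \<delta>" using \<delta>(1) by (simp_all add: \<epsilon>_def)
  obtain th where th: "spread th (2 powr (\<epsilon> / (12 * real th)))" using spread_exists[OF \<epsilon>(1)] by blast
  define b where "b = 1 + th + 2 * th * th"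
  \<comment> \<open>The bound \<open>1 / 4\<close> makes \<open>\<alpha> * n\<close> smaller than 2
    for \<open>n < 8\<close>, where the reading time already refutes the solver. The other bound is
    the one that \<open>solver_bound\<close> needs.\<close>
  define \<alpha> where "\<alpha> = min (1 / 4) (\<epsilon> / (16 * real b))"
  have "0 < b" by (simp add: b_def)
  then have b: "0 < real b" by simp
  have "\<alpha> \<le> \<epsilon> / (16 * real b)" "0 < \<alpha>" "\<alpha> \<le> 1 / 4" using \<epsilon>(1) b by (auto simp: \<alpha>_def)
  then have a: "0 < \<alpha>" "16 * real b * \<alpha> \<le> \<epsilon>" "\<alpha> \<le> 1 / 4" using b by (auto simp: field_simps)
  have "\<not> (T \<in> O(\<lambda>m. real m powr (\<alpha> * real n)) \<and> solver A cp ph n T)" if n: "3 \<le> n" for n cp ph A T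
  proof
    assume "T \<in> O(\<lambda>m. real m powr (\<alpha> * real n)) \<and> solver A cp ph n T"
    then have T: "T \<in> O(\<lambda>m. real m powr (\<alpha> * real n))" and A: "solver A cp ph n T" by blast+
    have two: "2 \<le> \<alpha> * real n" using solver_exponent[OF A _ T] a(1) n by simp
    have "\<alpha> * real n \<le> 1 / 4 * real n" using a(3) by (rule mult_right_mono) simp
    then have "8 \<le> n" using two by linarith
    from solver_gives_fast_sat[OF p(2) W \<epsilon> th A this T a(1) a(2)[unfolded b_def] two] show False
      using \<delta>(2) by blast
  qed
  then show ?thesis using a(1) by blast
qed

theorem theorem3p8:
  fixes \<Phi> :: "nat graph \<Rightarrow> nat"
  assumes "\<Phi> \<in> {max_degree, num_components, chromatic_number}"
  shows "sharp_W1_hard (IndSub_problem \<Phi>) \<and>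
    sharp_W1_hard (cpIndSub_problem \<Phi>) \<and>
    (ETH \<longrightarrow> (\<exists>\<alpha>::real. \<alpha> > 0 \<and> (\<forall>k::nat. k \<ge> 3 \<longrightarrow>
      \<not> (\<exists>A T. T \<in> O(\<lambda>n. real n powr (\<alpha> * real k)) \<and> computes_IndSub_in_time A \<Phi> k T) \<and>
      \<not> (\<exists>A T. T \<in> O(\<lambda>n. real n powr (\<alpha> * real k)) \<and> computes_cpIndSub_in_time A \<Phi> k T))))"
proof -
  have "\<Phi> = parameter_of 0 \<or> \<Phi> = parameter_of 1 \<or> \<Phi> = parameter_of 2"
    using assms by (auto simp: parameter_of_def)
  then obtain ph where ph: "\<Phi> = parameter_of ph" by blast
  have "\<exists>\<alpha>::real. \<alpha> > 0 \<and> (\<forall>k::nat. k \<ge> 3 \<longrightarrow>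
      \<not> (\<exists>A T. T \<in> O(\<lambda>n. real n powr (\<alpha> * real k)) \<and> computes_IndSub_in_time A \<Phi> k T) \<and>
      \<not> (\<exists>A T. T \<in> O(\<lambda>n. real n powr (\<alpha> * real k)) \<and> computes_cpIndSub_in_time A \<Phi> k T))" if ETH: ETH
  proof -
    obtain \<alpha> :: real where \<alpha>: "\<alpha> > 0" "\<And>n cp ph. 3 \<le> n \<Longrightarrow>
        \<not> (\<exists>A T. T \<in> O(\<lambda>m. real m powr (\<alpha> * real n)) \<and> solver A cp ph n T)"
      using ETH_lower_bound[OF ETH] by blast
    have "\<not> (\<exists>A T. T \<in> O(\<lambda>n. real n powr (\<alpha> * real k)) \<and> computes_IndSub_in_time A \<Phi> k T)"
      "\<not> (\<exists>A T. T \<in> O(\<lambda>n. real n powr (\<alpha> * real k)) \<and> computes_cpIndSub_in_time A \<Phi> k T)" if k: "3 \<le> k" for k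
      using \<alpha>(2)[OF k, of False ph] \<alpha>(2)[OF k, of True ph] unfolding solver_def ph if_True if_False by blast+
    then show ?thesis using \<alpha>(1) by blast
  qed
  then show ?thesis unfolding ph using W1_hard_IndSub W1_hard_cpIndSub by blast
qed

end
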